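(* Let $\Delta$ be the Hodge Laplacian on the flat $n$-torus $\mathbb{T}^n$, let $0<G(\Delta)\in\mathcal{L}^{1,\infty}(L^2(\mathbb{T}^n))$ be measurable, where $G$ is a positive bounded Borel function, and let $\epsilon>0$. If $f\in L^{1+\epsilon}(\mathbb{T}^n)$, then $\langle M_f\rangle_{G(\Delta)}=G(\Delta)^{1/2}M_fG(\Delta)^{1/2}\in\mathcal{L}^{1,\infty}(L^2(\mathbb{T}^n))$, and $$\mathrm{Tr}_\omega\big(G(\Delta)^{1/2}M_fG(\Delta)^{1/2}\big)=c\int_{\mathbb{T}^n}f(\mathbf{x})\,d^n\mathbf{x}\qquad\text{for all } f\in L^{1+\epsilon}(\mathbb{T}^n),$$ for the constant $0\le c=\mathrm{Tr}_\omega(G(\Delta))$, which is independent of $\omega\in DL_2$.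
   Context: $\mathbb{T}^n=(\mathbb{R}/2\pi\mathbb{Z})^n$ carries normalised Lebesgue measure $d^n\mathbf{x}$ (total mass 1), so that $e^{i\mathbf{m}\cdot\mathbf{x}}$, $\mathbf{m}\in\mathbb{Z}^n$, is an orthonormal basis of $L^2(\mathbb{T}^n)$ of eigenvectors of the Laplacian $\Delta\ge0$ (eigenvalues $|\mathbf{m}|^2$). $\mu_n(T)$ are the singular values of a compact operator $T$. $\mathcal{L}^{1,\infty}(H)$ is the ideal of compact $T$ with $\sup_{k\ge1}\frac{1}{\log(1+k)}\sum_{n=1}^k\mu_n(T)<\infty$. For $0<T\in\mathcal{L}^{1,\infty}$ put $\gamma(T)=\{\frac{1}{\log(1+k)}\sum_{n=1}^k\mu_n(T)\}_{k}\in\ell^\infty$. Let $D_2(\{a_k\})=\{a_{\lceil k/2\rceil}\}_{k}$ on $\ell^\infty$. $DL_2$ is the set of positive functionals $\omega\in(\ell^\infty)^*$ with $\omega(1)=1$, with $\liminf_k a_k\le\omega(\{a_k\})\le\limsup_k a_k$ for bounded $a_k\ge0$, and with $\omega(D_2(\gamma(T)))=\omega(\gamma(T))$ for all $0<T\in\mathcal{L}^{1,\infty}$. $\mathrm{Tr}_\omega$ is the linear extension to $\mathcal{L}^{1,\infty}$ of $T\mapsto\omega(\gamma(T))$, $T>0$. $T\in\mathcal{L}^{1,\infty}$ is measurable if $\mathrm{Tr}_\omega(T)$ does not depend on $\omega\in DL_2$. $M_f$ is multiplication by $f$ on $L^2(\mathbb{T}^n)$. For a positive compact operator $A$, $\langle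 B\rangle_A:=\sqrt A B\sqrt A$ (when densely defined with bounded closure); for possibly unbounded $M_f$ it is understood as $|M_{\sqrt f}\sqrt A|^2$ when $f\ge0$, and by linearity (decomposing $f$ into the positive/negative parts of its real and imaginary parts) in general. *)

theory Defs
  imports "HOL-Analysis.Analysis"
begin

section \<open>Complex Hilbert spaces and their bounded operators\<close>

text \<open>The distribution only has real inner product spaces; the complex structure is added on top.
  The complex inner product is conjugate linear in its first argument.\<close>

class complex_hilbert = real_inner + complete_space +
  fixes scaleC :: "complex \<Rightarrow> 'a \<Rightarrow> 'a" (infixr "*\<^sub>C" 75)
    and cinner :: "'a \<Rightarrow> 'a \<Rightarrow> complex"
  assumes scaleC_add_right: "a *\<^sub>C (x + y) = a *\<^sub>C x + a *\<^sub>C y"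
    and scaleC_add_left: "(a + b) *\<^sub>C x = a *\<^sub>C x + b *\<^sub>C x"
    and scaleC_scaleC: "a *\<^sub>C b *\<^sub>C x = (a * b) *\<^sub>C x"
    and scaleR_scaleC: "r *\<^sub>R x = complex_of_real r *\<^sub>C x"
    and cinner_commute: "cinner x y = cnj (cinner y x)"
    and cinner_add_right: "cinner x (y + z) = cinner x y + cinner x z"
    and cinner_scaleC_right: "cinner x (a *\<^sub>C y) = a * cinner x y"
    and inner_eq_Re_cinner: "inner x y = Re (cinner x y)"

lemma scaleC_one: "1 *\<^sub>C x = (x :: 'h::complex_hilbert)"
  using scaleR_scaleC[of 1 x] by simp

lemma vector_space_scaleC:
  "vector_space (scaleC :: complex \<Rightarrow> 'h \<Rightarrow> 'h::complex_hilbert)"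
  by unfold_locales (simp_all add: scaleC_add_right scaleC_add_left scaleC_scaleC scaleC_one)

lemma cinner_scaleC_left: "cinner (a *\<^sub>C x) y = cnj a * cinner x (y :: 'h::complex_hilbert)"
  by (subst (1 2) cinner_commute) (simp add: cinner_scaleC_right)

lemma norm_scaleC: "norm (a *\<^sub>C x) = cmod a * norm (x :: 'h::complex_hilbert)"
proof -
  have "cinner (a *\<^sub>C x) (a *\<^sub>C x) = (a * cnj a) * cinner x x"
    by (simp add: cinner_scaleC_left cinner_scaleC_right)
  also have "a * cnj a = complex_of_real ((cmod a)\<^sup>2)"
    by (simp add: complex_mult_cnj cmod_power2)
  finally have "inner (a *\<^sub>C x) (a *\<^sub>C x) = (cmod a)\<^sup>2 * inner x x"
    by (simp only: inner_eq_Re_cinner) simp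
  then show ?thesis
    by (simp add: norm_eq_sqrt_inner real_sqrt_mult)
qed

text \<open>Elements of \<open>'h op\<close> are only real linear; the operators of interest are those that
  are \<open>complex_linear\<close>.\<close>

type_synonym 'h op = "'h \<Rightarrow>\<^sub>L 'h"

definition complex_linear :: "'h::complex_hilbert op \<Rightarrow> bool" where
  "complex_linear T \<longleftrightarrow> (\<forall>c x. T (c *\<^sub>C x) = c *\<^sub>C T x)"

lift_definition scale_op :: "complex \<Rightarrow> 'h::complex_hilbert op \<Rightarrow> 'h op" is
  "\<lambda>c T x. c *\<^sub>C T x"
proof -
  fix c and T :: "'h \<Rightarrow> 'h" assume "bounded_linear T"
  moreover have "bounded_linear (\<lambda>x :: 'h. c *\<^sub>C x)"
    by (rule bounded_linear_intro[where K = "cmod c"])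
      (simp_all add: scaleC_add_right scaleC_scaleC scaleR_scaleC norm_scaleC mult.commute)
  ultimately show "bounded_linear (\<lambda>x. c *\<^sub>C T x)"
    by (rule bounded_linear_compose[rotated])
qed

definition adjoint_op :: "'h::complex_hilbert op \<Rightarrow> 'h op" where
  "adjoint_op T = (SOME S :: 'h op. \<forall>x y. cinner (S x) y = cinner x (T y))"

definition positive_op :: "'h::complex_hilbert op \<Rightarrow> bool" where
  "positive_op T \<longleftrightarrow> complex_linear T \<and> (\<forall>x. cinner x (T x) \<in> \<real>\<^sub>\<ge>\<^sub>0)"

definition sqrt_op :: "'h::complex_hilbert op \<Rightarrow> 'h op" where
  "sqrt_op A = (SOME S. positive_op S \<and> S o\<^sub>L S = A)"

definition abs_op :: "'h::complex_hilbert op \<Rightarrow> 'h op" where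
  "abs_op T = sqrt_op (adjoint_op T o\<^sub>L T)"

definition compact_op :: "'h::complex_hilbert op \<Rightarrow> bool" where
  "compact_op T \<longleftrightarrow> complex_linear T \<and> compact (closure (T ` cball 0 1))"

text \<open>\<open>singular_value T k\<close> is \<open>\<mu>\<^sub>k\<^sub>+\<^sub>1(T)\<close>, the \<open>(k+1)\<close>-st eigenvalue of \<open>|T|\<close> in decreasing order
  with multiplicity; the sequence is padded by zeros if \<open>T\<close> has finite rank. It is determined
  by the conditions below when \<open>T\<close> is compact. All sequences indexed from 1 on paper
  are shifted in this way.\<close>

definition singular_value :: "'h::complex_hilbert op \<Rightarrow> nat \<Rightarrow> real" where
  "singular_value T = (SOME \<mu>. decseq \<mu> \<and> (\<forall>k. 0 \<le> \<mu> k) \<and>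
     (\<forall>s>0. finite {k. \<mu> k = s} \<and>
        card {k. \<mu> k = s} = vector_space.dim scaleC {x. abs_op T x = s *\<^sub>R x}))"


section \<open>The ideal $\mathcal{L}^{1,\infty}$ and Dixmier traces\<close>

text \<open>Entry \<open>k\<close> belongs to the index \<open>k + 1\<close> on paper, whence the weight \<open>log (1 + (k + 1))\<close>.\<close>

definition log_mean :: "'h::complex_hilbert op \<Rightarrow> nat \<Rightarrow> real" where
  "log_mean T k = 1 / ln (1 + real (k + 1)) * (\<Sum>j\<le>k. singular_value T j)"

definition L1_inf :: "'h::complex_hilbert op set" where
  "L1_inf = {T. compact_op T \<and> bdd_above (range (log_mean T))}"

text \<open>\<open>nat \<Rightarrow>\<^sub>C real\<close> is the space of bounded real sequences, since \<open>nat\<close> is discrete. A positive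
  functional on the complex bounded sequences is the complexification of one on the real ones.\<close>

definition gamma_op :: "'h::complex_hilbert op \<Rightarrow> (nat \<Rightarrow>\<^sub>C real)" where
  "gamma_op T = Bcontfun (log_mean T)"

text \<open>With the shift of indices, the sequence of the \<open>a\<^bsub>\<lceil>k/2\<rceil>\<^esub>\<close>, \<open>k \<ge> 1\<close>, has the entries
  \<open>a (k div 2)\<close>, \<open>k \<ge> 0\<close>.\<close>

definition D2 :: "(nat \<Rightarrow>\<^sub>C real) \<Rightarrow> (nat \<Rightarrow>\<^sub>C real)" where
  "D2 a = Bcontfun (\<lambda>k. apply_bcontfun a (k div 2))"

text \<open>The argument of type \<open>'h itself\<close> names the Hilbert space on which the operators act.\<close>

definition DL2 :: "'h::complex_hilbert itself \<Rightarrow> ((nat \<Rightarrow>\<^sub>C real) \<Rightarrow>\<^sub>L real) set" where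
  "DL2 _ = {\<omega> :: (nat \<Rightarrow>\<^sub>C real) \<Rightarrow>\<^sub>L real.
     (\<forall>a. (\<forall>k. 0 \<le> apply_bcontfun a k) \<longrightarrow> 0 \<le> \<omega> a) \<and>
     \<omega> (const_bcontfun 1) = 1 \<and>
     (\<forall>a. (\<forall>k. 0 \<le> apply_bcontfun a k) \<longrightarrow>
        liminf (\<lambda>k. ereal (apply_bcontfun a k)) \<le> ereal (\<omega> a) \<and>
        ereal (\<omega> a) \<le> limsup (\<lambda>k. ereal (apply_bcontfun a k))) \<and>
     (\<forall>T :: 'h op. T \<in> L1_inf \<and> positive_op T \<longrightarrow> \<omega> (D2 (gamma_op T)) = \<omega> (gamma_op T))}"

text \<open>The positive operators of \<open>L1_inf\<close> span it, so its linear functionals are determined by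
  their values there. Positivity means \<open>T \<ge> 0\<close> here and in \<open>DL2\<close>; the operator 0 imposes
  no condition, since \<open>\<gamma>(0) = 0\<close>.\<close>

definition dixmier_trace ::
    "((nat \<Rightarrow>\<^sub>C real) \<Rightarrow>\<^sub>L real) \<Rightarrow> 'h::complex_hilbert op \<Rightarrow> complex" where
  "dixmier_trace \<omega> = (SOME \<tau>.
     (\<forall>S\<in>L1_inf. \<forall>T\<in>L1_inf. \<tau> (S + T) = \<tau> S + \<tau> T) \<and>
     (\<forall>c. \<forall>T\<in>L1_inf. \<tau> (scale_op c T) = c * \<tau> T) \<and>
     (\<forall>T\<in>L1_inf. positive_op T \<longrightarrow> \<tau> T = complex_of_real (\<omega> (gamma_op T))))"

definition dixmier_measurable :: "'h::complex_hilbert op \<Rightarrow> bool" where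
  "dixmier_measurable T \<longleftrightarrow> T \<in> L1_inf \<and>
     (\<forall>\<omega>\<in>DL2 TYPE('h). \<forall>\<omega>'\<in>DL2 TYPE('h). dixmier_trace \<omega> T = dixmier_trace \<omega>' T)"


section \<open>The Hilbert space of square integrable functions on the torus\<close>

text \<open>The torus is represented by the fundamental domain \<open>[0, 2\<pi>)\<^sup>n\<close>: the measure lives on
  the whole of \<open>real ^ 'n\<close>, but the complement of this cube is a null set.\<close>

definition torus_measure :: "(real ^ 'n) measure" where
  "torus_measure = uniform_measure lborel {x. \<forall>i. 0 \<le> x $ i \<and> x $ i < 2 * pi}"

definition Lp_torus :: "real \<Rightarrow> (real ^ 'n \<Rightarrow> complex) set" where
  "Lp_torus p = {f \<in> borel_measurable torus_measure.
     integrable torus_measure (\<lambda>x. cmod (f x) powr p)}"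

definition square_integrable :: "(real ^ 'n \<Rightarrow> complex) \<Rightarrow> bool" where
  "square_integrable u \<longleftrightarrow> u \<in> borel_measurable torus_measure \<and>
     integrable torus_measure (\<lambda>x. (cmod (u x))\<^sup>2)"

lemma sets_torus_measure [measurable_cong, simp]: "sets torus_measure = sets borel"
  by (simp add: torus_measure_def)

lemma space_torus_measure [simp]: "space torus_measure = UNIV"
  by (simp add: torus_measure_def)

lemma finite_measure_torus: "finite_measure (torus_measure :: (real ^ 'n) measure)"
proof
  let ?C = "{x :: real ^ 'n. \<forall>i. 0 \<le> x $ i \<and> x $ i < 2 * pi}"
  have C: "?C \<in> sets lborel"
    by measurable
  have "?C \<subseteq> cbox 0 (\<chi> i. 2 * pi)"
    by (auto simp: mem_box_cart less_imp_le)
  then have "emeasure lborel ?C \<le> emeasure lborel (cbox (0 :: real ^ 'n) (\<chi> i. 2 * pi))"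
    by (intro emeasure_mono) auto
  also have "\<dots> < \<infinity>"
    by (simp add: emeasure_lborel_cbox_eq)
  finally have "emeasure lborel ?C \<noteq> \<infinity>"
    by simp
  then have "emeasure lborel ?C / emeasure lborel ?C \<noteq> \<infinity>"
    by (cases "emeasure lborel ?C = 0") (auto simp: ennreal_divide_eq_top_iff)
  then show "emeasure torus_measure (space torus_measure :: (real ^ 'n) set) \<noteq> \<infinity>"
    using C by (simp add: torus_measure_def)
qed

lemma square_integrable_product:
  assumes "square_integrable u" "square_integrable v"
  shows "integrable torus_measure (\<lambda>x. cnj (u x) * v x)"
proof (rule Bochner_Integration.integrable_bound)
  show "integrable torus_measure (\<lambda>x. (cmod (u x))\<^sup>2 + (cmod (v x))\<^sup>2)"
    using assms by (auto simp: square_integrable_def)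
  show "(\<lambda>x. cnj (u x) * v x) \<in> borel_measurable torus_measure"
    using assms by (auto simp: square_integrable_def intro!: borel_measurable_times
      borel_measurable_continuous_on[OF continuous_on_cnj[OF continuous_on_id]])
  have "2 * (a * b) \<le> a\<^sup>2 + b\<^sup>2" for a b :: real
    using sum_squares_bound[of a b] by (simp add: mult.assoc)
  moreover have "0 \<le> a * b" if "0 \<le> a" "0 \<le> b" for a b :: real
    using that by simp
  ultimately have "a * b \<le> a\<^sup>2 + b\<^sup>2" if "0 \<le> a" "0 \<le> b" for a b :: real
    using that by (smt (verit))
  then show "AE x in torus_measure. norm (cnj (u x) * v x)
      \<le> norm ((cmod (u x))\<^sup>2 + (cmod (v x))\<^sup>2)"
    by (auto simp: norm_mult)
qed

lemma LINT_cnj_self: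
  fixes u :: "'a \<Rightarrow> complex"
  shows "(LINT x|M. cnj (u x) * u x) = complex_of_real (LINT x|M. (cmod (u x))\<^sup>2)"
proof -
  have "cnj z * z = complex_of_real ((cmod z)\<^sup>2)" for z
    using complex_norm_square[of z] by (simp only: mult.commute)
  then show ?thesis
    by (simp only: integral_complex_of_real)
qed

lemma square_integrable_zero: "square_integrable (\<lambda>_. 0)"
  by (simp add: square_integrable_def)

lemma square_integrable_mult:
  assumes "square_integrable u"
  shows "square_integrable (\<lambda>x. c * u x)"
  using assms by (auto simp: square_integrable_def norm_mult power_mult_distrib)

lemma square_integrable_add:
  assumes "square_integrable u" "square_integrable v"
  shows "square_integrable (\<lambda>x. u x + v x)"
  unfolding square_integrable_def
proof
  show "(\<lambda>x. u x + v x) \<in> borel_measurable torus_measure"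
    using assms by (auto simp: square_integrable_def)
  show "integrable torus_measure (\<lambda>x. (cmod (u x + v x))\<^sup>2)"
  proof (rule Bochner_Integration.integrable_bound)
    show "integrable torus_measure (\<lambda>x. 2 * (cmod (u x))\<^sup>2 + 2 * (cmod (v x))\<^sup>2)"
      using assms by (auto simp: square_integrable_def)
    have "(cmod (a + b))\<^sup>2 \<le> 2 * (cmod a)\<^sup>2 + 2 * (cmod b)\<^sup>2" for a b
    proof -
      have "(cmod (a + b))\<^sup>2 \<le> (cmod a + cmod b)\<^sup>2"
        by (intro power_mono norm_triangle_ineq) auto
      also have "\<dots> \<le> 2 * (cmod a)\<^sup>2 + 2 * (cmod b)\<^sup>2"
        using sum_squares_bound[of "cmod a" "cmod b"] by (simp add: power2_sum)
      finally show ?thesis .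
    qed
    then show "AE x in torus_measure. norm ((cmod (u x + v x))\<^sup>2)
        \<le> norm (2 * (cmod (u x))\<^sup>2 + 2 * (cmod (v x))\<^sup>2)"
      by simp
  qed (use assms in \<open>auto simp: square_integrable_def\<close>)
qed

quotient_type (overloaded) 'n L2_torus = "real ^ 'n::finite \<Rightarrow> complex" / partial:
  "\<lambda>u v. square_integrable u \<and> square_integrable v \<and> (AE x in torus_measure. u x = v x)"
proof (rule part_equivpI)
  show "\<exists>u :: real ^ 'n \<Rightarrow> complex. square_integrable u \<and> square_integrable u \<and>
      (AE x in torus_measure. u x = u x)"
    using square_integrable_zero by auto
  show "symp (\<lambda>u v :: real ^ 'n \<Rightarrow> complex. square_integrable u \<and> square_integrable v \<and>
      (AE x in torus_measure. u x = v x))"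
    by (auto simp: symp_def)
  show "transp (\<lambda>u v :: real ^ 'n \<Rightarrow> complex. square_integrable u \<and> square_integrable v \<and>
      (AE x in torus_measure. u x = v x))"
    by (auto simp: transp_def elim: AE_mp)
qed

lift_definition L2_scale :: "complex \<Rightarrow> 'n::finite L2_torus \<Rightarrow> 'n L2_torus" is "\<lambda>c u x. c * u x"
  by (auto simp: square_integrable_mult elim: AE_mp)

lift_definition L2_cinner :: "'n::finite L2_torus \<Rightarrow> 'n L2_torus \<Rightarrow> complex" is
  "\<lambda>u v. LINT x|torus_measure. cnj (u x) * v x"
proof -
  fix u u' v v' :: "real ^ 'n \<Rightarrow> complex"
  assume u: "square_integrable u \<and> square_integrable u' \<and> (AE x in torus_measure. u x = u' x)"
    and v: "square_integrable v \<and> square_integrable v' \<and> (AE x in torus_measure. v x = v' x)"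
  show "(LINT x|torus_measure. cnj (u x) * v x) = (LINT x|torus_measure. cnj (u' x) * v' x)"
  proof (rule integral_cong_AE)
    show "(\<lambda>x. cnj (u x) * v x) \<in> borel_measurable torus_measure"
      "(\<lambda>x. cnj (u' x) * v' x) \<in> borel_measurable torus_measure"
      using square_integrable_product[of u v] square_integrable_product[of u' v'] u v
      by (auto dest: borel_measurable_integrable)
    have "AE x in torus_measure. u x = u' x" "AE x in torus_measure. v x = v' x"
      using u v by auto
    then show "AE x in torus_measure. cnj (u x) * v x = cnj (u' x) * v' x"
      by eventually_elim simp
  qed
qed

instantiation L2_torus :: (finite) real_inner
begin

lift_definition zero_L2_torus :: "'a L2_torus" is "\<lambda>_. 0"
  by (simp add: square_integrable_zero)

lift_definition plus_L2_torus :: "'a L2_torus \<Rightarrow> 'a L2_torus \<Rightarrow> 'a L2_torus" is "\<lambda>u v x. u x + v x"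
  by (auto simp: square_integrable_add elim: AE_mp)

definition scaleR_L2_torus :: "real \<Rightarrow> 'a L2_torus \<Rightarrow> 'a L2_torus" where
  "scaleR_L2_torus r u = L2_scale (complex_of_real r) u"

definition uminus_L2_torus :: "'a L2_torus \<Rightarrow> 'a L2_torus" where
  "uminus_L2_torus u = L2_scale (- 1) u"

definition minus_L2_torus :: "'a L2_torus \<Rightarrow> 'a L2_torus \<Rightarrow> 'a L2_torus" where
  "minus_L2_torus u v = u + - v"

definition inner_L2_torus :: "'a L2_torus \<Rightarrow> 'a L2_torus \<Rightarrow> real" where
  "inner_L2_torus u v = Re (L2_cinner u v)"

definition norm_L2_torus :: "'a L2_torus \<Rightarrow> real" where
  "norm_L2_torus u = sqrt (inner u u)"

definition sgn_L2_torus :: "'a L2_torus \<Rightarrow> 'a L2_torus" where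
  "sgn_L2_torus u = inverse (norm u) *\<^sub>R u"

definition dist_L2_torus :: "'a L2_torus \<Rightarrow> 'a L2_torus \<Rightarrow> real" where
  "dist_L2_torus u v = norm (u - v)"

definition uniformity_L2_torus :: "('a L2_torus \<times> 'a L2_torus) filter" where
  "uniformity_L2_torus = (INF e\<in>{0<..}. principal {(u, v). dist u v < e})"

definition open_L2_torus :: "'a L2_torus set \<Rightarrow> bool" where
  "open_L2_torus U \<longleftrightarrow> (\<forall>u\<in>U. \<forall>\<^sub>F (u', v) in uniformity. u' = u \<longrightarrow> v \<in> U)"

instance
proof
  fix u v w :: "'a L2_torus" and a b :: real
  show "u + v + w = u + (v + w)"
    by transfer (auto simp: square_integrable_add add.assoc)
  show "u + v = v + u"
    by transfer (auto simp: square_integrable_add add.commute)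
  show "0 + u = u"
    by transfer auto
  show "- u + u = 0"
    unfolding uminus_L2_torus_def
    by transfer (auto intro!: square_integrable_zero)
  show "u - v = u + - v"
    by (rule minus_L2_torus_def)
  show "a *\<^sub>R (u + v) = a *\<^sub>R u + a *\<^sub>R v"
    unfolding scaleR_L2_torus_def
    by transfer (auto simp: square_integrable_add square_integrable_mult distrib_left[symmetric])
  show "(a + b) *\<^sub>R u = a *\<^sub>R u + b *\<^sub>R u"
    unfolding scaleR_L2_torus_def
    by transfer (auto simp: square_integrable_mult distrib_right[symmetric]
        of_real_add[symmetric] simp del: of_real_add)
  show "a *\<^sub>R b *\<^sub>R u = (a * b) *\<^sub>R u"
    unfolding scaleR_L2_torus_def
    by transfer (auto simp: square_integrable_mult mult.assoc)
  show "1 *\<^sub>R u = u"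
    unfolding scaleR_L2_torus_def by transfer auto
  show "dist u v = norm (u - v)"
    by (rule dist_L2_torus_def)
  show "sgn u = inverse (norm u) *\<^sub>R u"
    by (rule sgn_L2_torus_def)
  show "uniformity = (INF e\<in>{0<..}. principal {(u :: 'a L2_torus, v). dist u v < e})"
    by (rule uniformity_L2_torus_def)
  show "open U \<longleftrightarrow> (\<forall>u\<in>U. \<forall>\<^sub>F (u', v) in uniformity. u' = u \<longrightarrow> v \<in> U)"
    for U :: "'a L2_torus set"
    by (rule open_L2_torus_def)
  show "norm u = sqrt (inner u u)"
    by (rule norm_L2_torus_def)
  show "inner u v = inner v u"
    unfolding inner_L2_torus_def
  proof transfer
    fix u v :: "real ^ 'a \<Rightarrow> complex"
    have "(LINT x|torus_measure. cnj (u x) * v x) = cnj (LINT x|torus_measure. cnj (v x) * u x)"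
      using Bochner_Integration.integral_cnj[of torus_measure "\<lambda>x. cnj (v x) * u x"] by (simp add: mult.commute)
    then show "Re (LINT x|torus_measure. cnj (u x) * v x) = Re (LINT x|torus_measure. cnj (v x) * u x)"
      by simp
  qed
  show "inner (u + v) w = inner u w + inner v w"
    unfolding inner_L2_torus_def
    by transfer (simp add: square_integrable_product distrib_right)
  show "inner (a *\<^sub>R u) v = a * inner u v"
    unfolding inner_L2_torus_def scaleR_L2_torus_def
    by transfer (simp add: mult.assoc)
  show "0 \<le> inner u u"
    unfolding inner_L2_torus_def
  proof transfer
    fix u :: "real ^ 'a \<Rightarrow> complex"
    have "(LINT x|torus_measure. cnj (u x) * u x) = complex_of_real (LINT x|torus_measure. (cmod (u x))\<^sup>2)"
      by (rule LINT_cnj_self)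
    then show "0 \<le> Re (LINT x|torus_measure. cnj (u x) * u x)"
      by simp
  qed
  show "inner u u = 0 \<longleftrightarrow> u = 0"
    unfolding inner_L2_torus_def
  proof transfer
    fix u :: "real ^ 'a \<Rightarrow> complex"
    assume u: "square_integrable u \<and> square_integrable u \<and> (AE x in torus_measure. u x = u x)"
    have "(LINT x|torus_measure. cnj (u x) * u x) = complex_of_real (LINT x|torus_measure. (cmod (u x))\<^sup>2)"
      by (rule LINT_cnj_self)
    then have "Re (LINT x|torus_measure. cnj (u x) * u x) = 0 \<longleftrightarrow>
        (LINT x|torus_measure. (cmod (u x))\<^sup>2) = 0"
      by simp
    also have "\<dots> \<longleftrightarrow> (AE x in torus_measure. (cmod (u x))\<^sup>2 = 0)"
      using u by (intro integral_nonneg_eq_0_iff_AE) (auto simp: square_integrable_def)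
    finally show "Re (LINT x|torus_measure. cnj (u x) * u x) = 0 \<longleftrightarrow>
        square_integrable u \<and> square_integrable (\<lambda>_ :: real ^ 'a. 0) \<and> (AE x in torus_measure. u x = 0)"
      using u by (simp add: square_integrable_zero)
  qed
qed

end

lemma square_integrable_rep: "square_integrable (rep_L2_torus u)"
  using Quotient_rep_reflp[OF Quotient_L2_torus] by blast

lemma abs_rep_L2_torus: "abs_L2_torus (rep_L2_torus u) = u"
  by (rule Quotient_abs_rep[OF Quotient_L2_torus])

lemma norm_abs_L2_torus:
  assumes "square_integrable u"
  shows "(norm (abs_L2_torus u))\<^sup>2 = (LINT x|torus_measure. (cmod (u x))\<^sup>2)"
proof -
  have "(norm (abs_L2_torus u))\<^sup>2 = inner (abs_L2_torus u) (abs_L2_torus u)"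
    by (rule power2_norm_eq_inner)
  also have "\<dots> = Re (LINT x|torus_measure. cnj (u x) * u x)"
    using assms by (simp add: inner_L2_torus_def L2_cinner.abs_eq)
  also have "(LINT x|torus_measure. cnj (u x) * u x) =
      complex_of_real (LINT x|torus_measure. (cmod (u x))\<^sup>2)"
    by (rule LINT_cnj_self)
  finally show ?thesis
    by simp
qed

lemma abs_diff_L2_torus:
  assumes "square_integrable u" "square_integrable v"
  shows "abs_L2_torus u - abs_L2_torus v = abs_L2_torus (\<lambda>x. u x - v x)"
  using assms square_integrable_mult[OF assms(2), of "-1"]
  by (simp add: minus_L2_torus_def uminus_L2_torus_def L2_scale.abs_eq plus_L2_torus.abs_eq)

lemma square_integrable_diff:
  assumes "square_integrable u" "square_integrable v"
  shows "square_integrable (\<lambda>x. u x - v x)"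
  using square_integrable_add[OF assms(1) square_integrable_mult[OF assms(2), of "-1"]] by simp

lemma dist_abs_L2_torus:
  assumes "square_integrable u" "square_integrable v"
  shows "(\<integral>\<^sup>+x. ennreal ((cmod (u x - v x))\<^sup>2) \<partial>torus_measure) =
    ennreal ((dist (abs_L2_torus u) (abs_L2_torus v))\<^sup>2)"
  using square_integrable_diff[OF assms]
  by (simp add: dist_norm abs_diff_L2_torus[OF assms] norm_abs_L2_torus square_integrable_def
      nn_integral_eq_integral)

instance L2_torus :: (finite) complete_space
proof
  fix X :: "nat \<Rightarrow> 'a L2_torus"
  assume X: "Cauchy X"
  have "\<exists>M. \<forall>m\<ge>M. \<forall>n\<ge>M. dist (X m) (X n) < (1/2) ^ k" for k :: nat
    using X by (intro metric_CauchyD) auto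
  then obtain M where M: "\<And>k m n. M k \<le> m \<Longrightarrow> M k \<le> n \<Longrightarrow> dist (X m) (X n) < (1/2) ^ k"
    by metis
  define r where "r k = (\<Sum>j\<le>k. M j)" for k :: nat
  have r: "M n \<le> r k" if "n \<le> k" for n k
    unfolding r_def using that by (intro member_le_sum) auto
  define f where "f k = rep_L2_torus (X (r k))" for k
  have f: "square_integrable (f k)" and abs_f: "abs_L2_torus (f k) = X (r k)" for k
    by (simp_all add: f_def square_integrable_rep abs_rep_L2_torus)
  have f_meas [measurable]: "f k \<in> borel_measurable borel" for k
    using f[of k] by (simp add: square_integrable_def cong: measurable_cong_sets)
  have ff: "(\<integral>\<^sup>+x. ennreal ((cmod (f n x - f k x))\<^sup>2) \<partial>torus_measure) \<le> ennreal ((1/4) ^ n)"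
    if "n \<le> k" for n k
  proof -
    have "dist (X (r n)) (X (r k)) \<le> (1/2) ^ n"
      using M[of n "r n" "r k"] r that by (simp add: less_imp_le)
    then have "(dist (X (r n)) (X (r k)))\<^sup>2 \<le> ((1/2) ^ n)\<^sup>2"
      by (intro power_mono) auto
    also have "((1/2) ^ n)\<^sup>2 = (1/4 :: real) ^ n"
      by (simp add: power2_eq_square flip: power_mult_distrib)
    finally show ?thesis
      by (simp add: dist_abs_L2_torus f abs_f ennreal_leI)
  qed
  let ?C = "emeasure (torus_measure :: (real ^ 'a) measure) UNIV"
  have C: "?C < \<infinity>"
    using finite_measure.emeasure_finite[OF finite_measure_torus] by (simp add: top.not_eq_extremum)
  have step: "(\<integral>\<^sup>+x. ennreal (cmod (f (Suc k) x - f k x)) \<partial>torus_measure)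
      \<le> ennreal ((1/2) ^ k) * (1 + ?C)" for k
  proof -
    have "a \<le> 2 ^ k * a\<^sup>2 + (1/2) ^ k" if "0 \<le> a" for a :: real
    proof -
      have "0 \<le> (2 ^ k * a - 1)\<^sup>2 + 2 ^ k * a"
        using that by simp
      then have "2 ^ k * a \<le> 2 ^ k * (2 ^ k * a\<^sup>2 + (1/2) ^ k)"
        by (simp add: power2_eq_square algebra_simps power_one_over)
      then show ?thesis
        by simp
    qed
    then have "(\<integral>\<^sup>+x. ennreal (cmod (f (Suc k) x - f k x)) \<partial>torus_measure) \<le>
        (\<integral>\<^sup>+x. ennreal (2 ^ k) * ennreal ((cmod (f k x - f (Suc k) x))\<^sup>2) + ennreal ((1/2) ^ k) \<partial>torus_measure)"
      by (intro nn_integral_mono)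
        (simp add: norm_minus_commute flip: ennreal_mult ennreal_plus del: ennreal_plus)
    also have "\<dots> = ennreal (2 ^ k) * (\<integral>\<^sup>+x. ennreal ((cmod (f k x - f (Suc k) x))\<^sup>2) \<partial>torus_measure)
        + ennreal ((1/2) ^ k) * ?C"
      by (simp add: nn_integral_add nn_integral_cmult)
    also have "\<dots> \<le> ennreal (2 ^ k) * ennreal ((1/4) ^ k) + ennreal ((1/2) ^ k) * ?C"
      by (intro add_mono mult_left_mono ff) auto
    also have "ennreal (2 ^ k) * ennreal ((1/4) ^ k) = ennreal ((1/2) ^ k)"
      by (simp flip: ennreal_mult power_mult_distrib)
    finally show ?thesis
      by (simp add: distrib_left)
  qed
  have "(\<integral>\<^sup>+x. (\<Sum>k. ennreal (cmod (f (Suc k) x - f k x))) \<partial>torus_measure) =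
      (\<Sum>k. \<integral>\<^sup>+x. ennreal (cmod (f (Suc k) x - f k x)) \<partial>torus_measure)"
    by (intro nn_integral_suminf) measurable
  also have "\<dots> \<le> (\<Sum>k. ennreal ((1/2) ^ k) * (1 + ?C))"
    by (intro suminf_le step) auto
  also have "\<dots> = (\<Sum>k. ennreal ((1/2) ^ k)) * (1 + ?C)"
    by simp
  also have "(\<Sum>k. ennreal ((1/2) ^ k)) = ennreal (\<Sum>k. (1/2) ^ k)"
    by (intro suminf_ennreal2) auto
  also have "ennreal (\<Sum>k. (1/2) ^ k) * (1 + ?C) < \<infinity>"
    using C by (simp add: ennreal_mult_less_top)
  finally have "AE x in torus_measure. (\<Sum>k. ennreal (cmod (f (Suc k) x - f k x))) \<noteq> \<infinity>"
    by (intro nn_integral_noteq_infinite) auto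
  then have conv: "AE x in torus_measure. (\<lambda>k. f k x) \<longlonglongrightarrow> lim (\<lambda>k. f k x)"
  proof eventually_elim
    case (elim x)
    then have "summable (\<lambda>k. cmod (f (Suc k) x - f k x))"
      by (intro summable_suminf_not_top) auto
    then have "summable (\<lambda>k. f (Suc k) x - f k x)"
      by (rule summable_norm_cancel)
    then have "convergent (\<lambda>n. f n x - f 0 x)"
      using sum_lessThan_telescope[of "\<lambda>k. f k x"] by (simp add: summable_iff_convergent)
    then have "convergent (\<lambda>n. f n x - f 0 x + f 0 x)"
      by (intro convergent_add convergent_const)
    then show ?case
      by (simp add: convergent_LIMSEQ_iff)
  qed
  define h where "h x = lim (\<lambda>k. f k x)" for x
  have h_meas [measurable]: "h \<in> borel_measurable borel"
    unfolding h_def by measurable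
  have fh: "(\<integral>\<^sup>+x. ennreal ((cmod (f n x - h x))\<^sup>2) \<partial>torus_measure) \<le> ennreal ((1/4) ^ n)" for n
  proof -
    have "(\<integral>\<^sup>+x. ennreal ((cmod (f n x - h x))\<^sup>2) \<partial>torus_measure) =
        (\<integral>\<^sup>+x. liminf (\<lambda>k. ennreal ((cmod (f n x - f k x))\<^sup>2)) \<partial>torus_measure)"
    proof (rule nn_integral_cong_AE)
      show "AE x in torus_measure. ennreal ((cmod (f n x - h x))\<^sup>2) =
          liminf (\<lambda>k. ennreal ((cmod (f n x - f k x))\<^sup>2))"
        using conv
      proof eventually_elim
        case (elim x)
        then have "(\<lambda>k. ennreal ((cmod (f n x - f k x))\<^sup>2)) \<longlonglongrightarrow> ennreal ((cmod (f n x - h x))\<^sup>2)"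
          unfolding h_def by (intro tendsto_intros)
        then show ?case
          by (intro lim_imp_Liminf[symmetric]) auto
      qed
    qed
    also have "\<dots> \<le> liminf (\<lambda>k. \<integral>\<^sup>+x. ennreal ((cmod (f n x - f k x))\<^sup>2) \<partial>torus_measure)"
      by (intro nn_integral_liminf) measurable
    also have "\<dots> \<le> limsup (\<lambda>k. \<integral>\<^sup>+x. ennreal ((cmod (f n x - f k x))\<^sup>2) \<partial>torus_measure)"
      by (intro Liminf_le_Limsup) auto
    also have "\<dots> \<le> ennreal ((1/4) ^ n)"
      by (intro Limsup_bounded eventually_sequentiallyI[of n] ff)
    finally show ?thesis .
  qed
  have diff: "square_integrable (\<lambda>x. f n x - h x)" for n
    unfolding square_integrable_def
  proof
    show "integrable torus_measure (\<lambda>x. (cmod (f n x - h x))\<^sup>2)"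
      using le_less_trans[OF fh ennreal_less_top]
      by (intro integrableI_bounded) auto
  qed measurable
  then have h: "square_integrable h"
    using square_integrable_diff[OF f[of 0] diff[of 0]] by simp
  have "X \<longlonglongrightarrow> abs_L2_torus h"
  proof (rule metric_LIMSEQ_I)
    fix e :: real assume "0 < e"
    then obtain n where n: "(1/2) ^ n < e / 2"
      using real_arch_pow_inv[of "e / 2" "1/2"] by auto
    have "ennreal ((dist (X (r n)) (abs_L2_torus h))\<^sup>2) \<le> ennreal ((1/4) ^ n)"
      using fh[of n] dist_abs_L2_torus[OF f[of n] h] by (simp add: abs_f)
    then have "(dist (X (r n)) (abs_L2_torus h))\<^sup>2 \<le> (1/4) ^ n"
      by simp
    also have "(1/4 :: real) ^ n = ((1/2) ^ n)\<^sup>2"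
      by (simp add: power2_eq_square flip: power_mult_distrib)
    finally have Y: "dist (X (r n)) (abs_L2_torus h) \<le> (1/2) ^ n"
      by (rule power2_le_imp_le) simp
    have "dist (X m) (abs_L2_torus h) < e" if "M n \<le> m" for m
      using dist_triangle[of "X m" "abs_L2_torus h" "X (r n)"] M[OF that r[of n n]] Y n by simp
    then show "\<exists>N. \<forall>m\<ge>N. dist (X m) (abs_L2_torus h) < e"
      by blast
  qed
  then show "convergent X"
    by (rule convergentI)
qed

instantiation L2_torus :: (finite) complex_hilbert
begin

definition scaleC_L2_torus :: "complex \<Rightarrow> 'a L2_torus \<Rightarrow> 'a L2_torus" where
  "scaleC_L2_torus = L2_scale"

definition cinner_L2_torus :: "'a L2_torus \<Rightarrow> 'a L2_torus \<Rightarrow> complex" where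
  "cinner_L2_torus = L2_cinner"

instance
proof
  fix u v w :: "'a L2_torus" and a b :: complex and r :: real
  show "a *\<^sub>C (u + v) = a *\<^sub>C u + a *\<^sub>C v"
    unfolding scaleC_L2_torus_def
    by transfer (auto simp: square_integrable_add square_integrable_mult distrib_left[symmetric])
  show "(a + b) *\<^sub>C u = a *\<^sub>C u + b *\<^sub>C u"
    unfolding scaleC_L2_torus_def
    by transfer (auto simp: square_integrable_mult distrib_right[symmetric])
  show "a *\<^sub>C b *\<^sub>C u = (a * b) *\<^sub>C u"
    unfolding scaleC_L2_torus_def
    by transfer (auto simp: square_integrable_mult mult.assoc)
  show "r *\<^sub>R u = complex_of_real r *\<^sub>C u"
    by (simp add: scaleC_L2_torus_def scaleR_L2_torus_def)
  show "cinner u v = cnj (cinner v u)"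
    unfolding cinner_L2_torus_def
  proof transfer
    fix u v :: "real ^ 'a \<Rightarrow> complex"
    show "(LINT x|torus_measure. cnj (u x) * v x) = cnj (LINT x|torus_measure. cnj (v x) * u x)"
      using Bochner_Integration.integral_cnj[of torus_measure "\<lambda>x. cnj (v x) * u x"] by (simp add: mult.commute)
  qed
  show "cinner u (v + w) = cinner u v + cinner u w"
    unfolding cinner_L2_torus_def
    by transfer (simp add: square_integrable_product distrib_left)
  show "cinner u (a *\<^sub>C v) = a * cinner u v"
    unfolding cinner_L2_torus_def scaleC_L2_torus_def
    by transfer (simp add: mult.left_commute)
  show "inner u v = Re (cinner u v)"
    by (simp add: inner_L2_torus_def cinner_L2_torus_def)
qed

end


section \<open>The Laplacian\<close>

definition partial_deriv :: "'n \<Rightarrow> (real ^ 'n \<Rightarrow> complex) \<Rightarrow> real ^ 'n \<Rightarrow> complex" where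
  "partial_deriv i u x = frechet_derivative u (at x) (axis i 1)"

primrec Ck :: "nat \<Rightarrow> (real ^ 'n \<Rightarrow> complex) \<Rightarrow> bool" where
  "Ck 0 u \<longleftrightarrow> continuous_on UNIV u"
| "Ck (Suc k) u \<longleftrightarrow> (\<forall>x. u differentiable (at x)) \<and> (\<forall>i. Ck k (partial_deriv i u))"

text \<open>Smooth functions on the torus, as periodic functions on \<open>real ^ 'n\<close>.\<close>

definition smooth_torus :: "(real ^ 'n \<Rightarrow> complex) \<Rightarrow> bool" where
  "smooth_torus u \<longleftrightarrow> (\<forall>k. Ck k u) \<and> (\<forall>x i. u (x + axis i (2 * pi)) = u x)"

text \<open>On functions, the Hodge Laplacian of the flat metric is \<open>-\<Sum>\<^sub>i \<partial>\<^sub>i\<^sup>2\<close>. It is essentially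
  self-adjoint on the smooth functions; the self-adjoint operator \<open>\<Delta>\<close>, the closure, is given
  by its graph.\<close>

definition hodge_laplacian :: "(real ^ 'n \<Rightarrow> complex) \<Rightarrow> real ^ 'n \<Rightarrow> complex" where
  "hodge_laplacian u x = - (\<Sum>i\<in>UNIV. partial_deriv i (partial_deriv i u) x)"

definition Laplacian :: "('n::finite L2_torus \<times> 'n L2_torus) set" where
  "Laplacian = closure {(abs_L2_torus u, abs_L2_torus (hodge_laplacian u)) | u. smooth_torus u}"

text \<open>Borel functional calculus of a self-adjoint operator (given by its graph) with an
  orthonormal basis of eigenvectors, such as \<open>\<Delta>\<close>: for bounded \<open>G\<close> the condition below
  determines the bounded operator \<open>G(\<Delta>)\<close>.\<close>

definition function_of :: "(real \<Rightarrow> real) \<Rightarrow> ('h::complex_hilbert \<times> 'h) set \<Rightarrow> 'h op" where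
  "function_of G D = (SOME T :: 'h op. complex_linear T \<and>
     (\<forall>v s. (v, s *\<^sub>R v) \<in> D \<longrightarrow> T v = G s *\<^sub>R v))"


section \<open>The symmetrised product\<close>

text \<open>\<open>M\<^sub>g\<close> with its maximal domain.\<close>

definition mult_domain :: "(real ^ 'n \<Rightarrow> complex) \<Rightarrow> 'n::finite L2_torus set" where
  "mult_domain g = {u. square_integrable (\<lambda>x. g x * rep_L2_torus u x)}"

definition mult_op :: "(real ^ 'n \<Rightarrow> complex) \<Rightarrow> 'n::finite L2_torus \<Rightarrow> 'n L2_torus" where
  "mult_op g u = abs_L2_torus (\<lambda>x. g x * rep_L2_torus u x)"

text \<open>\<open>X\<close> is the closure of the operator \<open>M\<^sub>g S\<close>, which is densely defined on the vectors that
  \<open>S\<close> maps into the domain of \<open>M\<^sub>g\<close>, and bounded.\<close>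

definition is_bounded_closure ::
    "(real ^ 'n \<Rightarrow> complex) \<Rightarrow> 'n::finite L2_torus op \<Rightarrow> 'n L2_torus op \<Rightarrow> bool" where
  "is_bounded_closure g S X \<longleftrightarrow> complex_linear X \<and>
     closure {u. S u \<in> mult_domain g} = UNIV \<and>
     (\<forall>u. S u \<in> mult_domain g \<longrightarrow> X u = mult_op g (S u))"

text \<open>\<open>|M\<^bsub>\<surd>h\<^esub> \<surd>A|\<^sup>2\<close> for \<open>h \<ge> 0\<close>.\<close>

definition sandwich_nonneg_defined ::
    "'n::finite L2_torus op \<Rightarrow> (real ^ 'n \<Rightarrow> real) \<Rightarrow> bool" where
  "sandwich_nonneg_defined A h \<longleftrightarrow>
     (\<exists>X. is_bounded_closure (\<lambda>x. complex_of_real (sqrt (h x))) (sqrt_op A) X)"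

definition sandwich_nonneg ::
    "'n::finite L2_torus op \<Rightarrow> (real ^ 'n \<Rightarrow> real) \<Rightarrow> 'n L2_torus op" where
  "sandwich_nonneg A h =
     (let X = (SOME X. is_bounded_closure (\<lambda>x. complex_of_real (sqrt (h x))) (sqrt_op A) X)
      in abs_op X o\<^sub>L abs_op X)"

text \<open>\<open>\<langle>M\<^sub>f\<rangle>\<^sub>A\<close>, from \<open>f = (Re f)\<^sub>+ - (Re f)\<^sub>- + \<i> ((Im f)\<^sub>+ - (Im f)\<^sub>-)\<close>.\<close>

definition sandwich_defined ::
    "'n::finite L2_torus op \<Rightarrow> (real ^ 'n \<Rightarrow> complex) \<Rightarrow> bool" where
  "sandwich_defined A f \<longleftrightarrow>
     sandwich_nonneg_defined A (\<lambda>x. max 0 (Re (f x))) \<and>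
     sandwich_nonneg_defined A (\<lambda>x. max 0 (- Re (f x))) \<and>
     sandwich_nonneg_defined A (\<lambda>x. max 0 (Im (f x))) \<and>
     sandwich_nonneg_defined A (\<lambda>x. max 0 (- Im (f x)))"

definition sandwich ::
    "'n::finite L2_torus op \<Rightarrow> (real ^ 'n \<Rightarrow> complex) \<Rightarrow> 'n L2_torus op" where
  "sandwich A f =
     sandwich_nonneg A (\<lambda>x. max 0 (Re (f x))) - sandwich_nonneg A (\<lambda>x. max 0 (- Re (f x))) +
     scale_op \<i> (sandwich_nonneg A (\<lambda>x. max 0 (Im (f x)))
       - sandwich_nonneg A (\<lambda>x. max 0 (- Im (f x))))"

end

theory Submission
  imports Defs
begin

text \<open>
  Let \<open>a\<^sub>k\<close> be the eigenvalues of \<open>A\<close> on the exponentials. By Ky Fan's maximum principle, all estimates of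
  singular values reduce to bounds for \<open>\<Sum>\<^sub>w \<integral> h |\<surd>A w|\<^sup>2\<close> over finite orthonormal sets. On the set where
  \<open>\<lfloor>h\<rfloor> = j\<close>, split \<open>\<surd>A w\<close> at the \<open>n (j + 1)\<^sup>4\<close>-th largest eigenvalue: the exponentials
  have modulus one, so Bessel's inequality bounds the first part pointwise by a partial sum of the \<open>a\<^sub>k\<close>, while
  the remainder has small norm. Summing over \<open>j\<close> gives \<open>O(log (1 + n))\<close> uniformly on the unit ball of \<open>L\<^sup>p\<close>,
  \<open>p > 1\<close>, without interpolation theory.

  Hence \<open>h \<mapsto> Tr\<^sub>\<omega>(\<langle>M\<^sub>h\<rangle>\<^sub>A)\<close> is additive and \<open>L\<^sup>p\<close>-continuous. Diagonal unitaries commute with \<open>A\<close> and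
  translate \<open>h\<close>, which fixes the functional on \<open>1 + cos (m \<cdot> x + \<theta>)\<close>. The exponentials are total in \<open>L\<^sup>2\<close>, so
  it is \<open>c \<integral> h\<close> there, and truncation extends this to \<open>L\<^sup>p\<close>.
\<close>

section \<open>Orthonormal families\<close>

instance complex_hilbert \<subseteq> banach ..

lemma cinner_add_left: "cinner (x + y) z = cinner x z + cinner y (z :: 'h::complex_hilbert)"
  by (metis cinner_commute cinner_add_right complex_cnj_add)

lemma cinner_scaleR_right: "cinner x (r *\<^sub>R y) = r *\<^sub>R cinner x (y :: 'h::complex_hilbert)"
  by (simp add: scaleR_scaleC cinner_scaleC_right scaleR_conv_of_real)

lemma cinner_scaleR_left: "cinner (r *\<^sub>R x) y = r *\<^sub>R cinner x (y :: 'h::complex_hilbert)"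
  by (simp add: scaleR_scaleC cinner_scaleC_left scaleR_conv_of_real)

lemma norm_power2_cinner: "(norm x)\<^sup>2 = Re (cinner x (x :: 'h::complex_hilbert))"
  by (simp add: power2_norm_eq_inner inner_eq_Re_cinner)

lemma cinner_self: "cinner x x = complex_of_real ((norm (x :: 'h::complex_hilbert))\<^sup>2)"
proof -
  have "Im (cinner x x) = 0"
    using arg_cong[OF cinner_commute[of x x], of Im] by simp
  then show ?thesis
    by (simp add: norm_power2_cinner complex_eq_iff)
qed

lemma complex_phase:
  obtains c where "cmod c = 1" "c * z = complex_of_real (cmod z)"
proof (cases "z = 0")
  case True
  then show ?thesis using that[of 1] by simp
next
  case False
  have "cnj (sgn z) * z = cnj z * z / cmod z"
    by (simp add: sgn_eq)
  also have "cnj z * z = complex_of_real (cmod z) * complex_of_real (cmod z)"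
    using complex_norm_square[of z] by (simp add: mult.commute power2_eq_square)
  finally show ?thesis
    using that[of "cnj (sgn z)"] False by (simp add: norm_sgn)
qed

lemma cinner_bound: "cmod (cinner x y) \<le> norm x * norm (y :: 'h::complex_hilbert)"
proof -
  obtain c where c: "cmod c = 1" "c * cinner x y = complex_of_real (cmod (cinner x y))"
    by (rule complex_phase)
  have "cmod (cinner x y) = Re (cinner x (c *\<^sub>C y))"
    using c by (simp add: cinner_scaleC_right)
  also have "\<dots> = inner x (c *\<^sub>C y)"
    by (simp add: inner_eq_Re_cinner)
  also have "\<dots> \<le> norm x * norm (c *\<^sub>C y)"
    by (rule norm_cauchy_schwarz)
  finally show ?thesis
    using c by (simp add: norm_scaleC)
qed

interpretation cinner: bounded_bilinear "cinner :: 'h \<Rightarrow> 'h \<Rightarrow> complex" for dummy :: "'h::complex_hilbert"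
  by unfold_locales
    (auto simp: cinner_add_left cinner_add_right cinner_scaleR_left cinner_scaleR_right cinner_bound
      intro!: exI[of _ 1])

interpretation scaleC: bounded_bilinear "scaleC :: complex \<Rightarrow> 'h \<Rightarrow> 'h" for dummy :: "'h::complex_hilbert"
  by unfold_locales
    (auto simp: scaleC_add_left scaleC_add_right scaleR_scaleC scaleC_scaleC norm_scaleC
      scaleR_conv_of_real mult.commute intro!: exI[of _ 1])

lemmas [simp] = cinner.zero_left cinner.zero_right scaleC.zero_left scaleC.zero_right

lemma cinner_ext:
  assumes "\<And>z :: 'h::complex_hilbert. cinner z x = cinner z y"
  shows "x = y"
proof -
  have "cinner (x - y) (x - y) = 0"
    using assms by (simp add: cinner.diff_right)
  then show ?thesis
    by (simp add: cinner_self)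
qed

lemma cinner_ext_left:
  assumes "\<And>z :: 'h::complex_hilbert. cinner x z = cinner y z"
  shows "x = y"
  by (rule cinner_ext) (metis assms cinner_commute)

lemma cinner_eq_0_commute: "cinner x y = 0 \<longleftrightarrow> cinner y (x :: 'h::complex_hilbert) = 0"
  by (metis cinner_commute complex_cnj_zero)

lemma cmod_cinner_commute: "cmod (cinner x y) = cmod (cinner y (x :: 'h::complex_hilbert))"
  by (metis cinner_commute complex_mod_cnj)

lemma cinner_mult_commute: "cinner x y * cinner y (x :: 'h::complex_hilbert) = complex_of_real ((cmod (cinner x y))\<^sup>2)"
  using complex_norm_square[of "cinner x y"] cinner_commute[of y x] by simp

definition orthonormal :: "'i set \<Rightarrow> ('i \<Rightarrow> 'h::complex_hilbert) \<Rightarrow> bool" where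
  "orthonormal I \<phi> \<longleftrightarrow> (\<forall>i\<in>I. \<forall>j\<in>I. cinner (\<phi> i) (\<phi> j) = (if i = j then 1 else 0))"

lemma orthonormalD: "orthonormal I \<phi> \<Longrightarrow> i \<in> I \<Longrightarrow> j \<in> I \<Longrightarrow> cinner (\<phi> i) (\<phi> j) = (if i = j then 1 else 0)"
  by (simp add: orthonormal_def)

lemma orthonormal_subset: "orthonormal I \<phi> \<Longrightarrow> J \<subseteq> I \<Longrightarrow> orthonormal J \<phi>"
  unfolding orthonormal_def by blast

lemma orthonormal_norm: "orthonormal I \<phi> \<Longrightarrow> i \<in> I \<Longrightarrow> norm (\<phi> i) = 1"
  using orthonormalD[of I \<phi> i i] norm_power2_cinner[of "\<phi> i"]
  by (smt (verit) norm_ge_zero one_complex.simps(1) power2_eq_1_iff)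

lemma orthonormal_inj: "orthonormal I \<phi> \<Longrightarrow> inj_on \<phi> I"
  by (rule inj_onI) (metis orthonormalD zero_neq_one)

lemma orthonormal_image:
  assumes "orthonormal I \<phi>"
  shows "orthonormal (\<phi> ` I) (\<lambda>x. x)"
  using assms orthonormal_inj[OF assms] by (auto simp: orthonormal_def inj_on_def)

lemma cinner_orthonormal_sum:
  assumes "orthonormal I \<phi>" "finite I" "i \<in> I"
  shows "cinner (\<phi> i) (\<Sum>j\<in>I. c j *\<^sub>C \<phi> j) = c i"
proof -
  have "cinner (\<phi> i) (\<Sum>j\<in>I. c j *\<^sub>C \<phi> j) = (\<Sum>j\<in>I. c j * (if i = j then 1 else 0))"
    using assms by (simp add: cinner.sum_right cinner_scaleC_right orthonormalD)
  also have "\<dots> = c i"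
    using assms by (simp add: if_distrib sum.delta' cong: if_cong)
  finally show ?thesis .
qed

lemma norm_orthonormal_sum:
  assumes "orthonormal I \<phi>" "finite I"
  shows "(norm (\<Sum>i\<in>I. c i *\<^sub>C \<phi> i))\<^sup>2 = (\<Sum>i\<in>I. (cmod (c i))\<^sup>2)"
proof -
  have "cinner (\<Sum>i\<in>I. c i *\<^sub>C \<phi> i) (\<Sum>i\<in>I. c i *\<^sub>C \<phi> i) = (\<Sum>i\<in>I. cnj (c i) * c i)"
    using assms by (simp add: cinner.sum_left cinner_scaleC_left cinner_orthonormal_sum)
  also have "\<dots> = complex_of_real (\<Sum>i\<in>I. (cmod (c i))\<^sup>2)"
    using complex_norm_square by (simp add: mult.commute)
  finally show ?thesis
    unfolding cinner_self of_real_eq_iff .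
qed

lemma orthonormal_complement:
  assumes "orthonormal I \<phi>" "finite I" "i \<in> I"
  shows "cinner (\<phi> i) (x - (\<Sum>j\<in>I. cinner (\<phi> j) x *\<^sub>C \<phi> j)) = 0"
  using cinner_orthonormal_sum[OF assms] by (simp add: cinner.diff_right)

lemma norm_projection:
  assumes "orthonormal I \<phi>" "finite I"
  shows "(norm x)\<^sup>2 = (\<Sum>i\<in>I. (cmod (cinner (\<phi> i) x))\<^sup>2) + (norm (x - (\<Sum>i\<in>I. cinner (\<phi> i) x *\<^sub>C \<phi> i)))\<^sup>2"
proof -
  let ?p = "\<Sum>i\<in>I. cinner (\<phi> i) x *\<^sub>C \<phi> i"
  have "cinner ?p (x - ?p) = 0"
    using orthonormal_complement[OF assms] by (simp add: cinner.sum_left cinner_scaleC_left)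
  then have "inner ?p (x - ?p) = 0"
    by (simp add: inner_eq_Re_cinner)
  then have "(norm (?p + (x - ?p)))\<^sup>2 = (norm ?p)\<^sup>2 + (norm (x - ?p))\<^sup>2"
    by (simp only: power2_norm_eq_inner inner_add_left inner_add_right inner_commute[of "x - ?p" ?p])
  then show ?thesis
    using norm_orthonormal_sum[OF assms, of "\<lambda>i. cinner (\<phi> i) x"] by simp
qed

lemma bessel:
  assumes "orthonormal I \<phi>" "finite I"
  shows "(\<Sum>i\<in>I. (cmod (cinner (\<phi> i) x))\<^sup>2) \<le> (norm x)\<^sup>2"
  using norm_projection[OF assms, of x] by simp

lemma bessel_summable:
  assumes "orthonormal (UNIV :: nat set) \<phi>"
  shows "summable (\<lambda>k. (cmod (cinner (\<phi> k) x))\<^sup>2)"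
  using bessel[OF orthonormal_subset[OF assms]]
  by (intro summableI_nonneg_bounded[where x = "(norm x)\<^sup>2"]) auto

lemma riesz_fischer:
  assumes \<phi>: "orthonormal (UNIV :: nat set) \<phi>" and c: "summable (\<lambda>k. (cmod (c k))\<^sup>2)"
  shows "summable (\<lambda>k. c k *\<^sub>C \<phi> k)"
  unfolding summable_Cauchy
proof (intro allI impI)
  fix e :: real assume "0 < e"
  then obtain N where N: "\<And>m n. N \<le> m \<Longrightarrow> norm (\<Sum>k\<in>{m..<n}. (cmod (c k))\<^sup>2) < e\<^sup>2"
    using c unfolding summable_Cauchy by (meson zero_less_power)
  have "norm (\<Sum>k\<in>{m..<n}. c k *\<^sub>C \<phi> k) < e" if "N \<le> m" for m n
  proof -
    have "(norm (\<Sum>k\<in>{m..<n}. c k *\<^sub>C \<phi> k))\<^sup>2 = (\<Sum>k\<in>{m..<n}. (cmod (c k))\<^sup>2)"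
      by (intro norm_orthonormal_sum orthonormal_subset[OF \<phi>]) auto
    also have "\<dots> < e\<^sup>2"
      using N[OF that, of n] by simp
    finally show ?thesis
      using \<open>0 < e\<close> by (simp add: power_less_imp_less_base)
  qed
  then show "\<exists>N. \<forall>m\<ge>N. \<forall>n. norm (\<Sum>k\<in>{m..<n}. c k *\<^sub>C \<phi> k) < e"
    by blast
qed

lemma orthonormal_sums_coeff:
  assumes \<phi>: "orthonormal (UNIV :: nat set) \<phi>" and y: "(\<lambda>k. c k *\<^sub>C \<phi> k) sums y"
  shows "cinner (\<phi> k) y = c k"
proof -
  have "(\<lambda>j. cinner (\<phi> k) (c j *\<^sub>C \<phi> j)) sums cinner (\<phi> k) y"
    by (rule bounded_linear.sums[OF cinner.bounded_linear_right y])
  also have "(\<lambda>j. cinner (\<phi> k) (c j *\<^sub>C \<phi> j)) = (\<lambda>j. if j = k then c k else 0)"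
    using \<phi> by (auto simp: cinner_scaleC_right orthonormal_def)
  finally have "(\<lambda>j. if j = k then c k else 0) sums cinner (\<phi> k) y" .
  then show ?thesis
    by (rule sums_unique2[OF _ sums_single])
qed

lemma orthonormal_sums_norm:
  assumes \<phi>: "orthonormal (UNIV :: nat set) \<phi>" and y: "(\<lambda>k. c k *\<^sub>C \<phi> k) sums y"
  shows "(\<lambda>k. (cmod (c k))\<^sup>2) sums (norm y)\<^sup>2"
proof -
  have "(\<lambda>j. cinner y (c j *\<^sub>C \<phi> j)) sums cinner y y"
    by (rule bounded_linear.sums[OF cinner.bounded_linear_right y])
  also have "(\<lambda>j. cinner y (c j *\<^sub>C \<phi> j)) = (\<lambda>j. complex_of_real ((cmod (c j))\<^sup>2))"
  proof
    fix j
    have "cinner y (\<phi> j) = cnj (c j)"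
      using orthonormal_sums_coeff[OF assms, of j] by (metis cinner_commute)
    then show "cinner y (c j *\<^sub>C \<phi> j) = complex_of_real ((cmod (c j))\<^sup>2)"
      unfolding cinner_scaleC_right complex_norm_square by simp
  qed
  finally show ?thesis
    unfolding cinner_self using sums_of_real_iff[where 'a=complex] by blast
qed

lemma orthonormal_sequence_avoids:
  fixes e :: "nat \<Rightarrow> 'h::complex_hilbert"
  assumes e: "orthonormal UNIV e" and W: "finite (W :: 'h set)" "orthonormal W (\<lambda>x. x)"
  obtains z where "z \<noteq> 0" "\<And>w. w \<in> W \<Longrightarrow> cinner w z = 0"
proof -
  have "\<exists>k. e k - (\<Sum>w\<in>W. cinner w (e k) *\<^sub>C w) \<noteq> 0"
  proof (rule ccontr)
    assume "\<not> ?thesis"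
    then have "1 = (\<Sum>w\<in>W. (cmod (cinner w (e k)))\<^sup>2)" for k
      using norm_projection[OF W(2,1), of "e k"] orthonormal_norm[OF e, of k] by simp
    then have "real (Suc (card W)) = (\<Sum>k<Suc (card W). \<Sum>w\<in>W. (cmod (cinner w (e k)))\<^sup>2)"
      by simp
    also have "\<dots> = (\<Sum>w\<in>W. \<Sum>k<Suc (card W). (cmod (cinner (e k) w))\<^sup>2)"
      by (subst sum.swap) (simp add: cmod_cinner_commute)
    also have "\<dots> \<le> (\<Sum>w\<in>W. (norm w)\<^sup>2)"
      by (intro sum_mono bessel orthonormal_subset[OF e]) auto
    also have "\<dots> = (\<Sum>w\<in>W. 1)"
      using orthonormal_norm[OF W(2)] by (intro sum.cong) auto
    finally show False
      by simp
  qed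
  then show ?thesis
    using that orthonormal_complement[OF W(2,1)] by blast
qed

section \<open>Diagonal operators\<close>

definition diag_op :: "(nat \<Rightarrow> 'h::complex_hilbert) \<Rightarrow> (nat \<Rightarrow> complex) \<Rightarrow> 'h op" where
  "diag_op \<phi> s = Blinfun (\<lambda>x. \<Sum>k. (s k * cinner (\<phi> k) x) *\<^sub>C \<phi> k)"

abbreviation real_diag_op :: "(nat \<Rightarrow> 'h::complex_hilbert) \<Rightarrow> (nat \<Rightarrow> real) \<Rightarrow> 'h op" where
  "real_diag_op \<phi> s \<equiv> diag_op \<phi> (\<lambda>k. complex_of_real (s k))"

context
  fixes \<phi> :: "nat \<Rightarrow> 'h::complex_hilbert" and s :: "nat \<Rightarrow> complex"
  assumes \<phi>: "orthonormal UNIV \<phi>" and s: "bounded (range s)"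
begin

lemma diag_op_sums: "(\<lambda>k. (s k * cinner (\<phi> k) x) *\<^sub>C \<phi> k) sums diag_op \<phi> s x"
  and norm_diag_op_le: "(\<And>k. cmod (s k) \<le> M) \<Longrightarrow> norm (diag_op \<phi> s x) \<le> M * norm x"
proof -
  obtain B where B: "\<And>k. cmod (s k) \<le> B"
    using s by (auto simp: bounded_iff)
  have le: "(cmod (s k * cinner (\<phi> k) x))\<^sup>2 \<le> M\<^sup>2 * (cmod (cinner (\<phi> k) x))\<^sup>2"
    if "\<And>k. cmod (s k) \<le> M" for M k x
    using that[of k] by (auto simp: norm_mult power_mult_distrib intro!: mult_right_mono power_mono)
  have summ: "summable (\<lambda>k. (cmod (s k * cinner (\<phi> k) x))\<^sup>2)" for x
    by (rule summable_comparison_test'[OF summable_mult[OF bessel_summable[OF \<phi>]], of 0 _ "B\<^sup>2" x])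
      (use le[OF B] in auto)
  let ?f = "\<lambda>x. \<Sum>k. (s k * cinner (\<phi> k) x) *\<^sub>C \<phi> k"
  have sums: "(\<lambda>k. (s k * cinner (\<phi> k) x) *\<^sub>C \<phi> k) sums ?f x" for x
    by (intro summable_sums riesz_fischer[OF \<phi> summ])
  have bound: "norm (?f x) \<le> M * norm x" if M: "\<And>k. cmod (s k) \<le> M" for M x
  proof (rule power2_le_imp_le)
    have "(norm (?f x))\<^sup>2 = (\<Sum>k. (cmod (s k * cinner (\<phi> k) x))\<^sup>2)"
      using orthonormal_sums_norm[OF \<phi> sums[of x]] by (simp add: sums_iff)
    also have "\<dots> \<le> (\<Sum>k. M\<^sup>2 * (cmod (cinner (\<phi> k) x))\<^sup>2)"
      by (intro suminf_le le M summ summable_mult bessel_summable[OF \<phi>])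
    also have "\<dots> = M\<^sup>2 * (\<Sum>k. (cmod (cinner (\<phi> k) x))\<^sup>2)"
      by (intro suminf_mult bessel_summable[OF \<phi>])
    also have "\<dots> \<le> M\<^sup>2 * (norm x)\<^sup>2"
      by (intro mult_left_mono suminf_le_const bessel_summable[OF \<phi>] bessel orthonormal_subset[OF \<phi>]) auto
    finally show "(norm (?f x))\<^sup>2 \<le> (M * norm x)\<^sup>2"
      by (simp add: power_mult_distrib)
    show "0 \<le> M * norm x"
      using order_trans[OF norm_ge_zero M[of 0]] by simp
  qed
  have "bounded_linear ?f"
  proof (rule bounded_linear_intro)
    show "?f (x + y) = ?f x + ?f y" for x y
      using sums_add[OF sums[of x] sums[of y]]
      by (simp add: cinner_add_right distrib_left scaleC_add_left sums_iff)
    show "?f (r *\<^sub>R x) = r *\<^sub>R ?f x" for r x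
      using sums_scaleR_right[OF sums[of x], of r]
      by (simp add: cinner_scaleR_right sums_iff scaleC.scaleR_left)
    show "norm (?f x) \<le> norm x * B" for x
      using bound[OF B] by (simp add: mult.commute)
  qed
  then have eq: "blinfun_apply (diag_op \<phi> s) = ?f"
    by (simp add: diag_op_def bounded_linear_Blinfun_apply)
  show "(\<lambda>k. (s k * cinner (\<phi> k) x) *\<^sub>C \<phi> k) sums diag_op \<phi> s x"
    using sums eq by simp
  show "norm (diag_op \<phi> s x) \<le> M * norm x" if "\<And>k. cmod (s k) \<le> M"
    using bound[OF that] eq by simp
qed

lemma cinner_diag_op: "cinner (\<phi> k) (diag_op \<phi> s x) = s k * cinner (\<phi> k) x"
  by (rule orthonormal_sums_coeff[OF \<phi> diag_op_sums])

lemma cinner_diag_op_sums: "(\<lambda>k. s k * cinner y (\<phi> k) * cinner (\<phi> k) x) sums cinner y (diag_op \<phi> s x)"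
  using bounded_linear.sums[OF cinner.bounded_linear_right diag_op_sums, of y x]
  by (simp add: cinner_scaleC_right ac_simps)

lemma norm_diag_op_sums: "(\<lambda>k. (cmod (s k))\<^sup>2 * (cmod (cinner (\<phi> k) x))\<^sup>2) sums (norm (diag_op \<phi> s x))\<^sup>2"
  using orthonormal_sums_norm[OF \<phi> diag_op_sums, of x] by (simp add: norm_mult power_mult_distrib)

lemma diag_op_eigen: "diag_op \<phi> s (\<phi> k) = s k *\<^sub>C \<phi> k"
proof -
  have "(\<lambda>j. (s j * cinner (\<phi> j) (\<phi> k)) *\<^sub>C \<phi> j) = (\<lambda>j. if j = k then s k *\<^sub>C \<phi> k else 0)"
    using \<phi> by (auto simp: orthonormal_def scaleC.zero_left)
  then have "(\<lambda>j. if j = k then s k *\<^sub>C \<phi> k else 0) sums diag_op \<phi> s (\<phi> k)"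
    using diag_op_sums[of "\<phi> k"] by (simp only:)
  then show ?thesis
    by (rule sums_unique2[OF _ sums_single])
qed

lemma diag_op_complement: "(\<And>k. cinner (\<phi> k) x = 0) \<Longrightarrow> diag_op \<phi> s x = 0"
  using diag_op_sums[of x] by (simp add: scaleC.zero_left sums_iff)

lemma complex_linear_diag_op: "complex_linear (diag_op \<phi> s)"
  unfolding complex_linear_def
proof (intro allI)
  fix c x
  have "(\<lambda>k. c *\<^sub>C ((s k * cinner (\<phi> k) x) *\<^sub>C \<phi> k)) sums (c *\<^sub>C diag_op \<phi> s x)"
    by (rule bounded_linear.sums[OF scaleC.bounded_linear_right diag_op_sums])
  then have "(\<lambda>k. (s k * cinner (\<phi> k) (c *\<^sub>C x)) *\<^sub>C \<phi> k) sums (c *\<^sub>C diag_op \<phi> s x)"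
    by (simp add: scaleC_scaleC cinner_scaleC_right mult.left_commute)
  then show "diag_op \<phi> s (c *\<^sub>C x) = c *\<^sub>C diag_op \<phi> s x"
    by (rule sums_unique2[OF diag_op_sums])
qed

end

lemma diag_op_compose:
  assumes \<phi>: "orthonormal UNIV \<phi>" and s: "bounded (range s)" and t: "bounded (range t)"
  shows "diag_op \<phi> s o\<^sub>L diag_op \<phi> t = diag_op \<phi> (\<lambda>k. s k * t k)"
proof (rule blinfun_eqI)
  fix x
  have "bounded (range (\<lambda>k. s k * t k))"
  proof -
    obtain A where A: "\<And>k. cmod (s k) \<le> A"
      using s by (auto simp: bounded_iff)
    obtain B where B: "\<And>k. cmod (t k) \<le> B"
      using t by (auto simp: bounded_iff)
    note A B
    moreover have "0 \<le> A"
      using norm_ge_zero A by (rule order_trans)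
    ultimately have "cmod (s k * t k) \<le> A * B" for k
      unfolding norm_mult by (intro mult_mono) auto
    then show ?thesis
      by (auto simp: bounded_iff)
  qed
  from diag_op_sums[OF \<phi> this, of x]
  have "(\<lambda>k. (s k * cinner (\<phi> k) (diag_op \<phi> t x)) *\<^sub>C \<phi> k) sums diag_op \<phi> (\<lambda>k. s k * t k) x"
    by (simp add: cinner_diag_op[OF \<phi> t] mult.assoc)
  then have "diag_op \<phi> s (diag_op \<phi> t x) = diag_op \<phi> (\<lambda>k. s k * t k) x"
    by (rule sums_unique2[OF diag_op_sums[OF \<phi> s]])
  then show "(diag_op \<phi> s o\<^sub>L diag_op \<phi> t) x = diag_op \<phi> (\<lambda>k. s k * t k) x"
    by simp
qed

section \<open>Positive operators\<close>

lemma complex_linearD: "complex_linear T \<Longrightarrow> T (c *\<^sub>C x) = c *\<^sub>C T x"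
  by (simp add: complex_linear_def)

lemma complex_linear_add: "complex_linear S \<Longrightarrow> complex_linear T \<Longrightarrow> complex_linear (S + T)"
  by (simp add: complex_linear_def blinfun.add_left scaleC_add_right)

lemma complex_linear_diff: "complex_linear S \<Longrightarrow> complex_linear T \<Longrightarrow> complex_linear (S - T)"
  by (simp add: complex_linear_def blinfun.diff_left scaleC.diff_right)

lemma complex_linear_scale: "complex_linear T \<Longrightarrow> complex_linear (scale_op c T)"
  by (simp add: complex_linear_def scale_op.rep_eq scaleC_scaleC mult.commute)

lemma complex_linear_compose: "complex_linear S \<Longrightarrow> complex_linear T \<Longrightarrow> complex_linear (S o\<^sub>L T)"
  by (simp add: complex_linear_def)

lemma form_zero_imp_zero:
  fixes D :: "'h::complex_hilbert op"
  assumes D: "complex_linear D" and 0: "\<And>x. cinner x (D x) = 0"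
  shows "D = 0"
proof -
  have "cinner x (D y) = 0" for x y
  proof -
    have "cinner x (D y) + cinner y (D x) = 0"
      using 0[of "x + y"] 0[of x] 0[of y]
      by (simp add: blinfun.add_right cinner_add_left cinner_add_right add.commute)
    moreover have "\<i> * cinner x (D y) - \<i> * cinner y (D x) = 0"
      using 0[of "x + \<i> *\<^sub>C y"] 0[of x] 0[of y] complex_linearD[OF D]
      by (simp add: blinfun.add_right cinner_add_left cinner_add_right cinner_scaleC_left cinner_scaleC_right)
    ultimately show ?thesis
      by (simp add: complex_eq_iff)
  qed
  then have "D y = 0" for y
    by (metis cinner_self norm_eq_zero of_real_eq_0_iff power_eq_0_iff)
  then show ?thesis
    by (intro blinfun_eqI) simp
qed

lemma form_eq_imp_eq:
  fixes S T :: "'h::complex_hilbert op"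
  assumes "complex_linear S" "complex_linear T" "\<And>x. cinner x (S x) = cinner x (T x)"
  shows "S = T"
  using form_zero_imp_zero[OF complex_linear_diff[OF assms(1,2)]] assms(3)
  by (simp add: blinfun.diff_left cinner.diff_right)

lemma positive_op_complex_linear: "positive_op T \<Longrightarrow> complex_linear T"
  by (simp add: positive_op_def)

lemma positive_op_form: "positive_op T \<Longrightarrow> cinner x (T x) = complex_of_real (Re (cinner x (T x)))"
  by (simp add: positive_op_def complex_nonneg_Reals_iff complex_eq_iff)

lemma positive_op_form_nonneg: "positive_op T \<Longrightarrow> 0 \<le> Re (cinner x (T x))"
  by (simp add: positive_op_def complex_nonneg_Reals_iff)

lemma positive_opI:
  assumes "complex_linear T" "\<And>x. cinner x (T x) = complex_of_real (r x)" "\<And>x. 0 \<le> r x"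
  shows "positive_op T"
  using assms by (simp add: positive_op_def complex_nonneg_Reals_iff)

lemma positive_op_add: "positive_op S \<Longrightarrow> positive_op T \<Longrightarrow> positive_op (S + T)"
  by (auto simp: positive_op_def complex_linear_add blinfun.add_left cinner_add_right)

lemma positive_op_scale:
  assumes "positive_op T" "0 \<le> r"
  shows "positive_op (scale_op (complex_of_real r) T)"
  using assms positive_op_form[OF assms(1)] positive_op_form_nonneg[OF assms(1)]
  by (intro positive_opI[where r = "\<lambda>x. r * Re (cinner x (T x))"])
    (auto simp: scale_op.rep_eq cinner_scaleC_right complex_linear_scale positive_op_complex_linear)

lemma positive_op_selfadjoint:
  assumes T: "positive_op (T :: 'h::complex_hilbert op)"
  shows "cinner (T x) y = cinner x (T y)"
proof -
  have T': "T (c *\<^sub>C x) = c *\<^sub>C T x" for c x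
    using T by (simp add: complex_linearD positive_op_complex_linear)
  have real: "Im (cinner x (T x)) = 0" for x
    using T by (simp add: positive_op_def complex_nonneg_Reals_iff)
  have "Im (cinner x (T y)) + Im (cinner y (T x)) = 0"
    using real[of "x + y"] real[of x] real[of y]
    by (simp add: blinfun.add_right cinner_add_left cinner_add_right)
  moreover have "Re (cinner x (T y)) = Re (cinner y (T x))"
    using real[of "x + \<i> *\<^sub>C y"] real[of x] real[of y]
    by (simp add: T' blinfun.add_right cinner_add_left cinner_add_right cinner_scaleC_left cinner_scaleC_right)
  ultimately show ?thesis
    using cinner_commute[of "T x" y] by (simp add: complex_eq_iff)
qed

lemma positive_op_cauchy_schwarz:
  assumes T: "positive_op (T :: 'h::complex_hilbert op)"
  shows "(cmod (cinner x (T y)))\<^sup>2 \<le> Re (cinner x (T x)) * Re (cinner y (T y))"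
proof -
  have T': "T (c *\<^sub>C x) = c *\<^sub>C T x" for c x
    using T by (simp add: complex_linearD positive_op_complex_linear)
  obtain c where c: "cmod c = 1" "c * cinner x (T y) = complex_of_real (cmod (cinner x (T y)))"
    by (rule complex_phase)
  define m where "m = cmod (cinner x (T y))"
  define a where "a = Re (cinner x (T x))"
  define b where "b = Re (cinner y (T y))"
  have a: "0 \<le> a" and b: "0 \<le> b" and m: "0 \<le> m"
    using positive_op_form_nonneg[OF T] by (auto simp: a_def b_def m_def)
  have cc: "cnj c * c = 1"
    using complex_norm_square[of c] c(1) by (simp add: mult.commute)
  have q: "0 \<le> a - 2 * t * m + t\<^sup>2 * b" for t :: real
  proof -
    let ?y = "complex_of_real t *\<^sub>C c *\<^sub>C y"
    have 1: "cinner x (T ?y) = complex_of_real (t * m)"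
      using c(2) by (simp add: T' cinner_scaleC_right m_def)
    have "cinner ?y (T x) = cnj (cinner x (T ?y))"
      using positive_op_selfadjoint[OF T, of x ?y] cinner_commute[of ?y "T x"] by simp
    then have 2: "cinner ?y (T x) = complex_of_real (t * m)"
      using 1 by simp
    have "cinner ?y (T ?y) = complex_of_real (t\<^sup>2) * ((cnj c * c) * cinner y (T y))"
      by (simp add: T' cinner_scaleC_right cinner_scaleC_left power2_eq_square ac_simps)
    then have 3: "Re (cinner ?y (T ?y)) = t\<^sup>2 * b"
      by (simp add: cc b_def)
    have "0 \<le> Re (cinner (x - ?y) (T (x - ?y)))"
      by (rule positive_op_form_nonneg[OF T])
    also have "cinner (x - ?y) (T (x - ?y)) =
        cinner x (T x) - cinner x (T ?y) - cinner ?y (T x) + cinner ?y (T ?y)"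
      by (simp add: blinfun.diff_right cinner.diff_left cinner.diff_right)
    finally show ?thesis
      using 1 2 3 by (simp add: a_def ac_simps)
  qed
  have "m\<^sup>2 \<le> a * b"
  proof (cases "b = 0")
    case True
    then have "m = 0"
      using q[of "(a + 1) / (2 * m)"] by (cases "m = 0") auto
    then show ?thesis
      using a b by simp
  next
    case False
    then have "0 < b" using b by simp
    moreover have "0 \<le> (a - 2 * (m / b) * m + (m / b)\<^sup>2 * b) * b"
      using q[of "m / b"] b by (rule mult_nonneg_nonneg)
    moreover have "(a - 2 * (m / b) * m + (m / b)\<^sup>2 * b) * b = a * b - m\<^sup>2"
      using False by (simp add: field_simps power2_eq_square)
    ultimately show ?thesis by simp
  qed
  then show ?thesis
    by (simp add: m_def a_def b_def)
qed

text \<open>Apply the Cauchy-Schwarz inequality of the form to \<open>T x\<close> and \<open>x\<close>.\<close>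

lemma positive_op_norm_le_form:
  assumes T: "positive_op (T :: 'h::complex_hilbert op)"
    and M: "Re (cinner (T x) (T (T x))) \<le> M * (norm (T x))\<^sup>2"
  shows "(norm (T x))\<^sup>2 \<le> M * Re (cinner x (T x))"
proof (cases "T x = 0")
  case False
  have "((norm (T x))\<^sup>2)\<^sup>2 = (cmod (cinner (T x) (T x)))\<^sup>2"
    by (simp add: cinner_self norm_power)
  also have "\<dots> \<le> Re (cinner (T x) (T (T x))) * Re (cinner x (T x))"
    by (rule positive_op_cauchy_schwarz[OF T])
  also have "\<dots> \<le> (M * (norm (T x))\<^sup>2) * Re (cinner x (T x))"
    by (intro mult_right_mono M positive_op_form_nonneg[OF T])
  finally have "(norm (T x))\<^sup>2 * (norm (T x))\<^sup>2 \<le> (norm (T x))\<^sup>2 * (M * Re (cinner x (T x)))"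
    by (simp add: power2_eq_square ac_simps)
  then show ?thesis
    using False by (simp only: mult_le_cancel_left) auto
qed simp

lemma form_le_norm:
  fixes T :: "'h::complex_hilbert op"
  shows "Re (cinner x (T x)) \<le> norm T * (norm x)\<^sup>2"
proof -
  have "Re (cinner x (T x)) \<le> cmod (cinner x (T x))"
    by (rule complex_Re_le_cmod)
  also have "\<dots> \<le> norm x * norm (T x)"
    by (rule cinner_bound)
  also have "\<dots> \<le> norm x * (norm T * norm x)"
    by (intro mult_left_mono norm_blinfun) auto
  finally show ?thesis
    by (simp add: power2_eq_square ac_simps)
qed

lemma positive_op_norm_le:
  fixes T :: "'h::complex_hilbert op"
  shows "positive_op T \<Longrightarrow> (norm (T x))\<^sup>2 \<le> norm T * Re (cinner x (T x))"
  by (rule positive_op_norm_le_form) (auto intro: form_le_norm)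

lemma positive_op_form_zero: "positive_op T \<Longrightarrow> Re (cinner x (T x)) = 0 \<Longrightarrow> T (x :: 'h::complex_hilbert) = 0"
  using positive_op_norm_le[of T x] by simp

lemma real_diag_op_form:
  assumes \<phi>: "orthonormal UNIV \<phi>" and s: "bounded (range s)"
  shows "(\<lambda>k. s k * (cmod (cinner (\<phi> k) x))\<^sup>2) sums Re (cinner x (real_diag_op \<phi> s x))"
    and "Im (cinner x (real_diag_op \<phi> s x)) = 0"
proof -
  have s': "bounded (range (\<lambda>k. complex_of_real (s k)))"
    using s by (auto simp: bounded_iff)
  have *: "(\<lambda>k. complex_of_real (s k * (cmod (cinner (\<phi> k) x))\<^sup>2)) sums cinner x (real_diag_op \<phi> s x)"
    using cinner_diag_op_sums[OF \<phi> s', of x x]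
    by (simp only: mult.assoc cinner_mult_commute of_real_mult cmod_cinner_commute[of x])
  show "(\<lambda>k. s k * (cmod (cinner (\<phi> k) x))\<^sup>2) sums Re (cinner x (real_diag_op \<phi> s x))"
    using sums_Re[OF *] by simp
  show "Im (cinner x (real_diag_op \<phi> s x)) = 0"
    using sums_Im[OF *] by (simp add: sums_iff)
qed

lemma positive_diag_op:
  assumes \<phi>: "orthonormal UNIV \<phi>" and s: "bounded (range s)" "\<And>k. 0 \<le> s k"
  shows "positive_op (real_diag_op \<phi> s)"
proof (rule positive_opI)
  have "bounded (range (\<lambda>k. complex_of_real (s k)))"
    using s(1) by (auto simp: bounded_iff)
  then show "complex_linear (real_diag_op \<phi> s)"
    by (rule complex_linear_diag_op[OF \<phi>])
  show "cinner x (real_diag_op \<phi> s x) = complex_of_real (Re (cinner x (real_diag_op \<phi> s x)))" for x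
    using real_diag_op_form(2)[OF \<phi> s(1)] by (simp add: complex_eq_iff)
  show "0 \<le> Re (cinner x (real_diag_op \<phi> s x))" for x
    using s(2) by (intro sums_le[OF _ sums_zero real_diag_op_form(1)[OF \<phi> s(1)]]) simp
qed

text \<open>\<open>(S + \<surd>a) (S - \<surd>a) v = 0\<close>, and \<open>S + \<surd>a\<close> is injective if \<open>a > 0\<close>.\<close>

lemma positive_sqrt_eigen:
  assumes S: "positive_op (S :: 'h::complex_hilbert op)" and v: "S (S v) = a *\<^sub>R v" and a: "0 \<le> a"
  shows "S v = sqrt a *\<^sub>R v"
proof (cases "a = 0")
  case True
  have "cinner (S v) (S v) = cinner v (S (S v))"
    by (rule positive_op_selfadjoint[OF S])
  then show ?thesis
    using True v by (simp add: cinner_self cinner.zero_right)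
next
  case False
  define z where "z = S v - sqrt a *\<^sub>R v"
  have "S z + sqrt a *\<^sub>R z = 0"
    using v a by (simp add: z_def blinfun.diff_right blinfun.scaleR_right algebra_simps)
  then have "cinner z (S z + sqrt a *\<^sub>R z) = 0"
    by simp
  then have "cinner z (S z) + sqrt a *\<^sub>R cinner z z = 0"
    by (simp only: cinner_add_right cinner_scaleR_right)
  then have "Re (cinner z (S z)) + sqrt a * (norm z)\<^sup>2 = 0"
    by (simp add: cinner_self complex_eq_iff)
  moreover have "0 \<le> Re (cinner z (S z))"
    by (rule positive_op_form_nonneg[OF S])
  ultimately have "sqrt a * (norm z)\<^sup>2 = 0"
    using a by (simp add: add_nonneg_eq_0_iff)
  then show ?thesis
    using False by (simp add: z_def)
qed

section \<open>The spectral theorem for compact positive operators\<close>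

lemma compact_op_subsequence:
  fixes T :: "'h::complex_hilbert op"
  assumes T: "compact_op T" and x: "\<And>n :: nat. norm (x n) \<le> 1"
  obtains y r where "strict_mono r" "(\<lambda>n. T (x (r n))) \<longlonglongrightarrow> y"
proof -
  have "seq_compact (closure (T ` cball 0 1))"
    using T by (simp add: compact_op_def compact_imp_seq_compact)
  moreover have "\<forall>n. T (x n) \<in> closure (T ` cball 0 1)"
    using x by (intro allI subsetD[OF closure_subset] imageI) simp
  ultimately obtain y r where "strict_mono r" "((\<lambda>n. T (x n)) \<circ> r) \<longlonglongrightarrow> y"
    by (rule seq_compactE) 
  then show ?thesis
    using that by (simp add: comp_def)
qed

text \<open>A maximising sequence of the form consists of approximate eigenvectors, since
  \<open>\<parallel>T x - M x\<parallel>\<^sup>2 \<le> M (M - \<langle>x, T x\<rangle>)\<close>.\<close>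

lemma compact_positive_maximum:
  fixes T :: "'h::complex_hilbert op"
  assumes T: "positive_op T" "compact_op T" and H: "closed H" "\<And>c x. x \<in> H \<Longrightarrow> c *\<^sub>C x \<in> H"
    and inv: "\<And>x. x \<in> H \<Longrightarrow> T x \<in> H" and z: "z \<in> H" "z \<noteq> 0"
  obtains v s where "v \<in> H" "norm v = 1" "0 \<le> s" "T v = s *\<^sub>R v"
    "\<And>x. x \<in> H \<Longrightarrow> Re (cinner x (T x)) \<le> s * (norm x)\<^sup>2"
proof -
  define q where "q x = Re (cinner x (T x))" for x
  have T': "T (c *\<^sub>C x) = c *\<^sub>C T x" for c x
    using T(1) by (simp add: complex_linearD positive_op_complex_linear)
  have HR: "r *\<^sub>R x \<in> H" if "x \<in> H" for r x
    using H(2)[OF that] by (simp add: scaleR_scaleC)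
  have q_scale: "q (r *\<^sub>R x) = r\<^sup>2 * q x" for r x
    by (simp add: q_def blinfun.scaleR_right cinner_scaleR_left cinner_scaleR_right power2_eq_square)
  define U where "U = {x \<in> H. norm x = 1}"
  define M where "M = Sup (q ` U)"
  define z' where "z' = (1 / norm z) *\<^sub>R z"
  have z': "z' \<in> U"
    using z HR by (auto simp: U_def z'_def)
  have bdd: "bdd_above (q ` U)"
  proof (rule bdd_aboveI2)
    show "q x \<le> norm T" if "x \<in> U" for x
      using form_le_norm[of x T] that by (simp add: U_def q_def)
  qed
  have qM: "q x \<le> M * (norm x)\<^sup>2" if "x \<in> H" for x
  proof (cases "x = 0")
    case False
    then have "(1 / norm x) *\<^sub>R x \<in> U"
      using that HR by (auto simp: U_def)
    then have "q ((1 / norm x) *\<^sub>R x) \<le> M"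
      unfolding M_def by (intro cSUP_upper bdd)
    then have "(1 / norm x)\<^sup>2 * q x \<le> M"
      by (simp only: q_scale)
    then show ?thesis
      using False by (simp add: field_simps)
  qed (simp add: q_def)
  have q0: "0 \<le> q x" for x
    using positive_op_form_nonneg[OF T(1)] by (simp add: q_def)
  have M0: "0 \<le> M"
    using qM[of z'] q0[of z'] z' by (auto simp: U_def)
  have TM: "(norm (T x))\<^sup>2 \<le> M * q x" if "x \<in> H" for x
    using qM[OF inv[OF that]] unfolding q_def by (intro positive_op_norm_le_form[OF T(1)])
  show ?thesis
  proof (cases "M = 0")
    case True
    then have "T z' = 0"
      using TM[of z'] z' by (simp add: U_def)
    then show ?thesis
      using that[of z' 0] z' True qM by (auto simp: U_def q_def)
  next
    case False
    then have M: "0 < M" using M0 by simp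
    have "\<exists>x\<in>U. M - inverse (real (Suc n)) < q x" for n
    proof -
      have "M - inverse (real (Suc n)) < Sup (q ` U)"
        by (simp add: M_def)
      moreover have "U \<noteq> {}"
        using z' by blast
      ultimately show ?thesis
        using less_cSUP_iff[OF _ bdd] by blast
    qed
    then obtain x where xU: "\<And>n. x n \<in> U" and xq: "\<And>n. M - inverse (real (Suc n)) < q (x n)"
      by metis
    have xH: "x n \<in> H" "norm (x n) = 1" for n
      using xU by (auto simp: U_def)
    obtain y r where r: "strict_mono r" and y: "(\<lambda>n. T (x (r n))) \<longlonglongrightarrow> y"
      by (rule compact_op_subsequence[OF T(2), of x]) (simp add: xH)
    have diff: "(norm (T (x n) - M *\<^sub>R x n))\<^sup>2 \<le> M * inverse (real (Suc n))" for n
    proof -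
      have "(norm (a - M *\<^sub>R b))\<^sup>2 = (norm a)\<^sup>2 - 2 * M * inner b a + M\<^sup>2 * (norm b)\<^sup>2" for a b :: 'h
        by (simp add: power2_norm_eq_inner inner_diff_left inner_diff_right inner_commute[of a b]
          power2_eq_square[of M] algebra_simps)
      then have "(norm (T (x n) - M *\<^sub>R x n))\<^sup>2 = (norm (T (x n)))\<^sup>2 - 2 * M * q (x n) + M\<^sup>2"
        using xH(2)[of n] by (simp add: q_def inner_eq_Re_cinner)
      also have "\<dots> \<le> M * (M - q (x n))"
        using TM[OF xH(1)[of n]] by (simp add: algebra_simps power2_eq_square)
      also have "\<dots> \<le> M * inverse (real (Suc n))"
        using xq[of n] M0 by (intro mult_left_mono) auto
      finally show ?thesis .
    qed
    have "(\<lambda>n. (norm (T (x n) - M *\<^sub>R x n))\<^sup>2) \<longlonglongrightarrow> 0"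
    proof (rule tendsto_sandwich[OF _ _ tendsto_const])
      show "(\<lambda>n. M * inverse (real (Suc n))) \<longlonglongrightarrow> 0"
        using tendsto_mult_right_zero[OF LIMSEQ_inverse_real_of_nat] by simp
    qed (use diff in auto)
    from tendsto_real_sqrt[OF this] have "(\<lambda>n. norm (T (x n) - M *\<^sub>R x n)) \<longlonglongrightarrow> 0"
      by simp
    then have "(\<lambda>n. T (x n) - M *\<^sub>R x n) \<longlonglongrightarrow> 0"
      by (rule tendsto_norm_zero_cancel)
    from LIMSEQ_subseq_LIMSEQ[OF this r] have "(\<lambda>n. T (x (r n)) - M *\<^sub>R x (r n)) \<longlonglongrightarrow> 0"
      by (simp add: comp_def)
    from tendsto_diff[OF y this] have "(\<lambda>n. M *\<^sub>R x (r n)) \<longlonglongrightarrow> y"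
      by simp
    then have "(\<lambda>n. (1 / M) *\<^sub>R (M *\<^sub>R x (r n))) \<longlonglongrightarrow> (1 / M) *\<^sub>R y"
      by (intro tendsto_intros)
    then have xv: "(\<lambda>n. x (r n)) \<longlonglongrightarrow> (1 / M) *\<^sub>R y"
      using M by simp
    define v where "v = (1 / M) *\<^sub>R y"
    have "v \<in> H"
      unfolding v_def by (rule closed_sequentially[OF H(1) _ xv]) (rule xH(1))
    moreover have "norm v = 1"
      using tendsto_norm[OF xv] by (simp add: xH(2) v_def LIMSEQ_const_iff del: norm_scaleR)
    moreover have "T v = M *\<^sub>R v"
    proof -
      have "(\<lambda>n. T (x (r n))) \<longlonglongrightarrow> T v"
        using xv unfolding v_def by (intro blinfun.tendsto tendsto_const)
      then have "y = T v"
        by (rule LIMSEQ_unique[OF y])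
      then show ?thesis
        using M by (simp add: v_def)
    qed
    ultimately show ?thesis
      using that[of v M] M0 qM by (auto simp: q_def)
  qed
qed

lemma spectral_sequence:
  fixes T :: "'h::complex_hilbert op"
  assumes T: "positive_op T" "compact_op T" and e: "orthonormal UNIV (e :: nat \<Rightarrow> 'h)"
  obtains \<phi> :: "nat \<Rightarrow> 'h" and \<mu> where "orthonormal UNIV \<phi>" "\<And>k. 0 \<le> \<mu> k" "\<And>k. T (\<phi> k) = \<mu> k *\<^sub>R \<phi> k"
    "\<And>k x. (\<And>i. i < k \<Longrightarrow> cinner (\<phi> i) x = 0) \<Longrightarrow> Re (cinner x (T x)) \<le> \<mu> k * (norm x)\<^sup>2"
proof -
  define good where "good W v \<longleftrightarrow> norm v = 1 \<and> (\<forall>w\<in>W. cinner w v = 0) \<and>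
    (\<exists>s\<ge>0. T v = s *\<^sub>R v \<and> (\<forall>x. (\<forall>w\<in>W. cinner w x = 0) \<longrightarrow> Re (cinner x (T x)) \<le> s * (norm x)\<^sup>2))" for W v
  have ex: "\<exists>v. good W v" if W: "finite W" "orthonormal W (\<lambda>x. x)" "\<forall>w\<in>W. \<exists>s. T w = s *\<^sub>R w" for W
  proof -
    define H where "H = {x. \<forall>w\<in>W. cinner w x = 0}"
    obtain z where z: "z \<noteq> 0" "\<And>w. w \<in> W \<Longrightarrow> cinner w z = 0"
      using orthonormal_sequence_avoids[OF e W(1,2)] by blast
    have H_eq: "H = (\<Inter>w\<in>W. {x. cinner w x = 0})"
      by (auto simp: H_def)
    have H: "closed H"
      unfolding H_eq
      by (intro closed_INT ballI closed_Collect_eq continuous_intros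
        bounded_linear.continuous_on[OF cinner.bounded_linear_right])
    have scale: "c *\<^sub>C x \<in> H" if "x \<in> H" for c x
      using that by (auto simp: H_def cinner_scaleC_right)
    have inv: "T x \<in> H" if x: "x \<in> H" for x
      unfolding H_def
    proof safe
      fix w assume w: "w \<in> W"
      then obtain s where "T w = s *\<^sub>R w"
        using W(3) by blast
      then have "cinner w (T x) = s *\<^sub>R cinner w x"
        using positive_op_selfadjoint[OF T(1), of w x] by (simp add: cinner_scaleR_left)
      then show "cinner w (T x) = 0"
        using w x by (simp add: H_def)
    qed
    have "z \<in> H"
      using z by (simp add: H_def)
    with compact_positive_maximum[OF T H scale inv this z(1)]
    obtain v s where "v \<in> H" "norm v = 1" "0 \<le> s" "T v = s *\<^sub>R v"
      "\<And>x. x \<in> H \<Longrightarrow> Re (cinner x (T x)) \<le> s * (norm x)\<^sup>2"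
      by blast
    then have "good W v"
      unfolding good_def H_def by blast
    then show ?thesis
      by blast
  qed
  define step where "step W = (SOME v. good W v)" for W
  define W where "W = rec_nat {} (\<lambda>_ V. insert (step V) V)"
  define \<phi> where "\<phi> k = step (W k)" for k
  have W_Suc: "W (Suc k) = insert (\<phi> k) (W k)" and W_0: "W 0 = {}" for k
    by (simp_all add: W_def \<phi>_def)
  have W_eq: "W k = \<phi> ` {..<k}" for k
    by (induction k) (auto simp: W_Suc W_0 lessThan_Suc)
  have ind: "orthonormal (W k) (\<lambda>x. x) \<and> (\<forall>w\<in>W k. \<exists>s. T w = s *\<^sub>R w) \<and> finite (W k)" for k
  proof (induction k)
    case 0
    then show ?case by (simp add: W_0 orthonormal_def)
  next
    case (Suc k)
    then have "good (W k) (\<phi> k)"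
      unfolding \<phi>_def step_def using ex by (intro someI_ex[where P = "good (W k)"]) blast
    then have g: "norm (\<phi> k) = 1" "\<forall>w\<in>W k. cinner w (\<phi> k) = 0" "\<exists>s. T (\<phi> k) = s *\<^sub>R \<phi> k"
      by (auto simp: good_def)
    then have "\<forall>w\<in>W k. cinner (\<phi> k) w = 0" "cinner (\<phi> k) (\<phi> k) = 1"
      by (simp_all add: cinner_eq_0_commute cinner_self)
    then show ?case
      using Suc g unfolding W_Suc orthonormal_def by auto
  qed
  have good: "good (W k) (\<phi> k)" for k
    unfolding \<phi>_def step_def using ex ind by (intro someI_ex[where P = "good (W k)"]) blast
  then have "\<exists>s\<ge>0. T (\<phi> k) = s *\<^sub>R \<phi> k \<and>
      (\<forall>x. (\<forall>w\<in>W k. cinner w x = 0) \<longrightarrow> Re (cinner x (T x)) \<le> s * (norm x)\<^sup>2)" for k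
    unfolding good_def by blast
  then obtain \<mu> where \<mu>: "\<And>k. 0 \<le> \<mu> k" "\<And>k. T (\<phi> k) = \<mu> k *\<^sub>R \<phi> k"
      "\<And>k x. (\<forall>w\<in>W k. cinner w x = 0) \<Longrightarrow> Re (cinner x (T x)) \<le> \<mu> k * (norm x)\<^sup>2"
    by metis
  have lt: "cinner (\<phi> i) (\<phi> j) = 0" if "i < j" for i j
    using good[of j] that by (auto simp: good_def W_eq)
  have "cinner (\<phi> i) (\<phi> j) = 0" if "i \<noteq> j" for i j
    using lt[of i j] lt[of j i] that cinner_eq_0_commute[of "\<phi> i" "\<phi> j"] by (cases "i < j") auto
  moreover have "cinner (\<phi> i) (\<phi> i) = 1" for i
    using good[of i] by (simp add: good_def cinner_self)
  ultimately have "orthonormal UNIV \<phi>"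
    by (simp add: orthonormal_def)
  moreover have "Re (cinner x (T x)) \<le> \<mu> k * (norm x)\<^sup>2" if "\<And>i. i < k \<Longrightarrow> cinner (\<phi> i) x = 0" for k x
    using that by (intro \<mu>(3)) (auto simp: W_eq)
  ultimately show ?thesis
    using that[of \<phi> \<mu>] \<mu>(1,2) by blast
qed

lemma decseq_bounded_real:
  fixes s :: "nat \<Rightarrow> real"
  assumes "decseq s" "\<And>k. 0 \<le> s k"
  shows "bounded (range s)" "bounded (range (\<lambda>k. complex_of_real (s k)))"
proof -
  have "\<bar>s k\<bar> \<le> s 0" for k
    using assms decseqD[of s 0 k] by simp
  then show "bounded (range s)" "bounded (range (\<lambda>k. complex_of_real (s k)))"
    by (auto simp: bounded_iff)
qed

lemma eq_diag_opI:
  fixes T :: "'h::complex_hilbert op"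
  assumes T: "complex_linear T" and \<phi>: "orthonormal UNIV \<phi>" and s: "bounded (range s)"
    and eig: "\<And>k. T (\<phi> k) = s k *\<^sub>C \<phi> k" and 0: "\<And>x. (\<And>k. cinner (\<phi> k) x = 0) \<Longrightarrow> T x = 0"
  shows "T = diag_op \<phi> s"
proof (rule blinfun_eqI)
  fix x
  define p where "p = diag_op \<phi> (\<lambda>_. 1) x"
  have 1: "bounded (range (\<lambda>_ :: nat. 1 :: complex))"
    by simp
  have "T (x - p) = 0"
    by (rule 0) (simp add: p_def cinner.diff_right cinner_diag_op[OF \<phi> 1])
  then have "T x = T p"
    by (simp add: blinfun.diff_right)
  have "(\<lambda>k. T ((1 * cinner (\<phi> k) x) *\<^sub>C \<phi> k)) sums T p"
    unfolding p_def by (rule bounded_linear.sums[OF blinfun.bounded_linear_right diag_op_sums[OF \<phi> 1]])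
  then have "(\<lambda>k. (s k * cinner (\<phi> k) x) *\<^sub>C \<phi> k) sums T p"
    by (simp add: complex_linearD[OF T] eig scaleC_scaleC mult.commute)
  then have "T p = diag_op \<phi> s x"
    by (rule sums_unique2[OF _ diag_op_sums[OF \<phi> s]])
  then show "T x = diag_op \<phi> s x"
    using \<open>T x = T p\<close> by simp
qed

theorem compact_positive_spectral:
  fixes T :: "'h::complex_hilbert op"
  assumes T: "positive_op T" "compact_op T" and e: "orthonormal UNIV (e :: nat \<Rightarrow> 'h)"
  obtains \<phi> \<mu> where "orthonormal UNIV \<phi>" "decseq \<mu>" "\<And>k. 0 \<le> \<mu> k" "\<mu> \<longlonglongrightarrow> 0"
    "T = real_diag_op \<phi> \<mu>"
proof -
  obtain \<phi> :: "nat \<Rightarrow> 'h" and \<mu> where \<phi>: "orthonormal UNIV \<phi>" and \<mu>: "\<And>k. 0 \<le> \<mu> k"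
    and eig: "\<And>k. T (\<phi> k) = \<mu> k *\<^sub>R \<phi> k"
    and max: "\<And>k x. (\<And>i. i < k \<Longrightarrow> cinner (\<phi> i) x = 0) \<Longrightarrow> Re (cinner x (T x)) \<le> \<mu> k * (norm x)\<^sup>2"
    using spectral_sequence[OF T e] by metis
  have n1: "norm (\<phi> k) = 1" for k
    using orthonormal_norm[OF \<phi>] by simp
  have dec: "decseq \<mu>"
  proof (rule decseq_SucI)
    fix k
    have "Re (cinner (\<phi> (Suc k)) (T (\<phi> (Suc k)))) \<le> \<mu> k * (norm (\<phi> (Suc k)))\<^sup>2"
      using orthonormalD[OF \<phi>] by (intro max) auto
    then show "\<mu> (Suc k) \<le> \<mu> k"
      by (simp add: eig n1 cinner_scaleR_right cinner_self)
  qed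
  obtain l where l: "\<mu> \<longlonglongrightarrow> l" "\<And>k. l \<le> \<mu> k"
    using decseq_convergent[OF dec, of 0] \<mu> by blast
  have "0 \<le> l"
    using LIMSEQ_le_const[OF l(1)] \<mu> by blast
  have "l = 0"
  proof (rule ccontr)
    assume "l \<noteq> 0"
    with \<open>0 \<le> l\<close> have "0 < l" by simp
    obtain y r where r: "strict_mono r" and y: "(\<lambda>n. T (\<phi> (r n))) \<longlonglongrightarrow> y"
      by (rule compact_op_subsequence[OF T(2), of \<phi>]) (simp add: n1)
    then obtain N where N: "\<And>m n. N \<le> m \<Longrightarrow> N \<le> n \<Longrightarrow> dist (T (\<phi> (r m))) (T (\<phi> (r n))) < l"
      using LIMSEQ_imp_Cauchy[OF y] metric_CauchyD \<open>0 < l\<close> by meson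
    define i where "i = r N"
    define j where "j = r (Suc N)"
    have ij: "i \<noteq> j"
      using r by (auto simp: i_def j_def strict_mono_eq)
    have "inner (\<phi> i) (\<phi> j) = 0" "inner (\<phi> j) (\<phi> i) = 0"
      using ij orthonormalD[OF \<phi>] by (simp_all add: inner_eq_Re_cinner)
    then have "(norm (\<mu> i *\<^sub>R \<phi> i - \<mu> j *\<^sub>R \<phi> j))\<^sup>2 =
        (\<mu> i)\<^sup>2 * (norm (\<phi> i))\<^sup>2 + (\<mu> j)\<^sup>2 * (norm (\<phi> j))\<^sup>2"
      unfolding power2_norm_eq_inner inner_diff_left inner_diff_right by (simp add: power2_eq_square)
    then have "(norm (\<mu> i *\<^sub>R \<phi> i - \<mu> j *\<^sub>R \<phi> j))\<^sup>2 = (\<mu> i)\<^sup>2 + (\<mu> j)\<^sup>2"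
      by (simp add: n1)
    moreover have "(norm (\<mu> i *\<^sub>R \<phi> i - \<mu> j *\<^sub>R \<phi> j))\<^sup>2 < l\<^sup>2"
      using N[of N "Suc N"] unfolding dist_norm eig i_def j_def by (intro power_strict_mono) auto
    moreover have "l\<^sup>2 \<le> (\<mu> i)\<^sup>2"
      using l(2) \<open>0 \<le> l\<close> by (intro power_mono)
    ultimately show False
      using zero_le_power2[of "\<mu> j"] by linarith
  qed
  have "T = real_diag_op \<phi> \<mu>"
  proof (rule eq_diag_opI[OF _ \<phi>])
    show "complex_linear T"
      using T(1) by (rule positive_op_complex_linear)
    show "bounded (range (\<lambda>k. complex_of_real (\<mu> k)))"
      by (rule decseq_bounded_real[OF dec \<mu>])
    show "T (\<phi> k) = complex_of_real (\<mu> k) *\<^sub>C \<phi> k" for k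
      by (simp add: eig scaleR_scaleC)
    fix x assume "\<And>k. cinner (\<phi> k) x = 0"
    then have "Re (cinner x (T x)) \<le> \<mu> k * (norm x)\<^sup>2" for k
      by (intro max)
    moreover have "(\<lambda>k. \<mu> k * (norm x)\<^sup>2) \<longlonglongrightarrow> 0"
      using tendsto_mult_left_zero[OF l(1)[unfolded \<open>l = 0\<close>]] .
    ultimately have "Re (cinner x (T x)) \<le> 0"
      using LIMSEQ_le_const by blast
    then have "Re (cinner x (T x)) = 0"
      using positive_op_form_nonneg[OF T(1), of x] by simp
    then show "T x = 0"
      by (rule positive_op_form_zero[OF T(1)])
  qed
  then show ?thesis
    using that \<phi> dec \<mu> l(1) \<open>l = 0\<close> by blast
qed

section \<open>Square roots and singular values\<close>

lemma sqrt_op_diag: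
  fixes \<phi> :: "nat \<Rightarrow> 'h::complex_hilbert"
  assumes \<phi>: "orthonormal UNIV \<phi>" and \<mu>: "bounded (range \<mu>)" "\<And>k. 0 \<le> \<mu> k"
  shows "sqrt_op (real_diag_op \<phi> \<mu>) = real_diag_op \<phi> (\<lambda>k. sqrt (\<mu> k))"
proof -
  let ?R = "real_diag_op \<phi> (\<lambda>k. sqrt (\<mu> k))"
  obtain B where B: "\<And>k. \<mu> k \<le> B"
    using \<mu>(1) by (auto simp: bounded_iff) (meson abs_le_D1)
  have "\<bar>sqrt (\<mu> k)\<bar> \<le> sqrt B" for k
    using B \<mu>(2) by simp
  then have b: "bounded (range (\<lambda>k. sqrt (\<mu> k)))" and b': "bounded (range (\<lambda>k. complex_of_real (sqrt (\<mu> k))))"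
    by (auto simp: bounded_iff)
  have \<mu>': "bounded (range (\<lambda>k. complex_of_real (\<mu> k)))"
    using \<mu>(1) by (auto simp: bounded_iff)
  have "positive_op ?R"
    using \<mu>(2) by (intro positive_diag_op[OF \<phi> b]) simp
  moreover have "?R o\<^sub>L ?R = real_diag_op \<phi> \<mu>"
    using diag_op_compose[OF \<phi> b' b'] \<mu>(2) by (simp flip: of_real_mult)
  ultimately have "positive_op ?R \<and> ?R o\<^sub>L ?R = real_diag_op \<phi> \<mu>"
    by blast
  from someI[of "\<lambda>S. positive_op S \<and> S o\<^sub>L S = real_diag_op \<phi> \<mu>", OF this]
  have S: "positive_op (sqrt_op (real_diag_op \<phi> \<mu>))"
    "sqrt_op (real_diag_op \<phi> \<mu>) o\<^sub>L sqrt_op (real_diag_op \<phi> \<mu>) = real_diag_op \<phi> \<mu>"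
    by (simp_all add: sqrt_op_def)
  then have SS: "sqrt_op (real_diag_op \<phi> \<mu>) (sqrt_op (real_diag_op \<phi> \<mu>) x) = real_diag_op \<phi> \<mu> x" for x
    by (metis blinfun_apply_blinfun_compose)
  show ?thesis
  proof (rule eq_diag_opI[OF positive_op_complex_linear[OF S(1)] \<phi> b'])
    show "sqrt_op (real_diag_op \<phi> \<mu>) (\<phi> k) = complex_of_real (sqrt (\<mu> k)) *\<^sub>C \<phi> k" for k
      using positive_sqrt_eigen[OF S(1), of "\<phi> k" "\<mu> k"] \<mu>(2)[of k]
      by (simp add: SS diag_op_eigen[OF \<phi> \<mu>'] scaleR_scaleC)
    show "sqrt_op (real_diag_op \<phi> \<mu>) x = 0" if "\<And>k. cinner (\<phi> k) x = 0" for x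
      using positive_sqrt_eigen[OF S(1), of x 0] by (simp add: SS diag_op_complement[OF \<phi> \<mu>' that])
  qed
qed

lemma singular_value_unique:
  fixes \<mu> \<nu> :: "nat \<Rightarrow> real" and d :: "real \<Rightarrow> nat"
  assumes \<mu>: "decseq \<mu>" "\<And>k. 0 \<le> \<mu> k" "\<And>s. 0 < s \<Longrightarrow> finite {k. \<mu> k = s} \<and> card {k. \<mu> k = s} = d s"
    and \<nu>: "decseq \<nu>" "\<And>k. 0 \<le> \<nu> k" "\<And>s. 0 < s \<Longrightarrow> finite {k. \<nu> k = s} \<and> card {k. \<nu> k = s} = d s"
  shows "\<mu> = \<nu>"
proof -
  have aux: "\<mu> k \<le> \<nu> k" if eq: "\<forall>j<k. \<mu> j = \<nu> j"
    and \<mu>: "decseq \<mu>" "\<And>k. 0 \<le> \<mu> k" "\<And>s. 0 < s \<Longrightarrow> finite {k. \<mu> k = s} \<and> card {k. \<mu> k = s} = d s"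
    and \<nu>: "decseq \<nu>" "\<And>k. 0 \<le> \<nu> k" "\<And>s. 0 < s \<Longrightarrow> finite {k. \<nu> k = s} \<and> card {k. \<nu> k = s} = d s"
    for \<mu> \<nu> :: "nat \<Rightarrow> real" and k
  proof (rule ccontr)
    assume "\<not> \<mu> k \<le> \<nu> k"
    then have lt: "\<nu> k < \<mu> k" by simp
    have pos: "0 < \<mu> k"
      using lt \<nu>(2)[of k] by simp
    have "{j. \<nu> j = \<mu> k} \<subseteq> {j. \<mu> j = \<mu> k} - {k}"
    proof safe
      fix j assume j: "\<nu> j = \<mu> k"
      then have "j < k"
        using lt decseqD[OF \<nu>(1), of k j] by (cases "j < k") auto
      then show "\<mu> j = \<mu> k"
        using eq j by simp
    qed (use lt in auto)
    then have "card {j. \<nu> j = \<mu> k} \<le> card ({j. \<mu> j = \<mu> k} - {k})"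
      using \<mu>(3)[OF pos] by (intro card_mono) auto
    also have "\<dots> < card {j. \<mu> j = \<mu> k}"
      using \<mu>(3)[OF pos] by (intro psubset_card_mono) auto
    finally show False
      using \<mu>(3)[OF pos] \<nu>(3)[OF pos] by simp
  qed
  have "\<mu> k = \<nu> k" for k
  proof (induction k rule: less_induct)
    case (less k)
    have "\<mu> k \<le> \<nu> k"
      using less by (intro aux[OF _ \<mu> \<nu>]) auto
    moreover have "\<nu> k \<le> \<mu> k"
      using less by (intro aux[OF _ \<nu> \<mu>]) auto
    ultimately show ?case by simp
  qed
  then show ?thesis by blast
qed

interpretation CV: vector_space "scaleC :: complex \<Rightarrow> 'h \<Rightarrow> 'h::complex_hilbert"
  by (rule vector_space_scaleC)

lemma orthonormal_independent:
  assumes "orthonormal W (\<lambda>x. x)" "finite W"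
  shows "\<not> CV.dependent W"
  unfolding CV.dependent_finite[OF assms(2)]
proof safe
  fix u w assume w: "w \<in> W" "u w \<noteq> 0" and "(\<Sum>v\<in>W. u v *\<^sub>C v) = 0"
  then show False
    using cinner_orthonormal_sum[OF assms w(1), of u] by simp
qed

lemma singular_value_diag:
  fixes T :: "'h::complex_hilbert op" and \<phi> :: "nat \<Rightarrow> 'h"
  assumes \<phi>: "orthonormal UNIV \<phi>" and s: "decseq s" "\<And>k. 0 \<le> s k" "s \<longlonglongrightarrow> 0"
    and T: "abs_op T = real_diag_op \<phi> s"
  shows "singular_value T = s"
proof -
  note b = decseq_bounded_real(2)[OF s(1,2)]
  have fin: "finite {k. s k = t}" if t: "0 < t" for t
  proof -
    obtain N where "\<And>n. N \<le> n \<Longrightarrow> s n < t"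
      using order_tendstoD(2)[OF s(3) t] by (auto simp: eventually_sequentially)
    then have "{k. s k = t} \<subseteq> {..<N}"
      by (metis (mono_tags, lifting) lessThan_iff less_irrefl mem_Collect_eq not_le subsetI)
    then show ?thesis
      by (rule finite_subset) simp
  qed
  have dim: "vector_space.dim scaleC {x. abs_op T x = t *\<^sub>R x} = card {k. s k = t}" if t: "0 < t" for t
  proof -
    let ?I = "{k. s k = t}"
    have on: "orthonormal ?I \<phi>"
      by (rule orthonormal_subset[OF \<phi>]) simp
    have sub: "\<phi> ` ?I \<subseteq> {x. abs_op T x = t *\<^sub>R x}"
      by (auto simp: T diag_op_eigen[OF \<phi> b] scaleR_scaleC)
    moreover have "{x. abs_op T x = t *\<^sub>R x} \<subseteq> CV.span (\<phi> ` ?I)"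
    proof
      fix x assume "x \<in> {x. abs_op T x = t *\<^sub>R x}"
      then have x: "real_diag_op \<phi> s x = t *\<^sub>R x"
        by (simp add: T)
      have 0: "cinner (\<phi> k) x = 0" if "k \<notin> ?I" for k
      proof -
        have "complex_of_real (s k) * cinner (\<phi> k) x = complex_of_real t * cinner (\<phi> k) x"
          using cinner_diag_op[OF \<phi> b, of k x, symmetric] by (simp add: x cinner_scaleR_right scaleR_conv_of_real)
        then show ?thesis
          using that by (metis (mono_tags) mem_Collect_eq mult_cancel_right of_real_eq_iff)
      qed
      have "(\<lambda>k. (complex_of_real (s k) * cinner (\<phi> k) x) *\<^sub>C \<phi> k) sums
          (\<Sum>k\<in>?I. (complex_of_real (s k) * cinner (\<phi> k) x) *\<^sub>C \<phi> k)"
        using 0 by (intro sums_finite fin t) auto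
      then have "t *\<^sub>R x = (\<Sum>k\<in>?I. (complex_of_real (s k) * cinner (\<phi> k) x) *\<^sub>C \<phi> k)"
        by (rule sums_unique2[OF diag_op_sums[OF \<phi> b, of x, unfolded x]])
      moreover have "(\<Sum>k\<in>?I. (complex_of_real (s k) * cinner (\<phi> k) x) *\<^sub>C \<phi> k) \<in> CV.span (\<phi> ` ?I)"
        by (intro CV.span_sum CV.span_scale CV.span_base imageI)
      ultimately have "t *\<^sub>R x \<in> CV.span (\<phi> ` ?I)"
        by simp
      then have "complex_of_real (1 / t) *\<^sub>C (t *\<^sub>R x) \<in> CV.span (\<phi> ` ?I)"
        by (rule CV.span_scale)
      then show "x \<in> CV.span (\<phi> ` ?I)"
        using t by (simp flip: scaleR_scaleC del: of_real_divide)
    qed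
    moreover have "\<not> CV.dependent (\<phi> ` ?I)"
      using orthonormal_image[OF on] fin[OF t] by (intro orthonormal_independent) auto
    moreover have "card (\<phi> ` ?I) = card ?I"
      by (rule card_image[OF orthonormal_inj[OF on]])
    ultimately show ?thesis
      using CV.dim_unique by metis
  qed
  let ?P = "\<lambda>\<mu>. decseq \<mu> \<and> (\<forall>k. 0 \<le> \<mu> k) \<and>
     (\<forall>t>0. finite {k. \<mu> k = t} \<and>
        card {k. \<mu> k = t} = vector_space.dim scaleC {x. abs_op T x = t *\<^sub>R x})"
  have "?P s"
    using s fin dim by auto
  then have "?P (singular_value T)"
    unfolding singular_value_def by (rule someI[of ?P])
  with \<open>?P s\<close> show ?thesis
    using singular_value_unique[of "singular_value T" "\<lambda>t. vector_space.dim scaleC {x. abs_op T x = t *\<^sub>R x}" s]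
    by blast
qed

lemma adjoint_op_eqI:
  fixes S T :: "'h::complex_hilbert op"
  assumes "\<And>x y. cinner (S x) y = cinner x (T y)"
  shows "adjoint_op T = S"
proof -
  have "\<forall>x y. cinner (adjoint_op T x) y = cinner x (T y)"
    unfolding adjoint_op_def by (rule someI[of _ S]) (use assms in blast)
  then show ?thesis
    using assms by (intro blinfun_eqI cinner_ext_left) simp
qed

lemma abs_op_diag:
  fixes \<phi> :: "nat \<Rightarrow> 'h::complex_hilbert"
  assumes \<phi>: "orthonormal UNIV \<phi>" and s: "bounded (range s)" "\<And>k. 0 \<le> s k"
  shows "abs_op (real_diag_op \<phi> s) = real_diag_op \<phi> s"
proof -
  have s': "bounded (range (\<lambda>k. complex_of_real (s k)))"
    using s(1) by (auto simp: bounded_iff)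
  obtain B where "\<And>k. \<bar>s k\<bar> \<le> B"
    using s(1) by (auto simp: bounded_iff)
  moreover from this have "0 \<le> B"
    using abs_ge_zero order_trans by blast
  ultimately have "\<bar>s k\<bar> * \<bar>s k\<bar> \<le> B * B" for k
    by (intro mult_mono) auto
  then have "\<bar>s k * s k\<bar> \<le> B * B" for k
    by (simp only: abs_mult)
  then have ss: "bounded (range (\<lambda>k. s k * s k))"
    by (auto simp: bounded_iff)
  have "adjoint_op (real_diag_op \<phi> s) = real_diag_op \<phi> s"
    by (intro adjoint_op_eqI positive_op_selfadjoint positive_diag_op[OF \<phi> s])
  moreover have "real_diag_op \<phi> s o\<^sub>L real_diag_op \<phi> s = real_diag_op \<phi> (\<lambda>k. s k * s k)"
    using diag_op_compose[OF \<phi> s' s'] by simp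
  moreover have "sqrt (s k * s k) = s k" for k
    using s(2) by simp
  ultimately show ?thesis
    using sqrt_op_diag[OF \<phi> ss] by (simp add: abs_op_def)
qed

section \<open>Compactness criteria\<close>

lemma compact_opI_subset:
  assumes "complex_linear T" "compact K" "T ` cball 0 1 \<subseteq> K"
  shows "compact_op T"
proof -
  have "closure (T ` cball 0 1) \<subseteq> K"
    using assms by (intro closure_minimal compact_imp_closed)
  then have "compact (K \<inter> closure (T ` cball 0 1))" "K \<inter> closure (T ` cball 0 1) = closure (T ` cball 0 1)"
    using assms by (auto intro: compact_Int_closed)
  then show ?thesis
    using assms by (simp add: compact_op_def)
qed

lemma compact_op_add:
  fixes S T :: "'a::complex_hilbert op"
  assumes "compact_op S" "compact_op T"
  shows "compact_op (S + T)"
proof (rule compact_opI_subset)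
  show "complex_linear (S + T)"
    using assms by (simp add: compact_op_def complex_linear_add)
  show "compact {x + y |x y. x \<in> closure (S ` cball 0 1) \<and> y \<in> closure (T ` cball 0 1)}"
    using assms by (intro compact_sums) (auto simp: compact_op_def)
  show "(S + T) ` cball 0 1 \<subseteq> {x + y |x y. x \<in> closure (S ` cball 0 1) \<and> y \<in> closure (T ` cball 0 1)}"
  proof safe
    fix x :: 'a assume "x \<in> cball 0 1"
    then have "S x \<in> closure (S ` cball 0 1)" "T x \<in> closure (T ` cball 0 1)"
      by (auto intro!: subsetD[OF closure_subset])
    then show "\<exists>y z. (S + T) x = y + z \<and> y \<in> closure (S ` cball 0 1) \<and> z \<in> closure (T ` cball 0 1)"
      using blinfun.add_left by blast
  qed
qed

lemma compact_op_compose: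
  assumes S: "complex_linear S" and T: "compact_op T"
  shows "compact_op (S o\<^sub>L T)"
proof (rule compact_opI_subset)
  show "complex_linear (S o\<^sub>L T)"
    using assms by (simp add: compact_op_def complex_linear_compose)
  show "compact (S ` closure (T ` cball 0 1))"
    using T by (intro compact_continuous_image linear_continuous_on blinfun.bounded_linear_right)
      (simp add: compact_op_def)
  show "(S o\<^sub>L T) ` cball 0 1 \<subseteq> S ` closure (T ` cball 0 1)"
    using closure_subset[of "T ` cball 0 1"] by auto
qed

lemma compact_op_scale:
  assumes T: "compact_op T"
  shows "compact_op (scale_op c T)"
proof (rule compact_opI_subset)
  show "complex_linear (scale_op c T)"
    using assms by (simp add: compact_op_def complex_linear_scale)
  show "compact (scaleC c ` closure (T ` cball 0 1))"
    using T by (intro compact_continuous_image linear_continuous_on scaleC.bounded_linear_right)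
      (simp add: compact_op_def)
  show "scale_op c T ` cball 0 1 \<subseteq> scaleC c ` closure (T ` cball 0 1)"
    using closure_subset[of "T ` cball 0 1"] by (auto simp: scale_op.rep_eq)
qed

lemma compact_combinations:
  fixes f :: "'i \<Rightarrow> 'h::complex_hilbert"
  assumes "finite W"
  obtains K where "compact K" "\<And>c. (\<And>w. w \<in> W \<Longrightarrow> cmod (c w) \<le> 1) \<Longrightarrow> (\<Sum>w\<in>W. c w *\<^sub>C f w) \<in> K"
  using assms
proof (induction W arbitrary: thesis rule: finite_induct)
  case empty
  show ?case
    by (rule empty[of "{0}"]) auto
next
  case (insert w W)
  obtain K where K: "compact K" "\<And>c. (\<And>w. w \<in> W \<Longrightarrow> cmod (c w) \<le> 1) \<Longrightarrow> (\<Sum>w\<in>W. c w *\<^sub>C f w) \<in> K"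
    using insert.IH by blast
  have "compact ((\<lambda>c. c *\<^sub>C f w) ` cball 0 1)"
    by (intro compact_continuous_image linear_continuous_on scaleC.bounded_linear_left) auto
  from compact_sums[OF this K(1)] show ?case
  proof (rule insert.prems)
    fix c assume c: "\<And>v. v \<in> insert w W \<Longrightarrow> cmod (c v) \<le> 1"
    have "(\<Sum>v\<in>insert w W. c v *\<^sub>C f v) = c w *\<^sub>C f w + (\<Sum>v\<in>W. c v *\<^sub>C f v)"
      using insert.hyps by simp
    moreover have "c w *\<^sub>C f w \<in> (\<lambda>c. c *\<^sub>C f w) ` cball 0 1"
      using c[of w] by (intro imageI) simp
    moreover have "(\<Sum>v\<in>W. c v *\<^sub>C f v) \<in> K"
      using c by (intro K(2)) simp
    ultimately show "(\<Sum>v\<in>insert w W. c v *\<^sub>C f v) \<in>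
        {x + y |x y. x \<in> (\<lambda>c. c *\<^sub>C f w) ` cball 0 1 \<and> y \<in> K}"
      by blast
  qed
qed

lemma compact_opI_small_complement:
  fixes T :: "'h::complex_hilbert op"
  assumes T: "complex_linear T"
    and small: "\<And>\<delta>. 0 < \<delta> \<Longrightarrow> \<exists>W. finite W \<and> orthonormal W (\<lambda>x. x) \<and>
      (\<forall>x. (\<forall>w\<in>W. cinner w x = 0) \<longrightarrow> norm (T x) \<le> \<delta> * norm x)"
  shows "compact_op T"
proof -
  have cover: "\<exists>k. finite k \<and> closure (T ` cball 0 1) \<subseteq> (\<Union>y\<in>k. ball y r)" if r: "0 < r" for r
  proof -
    obtain W where W: "finite W" "orthonormal W (\<lambda>x. x)"
      and le: "\<And>x. (\<forall>w\<in>W. cinner w x = 0) \<Longrightarrow> norm (T x) \<le> (r / 3) * norm x"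
      using small[of "r / 3"] r by auto
    obtain K where K: "compact K" "\<And>c. (\<And>w. w \<in> W \<Longrightarrow> cmod (c w) \<le> 1) \<Longrightarrow> (\<Sum>w\<in>W. c w *\<^sub>C T w) \<in> K"
      using compact_combinations[OF W(1), of "\<lambda>w. T w"] by blast
    obtain k where k: "finite k" "K \<subseteq> (\<Union>y\<in>k. ball y (r / 3))"
      using K(1) r by (auto simp: compact_eq_totally_bounded dest!: spec[of _ "r / 3"])
    have "T ` cball 0 1 \<subseteq> (\<Union>y\<in>k. cball y (2 * r / 3))"
    proof safe
      fix x :: 'h assume "x \<in> cball 0 1"
      then have x: "norm x \<le> 1" by simp
      define p where "p = (\<Sum>w\<in>W. cinner w x *\<^sub>C w)"
      have "(norm (x - p))\<^sup>2 \<le> (norm x)\<^sup>2"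
        using norm_projection[OF W(2,1), of x] by (simp add: p_def sum_nonneg)
      then have "norm (x - p) \<le> 1"
        using x power2_le_imp_le[of "norm (x - p)" "norm x"] by simp
      then have "(r / 3) * norm (x - p) \<le> r / 3"
        using r by simp
      moreover have "norm (T (x - p)) \<le> (r / 3) * norm (x - p)"
        unfolding p_def using orthonormal_complement[OF W(2,1)] by (intro le) blast
      ultimately have 1: "norm (T (x - p)) \<le> r / 3"
        by linarith
      have "cmod (cinner w x) \<le> 1" if "w \<in> W" for w
        using cinner_bound[of w x] orthonormal_norm[OF W(2) that] x by simp
      then have "(\<Sum>w\<in>W. cinner w x *\<^sub>C T w) \<in> K"
        by (rule K(2))
      then have "T p \<in> K"
        by (simp add: p_def blinfun.sum_right complex_linearD[OF T])
      then obtain y where y: "y \<in> k" "dist y (T p) < r / 3"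
        using k(2) by auto
      have "dist y (T x) \<le> dist y (T p) + dist (T p) (T x)"
        by (rule dist_triangle)
      also have "dist (T p) (T x) = norm (T (x - p))"
        by (simp add: dist_norm norm_minus_commute blinfun.diff_right)
      finally show "T x \<in> (\<Union>y\<in>k. cball y (2 * r / 3))"
        using y 1 by (intro UN_I[of y]) auto
    qed
    then have "closure (T ` cball 0 1) \<subseteq> (\<Union>y\<in>k. cball y (2 * r / 3))"
      using k(1) by (intro closure_minimal closed_UN) auto
    also have "\<dots> \<subseteq> (\<Union>y\<in>k. ball y r)"
      using r by auto
    finally show ?thesis
      using k(1) by blast
  qed
  have "complete (closure (T ` cball 0 1))"
    by (simp add: complete_eq_closed)
  then show ?thesis
    using cover T by (simp add: compact_op_def compact_eq_totally_bounded)
qed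

lemma compact_diag_op:
  fixes \<phi> :: "nat \<Rightarrow> 'h::complex_hilbert"
  assumes \<phi>: "orthonormal UNIV \<phi>" and s: "decseq s" "\<And>k. 0 \<le> s k" "s \<longlonglongrightarrow> 0"
  shows "compact_op (real_diag_op \<phi> s)"
proof (rule compact_opI_small_complement)
  note b = decseq_bounded_real(2)[OF s(1,2)]
  show "complex_linear (real_diag_op \<phi> s)"
    by (rule complex_linear_diag_op[OF \<phi> b])
  fix \<delta> :: real assume \<delta>: "0 < \<delta>"
  obtain N where N: "\<And>n. N \<le> n \<Longrightarrow> s n < \<delta>"
    using order_tendstoD(2)[OF s(3) \<delta>] by (auto simp: eventually_sequentially)
  have "norm (real_diag_op \<phi> s x) \<le> \<delta> * norm x" if x: "\<forall>w\<in>\<phi> ` {..<N}. cinner w x = 0" for x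
  proof (rule power2_le_imp_le)
    have "(cmod (complex_of_real (s k)))\<^sup>2 * (cmod (cinner (\<phi> k) x))\<^sup>2 \<le> \<delta>\<^sup>2 * (cmod (cinner (\<phi> k) x))\<^sup>2" for k
    proof (cases "k < N")
      case False
      then have "(s k)\<^sup>2 \<le> \<delta>\<^sup>2"
        using N[of k] s(2)[of k] by (intro power_mono) auto
      then show ?thesis
        by (intro mult_right_mono) auto
    qed (use x in auto)
    then have "(norm (real_diag_op \<phi> s x))\<^sup>2 \<le> \<delta>\<^sup>2 * (\<Sum>k. (cmod (cinner (\<phi> k) x))\<^sup>2)"
      by (rule sums_le[OF _ norm_diag_op_sums[OF \<phi> b] sums_mult[OF summable_sums[OF bessel_summable[OF \<phi>]]]])
    also have "\<dots> \<le> \<delta>\<^sup>2 * (norm x)\<^sup>2"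
      by (intro mult_left_mono suminf_le_const bessel_summable[OF \<phi>] bessel orthonormal_subset[OF \<phi>]) auto
    finally show "(norm (real_diag_op \<phi> s x))\<^sup>2 \<le> (\<delta> * norm x)\<^sup>2"
      by (simp add: power_mult_distrib)
  qed (use \<delta> in auto)
  moreover have "finite (\<phi> ` {..<N})" "orthonormal (\<phi> ` {..<N}) (\<lambda>x. x)"
    by (auto intro!: orthonormal_image orthonormal_subset[OF \<phi>])
  ultimately show "\<exists>W. finite W \<and> orthonormal W (\<lambda>x. x) \<and>
      (\<forall>x. (\<forall>w\<in>W. cinner w x = 0) \<longrightarrow> norm (real_diag_op \<phi> s x) \<le> \<delta> * norm x)"
    by blast
qed

lemma orthonormal_insert:
  fixes v :: "'h::complex_hilbert"
  assumes "orthonormal W (\<lambda>x. x)" "\<And>w. w \<in> W \<Longrightarrow> cinner w v = 0" "norm v = 1"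
  shows "orthonormal (insert v W) (\<lambda>x. x)"
proof -
  have "v \<notin> W"
    using assms(2)[of v] assms(3) by (auto simp: cinner_self)
  moreover have "cinner v w = 0" if "w \<in> W" for w
    using assms(2)[OF that] cinner_eq_0_commute by blast
  ultimately show ?thesis
    using assms by (auto simp: orthonormal_def cinner_self)
qed

text \<open>A maximal orthonormal set on which the form exceeds a given bound is finite, and off its span
  the form stays below the bound.\<close>

lemma compact_positive_opI:
  fixes B :: "'h::complex_hilbert op"
  assumes B: "positive_op B" and lim: "(\<lambda>n. s n / real n) \<longlonglongrightarrow> 0"
    and le: "\<And>W. finite W \<Longrightarrow> orthonormal W (\<lambda>x. x) \<Longrightarrow> (\<Sum>w\<in>W. Re (cinner w (B w))) \<le> s (card W)"
  shows "compact_op B"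
proof (rule compact_opI_small_complement)
  show "complex_linear B"
    by (rule positive_op_complex_linear[OF B])
  fix \<delta> :: real assume \<delta>: "0 < \<delta>"
  define \<eta> where "\<eta> = \<delta>\<^sup>2 / (norm B + 1)"
  have M: "0 < norm B + 1"
    using norm_ge_zero[of B] by linarith
  have \<eta>: "0 < \<eta>"
    using \<delta> M by (simp add: \<eta>_def)
  obtain N0 where N0: "\<And>n. N0 \<le> n \<Longrightarrow> s n / real n < \<eta>"
    using order_tendstoD(2)[OF lim \<eta>] by (auto simp: eventually_sequentially)
  have "s (Suc N0) / real (Suc N0) < \<eta>"
    by (rule N0) simp
  moreover define N where "N = Suc N0"
  ultimately have N: "s N < real N * \<eta>"
    by (simp add: divide_less_eq mult.commute)
  define P where "P W \<longleftrightarrow> finite W \<and> orthonormal W (\<lambda>x. x) \<and> (\<forall>w\<in>W. \<eta> < Re (cinner w (B w)))" for W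
  have card: "card W < N" if W: "P W" for W
  proof (rule ccontr)
    assume "\<not> card W < N"
    then obtain V where V: "V \<subseteq> W" "card V = N" "finite V"
      using obtain_subset_with_card_n[of N W] by auto
    have "real N * \<eta> = (\<Sum>w\<in>V. \<eta>)"
      using V by simp
    also have "\<dots> \<le> (\<Sum>w\<in>V. Re (cinner w (B w)))"
      using V W by (intro sum_mono) (auto simp: P_def less_imp_le)
    also have "\<dots> \<le> s N"
      using le[of V] V W orthonormal_subset by (auto simp: P_def)
    finally show False
      using N by simp
  qed
  have "P {}"
    by (simp add: P_def orthonormal_def)
  then obtain W where W: "P W" "\<And>V. P V \<Longrightarrow> card V \<le> card W"
    using ex_has_greatest_nat[of P "{}" card N] card by auto
  have q: "Re (cinner x (B x)) \<le> \<eta> * (norm x)\<^sup>2" if x: "\<forall>w\<in>W. cinner w x = 0" for x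
  proof (rule ccontr)
    assume *: "\<not> ?thesis"
    then have "x \<noteq> 0" by auto
    define v where "v = (1 / norm x) *\<^sub>R x"
    have "norm v = 1"
      using \<open>x \<noteq> 0\<close> by (simp add: v_def)
    moreover have wv: "\<And>w. w \<in> W \<Longrightarrow> cinner w v = 0"
      using x by (simp add: v_def cinner_scaleR_right)
    ultimately have "orthonormal (insert v W) (\<lambda>x. x)"
      using W(1) by (intro orthonormal_insert) (auto simp: P_def)
    moreover have "\<eta> < Re (cinner v (B v))"
      using * \<open>x \<noteq> 0\<close>
      by (simp add: v_def blinfun.scaleR_right cinner_scaleR_left cinner_scaleR_right field_simps power2_eq_square)
    ultimately have "P (insert v W)"
      using W(1) by (auto simp: P_def)
    moreover have "v \<notin> W"
      using wv[of v] \<open>norm v = 1\<close> by (auto simp: cinner_self)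
    ultimately show False
      using W(2)[of "insert v W"] W(1) by (simp add: P_def)
  qed
  have "norm (B x) \<le> \<delta> * norm x" if x: "\<forall>w\<in>W. cinner w x = 0" for x
  proof (rule power2_le_imp_le)
    have "(norm (B x))\<^sup>2 \<le> norm B * Re (cinner x (B x))"
      by (rule positive_op_norm_le[OF B])
    also have "\<dots> \<le> (norm B + 1) * (\<eta> * (norm x)\<^sup>2)"
      using q[OF x] positive_op_form_nonneg[OF B] by (intro mult_mono) auto
    also have "\<dots> = (\<delta> * norm x)\<^sup>2"
      using M by (simp add: \<eta>_def power_mult_distrib)
    finally show "(norm (B x))\<^sup>2 \<le> (\<delta> * norm x)\<^sup>2" .
  qed (use \<delta> in auto)
  then show "\<exists>W. finite W \<and> orthonormal W (\<lambda>x. x) \<and>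
      (\<forall>x. (\<forall>w\<in>W. cinner w x = 0) \<longrightarrow> norm (B x) \<le> \<delta> * norm x)"
    using W(1) by (auto simp: P_def)
qed

section \<open>Ky Fan inequalities\<close>

lemma gram_schmidt:
  fixes V :: "'h::complex_hilbert set"
  assumes "finite V"
  obtains W where "finite W" "orthonormal W (\<lambda>x. x)" "card W \<le> card V"
    "\<And>v. v \<in> V \<Longrightarrow> v = (\<Sum>w\<in>W. cinner w v *\<^sub>C w)"
  using assms
proof (induction V arbitrary: thesis rule: finite_induct)
  case empty
  show ?case
    by (rule empty[of "{}"]) (auto simp: orthonormal_def)
next
  case (insert v V)
  obtain W where W: "finite W" "orthonormal W (\<lambda>x. x)" "card W \<le> card V"
    "\<And>v. v \<in> V \<Longrightarrow> v = (\<Sum>w\<in>W. cinner w v *\<^sub>C w)"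
    using insert.IH by blast
  define z where "z = v - (\<Sum>w\<in>W. cinner w v *\<^sub>C w)"
  have wz: "cinner w z = 0" if "w \<in> W" for w
    unfolding z_def by (rule orthonormal_complement[OF W(2,1) that])
  show ?case
  proof (cases "z = 0")
    case True
    then show ?thesis
      using W insert.hyps by (intro insert.prems[of W]) (auto simp: z_def)
  next
    case False
    define u where "u = (1 / norm z) *\<^sub>R z"
    have u: "norm u = 1"
      using False by (simp add: u_def)
    have wu: "cinner w u = 0" if "w \<in> W" for w
      using wz[OF that] by (simp add: u_def cinner_scaleR_right)
    have on: "orthonormal (insert u W) (\<lambda>x. x)"
      using W(2) wu u by (rule orthonormal_insert)
    have notin: "u \<notin> W"
      using wu[of u] u by (auto simp: cinner_self)
    have "cinner u w = 0" if "w \<in> W" for w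
      using wu[OF that] cinner_eq_0_commute by blast
    then have usum: "cinner u (\<Sum>w\<in>W. c w *\<^sub>C w) = 0" for c
      by (simp add: cinner.sum_right cinner_scaleC_right)
    then have uv: "cinner u x = 0" if "x \<in> V" for x
      using W(4)[OF that] by metis
    have "cinner u v = cinner u z"
      using usum by (simp add: z_def cinner.diff_right)
    also have "cinner u z = complex_of_real (norm z)"
      using False by (simp add: u_def cinner_scaleR_left cinner_self power2_eq_square scaleR_conv_of_real)
    finally have "cinner u v *\<^sub>C u = z"
      using False by (simp add: u_def flip: scaleR_scaleC)
    then have v: "v = (\<Sum>w\<in>insert u W. cinner w v *\<^sub>C w)"
      using W(1) notin by (simp add: z_def)
    show ?thesis
    proof (rule insert.prems)
      show "finite (insert u W)" "orthonormal (insert u W) (\<lambda>x. x)" "card (insert u W) \<le> card (insert v V)"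
        using W(1,3) on notin insert.hyps by auto
      show "x = (\<Sum>w\<in>insert u W. cinner w x *\<^sub>C w)" if "x \<in> insert v V" for x
      proof (cases "x = v")
        case False
        then have "x \<in> V" using that by simp
        then show ?thesis
          using W(1) notin uv W(4) by simp
      qed (use v in simp)
    qed
  qed
qed

lemma ky_fan_upper:
  fixes \<phi> :: "nat \<Rightarrow> 'h::complex_hilbert"
  assumes \<phi>: "orthonormal UNIV \<phi>" and \<mu>: "decseq \<mu>" "\<And>k. 0 \<le> \<mu> k"
    and I: "finite I" "orthonormal I \<psi>"
  shows "(\<Sum>i\<in>I. Re (cinner (\<psi> i) (real_diag_op \<phi> \<mu> (\<psi> i)))) \<le> (\<Sum>k<card I. \<mu> k)"
proof -
  define n where "n = card I"
  note b = decseq_bounded_real(1)[OF \<mu>]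
  have le: "Re (cinner x (real_diag_op \<phi> \<mu> x)) \<le>
      (\<Sum>k<n. (\<mu> k - \<mu> n) * (cmod (cinner (\<phi> k) x))\<^sup>2) + \<mu> n * (norm x)\<^sup>2" for x
  proof -
    define c where "c k = (cmod (cinner (\<phi> k) x))\<^sup>2" for k
    have c: "summable c" "suminf c \<le> (norm x)\<^sup>2"
      unfolding c_def using bessel[OF orthonormal_subset[OF \<phi>]]
      by (auto intro!: suminf_le_const bessel_summable[OF \<phi>])
    have "(\<lambda>k. if k \<in> {..<n} then (\<mu> k - \<mu> n) * c k else 0) sums (\<Sum>k<n. (\<mu> k - \<mu> n) * c k)"
      by (rule sums_If_finite_set) simp
    from sums_add[OF this sums_mult[OF summable_sums[OF c(1)], of "\<mu> n"]]
    have sums: "(\<lambda>k. (if k \<in> {..<n} then (\<mu> k - \<mu> n) * c k else 0) + \<mu> n * c k) sums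
        ((\<Sum>k<n. (\<mu> k - \<mu> n) * c k) + \<mu> n * suminf c)" .
    have "\<mu> k * c k \<le> (if k \<in> {..<n} then (\<mu> k - \<mu> n) * c k else 0) + \<mu> n * c k" for k
    proof (cases "k < n")
      case False
      then show ?thesis
        using decseqD[OF \<mu>(1), of n k] by (auto simp: c_def intro!: mult_right_mono)
    qed (simp add: algebra_simps)
    from sums_le[OF this real_diag_op_form(1)[OF \<phi> b, of x, folded c_def] sums]
    have "Re (cinner x (real_diag_op \<phi> \<mu> x)) \<le> (\<Sum>k<n. (\<mu> k - \<mu> n) * c k) + \<mu> n * suminf c" .
    also have "\<dots> \<le> (\<Sum>k<n. (\<mu> k - \<mu> n) * c k) + \<mu> n * (norm x)\<^sup>2"
      by (intro add_left_mono mult_left_mono c(2) \<mu>(2))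
    finally show ?thesis
      by (simp add: c_def)
  qed
  have "(\<Sum>i\<in>I. Re (cinner (\<psi> i) (real_diag_op \<phi> \<mu> (\<psi> i)))) \<le>
      (\<Sum>i\<in>I. (\<Sum>k<n. (\<mu> k - \<mu> n) * (cmod (cinner (\<phi> k) (\<psi> i)))\<^sup>2) + \<mu> n * 1)"
  proof (rule sum_mono)
    show "Re (cinner (\<psi> i) (real_diag_op \<phi> \<mu> (\<psi> i))) \<le>
        (\<Sum>k<n. (\<mu> k - \<mu> n) * (cmod (cinner (\<phi> k) (\<psi> i)))\<^sup>2) + \<mu> n * 1" if "i \<in> I" for i
      using le[of "\<psi> i"] orthonormal_norm[OF I(2) that] by simp
  qed
  also have "\<dots> = (\<Sum>k<n. (\<mu> k - \<mu> n) * (\<Sum>i\<in>I. (cmod (cinner (\<psi> i) (\<phi> k)))\<^sup>2)) + n * \<mu> n"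
    unfolding sum.distrib sum.swap[of _ "{..<n}" I]
    by (simp add: n_def sum_distrib_left cmod_cinner_commute[of "\<phi> _" "\<psi> _"])
  also have "\<dots> \<le> (\<Sum>k<n. (\<mu> k - \<mu> n) * 1) + n * \<mu> n"
  proof (intro add_right_mono sum_mono mult_left_mono)
    show "(\<Sum>i\<in>I. (cmod (cinner (\<psi> i) (\<phi> k)))\<^sup>2) \<le> 1" for k
      using bessel[OF I(2,1), of "\<phi> k"] orthonormal_norm[OF \<phi>, of k] by simp
    show "0 \<le> \<mu> k - \<mu> n" if "k \<in> {..<n}" for k
      using decseqD[OF \<mu>(1), of k n] that by simp
  qed
  also have "\<dots> = (\<Sum>k<n. \<mu> k)"
    by (simp add: sum_subtractf)
  finally show ?thesis
    by (simp add: n_def)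
qed

lemma ky_fan_lower:
  fixes \<phi> :: "nat \<Rightarrow> 'h::complex_hilbert"
  assumes \<phi>: "orthonormal UNIV \<phi>" and \<mu>: "decseq \<mu>" "\<And>k. 0 \<le> \<mu> k"
    and W: "finite W" "orthonormal W (\<lambda>x. x)" "\<And>k. k < n \<Longrightarrow> \<phi> k = (\<Sum>w\<in>W. cinner w (\<phi> k) *\<^sub>C w)"
  shows "(\<Sum>k<n. \<mu> k) \<le> (\<Sum>w\<in>W. Re (cinner w (real_diag_op \<phi> \<mu> w)))"
proof -
  note b = decseq_bounded_real(1)[OF \<mu>]
  have 1: "(\<Sum>w\<in>W. (cmod (cinner (\<phi> k) w))\<^sup>2) = 1" if "k < n" for k
  proof -
    have "(\<Sum>w\<in>W. (cmod (cinner w (\<phi> k)))\<^sup>2) = (norm (\<phi> k))\<^sup>2"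
      using norm_orthonormal_sum[OF W(2,1), of "\<lambda>w. cinner w (\<phi> k)"] W(3)[OF that] by simp
    then show ?thesis
      using orthonormal_norm[OF \<phi>] by (simp add: cmod_cinner_commute[of _ "\<phi> k"])
  qed
  have "(\<Sum>k<n. \<mu> k) = (\<Sum>k<n. \<mu> k * (\<Sum>w\<in>W. (cmod (cinner (\<phi> k) w))\<^sup>2))"
    using 1 by simp
  also have "\<dots> = (\<Sum>w\<in>W. \<Sum>k<n. \<mu> k * (cmod (cinner (\<phi> k) w))\<^sup>2)"
    by (simp add: sum_distrib_left sum.swap[of _ W])
  also have "\<dots> \<le> (\<Sum>w\<in>W. Re (cinner w (real_diag_op \<phi> \<mu> w)))"
  proof (rule sum_mono)
    fix w
    show "(\<Sum>k<n. \<mu> k * (cmod (cinner (\<phi> k) w))\<^sup>2) \<le> Re (cinner w (real_diag_op \<phi> \<mu> w))"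
      unfolding sums_unique[OF real_diag_op_form(1)[OF \<phi> b]] using \<mu>(2)
      by (intro sum_le_suminf sums_summable[OF real_diag_op_form(1)[OF \<phi> b]]) auto
  qed
  finally show ?thesis .
qed

section \<open>Singular values of compact operators\<close>

locale hilbert_basis =
  fixes e :: "nat \<Rightarrow> 'h::complex_hilbert"
  assumes basis_orthonormal: "orthonormal UNIV e"
    and basis_total: "(\<And>k. cinner (e k) x = 0) \<Longrightarrow> x = 0"
begin

lemma basis_expansion: "(\<lambda>k. cinner (e k) x *\<^sub>C e k) sums x"
proof -
  have "summable (\<lambda>k. cinner (e k) x *\<^sub>C e k)"
    by (intro riesz_fischer basis_orthonormal bessel_summable)
  then obtain y where y: "(\<lambda>k. cinner (e k) x *\<^sub>C e k) sums y"
    by (auto simp: summable_def)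
  have "x - y = 0"
    using orthonormal_sums_coeff[OF basis_orthonormal y] by (intro basis_total) (simp add: cinner.diff_right)
  then show ?thesis
    using y by simp
qed

lemma op_eq_diag_op:
  fixes T :: "'h op"
  assumes "complex_linear T" "bounded (range s)" "\<And>k. T (e k) = s k *\<^sub>C e k"
  shows "T = diag_op e s"
proof (rule eq_diag_opI[OF assms(1) basis_orthonormal assms(2,3)])
  fix x :: 'h
  assume "\<And>k. cinner (e k) x = 0"
  then have "x = 0" by (rule basis_total)
  then show "T x = 0"
    by simp
qed

lemma adjoint_exists:
  fixes T :: "'h op"
  assumes T: "complex_linear T"
  shows "\<exists>S :: 'h op. \<forall>x y. cinner (S x) y = cinner x (T y)"
proof -
  have "\<exists>z. \<forall>y. cinner z y = cinner x (T y)" for x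
  proof -
    define c where "c k = cinner (T (e k)) x" for k
    have bound: "(\<Sum>k<n. (cmod (c k))\<^sup>2) \<le> (norm T * norm x)\<^sup>2" for n
    proof -
      define s where "s = (\<Sum>k<n. (cmod (c k))\<^sup>2)"
      define y where "y = (\<Sum>k<n. c k *\<^sub>C e k)"
      have y: "(norm y)\<^sup>2 = s"
        unfolding y_def s_def
        by (intro norm_orthonormal_sum orthonormal_subset[OF basis_orthonormal]) auto
      have "cinner (T y) x = (\<Sum>k<n. cnj (c k) * c k)"
        by (simp add: y_def c_def blinfun.sum_right complex_linearD[OF T] cinner.sum_left cinner_scaleC_left)
      also have "\<dots> = complex_of_real s"
        unfolding s_def of_real_sum using complex_norm_square by (simp add: mult.commute)
      finally have Ty: "cinner (T y) x = complex_of_real s" .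
      have "0 \<le> s"
        by (simp add: s_def sum_nonneg)
      then have "s = cmod (cinner (T y) x)"
        by (simp add: Ty)
      also have "\<dots> \<le> norm (T y) * norm x"
        by (rule cinner_bound)
      also have "\<dots> \<le> norm T * norm y * norm x"
        by (intro mult_right_mono norm_blinfun) auto
      finally have "norm y * norm y \<le> norm y * (norm T * norm x)"
        using y by (simp add: power2_eq_square ac_simps)
      then have "norm y \<le> norm T * norm x"
        by (cases "norm y = 0") auto
      then have "(norm y)\<^sup>2 \<le> (norm T * norm x)\<^sup>2"
        by (intro power_mono) auto
      then show ?thesis
        using y by (simp add: s_def)
    qed
    have "summable (\<lambda>k. (cmod (c k))\<^sup>2)"
      by (rule bounded_imp_summable[OF _ bound[of "Suc _", unfolded lessThan_Suc_atMost]]) simp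
    then have "summable (\<lambda>k. c k *\<^sub>C e k)"
      by (rule riesz_fischer[OF basis_orthonormal])
    then obtain z where z: "(\<lambda>k. c k *\<^sub>C e k) sums z"
      by (auto simp: summable_def)
    have "cinner z y = cinner x (T y)" for y
    proof -
      have "(\<lambda>k. cinner z (cinner (e k) y *\<^sub>C e k)) sums cinner z y"
        by (rule bounded_linear.sums[OF cinner.bounded_linear_right basis_expansion])
      moreover have "cinner z (e k) = cinner x (T (e k))" for k
        using orthonormal_sums_coeff[OF basis_orthonormal z, of k] cinner_commute[of z] cinner_commute[of x]
        by (simp add: c_def)
      moreover have "(\<lambda>k. cinner x (T (cinner (e k) y *\<^sub>C e k))) sums cinner x (T y)"
        by (intro bounded_linear.sums[OF cinner.bounded_linear_right]
          bounded_linear.sums[OF blinfun.bounded_linear_right basis_expansion])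
      ultimately show ?thesis
        by (simp add: complex_linearD[OF T] cinner_scaleC_right sums_iff)
    qed
    then show ?thesis by blast
  qed
  then obtain S where S: "\<And>x y. cinner (S x) y = cinner x (T y)"
    by metis
  have "bounded_linear S"
  proof (rule bounded_linear_intro)
    show "S (x + y) = S x + S y" for x y
      by (rule cinner_ext_left) (simp add: S cinner_add_left)
    show "S (r *\<^sub>R x) = r *\<^sub>R S x" for r x
      by (rule cinner_ext_left) (simp add: S cinner_scaleR_left)
    show "norm (S x) \<le> norm x * norm T" for x
    proof -
      have "norm (S x) * norm (S x) = cmod (cinner (S x) (S x))"
        by (simp add: cinner_self norm_mult power2_eq_square)
      also have "\<dots> = cmod (cinner x (T (S x)))"
        by (simp add: S)
      also have "\<dots> \<le> norm x * norm (T (S x))"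
        by (rule cinner_bound)
      also have "\<dots> \<le> norm x * (norm T * norm (S x))"
        by (intro mult_left_mono norm_blinfun) auto
      finally show ?thesis
        by (cases "norm (S x) = 0") (auto simp: ac_simps)
    qed
  qed
  then have "blinfun_apply (Blinfun S) = S"
    by (rule bounded_linear_Blinfun_apply)
  then show ?thesis
    using S by metis
qed

lemma cinner_adjoint_op:
  assumes "complex_linear (T :: 'h op)"
  shows "cinner (adjoint_op T x) y = cinner x (T y)"
  using someI_ex[OF adjoint_exists[OF assms]] by (simp add: adjoint_op_def)

lemma complex_linear_adjoint_op:
  assumes "complex_linear (T :: 'h op)"
  shows "complex_linear (adjoint_op T)"
  unfolding complex_linear_def
  by (intro allI cinner_ext_left) (simp add: cinner_adjoint_op[OF assms] cinner_scaleC_left)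

lemma adjoint_compose_form:
  assumes "complex_linear (T :: 'h op)"
  shows "cinner x ((adjoint_op T o\<^sub>L T) y) = cinner (T x) (T y)"
  using cinner_adjoint_op[OF assms, of "T y" x] cinner_commute[of x] cinner_commute[of "T x"] by simp

lemma positive_adjoint_compose:
  assumes "complex_linear (T :: 'h op)"
  shows "positive_op (adjoint_op T o\<^sub>L T)"
proof (rule positive_opI)
  show "complex_linear (adjoint_op T o\<^sub>L T)"
    using assms by (intro complex_linear_compose complex_linear_adjoint_op)
  show "cinner x ((adjoint_op T o\<^sub>L T) x) = complex_of_real ((norm (T x))\<^sup>2)" for x
    by (simp add: adjoint_compose_form[OF assms] cinner_self del: blinfun_apply_blinfun_compose)
qed simp

lemma compact_op_singular_values:
  assumes T: "compact_op (T :: 'h op)"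
  obtains \<phi> :: "nat \<Rightarrow> 'h" where "orthonormal UNIV \<phi>" "decseq (singular_value T)" "\<And>k. 0 \<le> singular_value T k"
    "singular_value T \<longlonglongrightarrow> 0" "abs_op T = real_diag_op \<phi> (singular_value T)"
    "\<And>i j. cinner (T (\<phi> i)) (T (\<phi> j)) = (if i = j then complex_of_real ((singular_value T i)\<^sup>2) else 0)"
proof -
  have lin: "complex_linear T"
    using T by (simp add: compact_op_def)
  have "compact_op (adjoint_op T o\<^sub>L T)"
    by (intro compact_op_compose complex_linear_adjoint_op lin T)
  from compact_positive_spectral[OF positive_adjoint_compose[OF lin] this basis_orthonormal]
  obtain \<phi> \<mu> where \<phi>: "orthonormal UNIV \<phi>" and \<mu>: "decseq \<mu>" "\<And>k. 0 \<le> \<mu> k" "\<mu> \<longlonglongrightarrow> 0"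
    and eq: "adjoint_op T o\<^sub>L T = real_diag_op \<phi> \<mu>"
    by blast
  define s where "s k = sqrt (\<mu> k)" for k
  have s: "decseq s" "\<And>k. 0 \<le> s k" "s \<longlonglongrightarrow> 0"
    using \<mu>(2) decseqD[OF \<mu>(1)] tendsto_real_sqrt[OF \<mu>(3)] by (auto simp: s_def[abs_def] decseq_def)
  have abs: "abs_op T = real_diag_op \<phi> s"
    unfolding abs_op_def eq s_def by (intro sqrt_op_diag \<phi> \<mu>(2) decseq_bounded_real(1)[OF \<mu>(1,2)])
  have sv: "singular_value T = s"
    by (rule singular_value_diag[OF \<phi> s abs])
  have "cinner (T (\<phi> i)) (T (\<phi> j)) = (if i = j then complex_of_real ((s i)\<^sup>2) else 0)" for i j
  proof -
    have "cinner (T (\<phi> i)) (T (\<phi> j)) = cinner (\<phi> i) (real_diag_op \<phi> \<mu> (\<phi> j))"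
      using adjoint_compose_form[OF lin] by (simp add: eq)
    then show ?thesis
      using \<mu>(2) by (simp add: diag_op_eigen[OF \<phi> decseq_bounded_real(2)[OF \<mu>(1,2)]]
        cinner_scaleC_right orthonormalD[OF \<phi>] s_def)
  qed
  then show ?thesis
    using that[of \<phi>] \<phi> s abs sv by simp
qed

lemma singular_value_diag_op:
  assumes "orthonormal UNIV (\<phi> :: nat \<Rightarrow> 'h)" "decseq s" "\<And>k. 0 \<le> s k" "s \<longlonglongrightarrow> 0"
  shows "singular_value (real_diag_op \<phi> s) = s"
  by (rule singular_value_diag[OF assms abs_op_diag[OF assms(1) decseq_bounded_real(1)[OF assms(2,3)] assms(3)]])

lemma compact_positive_singular_values:
  assumes T: "compact_op (T :: 'h op)" "positive_op T"
  obtains \<phi> :: "nat \<Rightarrow> 'h" where "orthonormal UNIV \<phi>" "T = real_diag_op \<phi> (singular_value T)"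
proof -
  obtain \<phi> \<mu> where \<phi>: "orthonormal UNIV \<phi>" and \<mu>: "decseq \<mu>" "\<And>k. 0 \<le> \<mu> k" "\<mu> \<longlonglongrightarrow> 0"
    and eq: "T = real_diag_op \<phi> \<mu>"
    using compact_positive_spectral[OF T(2,1) basis_orthonormal] by blast
  have "singular_value T = \<mu>"
    unfolding eq by (intro singular_value_diag_op \<phi> \<mu>)
  then show ?thesis
    using that \<phi> eq by simp
qed

lemma
  assumes T: "compact_op (T :: 'h op)"
  shows singular_value_decseq: "decseq (singular_value T)"
    and singular_value_nonneg: "0 \<le> singular_value T k"
    and singular_value_tendsto: "singular_value T \<longlonglongrightarrow> 0"
  by (rule compact_op_singular_values[OF T]; simp)+

lemma ky_fan:
  assumes T: "compact_op (T :: 'h op)" "positive_op T" and I: "finite I" "orthonormal I \<psi>"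
  shows "(\<Sum>i\<in>I. Re (cinner (\<psi> i) (T (\<psi> i)))) \<le> (\<Sum>k<card I. singular_value T k)"
proof -
  obtain \<phi> :: "nat \<Rightarrow> 'h" where \<phi>: "orthonormal UNIV \<phi>" "T = real_diag_op \<phi> (singular_value T)"
    by (rule compact_positive_singular_values[OF T])
  then show ?thesis
    using ky_fan_upper[OF \<phi>(1) singular_value_decseq[OF T(1)] singular_value_nonneg[OF T(1)] I] by simp
qed

lemma singular_value_sum_leI:
  assumes T: "compact_op (T :: 'h op)" "positive_op T"
    and le: "\<And>W. finite W \<Longrightarrow> orthonormal W (\<lambda>x. x) \<Longrightarrow> card W = n \<Longrightarrow> (\<Sum>w\<in>W. Re (cinner w (T w))) \<le> c"
  shows "(\<Sum>k<n. singular_value T k) \<le> c"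
proof -
  obtain \<phi> :: "nat \<Rightarrow> 'h" where \<phi>: "orthonormal UNIV \<phi>" "T = real_diag_op \<phi> (singular_value T)"
    by (rule compact_positive_singular_values[OF T])
  note b = decseq_bounded_real(2)[OF singular_value_decseq[OF T(1)] singular_value_nonneg[OF T(1)]]
  have T\<phi>: "T (\<phi> k) = complex_of_real (singular_value T k) *\<^sub>C \<phi> k" for k
    using diag_op_eigen[OF \<phi>(1) b, of k] \<phi>(2) by simp
  have on: "orthonormal {..<n} \<phi>"
    by (rule orthonormal_subset[OF \<phi>(1)]) simp
  have "(\<Sum>k<n. singular_value T k) = (\<Sum>k<n. Re (cinner (\<phi> k) (T (\<phi> k))))"
    by (simp add: T\<phi> cinner_scaleC_right orthonormalD[OF \<phi>(1)])
  also have "\<dots> = (\<Sum>w\<in>\<phi> ` {..<n}. Re (cinner w (T w)))"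
    using orthonormal_inj[OF on] by (simp add: sum.reindex)
  also have "\<dots> \<le> c"
    using card_image[OF orthonormal_inj[OF on]] by (intro le orthonormal_image on) auto
  finally show ?thesis .
qed

lemma singular_value_sum_mono:
  assumes "compact_op (T :: 'h op)" "m \<le> n"
  shows "(\<Sum>k<m. singular_value T k) \<le> (\<Sum>k<n. singular_value T k)"
  using assms singular_value_nonneg[OF assms(1)] by (intro sum_mono2) auto

lemma singular_value_sum_add_le:
  assumes S: "compact_op (S :: 'h op)" "positive_op S" and T: "compact_op T" "positive_op T"
  shows "(\<Sum>k<n. singular_value (S + T) k) \<le> (\<Sum>k<n. singular_value S k) + (\<Sum>k<n. singular_value T k)"
proof (rule singular_value_sum_leI[OF compact_op_add[OF S(1) T(1)] positive_op_add[OF S(2) T(2)]])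
  fix W :: "'h set" assume W: "finite W" "orthonormal W (\<lambda>x. x)" "card W = n"
  have "(\<Sum>w\<in>W. Re (cinner w ((S + T) w))) = (\<Sum>w\<in>W. Re (cinner w (S w))) + (\<Sum>w\<in>W. Re (cinner w (T w)))"
    by (simp add: blinfun.add_left cinner_add_right sum.distrib)
  then show "(\<Sum>w\<in>W. Re (cinner w ((S + T) w))) \<le> (\<Sum>k<n. singular_value S k) + (\<Sum>k<n. singular_value T k)"
    using ky_fan[OF S W(1,2)] ky_fan[OF T W(1,2)] W(3) by simp
qed

lemma singular_value_sum_add_ge:
  assumes S: "compact_op (S :: 'h op)" "positive_op S" and T: "compact_op T" "positive_op T"
  shows "(\<Sum>k<n. singular_value S k) + (\<Sum>k<n. singular_value T k) \<le> (\<Sum>k<2 * n. singular_value (S + T) k)"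
proof -
  obtain \<phi> :: "nat \<Rightarrow> 'h" where \<phi>: "orthonormal UNIV \<phi>" "S = real_diag_op \<phi> (singular_value S)"
    by (rule compact_positive_singular_values[OF S])
  obtain \<psi> :: "nat \<Rightarrow> 'h" where \<psi>: "orthonormal UNIV \<psi>" "T = real_diag_op \<psi> (singular_value T)"
    by (rule compact_positive_singular_values[OF T])
  have "finite (\<phi> ` {..<n} \<union> \<psi> ` {..<n})" by simp
  then obtain W where W: "finite W" "orthonormal W (\<lambda>x. x)" "card W \<le> card (\<phi> ` {..<n} \<union> \<psi> ` {..<n})"
    "\<And>v. v \<in> \<phi> ` {..<n} \<union> \<psi> ` {..<n} \<Longrightarrow> v = (\<Sum>w\<in>W. cinner w v *\<^sub>C w)"
    by (rule gram_schmidt) blast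
  note W(3)
  also have "card (\<phi> ` {..<n} \<union> \<psi> ` {..<n}) \<le> card (\<phi> ` {..<n}) + card (\<psi> ` {..<n})"
    by (rule card_Un_le)
  also have "\<dots> \<le> n + n"
    by (intro add_mono order_trans[OF card_image_le]) auto
  finally have card: "card W \<le> 2 * n" by simp
  have "(\<Sum>k<n. singular_value S k) \<le> (\<Sum>w\<in>W. Re (cinner w (S w)))"
    using ky_fan_lower[OF \<phi>(1) singular_value_decseq[OF S(1)] singular_value_nonneg[OF S(1)] W(1,2), of n]
      W(4) \<phi>(2) by auto
  moreover have "(\<Sum>k<n. singular_value T k) \<le> (\<Sum>w\<in>W. Re (cinner w (T w)))"
    using ky_fan_lower[OF \<psi>(1) singular_value_decseq[OF T(1)] singular_value_nonneg[OF T(1)] W(1,2), of n]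
      W(4) \<psi>(2) by auto
  moreover have "(\<Sum>w\<in>W. Re (cinner w (S w))) + (\<Sum>w\<in>W. Re (cinner w (T w))) = (\<Sum>w\<in>W. Re (cinner w ((S + T) w)))"
    by (simp add: blinfun.add_left cinner_add_right sum.distrib)
  moreover have "\<dots> \<le> (\<Sum>k<card W. singular_value (S + T) k)"
    by (intro ky_fan compact_op_add positive_op_add S T W)
  moreover have "\<dots> \<le> (\<Sum>k<2 * n. singular_value (S + T) k)"
    by (intro singular_value_sum_mono compact_op_add S T card)
  ultimately show ?thesis by linarith
qed

text \<open>In the polar decomposition \<open>T \<phi>\<^sub>k = \<mu>\<^sub>k \<psi>\<^sub>k\<close> the \<open>k\<close>-th singular value is
  \<open>\<langle>\<psi>\<^sub>k, T \<phi>\<^sub>k\<rangle>\<close>, and both \<open>\<phi>\<close> and \<open>\<psi>\<close> are orthonormal.\<close>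

lemma singular_value_sum_form_le:
  assumes T: "compact_op (T :: 'h op)" and P: "compact_op P" "positive_op P"
    and le: "\<And>x y. Re (cinner y (T x)) \<le> (Re (cinner x (P x)) + Re (cinner y (P y))) / 2"
  shows "(\<Sum>k<n. singular_value T k) \<le> (\<Sum>k<n. singular_value P k)"
proof -
  obtain \<phi> :: "nat \<Rightarrow> 'h" where \<phi>: "orthonormal UNIV \<phi>"
    and T\<phi>: "\<And>i j. cinner (T (\<phi> i)) (T (\<phi> j)) = (if i = j then complex_of_real ((singular_value T i)\<^sup>2) else 0)"
    by (rule compact_op_singular_values[OF T]) (rule that)
  define I where "I = {k. k < n \<and> singular_value T k \<noteq> 0}"
  define \<psi> where "\<psi> k = (1 / singular_value T k) *\<^sub>R T (\<phi> k)" for k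
  have I: "finite I" "card I \<le> n"
    using card_mono[of "{..<n}" I] by (auto simp: I_def)
  have \<psi>: "orthonormal I \<psi>"
    unfolding orthonormal_def
    by (auto simp: I_def \<psi>_def cinner_scaleR_left cinner_scaleR_right T\<phi> scaleR_conv_of_real power2_eq_square)
  have "singular_value T k = Re (cinner (\<psi> k) (T (\<phi> k)))" if "k \<in> I" for k
    using that by (simp add: \<psi>_def cinner_scaleR_left T\<phi> I_def power2_eq_square)
  then have "(\<Sum>k\<in>I. singular_value T k) \<le>
      (\<Sum>k\<in>I. (Re (cinner (\<phi> k) (P (\<phi> k))) + Re (cinner (\<psi> k) (P (\<psi> k)))) / 2)"
    using le by (intro sum_mono) simp
  also have "\<dots> = ((\<Sum>k\<in>I. Re (cinner (\<phi> k) (P (\<phi> k)))) + (\<Sum>k\<in>I. Re (cinner (\<psi> k) (P (\<psi> k))))) / 2"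
    by (simp add: sum_divide_distrib[symmetric] sum.distrib)
  also have "\<dots> \<le> (\<Sum>k<card I. singular_value P k)"
    using ky_fan[OF P I(1) \<psi>] ky_fan[OF P I(1) orthonormal_subset[OF \<phi>]] by simp
  also have "\<dots> \<le> (\<Sum>k<n. singular_value P k)"
    by (rule singular_value_sum_mono[OF P(1) I(2)])
  also have "(\<Sum>k\<in>I. singular_value T k) = (\<Sum>k<n. singular_value T k)"
    by (intro sum.mono_neutral_left) (auto simp: I_def)
  finally show ?thesis .
qed

lemma singular_value_scale:
  assumes T: "compact_op (T :: 'h op)" "positive_op T" and r: "0 \<le> r"
  shows "singular_value (scale_op (complex_of_real r) T) k = r * singular_value T k"
proof -
  obtain \<phi> :: "nat \<Rightarrow> 'h" where \<phi>: "orthonormal UNIV \<phi>" "T = real_diag_op \<phi> (singular_value T)"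
    by (rule compact_positive_singular_values[OF T])
  define s where "s k = r * singular_value T k" for k
  have s: "decseq s" "\<And>k. 0 \<le> s k" "s \<longlonglongrightarrow> 0"
    using r singular_value_nonneg[OF T(1)] decseqD[OF singular_value_decseq[OF T(1)]]
      tendsto_mult_right_zero[OF singular_value_tendsto[OF T(1)], of r]
    by (auto simp: s_def[abs_def] decseq_def intro!: mult_left_mono)
  note b = decseq_bounded_real(2)[OF singular_value_decseq[OF T(1)] singular_value_nonneg[OF T(1)]]
  have "scale_op (complex_of_real r) T = real_diag_op \<phi> s"
  proof (rule blinfun_eqI)
    fix x
    have "(\<lambda>k. complex_of_real r *\<^sub>C ((complex_of_real (singular_value T k) * cinner (\<phi> k) x) *\<^sub>C \<phi> k)) sums
        (complex_of_real r *\<^sub>C T x)"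
      by (rule bounded_linear.sums[OF scaleC.bounded_linear_right
        diag_op_sums[OF \<phi>(1) b, of x, folded \<phi>(2)]])
    then have "(\<lambda>k. (complex_of_real (s k) * cinner (\<phi> k) x) *\<^sub>C \<phi> k) sums (complex_of_real r *\<^sub>C T x)"
      by (simp add: scaleC_scaleC s_def mult.assoc)
    from sums_unique2[OF this diag_op_sums[OF \<phi>(1) decseq_bounded_real(2)[OF s(1,2)]]]
    show "scale_op (complex_of_real r) T x = real_diag_op \<phi> s x"
      by (simp add: scale_op.rep_eq)
  qed
  then show ?thesis
    using singular_value_diag_op[OF \<phi>(1) s] by (simp add: s_def)
qed

lemma L1_infI:
  assumes T: "compact_op (T :: 'h op)" and C: "\<And>n. (\<Sum>k<n. singular_value T k) \<le> C * ln (1 + real n)"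
  shows "T \<in> L1_inf"
proof -
  have "log_mean T k \<le> C" for k
  proof -
    have "0 < ln (1 + real (k + 1))"
      by simp
    then show ?thesis
      using C[of "Suc k"] by (simp add: log_mean_def lessThan_Suc_atMost divide_le_eq)
  qed
  then show ?thesis
    using T by (auto simp: L1_inf_def intro!: bdd_aboveI2)
qed

lemma L1_infE:
  assumes "(T :: 'h op) \<in> L1_inf"
  obtains C where "0 \<le> C" "\<And>n. (\<Sum>k<n. singular_value T k) \<le> C * ln (1 + real n)"
proof -
  obtain C where C: "\<And>k. log_mean T k \<le> C"
    using assms by (auto simp: L1_inf_def bdd_above_def)
  have "(\<Sum>k<n. singular_value T k) \<le> max 0 C * ln (1 + real n)" for n
  proof (cases n)
    case (Suc k)
    have pos: "0 < ln (1 + real (k + 1))"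
      by simp
    then have "(\<Sum>k<n. singular_value T k) \<le> C * ln (1 + real n)"
      using C[of k] by (simp add: Suc log_mean_def lessThan_Suc_atMost divide_le_eq)
    also have "\<dots> \<le> max 0 C * ln (1 + real n)"
      using pos by (intro mult_right_mono) (auto simp: Suc)
    finally show ?thesis .
  qed simp
  then show ?thesis
    using that[of "max 0 C"] by simp
qed

lemma L1_inf_compact: "T \<in> L1_inf \<Longrightarrow> compact_op (T :: 'h op)"
  by (simp add: L1_inf_def)

lemma L1_inf_form_le:
  assumes T: "compact_op (T :: 'h op)" and P: "P \<in> L1_inf" "positive_op P"
    and le: "\<And>x y. Re (cinner y (T x)) \<le> (Re (cinner x (P x)) + Re (cinner y (P y))) / 2"
  shows "T \<in> L1_inf"
proof -
  obtain C where "\<And>n. (\<Sum>k<n. singular_value P k) \<le> C * ln (1 + real n)"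
    using L1_infE[OF P(1)] by blast
  then show ?thesis
    using singular_value_sum_form_le[OF T L1_inf_compact[OF P(1)] P(2) le]
    by (intro L1_infI[OF T, of C]) (meson order_trans)
qed

lemma L1_inf_add_positive:
  assumes S: "(S :: 'h op) \<in> L1_inf" "positive_op S" and T: "T \<in> L1_inf" "positive_op T"
  shows "S + T \<in> L1_inf"
proof -
  obtain C where C: "\<And>n. (\<Sum>k<n. singular_value S k) \<le> C * ln (1 + real n)"
    using L1_infE[OF S(1)] by blast
  obtain D where D: "\<And>n. (\<Sum>k<n. singular_value T k) \<le> D * ln (1 + real n)"
    using L1_infE[OF T(1)] by blast
  show ?thesis
  proof (rule L1_infI)
    show "compact_op (S + T)"
      by (intro compact_op_add L1_inf_compact S T)
    show "(\<Sum>k<n. singular_value (S + T) k) \<le> (C + D) * ln (1 + real n)" for n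
      using singular_value_sum_add_le[OF L1_inf_compact[OF S(1)] S(2) L1_inf_compact[OF T(1)] T(2), of n]
        C[of n] D[of n] by (simp add: distrib_right)
  qed
qed

lemma L1_inf_scale_positive:
  assumes T: "(T :: 'h op) \<in> L1_inf" "positive_op T" and r: "0 \<le> r"
  shows "scale_op (complex_of_real r) T \<in> L1_inf"
proof -
  obtain C where C: "\<And>n. (\<Sum>k<n. singular_value T k) \<le> C * ln (1 + real n)"
    using L1_infE[OF T(1)] by blast
  show ?thesis
  proof (rule L1_infI)
    show "compact_op (scale_op (complex_of_real r) T)"
      by (intro compact_op_scale L1_inf_compact T)
    show "(\<Sum>k<n. singular_value (scale_op (complex_of_real r) T) k) \<le> (r * C) * ln (1 + real n)" for n
      using mult_left_mono[OF C[of n] r]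
      by (simp add: singular_value_scale[OF L1_inf_compact[OF T(1)] T(2) r] sum_distrib_left mult.assoc)
  qed
qed

end

section \<open>Dixmier traces\<close>

lemma apply_Bcontfun_nat:
  fixes f :: "nat \<Rightarrow> real"
  assumes "bounded (range f)"
  shows "apply_bcontfun (Bcontfun f) = f"
  using assms by (intro Bcontfun_inverse) (auto simp: bcontfun_def)

lemma apply_D2: "apply_bcontfun (D2 a) k = apply_bcontfun a (k div 2)"
proof -
  have "range (\<lambda>k. apply_bcontfun a (k div 2)) \<subseteq> range (apply_bcontfun a)"
    by auto
  then show ?thesis
    unfolding D2_def by (subst apply_Bcontfun_nat) (auto intro: bounded_subset)
qed

lemma
  assumes "\<omega> \<in> DL2 TYPE('h::complex_hilbert)"
  shows DL2_nonneg: "(\<And>k. 0 \<le> apply_bcontfun a k) \<Longrightarrow> 0 \<le> \<omega> a"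
    and DL2_one: "\<omega> (const_bcontfun 1) = 1"
    and DL2_limsup: "(\<And>k. 0 \<le> apply_bcontfun a k) \<Longrightarrow> ereal (\<omega> a) \<le> limsup (\<lambda>k. ereal (apply_bcontfun a k))"
    and DL2_D2: "T \<in> L1_inf \<Longrightarrow> positive_op (T :: 'h op) \<Longrightarrow> \<omega> (D2 (gamma_op T)) = \<omega> (gamma_op T)"
  using assms by (simp_all add: DL2_def)

lemma DL2_le:
  assumes \<omega>: "\<omega> \<in> DL2 TYPE('h::complex_hilbert)"
    and le: "\<And>k. apply_bcontfun a k \<le> apply_bcontfun b k + c k" and c: "\<And>k. 0 \<le> c k" "c \<longlonglongrightarrow> 0"
  shows "\<omega> a \<le> \<omega> b"
proof -
  have "bounded (range c)"
    using c(2) by (intro convergent_imp_bounded)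
  then have C: "apply_bcontfun (Bcontfun c) = c"
    by (rule apply_Bcontfun_nat)
  have "(\<lambda>k. ereal (c k)) \<longlonglongrightarrow> ereal 0"
    using c(2) by simp
  then have "limsup (\<lambda>k. ereal (c k)) = 0"
    using lim_imp_Limsup[of sequentially "\<lambda>k. ereal (c k)" "ereal 0"] by (simp add: zero_ereal_def)
  then have "\<omega> (Bcontfun c) \<le> 0"
    using DL2_limsup[OF \<omega>, of "Bcontfun c"] c(1) by (simp add: C zero_ereal_def)
  moreover have "0 \<le> \<omega> (b + Bcontfun c - a)"
    using le by (intro DL2_nonneg[OF \<omega>]) (simp add: C)
  ultimately show ?thesis
    by (simp add: blinfun.add_right blinfun.diff_right)
qed

lemma DL2_le_scaled:
  assumes \<omega>: "\<omega> \<in> DL2 TYPE('h::complex_hilbert)" and le: "\<And>k. apply_bcontfun a k \<le> C"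
  shows "\<omega> a \<le> C"
proof -
  have "\<omega> a \<le> \<omega> (C *\<^sub>R const_bcontfun 1)"
    using le by (intro DL2_le[OF \<omega>, where c = "\<lambda>_. 0"]) (auto simp: const_bcontfun.rep_eq)
  then show ?thesis
    by (simp add: blinfun.scaleR_right DL2_one[OF \<omega>])
qed

context hilbert_basis
begin

lemma log_mean_eq: "log_mean (T :: 'h op) k = (\<Sum>j<Suc k. singular_value T j) / ln (2 + real k)"
  by (simp add: log_mean_def lessThan_Suc_atMost add.commute)

lemma log_mean_nonneg: "(T :: 'h op) \<in> L1_inf \<Longrightarrow> 0 \<le> log_mean T k"
  unfolding log_mean_eq
  by (intro divide_nonneg_nonneg sum_nonneg singular_value_nonneg L1_inf_compact) auto

lemma apply_gamma_op:
  assumes T: "(T :: 'h op) \<in> L1_inf"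
  shows "apply_bcontfun (gamma_op T) = log_mean T"
proof -
  obtain C where C: "\<And>k. log_mean T k \<le> C"
    using T by (auto simp: L1_inf_def bdd_above_def)
  then have "\<bar>log_mean T k\<bar> \<le> C" for k
    using C[of k] log_mean_nonneg[OF T] by (simp add: abs_of_nonneg)
  then have "bounded (range (log_mean T))"
    by (auto simp: bounded_iff)
  then show ?thesis
    by (simp add: gamma_op_def apply_Bcontfun_nat)
qed

definition omega_gamma :: "((nat \<Rightarrow>\<^sub>C real) \<Rightarrow>\<^sub>L real) \<Rightarrow> 'h op \<Rightarrow> real" where
  "omega_gamma \<omega> T = \<omega> (gamma_op T)"

lemma omega_gamma_nonneg: "\<omega> \<in> DL2 TYPE('h) \<Longrightarrow> T \<in> L1_inf \<Longrightarrow> 0 \<le> omega_gamma \<omega> T"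
  unfolding omega_gamma_def by (intro DL2_nonneg) (auto simp: apply_gamma_op log_mean_nonneg)

lemma omega_gamma_le:
  assumes \<omega>: "\<omega> \<in> DL2 TYPE('h)" and T: "T \<in> L1_inf"
    and C: "\<And>n. (\<Sum>k<n. singular_value T k) \<le> C * ln (1 + real n)"
  shows "omega_gamma \<omega> T \<le> C"
  unfolding omega_gamma_def
proof (rule DL2_le_scaled[OF \<omega>])
  show "apply_bcontfun (gamma_op T) k \<le> C" for k
    using C[of "Suc k"] by (simp add: apply_gamma_op[OF T] log_mean_eq divide_le_eq add.commute)
qed

lemma omega_gamma_mono:
  assumes \<omega>: "\<omega> \<in> DL2 TYPE('h)" and S: "S \<in> L1_inf" and T: "T \<in> L1_inf"
    and le: "\<And>n. (\<Sum>k<n. singular_value S k) \<le> (\<Sum>k<n. singular_value T k)"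
  shows "omega_gamma \<omega> S \<le> omega_gamma \<omega> T"
  unfolding omega_gamma_def
proof (rule DL2_le[OF \<omega>, where c = "\<lambda>_. 0"])
  have "log_mean S k \<le> log_mean T k" for k
    unfolding log_mean_eq by (intro divide_right_mono le) simp
  then show "apply_bcontfun (gamma_op S) k \<le> apply_bcontfun (gamma_op T) k + 0" for k
    by (simp add: apply_gamma_op S T)
qed auto

lemma omega_gamma_scale:
  assumes T: "T \<in> L1_inf" "positive_op T" and r: "0 \<le> r"
  shows "omega_gamma \<omega> (scale_op (complex_of_real r) T) = r * omega_gamma \<omega> T"
proof -
  have "gamma_op (scale_op (complex_of_real r) T) = r *\<^sub>R gamma_op T"
    by (rule bcontfun_eqI)
      (simp add: apply_gamma_op L1_inf_scale_positive T r log_mean_eq singular_value_scale L1_inf_compact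
        sum_distrib_left[symmetric] del: sum.lessThan_Suc)
  then show ?thesis
    by (simp add: omega_gamma_def blinfun.scaleR_right)
qed

text \<open>The singular values of \<open>S\<close>, added in pairs, are those of a diagonal operator \<open>R\<close> whose sequence
  \<open>\<gamma>(R)\<close> dominates \<open>\<gamma>(A) + \<gamma>(B)\<close> for \<open>S = A + B\<close>, while \<open>D2 (\<gamma>(R))\<close> is asymptotic
  to \<open>\<gamma>(S)\<close>.\<close>

lemma omega_gamma_pair_sums:
  assumes \<omega>: "\<omega> \<in> DL2 TYPE('h)" and S: "S \<in> L1_inf"
  obtains R where "R \<in> L1_inf" "\<And>k. log_mean R k = (\<Sum>j<2 * Suc k. singular_value S j) / ln (2 + real k)"
    "omega_gamma \<omega> R \<le> omega_gamma \<omega> S"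
proof -
  note cS = L1_inf_compact[OF S]
  note nn = singular_value_nonneg[OF cS]
  obtain C where C: "0 \<le> C" "\<And>n. (\<Sum>k<n. singular_value S k) \<le> C * ln (1 + real n)"
    using L1_infE[OF S] by blast
  define b where "b j = singular_value S (2 * j) + singular_value S (2 * j + 1)" for j
  have b: "decseq b" "\<And>k. 0 \<le> b k"
    using decseqD[OF singular_value_decseq[OF cS]] nn by (auto simp: b_def decseq_def intro!: add_mono)
  have "(\<lambda>j. singular_value S (2 * j)) \<longlonglongrightarrow> 0" "(\<lambda>j. singular_value S (2 * j + 1)) \<longlonglongrightarrow> 0"
    using LIMSEQ_subseq_LIMSEQ[OF singular_value_tendsto[OF cS], of "\<lambda>j. 2 * j"]
      LIMSEQ_subseq_LIMSEQ[OF singular_value_tendsto[OF cS], of "\<lambda>j. 2 * j + 1"]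
    by (auto simp: strict_mono_def comp_def)
  from tendsto_add[OF this] have b0: "b \<longlonglongrightarrow> 0"
    by (simp add: b_def[abs_def])
  have b_sum: "(\<Sum>j<n. b j) = (\<Sum>j<2 * n. singular_value S j)" for n
    by (induction n) (auto simp: b_def)
  define R where "R = real_diag_op e b"
  have svR: "singular_value R = b"
    unfolding R_def by (rule singular_value_diag_op[OF basis_orthonormal b b0])
  have posR: "positive_op R"
    unfolding R_def by (rule positive_diag_op[OF basis_orthonormal decseq_bounded_real(1)[OF b] b(2)])
  have R: "R \<in> L1_inf"
  proof (rule L1_infI)
    show "compact_op R"
      unfolding R_def by (rule compact_diag_op[OF basis_orthonormal b b0])
    show "(\<Sum>k<n. singular_value R k) \<le> (2 * C) * ln (1 + real n)" for n
    proof -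
      have "(\<Sum>k<n. singular_value R k) \<le> C * ln (1 + real (2 * n))"
        unfolding svR b_sum by (rule C(2))
      also have "\<dots> \<le> C * ln ((1 + real n)\<^sup>2)"
        using C(1) by (intro mult_left_mono ln_mono) (auto simp: power2_eq_square algebra_simps)
      also have "\<dots> = (2 * C) * ln (1 + real n)"
        by (simp add: ln_realpow)
      finally show ?thesis .
    qed
  qed
  have lmR: "log_mean R k = (\<Sum>j<2 * Suc k. singular_value S j) / ln (2 + real k)" for k
    unfolding log_mean_eq svR b_sum ..
  define L where "L k = ln (2 + real (k div 2))" for k
  have L: "0 < L k" for k
    by (simp add: L_def)
  define c where "c k = (C * ln 2 + singular_value S 0) / L k" for k
  have "LIM k sequentially. 1 / 2 * real k :> at_top"
    by (rule filterlim_tendsto_pos_mult_at_top[OF tendsto_const _ filterlim_real_sequentially]) simp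
  moreover have "\<And>k. 1 / 2 * real k \<le> 2 + real (k div 2)"
    by linarith
  then have "\<forall>\<^sub>F k in sequentially. 1 / 2 * real k \<le> 2 + real (k div 2)"
    by simp
  ultimately have "LIM k sequentially. 2 + real (k div 2) :> at_top"
    by (rule filterlim_at_top_mono)
  then have "filterlim L at_top sequentially"
    unfolding L_def[abs_def] by (rule filterlim_compose[OF ln_at_top])
  then have c0: "c \<longlonglongrightarrow> 0"
    unfolding c_def[abs_def] by (rule tendsto_divide_0[OF tendsto_const filterlim_at_top_imp_at_infinity])
  have "\<omega> (D2 (gamma_op R)) \<le> \<omega> (gamma_op S)"
  proof (rule DL2_le[OF \<omega>, where c = c])
    show "0 \<le> c k" for k
      using C(1) nn L[of k] by (auto simp: c_def less_imp_le)
    show "c \<longlonglongrightarrow> 0"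
      by (rule c0)
    fix k
    have "(\<Sum>j<2 * Suc (k div 2). singular_value S j) \<le> (\<Sum>j<Suc (Suc k). singular_value S j)"
      by (rule singular_value_sum_mono[OF cS]) simp
    also have "\<dots> = (\<Sum>j<Suc k. singular_value S j) + singular_value S (Suc k)"
      by simp
    also have "\<dots> \<le> (\<Sum>j<Suc k. singular_value S j) + singular_value S 0"
      using decseqD[OF singular_value_decseq[OF cS]] by simp
    finally have 1: "(\<Sum>j<2 * Suc (k div 2). singular_value S j) \<le> log_mean S k * ln (2 + real k) + singular_value S 0"
      by (simp add: log_mean_eq)
    have "real k \<le> real (2 * (k div 2) + 1)"
      unfolding of_nat_le_iff by arith
    then have "2 + real k \<le> 2 * (2 + real (k div 2))"
      by simp
    then have "ln (2 + real k) \<le> ln (2 * (2 + real (k div 2)))"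
      by (intro ln_mono) auto
    also have "\<dots> = ln 2 + L k"
      unfolding L_def by (rule ln_mult_pos) simp_all
    finally have "log_mean S k * ln (2 + real k) \<le> log_mean S k * (ln 2 + L k)"
      by (intro mult_left_mono log_mean_nonneg S)
    also have "log_mean S k * ln 2 \<le> C * ln 2"
      using C(2)[of "Suc k"] by (intro mult_right_mono) (auto simp: log_mean_eq divide_le_eq add.commute)
    then have "log_mean S k * (ln 2 + L k) \<le> log_mean S k * L k + C * ln 2"
      by (simp add: algebra_simps)
    finally have "(\<Sum>j<2 * Suc (k div 2). singular_value S j) \<le> log_mean S k * L k + (C * ln 2 + singular_value S 0)"
      using 1 by simp
    then have "(\<Sum>j<2 * Suc (k div 2). singular_value S j) / L k \<le>
        (log_mean S k * L k + (C * ln 2 + singular_value S 0)) / L k"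
      using L[of k] by (intro divide_right_mono) auto
    also have "\<dots> = log_mean S k + c k"
      using L[of k] by (simp add: c_def add_divide_distrib)
    finally show "apply_bcontfun (D2 (gamma_op R)) k \<le> apply_bcontfun (gamma_op S) k + c k"
      by (simp add: apply_D2 apply_gamma_op R S lmR L_def del: sum.lessThan_Suc)
  qed
  then have "omega_gamma \<omega> R \<le> omega_gamma \<omega> S"
    using DL2_D2[OF \<omega> R posR] by (simp add: omega_gamma_def)
  then show ?thesis
    using that R lmR by blast
qed

lemma omega_gamma_add:
  assumes \<omega>: "\<omega> \<in> DL2 TYPE('h)"
    and A: "A \<in> L1_inf" "positive_op A" and B: "B \<in> L1_inf" "positive_op B"
  shows "omega_gamma \<omega> (A + B) = omega_gamma \<omega> A + omega_gamma \<omega> B"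
proof (rule antisym)
  note cA = L1_inf_compact[OF A(1)] and cB = L1_inf_compact[OF B(1)]
  have AB: "A + B \<in> L1_inf"
    by (intro L1_inf_add_positive A B)
  have "\<omega> (gamma_op (A + B)) \<le> \<omega> (gamma_op A + gamma_op B)"
    using singular_value_sum_add_le[OF cA A(2) cB B(2)]
    by (intro DL2_le[OF \<omega>, where c = "\<lambda>_. 0"])
      (auto simp: apply_gamma_op A B AB log_mean_eq add_divide_distrib[symmetric]
        intro!: divide_right_mono simp del: sum.lessThan_Suc)
  then show "omega_gamma \<omega> (A + B) \<le> omega_gamma \<omega> A + omega_gamma \<omega> B"
    by (simp add: omega_gamma_def blinfun.add_right)
  obtain R where R: "R \<in> L1_inf"
    "\<And>k. log_mean R k = (\<Sum>j<2 * Suc k. singular_value (A + B) j) / ln (2 + real k)"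
    "omega_gamma \<omega> R \<le> omega_gamma \<omega> (A + B)"
    using omega_gamma_pair_sums[OF \<omega> AB] by blast
  have "\<omega> (gamma_op A + gamma_op B) \<le> \<omega> (gamma_op R)"
  proof (rule DL2_le[OF \<omega>, where c = "\<lambda>_. 0"])
    fix k
    have "log_mean A k + log_mean B k \<le> log_mean R k"
      unfolding R(2) unfolding log_mean_eq add_divide_distrib[symmetric]
      by (intro divide_right_mono singular_value_sum_add_ge cA A cB B) simp
    then show "apply_bcontfun (gamma_op A + gamma_op B) k \<le> apply_bcontfun (gamma_op R) k + 0"
      by (simp add: apply_gamma_op A B R(1))
  qed auto
  then show "omega_gamma \<omega> A + omega_gamma \<omega> B \<le> omega_gamma \<omega> (A + B)"
    using R(3) by (simp add: omega_gamma_def blinfun.add_right)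
qed

definition pos_L1_inf :: "'h op set" where
  "pos_L1_inf = {P. P \<in> L1_inf \<and> positive_op P}"

definition combination :: "'h op \<Rightarrow> 'h op \<Rightarrow> 'h op \<Rightarrow> 'h op \<Rightarrow> 'h op" where
  "combination P Q P' Q' = P - Q + scale_op \<i> (P' - Q')"

end

lemma scale_op_add_right: "scale_op c (S + T) = scale_op c S + scale_op c T"
  by (rule blinfun_eqI) (simp add: scale_op.rep_eq blinfun.add_left scaleC_add_right)

lemma scale_op_diff_right: "scale_op c (S - T) = scale_op c S - scale_op c T"
  by (rule blinfun_eqI) (simp add: scale_op.rep_eq blinfun.diff_left scaleC.diff_right)

lemma scale_op_add_left: "scale_op (a + b) T = scale_op a T + scale_op b T"
  by (rule blinfun_eqI) (simp add: scale_op.rep_eq blinfun.add_left scaleC_add_left)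

lemma scale_op_scale_op: "scale_op a (scale_op b T) = scale_op (a * b) T"
  by (rule blinfun_eqI) (simp add: scale_op.rep_eq scaleC_scaleC)

lemma scale_op_of_real: "scale_op (complex_of_real r) T = r *\<^sub>R T"
  by (rule blinfun_eqI) (simp add: scale_op.rep_eq blinfun.scaleR_left scaleR_scaleC)

lemma scale_op_zero_right [simp]: "scale_op c 0 = 0"
  by (rule blinfun_eqI) (simp add: scale_op.rep_eq)

lemma scale_op_scaleR: "scale_op c (r *\<^sub>R T) = r *\<^sub>R scale_op c T"
  unfolding scale_op_of_real[symmetric] scale_op_scale_op by (simp add: mult.commute)

context hilbert_basis
begin

lemma zero_pos_L1_inf [simp]: "0 \<in> pos_L1_inf"
proof -
  have b: "decseq (\<lambda>_ :: nat. 0 :: real)" "\<And>k :: nat. (0 :: real) \<le> 0" "(\<lambda>_ :: nat. 0 :: real) \<longlonglongrightarrow> 0"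
    by (auto simp: decseq_def)
  have 0: "(0 :: 'h op) = real_diag_op e (\<lambda>_. 0)"
    by (rule op_eq_diag_op) (auto simp: complex_linear_def)
  have "compact_op (0 :: 'h op)" "singular_value (0 :: 'h op) = (\<lambda>_. 0)" "positive_op (0 :: 'h op)"
    unfolding 0
    by (rule compact_diag_op[OF basis_orthonormal b] singular_value_diag_op[OF basis_orthonormal b]
      positive_diag_op[OF basis_orthonormal decseq_bounded_real(1)[OF b(1,2)] b(2)])+
  then show ?thesis
    by (auto simp: pos_L1_inf_def intro!: L1_infI[where C = 0])
qed

lemma pos_L1_inf_add: "P \<in> pos_L1_inf \<Longrightarrow> Q \<in> pos_L1_inf \<Longrightarrow> P + Q \<in> pos_L1_inf"
  by (simp add: pos_L1_inf_def L1_inf_add_positive positive_op_add)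

lemma pos_L1_inf_scale: "P \<in> pos_L1_inf \<Longrightarrow> 0 \<le> r \<Longrightarrow> r *\<^sub>R P \<in> pos_L1_inf"
  by (simp add: pos_L1_inf_def L1_inf_scale_positive positive_op_scale flip: scale_op_of_real)

lemma combination_L1_inf:
  assumes P: "P \<in> pos_L1_inf" "Q \<in> pos_L1_inf" "P' \<in> pos_L1_inf" "Q' \<in> pos_L1_inf"
  shows "combination P Q P' Q' \<in> L1_inf"
proof (rule L1_inf_form_le)
  have comp: "compact_op S" if "S \<in> pos_L1_inf" for S
    using that by (simp add: pos_L1_inf_def L1_inf_compact)
  have diff: "compact_op (S - T)" if "compact_op S" "compact_op T" for S T :: "'h op"
  proof -
    have "S - T = S + scale_op (complex_of_real (- 1)) T"
      unfolding scale_op_of_real by simp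
    then show ?thesis
      using that compact_op_add compact_op_scale by metis
  qed
  show "compact_op (combination P Q P' Q')"
    unfolding combination_def by (intro compact_op_add compact_op_scale diff comp P)
  have sum: "P + Q + P' + Q' \<in> pos_L1_inf"
    by (intro pos_L1_inf_add P)
  then show "P + Q + P' + Q' \<in> L1_inf" "positive_op (P + Q + P' + Q')"
    by (simp_all add: pos_L1_inf_def)
  fix x y
  have *: "cmod (cinner y (S x)) \<le> (Re (cinner x (S x)) + Re (cinner y (S y))) / 2" if S: "S \<in> pos_L1_inf" for S
  proof (rule power2_le_imp_le)
    let ?a = "Re (cinner x (S x))" and ?b = "Re (cinner y (S y))"
    have pos: "positive_op S"
      using S by (simp add: pos_L1_inf_def)
    have "(cmod (cinner y (S x)))\<^sup>2 \<le> ?b * ?a"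
      by (rule positive_op_cauchy_schwarz[OF pos])
    also have "\<dots> \<le> ((?a + ?b) / 2)\<^sup>2"
      using zero_le_power2[of "?a - ?b"] by (simp add: power2_eq_square algebra_simps)
    finally show "(cmod (cinner y (S x)))\<^sup>2 \<le> ((?a + ?b) / 2)\<^sup>2" .
    show "0 \<le> (?a + ?b) / 2"
      using positive_op_form_nonneg[OF pos] by simp
  qed
  have "Re (cinner y (combination P Q P' Q' x)) =
      Re (cinner y (P x)) - Re (cinner y (Q x)) - (Im (cinner y (P' x)) - Im (cinner y (Q' x)))"
    by (simp add: combination_def blinfun.add_left blinfun.diff_left scale_op.rep_eq cinner_add_right
      cinner.diff_right cinner_scaleC_right)
  also have "\<dots> \<le> cmod (cinner y (P x)) + cmod (cinner y (Q x)) + cmod (cinner y (P' x)) + cmod (cinner y (Q' x))"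
    using abs_Re_le_cmod[of "cinner y (P x)"] abs_Re_le_cmod[of "cinner y (Q x)"]
      abs_Im_le_cmod[of "cinner y (P' x)"] abs_Im_le_cmod[of "cinner y (Q' x)"] by linarith
  also have "\<dots> \<le> (Re (cinner x ((P + Q + P' + Q') x)) + Re (cinner y ((P + Q + P' + Q') y))) / 2"
    using *[OF P(1)] *[OF P(2)] *[OF P(3)] *[OF P(4)]
    by (simp add: blinfun.add_left cinner_add_right)
  finally show "Re (cinner y (combination P Q P' Q' x)) \<le>
      (Re (cinner x ((P + Q + P' + Q') x)) + Re (cinner y ((P + Q + P' + Q') y))) / 2" .
qed

lemma combination_add:
  "combination P Q P' Q' + combination R S R' S' = combination (P + R) (Q + S) (P' + R') (Q' + S')"
  by (simp add: combination_def scale_op_diff_right scale_op_add_right)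

lemma combination_scaleR: "r *\<^sub>R combination P Q P' Q' = combination (r *\<^sub>R P) (r *\<^sub>R Q) (r *\<^sub>R P') (r *\<^sub>R Q')"
  by (simp add: combination_def scale_op_diff_right scale_op_scaleR algebra_simps)

lemma combination_minus: "- combination P Q P' Q' = combination Q P Q' P'"
  by (simp add: combination_def scale_op_diff_right)

lemma combination_eq_omega_gamma:
  assumes \<omega>: "\<omega> \<in> DL2 TYPE('h)"
    and P: "P \<in> pos_L1_inf" "Q \<in> pos_L1_inf" "P' \<in> pos_L1_inf" "Q' \<in> pos_L1_inf"
    and R: "R \<in> pos_L1_inf" "S \<in> pos_L1_inf" "R' \<in> pos_L1_inf" "S' \<in> pos_L1_inf"
    and eq: "combination P Q P' Q' = combination R S R' S'"
  shows "omega_gamma \<omega> P - omega_gamma \<omega> Q = omega_gamma \<omega> R - omega_gamma \<omega> S"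
proof -
  have real: "Im (cinner x (V x)) = 0" if "V \<in> pos_L1_inf" for V x
    using that by (simp add: pos_L1_inf_def positive_op_def complex_nonneg_Reals_iff)
  have Re: "Re (cinner x (combination V W V' W' x)) = Re (cinner x (V x)) - Re (cinner x (W x))"
    if "V' \<in> pos_L1_inf" "W' \<in> pos_L1_inf" for V W V' W' x
    using real[OF that(1)] real[OF that(2)]
    by (simp add: combination_def blinfun.add_left blinfun.diff_left scale_op.rep_eq cinner_add_right
      cinner.diff_right cinner_scaleC_right)
  have form: "Re (cinner x (P x)) - Re (cinner x (Q x)) = Re (cinner x (R x)) - Re (cinner x (S x))" for x
    using Re[OF P(3,4), of x P Q] Re[OF R(3,4), of x R S] by (simp add: eq)
  have "P + S = R + Q"
  proof (rule form_eq_imp_eq)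
    show "complex_linear (P + S)" "complex_linear (R + Q)"
      using P R by (auto simp: pos_L1_inf_def intro!: positive_op_complex_linear positive_op_add)
    show "cinner x ((P + S) x) = cinner x ((R + Q) x)" for x
      using form[of x] real P R by (simp add: complex_eq_iff blinfun.add_left cinner_add_right)
  qed
  then have "omega_gamma \<omega> P + omega_gamma \<omega> S = omega_gamma \<omega> R + omega_gamma \<omega> Q"
    using omega_gamma_add[OF \<omega>, of P S] omega_gamma_add[OF \<omega>, of R Q] P R by (simp add: pos_L1_inf_def)
  then show ?thesis by simp
qed

text \<open>A complex linear functional is determined by its real part \<open>F\<close>. On the complex span of the positive
  operators \<open>F\<close> is forced; composing it with a linear projection onto that span makes it total.\<close>

lemma dixmier_trace_exists:
  assumes \<omega>: "\<omega> \<in> DL2 TYPE('h)"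
  shows "\<exists>\<tau> :: 'h op \<Rightarrow> complex. (\<forall>S\<in>L1_inf. \<forall>T\<in>L1_inf. \<tau> (S + T) = \<tau> S + \<tau> T) \<and>
     (\<forall>c. \<forall>T\<in>L1_inf. \<tau> (scale_op c T) = c * \<tau> T) \<and>
     (\<forall>T\<in>L1_inf. positive_op T \<longrightarrow> \<tau> T = complex_of_real (\<omega> (gamma_op T)))"
proof -
  define D where "D = {combination P Q P' Q' | P Q P' Q'.
    P \<in> pos_L1_inf \<and> Q \<in> pos_L1_inf \<and> P' \<in> pos_L1_inf \<and> Q' \<in> pos_L1_inf}"
  define F0 where "F0 T = (SOME r. \<exists>P Q P' Q'. P \<in> pos_L1_inf \<and> Q \<in> pos_L1_inf \<and> P' \<in> pos_L1_inf \<and>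
    Q' \<in> pos_L1_inf \<and> T = combination P Q P' Q' \<and> r = omega_gamma \<omega> P - omega_gamma \<omega> Q)" for T
  have F0: "F0 (combination P Q P' Q') = omega_gamma \<omega> P - omega_gamma \<omega> Q"
    if P: "P \<in> pos_L1_inf" "Q \<in> pos_L1_inf" "P' \<in> pos_L1_inf" "Q' \<in> pos_L1_inf" for P Q P' Q'
    unfolding F0_def
  proof (rule some_equality, goal_cases)
    case 1
    show ?case
      using P by blast
  next
    case (2 r)
    then obtain R S R' S' where R: "R \<in> pos_L1_inf" "S \<in> pos_L1_inf" "R' \<in> pos_L1_inf" "S' \<in> pos_L1_inf"
      "combination P Q P' Q' = combination R S R' S'" "r = omega_gamma \<omega> R - omega_gamma \<omega> S"
      by blast
    then show ?case
      using combination_eq_omega_gamma[OF \<omega> P R(1-5)] by simp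
  qed
  have D_add: "S + T \<in> D" "F0 (S + T) = F0 S + F0 T" if ST: "S \<in> D" "T \<in> D" for S T
  proof -
    obtain P Q P' Q' where P: "P \<in> pos_L1_inf" "Q \<in> pos_L1_inf" "P' \<in> pos_L1_inf" "Q' \<in> pos_L1_inf"
      "S = combination P Q P' Q'"
      using ST(1) by (auto simp: D_def)
    obtain R V R' V' where R: "R \<in> pos_L1_inf" "V \<in> pos_L1_inf" "R' \<in> pos_L1_inf" "V' \<in> pos_L1_inf"
      "T = combination R V R' V'"
      using ST(2) by (auto simp: D_def)
    show "S + T \<in> D"
      using P R pos_L1_inf_add unfolding D_def combination_add P(5) R(5) by blast
    show "F0 (S + T) = F0 S + F0 T"
      using P R omega_gamma_add[OF \<omega>, of P R] omega_gamma_add[OF \<omega>, of Q V]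
      by (simp add: F0 combination_add pos_L1_inf_add) (simp add: pos_L1_inf_def)
  qed
  have D_scale: "r *\<^sub>R T \<in> D" "F0 (r *\<^sub>R T) = r * F0 T" if T: "T \<in> D" for r T
  proof -
    obtain P Q P' Q' where P: "P \<in> pos_L1_inf" "Q \<in> pos_L1_inf" "P' \<in> pos_L1_inf" "Q' \<in> pos_L1_inf"
      "T = combination P Q P' Q'"
      using T by (auto simp: D_def)
    have sc: "omega_gamma \<omega> (\<bar>r\<bar> *\<^sub>R P) = \<bar>r\<bar> * omega_gamma \<omega> P" if "P \<in> pos_L1_inf" for P
      using omega_gamma_scale[of P "\<bar>r\<bar>" \<omega>] that by (simp add: pos_L1_inf_def scale_op_of_real)
    have sP: "\<bar>r\<bar> *\<^sub>R P \<in> pos_L1_inf" if "P \<in> pos_L1_inf" for P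
      using that by (rule pos_L1_inf_scale) simp
    have *: "r *\<^sub>R T = (if 0 \<le> r then combination (\<bar>r\<bar> *\<^sub>R P) (\<bar>r\<bar> *\<^sub>R Q) (\<bar>r\<bar> *\<^sub>R P') (\<bar>r\<bar> *\<^sub>R Q')
        else combination (\<bar>r\<bar> *\<^sub>R Q) (\<bar>r\<bar> *\<^sub>R P) (\<bar>r\<bar> *\<^sub>R Q') (\<bar>r\<bar> *\<^sub>R P'))"
    proof (cases "0 \<le> r")
      case False
      then have "r *\<^sub>R T = \<bar>r\<bar> *\<^sub>R (- T)"
        by simp
      also have "\<dots> = combination (\<bar>r\<bar> *\<^sub>R Q) (\<bar>r\<bar> *\<^sub>R P) (\<bar>r\<bar> *\<^sub>R Q') (\<bar>r\<bar> *\<^sub>R P')"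
        by (simp only: P(5) combination_minus combination_scaleR)
      finally show ?thesis
        using False by simp
    qed (simp add: P(5) combination_scaleR)
    have D: "combination A B A' B' \<in> D"
      if "A \<in> pos_L1_inf" "B \<in> pos_L1_inf" "A' \<in> pos_L1_inf" "B' \<in> pos_L1_inf" for A B A' B'
      unfolding D_def using that by blast
    show "r *\<^sub>R T \<in> D"
    proof (cases "0 \<le> r")
      case True
      have "combination (\<bar>r\<bar> *\<^sub>R P) (\<bar>r\<bar> *\<^sub>R Q) (\<bar>r\<bar> *\<^sub>R P') (\<bar>r\<bar> *\<^sub>R Q') \<in> D"
        by (intro D sP P(1-4))
      then show ?thesis
        using True by (simp only: * if_True)
    next
      case False
      have "combination (\<bar>r\<bar> *\<^sub>R Q) (\<bar>r\<bar> *\<^sub>R P) (\<bar>r\<bar> *\<^sub>R Q') (\<bar>r\<bar> *\<^sub>R P') \<in> D"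
        by (intro D sP P(1-4))
      then show ?thesis
        using False by (simp only: * if_False)
    qed
    show "F0 (r *\<^sub>R T) = r * F0 T"
    proof (cases "0 \<le> r")
      case True
      then have "F0 (r *\<^sub>R T) = F0 (combination (\<bar>r\<bar> *\<^sub>R P) (\<bar>r\<bar> *\<^sub>R Q) (\<bar>r\<bar> *\<^sub>R P') (\<bar>r\<bar> *\<^sub>R Q'))"
        by (simp only: * if_True)
      also have "\<dots> = \<bar>r\<bar> * omega_gamma \<omega> P - \<bar>r\<bar> * omega_gamma \<omega> Q"
        by (simp only: F0 sP sc P(1-4))
      also have "\<dots> = r * F0 T"
        using True by (simp add: P(5) F0[OF P(1-4)] right_diff_distrib)
      finally show ?thesis .
    next
      case False
      then have "F0 (r *\<^sub>R T) = F0 (combination (\<bar>r\<bar> *\<^sub>R Q) (\<bar>r\<bar> *\<^sub>R P) (\<bar>r\<bar> *\<^sub>R Q') (\<bar>r\<bar> *\<^sub>R P'))"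
        by (simp only: * if_False)
      also have "\<dots> = \<bar>r\<bar> * omega_gamma \<omega> Q - \<bar>r\<bar> * omega_gamma \<omega> P"
        by (simp only: F0 sP sc P(1-4))
      also have "\<dots> = r * F0 T"
        using False by (simp add: P(5) F0[OF P(1-4)] right_diff_distrib)
      finally show ?thesis .
    qed
  qed
  have "0 \<in> D"
    unfolding D_def mem_Collect_eq by (intro exI[of _ 0]) (simp add: combination_def)
  then have "subspace D"
    using D_add D_scale by (simp add: subspace_def)
  then obtain g where g: "range g \<subseteq> D" "linear g" "\<And>T. T \<in> D \<Longrightarrow> g T = T"
    using linear_exists_left_inverse_on[OF linear_id, of D] by auto
  have gD: "g T \<in> D" for T
    using g(1) by auto
  define F where "F T = F0 (g T)" for T
  have F_add: "F (S + T) = F S + F T" for S T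
    using gD by (simp add: F_def linear_add[OF g(2)] D_add)
  have F_scale: "F (r *\<^sub>R T) = r * F T" for r T
    using gD by (simp add: F_def linear_scale[OF g(2)] D_scale)
  define \<tau> where "\<tau> T = complex_of_real (F T) - \<i> * complex_of_real (F (scale_op \<i> T))" for T
  have "\<tau> (S + T) = \<tau> S + \<tau> T" for S T
    by (simp add: \<tau>_def F_add scale_op_add_right algebra_simps)
  moreover have "\<tau> (scale_op c T) = c * \<tau> T" for c T
  proof -
    have c: "c = complex_of_real (Re c) + complex_of_real (Im c) * \<i>"
      by (simp add: complex_eq_iff)
    have 1: "scale_op c T = Re c *\<^sub>R T + Im c *\<^sub>R scale_op \<i> T"
      by (subst c) (simp only: scale_op_add_left scale_op_scale_op[symmetric] scale_op_of_real)
    have "scale_op \<i> (scale_op \<i> T) = (- 1) *\<^sub>R T"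
      by (simp only: scale_op_scale_op scale_op_of_real[symmetric]) simp
    then have 2: "scale_op \<i> (scale_op c T) = Re c *\<^sub>R scale_op \<i> T + Im c *\<^sub>R ((- 1) *\<^sub>R T)"
      by (simp only: 1 scale_op_add_right scale_op_scaleR)
    show ?thesis
      unfolding \<tau>_def 2 unfolding 1 F_add F_scale by (simp add: complex_eq_iff algebra_simps)
  qed
  moreover have "\<tau> P = complex_of_real (\<omega> (gamma_op P))" if "P \<in> L1_inf" "positive_op P" for P
  proof -
    have P: "P \<in> pos_L1_inf"
      using that by (simp add: pos_L1_inf_def)
    have "P = combination P 0 0 0" "scale_op \<i> P = combination 0 0 P 0"
      by (simp_all add: combination_def)
    moreover have "combination P 0 0 0 \<in> D" "combination 0 0 P 0 \<in> D"
      unfolding D_def using P zero_pos_L1_inf by blast+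
    moreover have "omega_gamma \<omega> 0 = 0"
      using omega_gamma_scale[of 0 0 \<omega>] zero_pos_L1_inf by (simp add: pos_L1_inf_def)
    ultimately have "F P = omega_gamma \<omega> P" "F (scale_op \<i> P) = 0"
      using P F0[of P 0 0 0] F0[of 0 0 P 0] g(3) by (simp_all add: F_def)
    then show ?thesis
      by (simp add: \<tau>_def omega_gamma_def)
  qed
  ultimately show ?thesis
    by blast
qed

lemma
  assumes \<omega>: "\<omega> \<in> DL2 TYPE('h)"
  shows dixmier_trace_add: "S \<in> L1_inf \<Longrightarrow> T \<in> L1_inf \<Longrightarrow>
      dixmier_trace \<omega> (S + T) = dixmier_trace \<omega> S + dixmier_trace \<omega> (T :: 'h op)"
    and dixmier_trace_scale: "T \<in> L1_inf \<Longrightarrow> dixmier_trace \<omega> (scale_op c T) = c * dixmier_trace \<omega> T"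
    and dixmier_trace_positive: "T \<in> L1_inf \<Longrightarrow> positive_op T \<Longrightarrow> dixmier_trace \<omega> T = complex_of_real (omega_gamma \<omega> T)"
proof -
  have "(\<forall>S\<in>L1_inf. \<forall>T\<in>L1_inf. dixmier_trace \<omega> (S + T) = dixmier_trace \<omega> S + dixmier_trace \<omega> (T :: 'h op)) \<and>
     (\<forall>c. \<forall>T\<in>L1_inf. dixmier_trace \<omega> (scale_op c T) = c * dixmier_trace \<omega> (T :: 'h op)) \<and>
     (\<forall>T\<in>L1_inf. positive_op T \<longrightarrow> dixmier_trace \<omega> (T :: 'h op) = complex_of_real (\<omega> (gamma_op T)))"
    unfolding dixmier_trace_def by (rule someI_ex[OF dixmier_trace_exists[OF \<omega>]])
  then show "S \<in> L1_inf \<Longrightarrow> T \<in> L1_inf \<Longrightarrow>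
      dixmier_trace \<omega> (S + T) = dixmier_trace \<omega> S + dixmier_trace \<omega> (T :: 'h op)"
    and "T \<in> L1_inf \<Longrightarrow> dixmier_trace \<omega> (scale_op c T) = c * dixmier_trace \<omega> T"
    and "T \<in> L1_inf \<Longrightarrow> positive_op T \<Longrightarrow> dixmier_trace \<omega> T = complex_of_real (omega_gamma \<omega> T)"
    by (simp_all add: omega_gamma_def)
qed

lemma dixmier_trace_combination:
  assumes \<omega>: "\<omega> \<in> DL2 TYPE('h)"
    and P: "P \<in> pos_L1_inf" "Q \<in> pos_L1_inf" "P' \<in> pos_L1_inf" "Q' \<in> pos_L1_inf"
  shows "dixmier_trace \<omega> (combination P Q P' Q') =
    complex_of_real (omega_gamma \<omega> P - omega_gamma \<omega> Q) + \<i> * complex_of_real (omega_gamma \<omega> P' - omega_gamma \<omega> Q')"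
proof -
  have minus: "scale_op (- 1) T = - T" for T :: "'h op"
    using scale_op_of_real[of "- 1" T] by simp
  have pos: "dixmier_trace \<omega> P = complex_of_real (omega_gamma \<omega> P)" if "P \<in> pos_L1_inf" for P
    using dixmier_trace_positive[OF \<omega>] that by (simp add: pos_L1_inf_def)
  have diff: "dixmier_trace \<omega> (P - Q) = complex_of_real (omega_gamma \<omega> P - omega_gamma \<omega> Q)" "P - Q \<in> L1_inf"
    if P: "P \<in> pos_L1_inf" "Q \<in> pos_L1_inf" for P Q
  proof -
    have Q: "scale_op (- 1) Q \<in> L1_inf"
      using combination_L1_inf[OF zero_pos_L1_inf P(2) zero_pos_L1_inf zero_pos_L1_inf]
      by (simp add: combination_def minus)
    have "dixmier_trace \<omega> (P + scale_op (- 1) Q) = dixmier_trace \<omega> P + dixmier_trace \<omega> (scale_op (- 1) Q)"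
      using P Q by (intro dixmier_trace_add[OF \<omega>]) (auto simp: pos_L1_inf_def)
    also have "dixmier_trace \<omega> (scale_op (- 1) Q) = - 1 * dixmier_trace \<omega> Q"
      using P by (intro dixmier_trace_scale[OF \<omega>]) (simp add: pos_L1_inf_def)
    finally show "dixmier_trace \<omega> (P - Q) = complex_of_real (omega_gamma \<omega> P - omega_gamma \<omega> Q)"
      using P by (simp add: minus pos)
    show "P - Q \<in> L1_inf"
      using combination_L1_inf[OF P zero_pos_L1_inf zero_pos_L1_inf] by (simp add: combination_def)
  qed
  have "scale_op \<i> (P' - Q') \<in> L1_inf"
    using combination_L1_inf[OF zero_pos_L1_inf zero_pos_L1_inf P(3,4)] by (simp add: combination_def)
  then show ?thesis
    unfolding combination_def
    using dixmier_trace_add[OF \<omega> diff(2)[OF P(1,2)]] dixmier_trace_scale[OF \<omega> diff(2)[OF P(3,4)], of \<i>]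
      diff(1)[OF P(1,2)] diff(1)[OF P(3,4)] by simp
qed

end

section \<open>Integration on the torus\<close>

abbreviation torus_cube :: "(real ^ 'n) set" where
  "torus_cube \<equiv> {x. \<forall>i. 0 \<le> x $ i \<and> x $ i < 2 * pi}"

lemma torus_cube_sets [measurable]: "(torus_cube :: (real ^ 'n) set) \<in> sets borel"
  by measurable

lemma torus_cube_subset: "(torus_cube :: (real ^ 'n) set) \<subseteq> cbox 0 (\<chi> i. 2 * pi)"
  by (auto simp: mem_box_cart less_imp_le)

lemma emeasure_torus_cube:
  "emeasure lborel (torus_cube :: (real ^ 'n) set) \<noteq> 0" "emeasure lborel (torus_cube :: (real ^ 'n) set) \<noteq> \<infinity>"
proof -
  let ?u = "(\<chi> i. 2 * pi) :: real ^ 'n"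
  have u: "?u \<bullet> b = 2 * pi" if "b \<in> Basis" for b
    using that by (auto simp: Basis_vec_def inner_axis)
  have "emeasure lborel (box 0 ?u) = (\<Prod>b\<in>Basis. (?u - 0) \<bullet> b)"
    using u by (intro emeasure_lborel_box) simp
  also have "(\<Prod>b\<in>Basis. (?u - 0) \<bullet> b) = (\<Prod>b\<in>(Basis :: (real ^ 'n) set). 2 * pi)"
    using u by (intro prod.cong) auto
  finally have box: "emeasure lborel (box 0 ?u) = ennreal (\<Prod>b\<in>(Basis :: (real ^ 'n) set). 2 * pi)" .
  have "0 < (\<Prod>b\<in>(Basis :: (real ^ 'n) set). 2 * pi)"
    by (intro prod_pos) simp
  then have "0 < emeasure lborel (box 0 ?u)"
    unfolding box by (simp only: ennreal_less_zero_iff)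
  also have "\<dots> \<le> emeasure lborel (torus_cube :: (real ^ 'n) set)"
    by (intro emeasure_mono) (auto simp: mem_box_cart less_imp_le)
  finally show "emeasure lborel (torus_cube :: (real ^ 'n) set) \<noteq> 0"
    by simp
  have "emeasure lborel (torus_cube :: (real ^ 'n) set) \<le> emeasure lborel (cbox 0 ?u)"
    by (intro emeasure_mono torus_cube_subset) auto
  also have "\<dots> < \<infinity>"
    by (simp add: emeasure_lborel_cbox_eq)
  finally show "emeasure lborel (torus_cube :: (real ^ 'n) set) \<noteq> \<infinity>"
    by simp
qed

lemma emeasure_torus_UNIV: "emeasure torus_measure (UNIV :: (real ^ 'n) set) = 1"
  using emeasure_torus_cube[where 'n = 'n] by (simp add: torus_measure_def ennreal_divide_self less_top)

interpretation torus_measure: finite_measure "torus_measure :: (real ^ 'n) measure" for dummy :: "'n::finite"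
  by (rule finite_measure_torus)

lemma AE_torusI:
  assumes "\<And>x :: real ^ 'n. x \<in> torus_cube \<Longrightarrow> P x"
  shows "AE x in torus_measure. P x"
  unfolding torus_measure_def using assms by (intro AE_uniform_measureI) auto

lemma integral_torus:
  fixes f :: "real ^ 'n \<Rightarrow> 'b::{banach, second_countable_topology}"
  assumes f: "f \<in> borel_measurable borel"
  shows "(LINT x|torus_measure. f x) = (1 / measure lborel (torus_cube :: (real ^ 'n) set)) *\<^sub>R (LINT x:torus_cube|lborel. f x)"
proof -
  let ?C = "torus_cube :: (real ^ 'n) set"
  define V where "V = measure lborel ?C"
  have V1: "emeasure lborel ?C = ennreal V"
    unfolding V_def using emeasure_torus_cube(2)[where 'n = 'n] by (intro emeasure_eq_ennreal_measure) simp
  then have "V \<noteq> 0"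
    using emeasure_torus_cube(1)[where 'n = 'n] by (metis ennreal_0)
  then have V: "emeasure lborel ?C = ennreal V" "0 < V"
    using V1 measure_nonneg[of lborel ?C] by (auto simp: V_def less_le)
  have "1 / ennreal V = ennreal (1 / V)"
    using divide_ennreal[of 1 V] V(2) by simp
  then have "torus_measure = density lborel (\<lambda>x. ennreal (indicator ?C x / V))"
    unfolding torus_measure_def uniform_measure_def V(1) using V(2)
    by (intro density_cong) (auto simp: indicator_def)
  then have "(LINT x|torus_measure. f x) = (LINT x|density lborel (\<lambda>x. ennreal (indicator ?C x / V)). f x)"
    by simp
  also have "\<dots> = (LINT x|lborel. (indicator ?C x / V) *\<^sub>R f x)"
    using f V(2) by (intro integral_density) auto
  also have "\<dots> = (LINT x|lborel. (1 / V) *\<^sub>R (indicator ?C x *\<^sub>R f x))"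
    by (intro Bochner_Integration.integral_cong) auto
  also have "\<dots> = (1 / V) *\<^sub>R (LINT x|lborel. indicator ?C x *\<^sub>R f x)"
    by (rule integral_scaleR_right) 
  finally show ?thesis
    by (simp add: V_def set_lebesgue_integral_def)
qed

lemma integrable_torus_continuous:
  fixes f :: "real ^ 'n \<Rightarrow> 'b::{banach, second_countable_topology}"
  assumes f: "continuous_on UNIV f"
  shows "integrable torus_measure f"
proof -
  have "compact (f ` cbox 0 (\<chi> i. 2 * pi))"
    by (intro compact_continuous_image continuous_on_subset[OF f]) auto
  from compact_imp_bounded[OF this]
  obtain B where B: "\<And>x. x \<in> cbox 0 (\<chi> i. 2 * pi) \<Longrightarrow> norm (f x) \<le> B"
    unfolding bounded_iff by blast
  show ?thesis
  proof (rule torus_measure.integrable_const_bound[where B = B])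
    show "AE x in torus_measure. norm (f x) \<le> B"
      using torus_cube_subset by (intro AE_torusI B) blast
    show "f \<in> borel_measurable torus_measure"
      using borel_measurable_continuous_onI[OF f] by simp
  qed
qed

lemma square_integrable_continuous: "continuous_on UNIV u \<Longrightarrow> square_integrable u"
  using borel_measurable_continuous_onI[of u]
  by (auto simp: square_integrable_def intro!: integrable_torus_continuous continuous_intros)

lemma lborel_integral_translate:
  fixes g :: "'a::euclidean_space \<Rightarrow> 'b::{banach, second_countable_topology}"
  assumes "g \<in> borel_measurable borel"
  shows "(LINT x|lborel. g (c + x)) = (LINT x|lborel. g x)"
proof -
  have "(LINT x|lborel. g x) = (LINT x|distr lborel borel ((+) c). g x)"
    by (simp add: lborel_distr_plus)
  also have "\<dots> = (LINT x|lborel. g (c + x))"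
    using assms by (intro integral_distr) auto
  finally show ?thesis ..
qed

text \<open>The part of the translated cube that leaves the cube is a translate by a period of the
  missing part of the cube.\<close>

lemma torus_shift:
  fixes w :: "real ^ 'n \<Rightarrow> complex"
  assumes w: "continuous_on UNIV w" and per: "\<And>x. w (x + axis i (2 * pi)) = w x" and h: "0 \<le> h" "h \<le> 2 * pi"
  shows "(LINT x|torus_measure. w (x + axis i h)) = (LINT x|torus_measure. w x)"
proof -
  let ?C = "torus_cube :: (real ^ 'n) set"
  let ?K = "cbox 0 (\<chi> i. 4 * pi) :: (real ^ 'n) set"
  define A1 where "A1 = {x \<in> ?C. h \<le> x $ i}"
  define A2 where "A2 = {x \<in> ?C. x $ i < h}"
  define A3 where "A3 = {y. y - axis i (2 * pi) \<in> A2}"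
  define C' where "C' = {y. y - axis i h \<in> ?C}"
  have [measurable]: "w \<in> borel_measurable borel"
    by (rule borel_measurable_continuous_onI[OF w])
  have meas [measurable]: "A1 \<in> sets borel" "A2 \<in> sets borel" "A3 \<in> sets borel" "C' \<in> sets borel"
    by (simp_all add: A1_def A2_def A3_def C'_def)
  have ax: "axis i c $ j = (if j = i then c else 0)" for c :: real and j
    by (simp add: axis_def)
  have C': "C' = A1 \<union> A3"
  proof (intro set_eqI iffI)
    fix y assume y: "y \<in> C'"
    show "y \<in> A1 \<union> A3"
    proof (cases "y $ i < 2 * pi")
      case True
      then have "y \<in> A1"
        using y h unfolding A1_def C'_def by (auto simp: ax) (smt (verit))+
      then show ?thesis by simp
    next
      case False
      then have "y \<in> A3"
        using y h unfolding A3_def A2_def C'_def by (auto simp: ax) (smt (verit))+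
      then show ?thesis by simp
    qed
  next
    fix y assume "y \<in> A1 \<union> A3"
    then show "y \<in> C'"
      using h unfolding A1_def A2_def A3_def C'_def by (auto simp: ax) (smt (verit))+
  qed
  have disj: "A1 \<inter> A3 = {}"
    unfolding A1_def A2_def A3_def by (auto simp: ax) (smt (verit))
  have C: "?C = A1 \<union> A2" "A1 \<inter> A2 = {}"
    by (auto simp: A1_def A2_def)
  have K: "set_integrable lborel ?K w"
    unfolding set_integrable_def
    by (intro borel_integrable_compact continuous_on_subset[OF w]) auto
  have "A3 \<subseteq> ?K"
  proof
    fix y assume "y \<in> A3"
    then have y: "0 \<le> y $ j - (if j = i then 2 * pi else 0)" "y $ j - (if j = i then 2 * pi else 0) < 2 * pi" for j
      by (auto simp: A3_def A2_def ax dest!: spec[of _ j])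
    have "0 \<le> y $ j" "y $ j \<le> 4 * pi" for j
      using y[of j] pi_gt_zero by (auto split: if_splits)
    then show "y \<in> ?K"
      by (auto simp: mem_box_cart)
  qed
  moreover have "A1 \<subseteq> ?K" "A2 \<subseteq> ?K"
    using pi_gt_zero by (auto simp: A1_def A2_def mem_box_cart) (smt (verit))+
  ultimately have int: "set_integrable lborel A1 w" "set_integrable lborel A2 w" "set_integrable lborel A3 w"
    by (auto intro!: set_integrable_subset[OF K])
  have "(LINT x:?C|lborel. w (x + axis i h)) = (LINT x|lborel. indicator C' (axis i h + x) *\<^sub>R w (axis i h + x))"
    unfolding set_lebesgue_integral_def
    by (intro Bochner_Integration.integral_cong) (auto simp: C'_def indicator_def add.commute)
  also have "\<dots> = (LINT x:C'|lborel. w x)"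
    unfolding set_lebesgue_integral_def by (rule lborel_integral_translate) measurable
  also have "\<dots> = (LINT x:A1|lborel. w x) + (LINT x:A3|lborel. w x)"
    unfolding C' by (rule set_integral_Un[OF disj int(1,3)])
  also have "(LINT x:A3|lborel. w x) =
      (LINT x|lborel. indicator A3 (axis i (2 * pi) + x) *\<^sub>R w (axis i (2 * pi) + x))"
    unfolding set_lebesgue_integral_def by (rule lborel_integral_translate[symmetric]) measurable
  also have "\<dots> = (LINT x:A2|lborel. w x)"
    unfolding set_lebesgue_integral_def using per
    by (intro Bochner_Integration.integral_cong) (auto simp: A3_def indicator_def add.commute)
  also have "(LINT x:A1|lborel. w x) + (LINT x:A2|lborel. w x) = (LINT x:?C|lborel. w x)"
    unfolding C(1) by (rule set_integral_Un[OF C(2) int(1,2), symmetric])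
  finally show ?thesis
    using integral_torus[of w] integral_torus[of "\<lambda>x. w (x + axis i h)"] by simp
qed

lemma axis_add: "axis i (a + b) = axis i a + axis i (b :: real)"
  by (simp add: vec_eq_iff axis_def)

lemma axis_scaleR: "axis i (r * a) = r *\<^sub>R axis i (a :: real)"
  by (simp add: vec_eq_iff axis_def)

lemma norm_axis_real: "norm (axis i t :: real ^ 'n) = \<bar>t\<bar>"
  using axis_scaleR[of i t 1] by (simp add: norm_axis_1)

lemma integral_partial_deriv:
  fixes w :: "real ^ 'n \<Rightarrow> complex"
  assumes w: "\<And>x. w differentiable (at x)" and cont: "continuous_on UNIV (partial_deriv i w)"
    and per: "\<And>x. w (x + axis i (2 * pi)) = w x"
  shows "(LINT x|torus_measure. partial_deriv i w x) = 0"
proof -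
  let ?K = "cbox 0 (\<chi> i. 2 * pi + 1) :: (real ^ 'n) set"
  define h where "h k = 1 / real (Suc k)" for k
  have h: "0 < h k" "h k \<le> 1" for k
    by (simp_all add: h_def)
  have cw: "continuous_on UNIV w"
    using w by (intro continuous_at_imp_continuous_on ballI differentiable_imp_continuous_within) auto
  have [measurable]: "w \<in> borel_measurable borel" "partial_deriv i w \<in> borel_measurable borel"
    by (rule borel_measurable_continuous_onI[OF cw] borel_measurable_continuous_onI[OF cont])+
  have der: "(w has_derivative frechet_derivative w (at x)) (at x)" for x
    using w by (simp add: frechet_derivative_works)
  have dax: "frechet_derivative w (at x) (axis i t) = t *\<^sub>R partial_deriv i w x" for x t
  proof -
    have "linear (frechet_derivative w (at x))"
      using der has_derivative_linear by blast
    then show ?thesis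
      using linear_scale[of "frechet_derivative w (at x)" t "axis i 1"] axis_scaleR[of i t 1]
      by (simp add: partial_deriv_def)
  qed
  define q where "q k x = (1 / h k) *\<^sub>R (w (x + axis i (h k)) - w x)" for k x
  have "compact (partial_deriv i w ` ?K)"
    by (intro compact_continuous_image continuous_on_subset[OF cont]) auto
  from compact_imp_bounded[OF this]
  obtain B where B: "\<And>x. x \<in> ?K \<Longrightarrow> norm (partial_deriv i w x) \<le> B"
    unfolding bounded_iff by blast
  have q0: "(LINT x|torus_measure. q k x) = 0" for k
  proof -
    have "continuous_on UNIV (\<lambda>x. w (x + axis i (h k)))"
      by (rule continuous_on_compose2[OF cw]) (auto intro!: continuous_on_add)
    then have "integrable torus_measure (\<lambda>x. w (x + axis i (h k)))" "integrable torus_measure w"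
      using cw by (auto intro: integrable_torus_continuous)
    moreover have "h k \<le> 2 * pi"
      using h(2)[of k] pi_gt3 by linarith
    ultimately show ?thesis
      using torus_shift[OF cw per, of "h k"] h(1)[of k] by (simp add: q_def)
  qed
  have lim: "(\<lambda>k. q k x) \<longlonglongrightarrow> partial_deriv i w x" for x
  proof -
    have ht: "h \<longlonglongrightarrow> 0"
      unfolding h_def using LIMSEQ_inverse_real_of_nat by (simp add: inverse_eq_divide)
    have "(\<lambda>k. h k *\<^sub>R (axis i 1 :: real ^ 'n)) \<longlonglongrightarrow> 0 *\<^sub>R axis i 1"
      by (intro tendsto_intros ht)
    moreover have "(\<lambda>k. axis i (h k) :: real ^ 'n) = (\<lambda>k. h k *\<^sub>R axis i 1)"
      by (intro ext) (simp add: axis_scaleR[symmetric])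
    ultimately have "(\<lambda>k. axis i (h k) :: real ^ 'n) \<longlonglongrightarrow> 0"
      by (simp only: scaleR_zero_left)
    moreover have nz: "axis i (h k) \<noteq> (0 :: real ^ 'n)" for k
      using h(1)[of k] by (simp add: axis_eq_0_iff)
    ultimately have "filterlim (\<lambda>k. axis i (h k) :: real ^ 'n) (at 0) sequentially"
      by (simp add: filterlim_at)
    moreover have "((\<lambda>v. norm (w (x + v) - w x - frechet_derivative w (at x) v) / norm v) \<longlongrightarrow> 0) (at 0)"
      using der[of x] by (simp add: has_derivative_at)
    ultimately have "(\<lambda>k. norm (w (x + axis i (h k)) - w x - frechet_derivative w (at x) (axis i (h k))) /
        norm (axis i (h k) :: real ^ 'n)) \<longlonglongrightarrow> 0"
      by (rule filterlim_compose[rotated])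
    moreover have "norm (w (x + axis i (h k)) - w x - frechet_derivative w (at x) (axis i (h k))) /
        norm (axis i (h k) :: real ^ 'n) = norm (q k x - partial_deriv i w x)" for k
    proof -
      have "q k x - partial_deriv i w x = (1 / h k) *\<^sub>R (w (x + axis i (h k)) - w x - frechet_derivative w (at x) (axis i (h k)))"
        using h(1)[of k] by (simp add: q_def dax scaleR_right_diff_distrib)
      then show ?thesis
        using h(1)[of k] by (simp add: norm_axis_real)
    qed
    ultimately have "(\<lambda>k. norm (q k x - partial_deriv i w x)) \<longlonglongrightarrow> 0"
      by simp
    then show ?thesis
      by (rule LIM_zero_cancel[OF tendsto_norm_zero_cancel])
  qed
  have bound: "norm (q k x) \<le> B" if x: "x \<in> torus_cube" for k x
  proof -
    have inK: "x + axis i t \<in> ?K" if "0 \<le> t" "t \<le> 1" for t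
    proof -
      have "0 \<le> (x + axis i t) $ j \<and> (x + axis i t) $ j \<le> 2 * pi + 1" for j
        using x that by (auto simp: axis_def dest!: spec[of _ j])
      then show ?thesis
        by (simp add: mem_box_cart)
    qed
    have "norm (w (x + axis i (h k)) - w (x + axis i 0)) \<le> B * norm (h k - 0)"
    proof (rule differentiable_bound[where S = "{0..h k}" and f = "\<lambda>t. w (x + axis i t)"
        and f' = "\<lambda>t s. frechet_derivative w (at (x + axis i t)) (axis i s)"])
      fix t assume t: "t \<in> {0..h k}"
      have "bounded_linear (axis i :: real \<Rightarrow> real ^ 'n)"
        by (intro linear_conv_bounded_linear[THEN iffD1] linearI)
          (simp_all add: axis_add axis_scaleR)
      then have "((\<lambda>t. x + axis i t) has_derivative (\<lambda>s. 0 + axis i s)) (at t within {0..h k})"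
        by (intro derivative_intros bounded_linear_imp_has_derivative)
      from has_derivative_compose[OF this der]
      show "((\<lambda>t. w (x + axis i t)) has_derivative (\<lambda>s. frechet_derivative w (at (x + axis i t)) (axis i s))) (at t within {0..h k})"
        by simp
      have "norm (partial_deriv i w (x + axis i t)) \<le> B"
        using t h(2)[of k] by (intro B inK) auto
      then show "onorm (\<lambda>s. frechet_derivative w (at (x + axis i t)) (axis i s)) \<le> B"
        unfolding dax by (intro onorm_le) (simp add: mult.commute[of B] mult_left_mono)
    qed (use h(1)[of k] in auto)
    moreover have "x + axis i 0 = x"
      by (simp add: vec_eq_iff axis_def)
    ultimately show ?thesis
      using h(1)[of k] by (simp add: q_def divide_le_eq)
  qed
  have "(\<lambda>k. LINT x|torus_measure. q k x) \<longlonglongrightarrow> (LINT x|torus_measure. partial_deriv i w x)"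
  proof (rule integral_dominated_convergence[where w = "\<lambda>_. B"])
    show "AE x in torus_measure. norm (q k x) \<le> B" for k
      by (intro AE_torusI bound)
    show "AE x in torus_measure. (\<lambda>k. q k x) \<longlonglongrightarrow> partial_deriv i w x"
      using lim by simp
  qed (auto simp: q_def)
  then show ?thesis
    by (simp add: q0 LIMSEQ_const_iff)
qed

section \<open>The exponentials\<close>

definition phase :: "int ^ 'n \<Rightarrow> real ^ 'n \<Rightarrow> real" where
  "phase m x = (\<Sum>i\<in>UNIV. of_int (m $ i) * x $ i)"

definition expi :: "int ^ 'n \<Rightarrow> real ^ 'n \<Rightarrow> complex" where
  "expi m x = cis (phase m x)"

lemma norm_expi [simp]: "cmod (expi m x) = 1"
  by (simp add: expi_def)

lemma expi_mult: "expi m x * expi k x = expi (m + k) x"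
  by (simp add: expi_def cis_mult phase_def distrib_right sum.distrib)

lemma cnj_expi: "cnj (expi m x) = expi (- m) x"
  by (simp add: expi_def cis_cnj phase_def sum_negf)

lemma expi_0 [simp]: "expi 0 x = 1"
  by (simp add: expi_def phase_def)

lemma phase_axis: "phase m (axis i t) = of_int (m $ i) * t"
  by (simp add: phase_def axis_def if_distrib[of "\<lambda>t. _ * t"] cong: if_cong)

lemma phase_add: "phase m (x + y) = phase m x + phase m y"
  by (simp add: phase_def distrib_left sum.distrib)

lemma expi_add_axis: "expi m (x + axis i t) = cis (of_int (m $ i) * t) * expi m x"
  by (simp add: expi_def phase_add phase_axis cis_mult add.commute)

lemma expi_periodic: "expi m (x + axis i (2 * pi)) = expi m x"
proof -
  have "cis (of_int (m $ i) * (2 * pi)) = 1"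
    using cis_multiple_2pi[of "of_int (m $ i)"] by (simp add: mult.commute mult.left_commute)
  then show ?thesis
    by (simp add: expi_add_axis)
qed

lemma has_derivative_expi:
  "(expi m has_derivative (\<lambda>v. phase m v *\<^sub>R (\<i> * expi m x))) (at x)"
proof -
  have "bounded_linear (phase m)"
    unfolding phase_def[abs_def]
    by (intro bounded_linear_sum bounded_linear_compose[OF bounded_linear_mult_right] bounded_linear_vec_nth)
  then have "(phase m has_derivative phase m) (at x)"
    by (rule bounded_linear_imp_has_derivative)
  then have "((\<lambda>x. cis (phase m x)) has_derivative (\<lambda>v. phase m v *\<^sub>R (\<i> * cis (phase m x)))) (at x)"
    by (rule has_derivative_cis)
  then show ?thesis
    by (simp add: expi_def[abs_def])
qed

lemma continuous_on_expi: "continuous_on UNIV (expi m)"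
  by (intro has_derivative_continuous_on[OF has_derivative_at_withinI[OF has_derivative_expi]])

lemma borel_measurable_expi [measurable]: "expi m \<in> borel_measurable borel"
  by (rule borel_measurable_continuous_onI[OF continuous_on_expi])

lemma partial_deriv_eqI: "(u has_derivative D) (at x) \<Longrightarrow> partial_deriv i u x = D (axis i 1)"
  using frechet_derivative_at[of u D x] by (simp add: partial_deriv_def)

lemma partial_deriv_expi: "partial_deriv i (\<lambda>x. c * expi m x) = (\<lambda>x. (c * \<i> * of_int (m $ i)) * expi m x)"
proof
  fix x
  have "((\<lambda>x. c * expi m x) has_derivative (\<lambda>v. c * (phase m v *\<^sub>R (\<i> * expi m x)))) (at x)"
    by (intro has_derivative_mult_right has_derivative_expi)
  from partial_deriv_eqI[OF this, of i] show "partial_deriv i (\<lambda>x. c * expi m x) x = (c * \<i> * of_int (m $ i)) * expi m x"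
    by (simp add: phase_axis scaleR_conv_of_real ac_simps)
qed

lemma Ck_expi: "Ck k (\<lambda>x. c * expi m x)"
proof (induction k arbitrary: c)
  case 0
  show ?case
    by (simp add: continuous_on_expi continuous_on_mult_left)
next
  case (Suc k)
  have "(\<lambda>x. c * expi m x) differentiable (at x)" for x
    using has_derivative_mult_right[OF has_derivative_expi] by (auto simp: differentiable_def)
  then show ?case
    using Suc by (simp add: partial_deriv_expi)
qed

lemma smooth_torus_expi: "smooth_torus (expi m)"
  using Ck_expi[of _ 1 m] by (simp add: smooth_torus_def expi_periodic)

lemma hodge_laplacian_expi: "hodge_laplacian (expi m) = (\<lambda>x. of_int (\<Sum>i\<in>UNIV. (m $ i)\<^sup>2) * expi m x)"
proof
  fix x
  have "partial_deriv i (partial_deriv i (expi m)) x = - of_int ((m $ i)\<^sup>2) * expi m x" for i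
    using partial_deriv_expi[of i 1 m] partial_deriv_expi[of i "\<i> * of_int (m $ i)" m]
    by (simp add: power2_eq_square ac_simps)
  then show "hodge_laplacian (expi m) x = of_int (\<Sum>i\<in>UNIV. (m $ i)\<^sup>2) * expi m x"
    by (simp add: hodge_laplacian_def sum_distrib_right sum_negf)
qed

lemma integral_expi: "(LINT x|torus_measure. expi m x) = (if m = (0 :: int ^ 'n) then 1 else 0)"
proof (cases "m = 0")
  case True
  then show ?thesis
    using emeasure_torus_UNIV[where 'n = 'n] by (simp add: measure_def)
next
  case False
  then obtain i where i: "m $ i \<noteq> 0"
    by (auto simp: vec_eq_iff)
  define h where "h = pi / \<bar>real_of_int (m $ i)\<bar>"
  have "1 \<le> \<bar>real_of_int (m $ i)\<bar>"
    using i by simp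
  then have h: "0 \<le> h" "h \<le> 2 * pi"
    using i pi_gt_zero by (auto simp: h_def divide_le_eq intro: order_trans[of _ "1 * (2 * pi)"])
  have "of_int (m $ i) * h = pi \<or> of_int (m $ i) * h = - pi"
    using i by (auto simp: h_def abs_if)
  then have "cis (of_int (m $ i) * h) = - 1"
    by (auto simp: cis.ctr complex_eq_iff)
  then have "(LINT x|torus_measure. expi m x) = - (LINT x|torus_measure. expi m x)"
    using torus_shift[OF continuous_on_expi[of m] expi_periodic[of m _ i] h] by (simp add: expi_add_axis)
  then show ?thesis
    using False by simp
qed

lemma integral_expi_parts:
  fixes v :: "real ^ 'n \<Rightarrow> complex"
  assumes v: "\<And>x. v differentiable (at x)" and cont: "continuous_on UNIV (partial_deriv i v)"
    and per: "\<And>x. v (x + axis i (2 * pi)) = v x"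
  shows "(LINT x|torus_measure. expi m x * partial_deriv i v x) =
    - \<i> * of_int (m $ i) * (LINT x|torus_measure. expi m x * v x)"
proof -
  have cv: "continuous_on UNIV v"
    using v by (intro continuous_at_imp_continuous_on ballI differentiable_imp_continuous_within) auto
  have der: "((\<lambda>x. expi m x * v x) has_derivative
      (\<lambda>t. expi m x * frechet_derivative v (at x) t + phase m t *\<^sub>R (\<i> * expi m x) * v x)) (at x)" for x
    using v by (intro has_derivative_mult has_derivative_expi) (simp add: frechet_derivative_works)
  have pd: "partial_deriv i (\<lambda>x. expi m x * v x) = (\<lambda>x. expi m x * partial_deriv i v x +
      \<i> * of_int (m $ i) * (expi m x * v x))"
    using partial_deriv_eqI[OF der, of i]
    by (auto simp: phase_axis scaleR_conv_of_real partial_deriv_def ac_simps)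
  have int: "integrable torus_measure (\<lambda>x. expi m x * partial_deriv i v x)"
    "integrable torus_measure (\<lambda>x. expi m x * v x)"
    using cont cv continuous_on_expi by (auto intro!: integrable_torus_continuous continuous_on_mult)
  have "(LINT x|torus_measure. partial_deriv i (\<lambda>x. expi m x * v x) x) = 0"
  proof (rule integral_partial_deriv)
    show "(\<lambda>x. expi m x * v x) differentiable (at x)" for x
      using der by (auto simp: differentiable_def)
    show "continuous_on UNIV (partial_deriv i (\<lambda>x. expi m x * v x))"
      unfolding pd using cont cv continuous_on_expi
      by (intro continuous_on_add continuous_on_mult continuous_on_const) auto
  qed (simp add: per expi_periodic)
  then show ?thesis
    using int unfolding pd by (simp add: add_eq_0_iff)
qed

lemma partial_deriv_periodic:
  assumes v: "\<And>x. v differentiable (at x)" and per: "\<And>x. v (x + a) = v x"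
  shows "partial_deriv i v (x + a) = partial_deriv i v x"
proof -
  have "(v has_derivative frechet_derivative v (at (x + a))) (at (x + a))"
    using v by (simp add: frechet_derivative_works)
  moreover have "((\<lambda>y. y + a) has_derivative (\<lambda>t. t)) (at x)"
    by (auto intro!: derivative_eq_intros)
  ultimately have "((\<lambda>y. v (y + a)) has_derivative frechet_derivative v (at (x + a))) (at x)"
    using has_derivative_compose[of "\<lambda>y. y + a" "\<lambda>t. t" x UNIV v] by simp
  then have "(v has_derivative frechet_derivative v (at (x + a))) (at x)"
    by (simp add: per)
  then show ?thesis
    using partial_deriv_eqI[of v "frechet_derivative v (at (x + a))" x i] by (simp add: partial_deriv_def)
qed

lemma smooth_torus_continuous: "smooth_torus u \<Longrightarrow> continuous_on UNIV u"
  by (auto simp: smooth_torus_def dest!: spec[of _ 0])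

lemma smooth_torus_partial_deriv: "smooth_torus u \<Longrightarrow> smooth_torus (partial_deriv i u)"
proof -
  assume u: "smooth_torus u"
  then have "Ck (Suc k) u" for k
    by (simp only: smooth_torus_def)
  then have "u differentiable (at x)" "Ck k (partial_deriv i u)" for x k
    by simp_all
  then show "smooth_torus (partial_deriv i u)"
    using u partial_deriv_periodic[of u] by (simp add: smooth_torus_def)
qed

lemma smooth_torus_differentiable: "smooth_torus u \<Longrightarrow> u differentiable (at x)"
  by (auto simp: smooth_torus_def dest!: spec[of _ "Suc 0"])

lemma smooth_torus_parts:
  assumes u: "smooth_torus u"
  shows "(LINT x|torus_measure. expi m x * partial_deriv i u x) =
    - \<i> * of_int (m $ i) * (LINT x|torus_measure. expi m x * u x)"
  using u by (intro integral_expi_parts smooth_torus_differentiable smooth_torus_continuous smooth_torus_partial_deriv)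
    (auto simp: smooth_torus_def)

lemma continuous_on_hodge_laplacian: "smooth_torus u \<Longrightarrow> continuous_on UNIV (hodge_laplacian u)"
  unfolding hodge_laplacian_def[abs_def]
  by (intro continuous_intros smooth_torus_continuous smooth_torus_partial_deriv)

lemma integral_expi_laplacian:
  fixes u :: "real ^ 'n \<Rightarrow> complex"
  assumes u: "smooth_torus u"
  shows "(LINT x|torus_measure. expi m x * hodge_laplacian u x) =
    of_int (\<Sum>i\<in>UNIV. (m $ i)\<^sup>2) * (LINT x|torus_measure. expi m x * u x)"
proof -
  have pd: "smooth_torus (partial_deriv i u)" "smooth_torus (partial_deriv i (partial_deriv i u))" for i
    using u by (auto intro: smooth_torus_partial_deriv)
  have int: "integrable torus_measure (\<lambda>x. expi m x * partial_deriv i (partial_deriv i u) x)" for i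
    using pd by (intro integrable_torus_continuous continuous_on_mult continuous_on_expi smooth_torus_continuous)
  have "(LINT x|torus_measure. expi m x * hodge_laplacian u x) =
      - (LINT x|torus_measure. (\<Sum>i\<in>UNIV. expi m x * partial_deriv i (partial_deriv i u) x))"
    by (simp add: hodge_laplacian_def sum_distrib_left)
  also have "\<dots> = - (\<Sum>i\<in>UNIV. LINT x|torus_measure. expi m x * partial_deriv i (partial_deriv i u) x)"
    using int by (subst Bochner_Integration.integral_sum) auto
  also have "\<dots> = - (\<Sum>i\<in>UNIV. - of_int ((m $ i)\<^sup>2) * (LINT x|torus_measure. expi m x * u x))"
    using smooth_torus_parts[OF u, of m] smooth_torus_parts[OF pd(1), of m]
    by (simp add: power2_eq_square ac_simps)
  also have "\<dots> = of_int (\<Sum>i\<in>UNIV. (m $ i)\<^sup>2) * (LINT x|torus_measure. expi m x * u x)"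
    by (simp add: sum_negf sum_distrib_right)
  finally show ?thesis .
qed

section \<open>Completeness of the exponentials\<close>

lemma step_limit:
  fixes s :: real
  assumes s: "0 \<le> s" "s \<le> 1"
  shows "(\<lambda>n. (1 - s ^ n) ^ (n * 2 ^ n)) \<longlonglongrightarrow> (if s < 1/2 then 1 else 0)"
proof (cases "s < 1/2")
  case True
  have "(\<lambda>n. real n * (2 * s) ^ n) \<longlonglongrightarrow> 0"
    using powser_times_n_limit_0[of "2 * s"] True s by simp
  then have "(\<lambda>n. 1 - real n * (2 * s) ^ n) \<longlonglongrightarrow> 1 - 0"
    by (intro tendsto_intros)
  then have lim: "(\<lambda>n. 1 - real n * (2 * s) ^ n) \<longlonglongrightarrow> 1"
    by simp
  have lower: "1 - real n * (2 * s) ^ n \<le> (1 - s ^ n) ^ (n * 2 ^ n)" for n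
  proof -
    have "1 + real (n * 2 ^ n) * (- (s ^ n)) \<le> (1 + - (s ^ n)) ^ (n * 2 ^ n)"
      using power_le_one[OF s, of n] by (intro Bernoulli_inequality) simp
    then show ?thesis
      by (simp add: power_mult_distrib ac_simps)
  qed
  have upper: "(1 - s ^ n) ^ (n * 2 ^ n) \<le> 1" for n
    using power_le_one[OF s, of n] s by (intro power_le_one) auto
  have "(\<lambda>n. (1 - s ^ n) ^ (n * 2 ^ n)) \<longlonglongrightarrow> 1"
    by (rule tendsto_sandwich[OF always_eventually[OF allI[OF lower]] always_eventually[OF allI[OF upper]] lim tendsto_const])
  then show ?thesis
    using True by simp
next
  case False
  have upper: "(1 - s ^ n) ^ (n * 2 ^ n) \<le> exp (- real n)" for n
  proof -
    have "(1 - s ^ n) ^ (n * 2 ^ n) \<le> exp (- (s ^ n)) ^ (n * 2 ^ n)"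
      using power_le_one[OF s, of n] exp_ge_add_one_self[of "- (s ^ n)"] by (intro power_mono) auto
    also have "\<dots> = exp (- real n * (2 * s) ^ n)"
      by (simp add: power_mult_distrib ac_simps flip: exp_of_nat_mult)
    also have "\<dots> \<le> exp (- real n * 1)"
      using False one_le_power[of "2 * s" n] by (simp add: mult_le_cancel_left1)
    finally show ?thesis by simp
  qed
  have lower: "0 \<le> (1 - s ^ n) ^ (n * 2 ^ n)" for n
    using power_le_one[OF s, of n] by simp
  have lim: "(\<lambda>n. exp (- real n)) \<longlonglongrightarrow> 0"
    by (rule filterlim_compose[OF exp_at_bot
      filterlim_compose[OF filterlim_uminus_at_bot_at_top filterlim_real_sequentially]])
  have "(\<lambda>n. (1 - s ^ n) ^ (n * 2 ^ n)) \<longlonglongrightarrow> 0"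
    by (rule tendsto_sandwich[OF always_eventually[OF allI[OF lower]] always_eventually[OF allI[OF upper]] tendsto_const lim])
  then show ?thesis
    using False by simp
qed

lemma cos_ge_interval_iff:
  assumes a: "0 \<le> a" "a < 2 * pi" and t: "0 \<le> t" "t < 2 * pi"
  shows "cos (a / 2) \<le> cos (t - a / 2) \<longleftrightarrow> t \<le> a"
proof -
  have *: "cos (a / 2) \<le> cos u \<longleftrightarrow> u \<le> a / 2" if "0 \<le> u" "u \<le> pi" for u
    using that a cos_mono_le_eq[of "a / 2" u] by auto
  show ?thesis
  proof (cases "t \<le> a / 2")
    case True
    have "cos (t - a / 2) = cos (a / 2 - t)"
      by (metis cos_minus minus_diff_eq)
    then show ?thesis
      using True a t *[of "a / 2 - t"] by auto
  next
    case False
    show ?thesis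
    proof (cases "t - a / 2 \<le> pi")
      case True
      then show ?thesis
        using False *[of "t - a / 2"] by auto
    next
      case F: False
      have "cos (t - a / 2) = cos (2 * pi - (t - a / 2))"
        by (simp add: cos_diff)
      then show ?thesis
        using False F a t *[of "2 * pi - (t - a / 2)"] by auto
    qed
  qed
qed

text \<open>Completeness: if all Fourier coefficients of \<open>u\<close> vanish, then \<open>annihilator u\<close> contains the constant 1, hence
  (by \<open>step_limit\<close>, applied to affine functions of \<open>cos (x\<^sub>i - c)\<close>) the indicator functions of half-spaces.\<close>

definition annihilator :: "(real ^ 'n \<Rightarrow> complex) \<Rightarrow> (real ^ 'n \<Rightarrow> complex) set" where
  "annihilator u = {g \<in> borel_measurable borel. (\<exists>B. \<forall>x. cmod (g x) \<le> B) \<and>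
     (\<forall>m. (LINT x|torus_measure. u x * g x * expi m x) = 0)}"

context
  fixes u :: "real ^ 'n \<Rightarrow> complex"
  assumes u: "integrable torus_measure u"
begin

lemma borel_measurable_u [measurable]: "u \<in> borel_measurable borel"
  using borel_measurable_integrable[OF u] by simp

lemma integrable_bounded_mult:
  assumes [measurable]: "g \<in> borel_measurable borel" and B: "\<And>x. cmod (g x) \<le> B"
  shows "integrable torus_measure (\<lambda>x. u x * g x)"
proof (rule Bochner_Integration.integrable_bound)
  show "integrable torus_measure (\<lambda>x. B *\<^sub>R u x)"
    using u by simp
  show "AE x in torus_measure. norm (u x * g x) \<le> norm (B *\<^sub>R u x)"
    using B by (intro always_eventually) (auto simp: norm_mult mult.commute intro!: mult_right_mono order_trans[OF B abs_ge_self])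
qed measurable

lemma annihilator_integrable:
  assumes "g \<in> annihilator u"
  shows "integrable torus_measure (\<lambda>x. u x * g x * expi m x)"
proof -
  obtain B where g[measurable]: "g \<in> borel_measurable borel" and B: "\<And>x. cmod (g x) \<le> B"
    using assms by (auto simp: annihilator_def)
  have "integrable torus_measure (\<lambda>x. u x * (g x * expi m x))"
    using B by (intro integrable_bounded_mult) (auto simp: norm_mult)
  then show ?thesis
    by (simp add: mult.assoc)
qed

lemma annihilator_integral: "g \<in> annihilator u \<Longrightarrow> (LINT x|torus_measure. u x * g x * expi m x) = 0"
  by (simp add: annihilator_def)

lemma annihilator_expi:
  assumes g: "g \<in> annihilator u"
  shows "(\<lambda>x. expi k x * g x) \<in> annihilator u"
  unfolding annihilator_def
proof safe
  show "(\<lambda>x. expi k x * g x) \<in> borel_measurable borel"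
    using g by (auto simp: annihilator_def)
  show "\<exists>B. \<forall>x. cmod (expi k x * g x) \<le> B"
    using g by (auto simp: annihilator_def norm_mult)
  show "(LINT x|torus_measure. u x * (expi k x * g x) * expi m x) = 0" for m
    using annihilator_integral[OF g, of "m + k"] by (simp add: expi_mult[symmetric] ac_simps)
qed

lemma annihilator_add:
  assumes g: "g \<in> annihilator u" and h: "h \<in> annihilator u"
  shows "(\<lambda>x. g x + h x) \<in> annihilator u"
  unfolding annihilator_def
proof safe
  show "(\<lambda>x. g x + h x) \<in> borel_measurable borel"
    using g h by (auto simp: annihilator_def)
  obtain B C where "\<forall>x. cmod (g x) \<le> B" "\<forall>x. cmod (h x) \<le> C"
    using g h by (auto simp: annihilator_def)
  then have "\<forall>x. cmod (g x + h x) \<le> B + C"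
    using norm_triangle_mono by blast
  then show "\<exists>B. \<forall>x. cmod (g x + h x) \<le> B" ..
  show "(LINT x|torus_measure. u x * (g x + h x) * expi m x) = 0" for m
    using annihilator_integral[OF g, of m] annihilator_integral[OF h, of m]
      annihilator_integrable[OF g, of m] annihilator_integrable[OF h, of m]
    by (simp add: distrib_left distrib_right)
qed

lemma annihilator_scale:
  assumes g: "g \<in> annihilator u"
  shows "(\<lambda>x. c * g x) \<in> annihilator u"
  unfolding annihilator_def
proof safe
  show "(\<lambda>x. c * g x) \<in> borel_measurable borel"
    using g by (auto simp: annihilator_def)
  obtain B where "\<forall>x. cmod (g x) \<le> B"
    using g by (auto simp: annihilator_def)
  then have "\<forall>x. cmod (c * g x) \<le> cmod c * B"
    by (auto simp: norm_mult intro!: mult_left_mono)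
  then show "\<exists>B. \<forall>x. cmod (c * g x) \<le> B" ..
  show "(LINT x|torus_measure. u x * (c * g x) * expi m x) = 0" for m
    using annihilator_integral[OF g, of m] by (simp add: mult.left_commute mult.assoc)
qed

lemma annihilator_limit:
  assumes g: "\<And>n. g n \<in> annihilator u" and h: "h \<in> borel_measurable borel"
    and B: "\<And>n x. cmod (g n x) \<le> B" "\<And>x. cmod (h x) \<le> B"
    and lim: "\<And>x. x \<in> torus_cube \<Longrightarrow> (\<lambda>n. g n x) \<longlonglongrightarrow> h x"
  shows "h \<in> annihilator u"
  unfolding annihilator_def
proof safe
  show "h \<in> borel_measurable borel" by (rule h)
  show "\<exists>B. \<forall>x. cmod (h x) \<le> B" using B(2) by blast
  fix m
  have [measurable]: "g n \<in> borel_measurable borel" "h \<in> borel_measurable borel" for n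
    using g h by (auto simp: annihilator_def)
  have "(\<lambda>n. LINT x|torus_measure. u x * g n x * expi m x) \<longlonglongrightarrow> (LINT x|torus_measure. u x * h x * expi m x)"
  proof (rule integral_dominated_convergence[where w = "\<lambda>x. B * cmod (u x)"])
    show "integrable torus_measure (\<lambda>x. B * cmod (u x))"
      using u by simp
    show "AE x in torus_measure. (\<lambda>n. u x * g n x * expi m x) \<longlonglongrightarrow> u x * h x * expi m x"
      using lim by (intro AE_torusI tendsto_intros)
    show "AE x in torus_measure. norm (u x * g n x * expi m x) \<le> B * cmod (u x)" for n
      using B(1) by (intro always_eventually) (auto simp: norm_mult mult.commute[of B] intro!: mult_left_mono)
  qed measurable
  then show "(LINT x|torus_measure. u x * h x * expi m x) = 0"
    by (simp add: annihilator_integral[OF g] LIMSEQ_const_iff)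
qed

lemma annihilator_cos:
  assumes g: "g \<in> annihilator u"
  shows "(\<lambda>x. complex_of_real (cos (x $ i - c)) * g x) \<in> annihilator u"
proof -
  have cos: "complex_of_real (cos (x $ i - c)) = (cis (- c) / 2) * expi (axis i 1) x + (cis c / 2) * expi (axis i (- 1)) x" for x :: "real ^ 'n"
  proof -
    have "phase (axis i m) x = of_int m * x $ i" for m
      by (simp add: phase_def axis_def if_distrib[of "\<lambda>t. of_int t * _"] cong: if_cong)
    then have "expi (axis i 1) x = cis (x $ i)" "expi (axis i (- 1)) x = cis (- (x $ i))"
      by (simp_all add: expi_def)
    then show ?thesis
      by (simp add: complex_eq_iff cos_diff cis.ctr field_simps)
  qed
  have "(\<lambda>x. (cis (- c) / 2) * (expi (axis i 1) x * g x) + (cis c / 2) * (expi (axis i (- 1)) x * g x)) \<in> annihilator u"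
    by (intro annihilator_add annihilator_scale annihilator_expi g)
  then show ?thesis
    by (simp add: cos distrib_right mult.assoc)
qed

lemma annihilator_power:
  assumes step: "\<And>g. g \<in> annihilator u \<Longrightarrow> (\<lambda>x. s x * g x) \<in> annihilator u" and g: "g \<in> annihilator u"
  shows "(\<lambda>x. s x ^ n * g x) \<in> annihilator u"
proof (induction n)
  case (Suc n)
  then show ?case
    using step[OF Suc] by (simp add: mult.assoc)
qed (simp add: g)

lemma annihilator_half_space:
  assumes g: "g \<in> annihilator u"
  shows "(\<lambda>x. indicator {x. x $ i \<le> a} x * g x) \<in> annihilator u"
proof -
  obtain B where gm [measurable]: "g \<in> borel_measurable borel" and B: "\<And>x. cmod (g x) \<le> B"
    using g by (auto simp: annihilator_def)
  have B0: "0 \<le> B"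
    using B[of 0] norm_ge_zero order_trans by blast
  have indB: "cmod (indicator {x. x $ i \<le> a} x * g x) \<le> B" for x
    using B[of x] B0 by (simp add: indicator_def)
  have ind_meas: "(\<lambda>x. indicator {x. x $ i \<le> a} x * g x) \<in> borel_measurable borel"
    by measurable
  consider "a < 0" | "2 * pi \<le> a" | "0 \<le> a" "a < 2 * pi" by linarith
  then show ?thesis
  proof cases
    case 1
    show ?thesis
    proof (rule annihilator_limit[where g = "\<lambda>_ x. 0 * g x" and B = B])
      show "(\<lambda>x. 0 * g x) \<in> annihilator u"
        by (rule annihilator_scale[OF g])
      fix x :: "real ^ 'n" assume "x \<in> torus_cube"
      then have "\<not> x $ i \<le> a"
        using 1 by (auto simp: not_le intro: less_le_trans)
      then show "(\<lambda>_. 0 * g x) \<longlonglongrightarrow> indicator {x. x $ i \<le> a} x * g x"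
        by simp
    qed (use B0 indB ind_meas in auto)
  next
    case 2
    show ?thesis
    proof (rule annihilator_limit[where g = "\<lambda>_. g" and B = B])
      fix x :: "real ^ 'n" assume "x \<in> torus_cube"
      then have "x $ i \<le> a"
        using 2 by (auto intro: less_imp_le less_le_trans)
      then show "(\<lambda>_. g x) \<longlonglongrightarrow> indicator {x. x $ i \<le> a} x * g x"
        by simp
    qed (use g B indB ind_meas in auto)
  next
    case 3
    define s where "s x = 1/2 + (cos (a / 2) - cos (x $ i - a / 2)) / 4" for x :: "real ^ 'n"
    have "0 \<le> 1/2 + (p - q) / 4 \<and> 1/2 + (p - q) / 4 \<le> 1"
      if "- 1 \<le> p" "p \<le> 1" "- 1 \<le> q" "q \<le> 1" for p q :: real
      using that by (auto simp: field_simps)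
    from this[OF cos_ge_minus_one cos_le_one cos_ge_minus_one cos_le_one]
    have "0 \<le> s x \<and> s x \<le> 1" for x
      unfolding s_def .
    then have s: "0 \<le> s x" "s x \<le> 1" for x
      by auto
    have one_minus: "(\<lambda>x. (1 - r x) * g x) \<in> annihilator u"
      if "\<And>g. g \<in> annihilator u \<Longrightarrow> (\<lambda>x. r x * g x) \<in> annihilator u" "g \<in> annihilator u" for r :: "real ^ 'n \<Rightarrow> complex" and g
      using annihilator_add[OF that(2) annihilator_scale[OF that(1)[OF that(2)], of "- 1"]]
      by (simp add: left_diff_distrib)
    have s_step: "(\<lambda>x. complex_of_real (s x) * g x) \<in> annihilator u" if g: "g \<in> annihilator u" for g
    proof -
      have "(\<lambda>x. complex_of_real (1/2 + cos (a / 2) / 4) * g x + (- 1/4) * (complex_of_real (cos (x $ i - a / 2)) * g x)) \<in> annihilator u"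
        by (intro annihilator_add annihilator_scale annihilator_cos g)
      moreover have "complex_of_real (s x) * g x =
          complex_of_real (1/2 + cos (a / 2) / 4) * g x + (- 1/4) * (complex_of_real (cos (x $ i - a / 2)) * g x)" for x
        by (simp add: s_def field_simps)
      ultimately show ?thesis by simp
    qed
    show ?thesis
    proof (rule annihilator_limit)
      let ?p = "\<lambda>n x. complex_of_real ((1 - (1 - s x) ^ n) ^ (n * 2 ^ n)) * g x"
      have s': "0 \<le> 1 - s x" "1 - s x \<le> 1" for x
        using s[of x] by auto
      have one_s: "(\<lambda>x. (1 - complex_of_real (s x)) * g x) \<in> annihilator u" if "g \<in> annihilator u" for g
        by (rule one_minus[OF s_step that])
      have "(\<lambda>x. (1 - complex_of_real (s x)) ^ n * g x) \<in> annihilator u" if "g \<in> annihilator u" for n g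
        by (rule annihilator_power[OF one_s that])
      then have "(\<lambda>x. (1 - (1 - complex_of_real (s x)) ^ n) * g x) \<in> annihilator u" if "g \<in> annihilator u" for n g
        by (rule one_minus[OF _ that])
      then have "(\<lambda>x. (1 - (1 - complex_of_real (s x)) ^ n) ^ k * g x) \<in> annihilator u" for n k
        by (rule annihilator_power[OF _ g])
      then have pA: "?p n \<in> annihilator u" for n
        by simp
      have "(\<lambda>x. g x - ?p n x) \<in> annihilator u" for n
        using annihilator_add[OF g annihilator_scale[OF pA, of "- 1"]] by simp
      then show "(\<lambda>x. g x - ?p n x) \<in> annihilator u" for n .
      show "cmod (g x - ?p n x) \<le> B" for n x
      proof -
        let ?r = "(1 - (1 - s x) ^ n) ^ (n * 2 ^ n)"
        have "0 \<le> 1 - (1 - s x) ^ n" "1 - (1 - s x) ^ n \<le> 1"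
          using power_le_one[OF s'[of x], of n] s'[of x] by auto
        then have r: "0 \<le> ?r" "?r \<le> 1"
          by (auto intro: power_le_one)
        have "g x - ?p n x = complex_of_real (1 - ?r) * g x"
          by (simp add: left_diff_distrib)
        also have "cmod \<dots> = (1 - ?r) * cmod (g x)"
          unfolding norm_mult norm_of_real using r by simp
        also have "\<dots> \<le> 1 * B"
          using r B by (intro mult_mono) auto
        finally show ?thesis by simp
      qed
      show "cmod (indicator {x. x $ i \<le> a} x * g x) \<le> B" for x
        by (rule indB)
      show "(\<lambda>x. indicator {x. x $ i \<le> a} x * g x) \<in> borel_measurable borel"
        by (rule ind_meas)
      fix x :: "real ^ 'n" assume x: "x \<in> torus_cube"
      have iff: "1 - s x < 1/2 \<longleftrightarrow> \<not> x $ i \<le> a"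
        using cos_ge_interval_iff[OF 3, of "x $ i"] x by (auto simp: s_def)
      have "(\<lambda>n. g x - ?p n x) \<longlonglongrightarrow> g x - complex_of_real (if 1 - s x < 1/2 then 1 else 0) * g x"
        by (intro tendsto_intros tendsto_of_real step_limit s')
      also have "g x - complex_of_real (if 1 - s x < 1/2 then 1 else 0) * g x = indicator {x. x $ i \<le> a} x * g x"
        unfolding iff by simp
      finally show "(\<lambda>n. g x - ?p n x) \<longlonglongrightarrow> indicator {x. x $ i \<le> a} x * g x" .
    qed
  qed
qed

lemma annihilator_atMost:
  assumes 1: "(\<lambda>_. 1) \<in> annihilator u"
  shows "(\<lambda>x. indicator {..a} x) \<in> annihilator u"
proof -
  have "(\<lambda>x. \<Prod>i\<in>I. indicator {x. x $ i \<le> a $ i} x) \<in> annihilator u" if "finite I" for I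
    using that by (induction I) (auto simp: 1 annihilator_half_space)
  from this[of UNIV] have "(\<lambda>x. \<Prod>i\<in>UNIV. indicator {x. x $ i \<le> a $ i} x) \<in> annihilator u"
    by simp
  moreover have "(\<Prod>i\<in>UNIV. indicator {x. x $ i \<le> a $ i} x) = (indicator {..a} x :: complex)" for x :: "real ^ 'n"
  proof (cases "x \<le> a")
    case False
    then obtain i where "\<not> x $ i \<le> a $ i"
      by (auto simp: less_eq_vec_def)
    then have "indicator {x. x $ i \<le> a $ i} x = (0 :: complex)"
      by simp
    then have "(\<Prod>i\<in>UNIV. indicator {x. x $ i \<le> a $ i} x) = (0 :: complex)"
      by (intro prod_zero) auto
    then show ?thesis
      using False by simp
  qed (simp add: less_eq_vec_def)
  ultimately show ?thesis
    by simp
qed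

lemma integral_set_eq_0:
  assumes 1: "(\<lambda>_. 1) \<in> annihilator u" and S: "S \<in> sets borel"
  shows "(LINT x|torus_measure. u x * indicator S x) = 0"
proof -
  have S': "S \<in> sigma_sets UNIV (range (\<lambda>a. {..a :: real ^ 'n}))"
    using S by (simp add: borel_eq_atMost)
  have stable: "Int_stable (range (\<lambda>a. {..a :: real ^ 'n}))"
  proof (rule Int_stableI)
    fix A B assume "A \<in> range (\<lambda>a. {..a :: real ^ 'n})" "B \<in> range (\<lambda>a. {..a :: real ^ 'n})"
    then obtain a b where "A = {..a}" "B = {..b}"
      by blast
    then have "A \<inter> B = {..inf a b}"
      by auto
    then show "A \<inter> B \<in> range (\<lambda>a. {..a})"
      by blast
  qed
  have subset_Pow: "range (\<lambda>a. {..a :: real ^ 'n}) \<subseteq> Pow UNIV"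
    by simp
  have sets: "A \<in> sets borel" if "A \<in> sigma_sets UNIV (range (\<lambda>a. {..a :: real ^ 'n}))" for A
    using that by (simp add: borel_eq_atMost)
  have int: "integrable torus_measure (\<lambda>x. u x * indicator A x)" if "A \<in> sets borel" for A
    using that by (intro integrable_bounded_mult[where B = 1]) (auto simp: indicator_def)
  have u0: "(LINT x|torus_measure. u x) = 0"
    using annihilator_integral[OF 1, of 0] by simp
  show ?thesis
    using stable subset_Pow S'
  proof (induction S rule: sigma_sets_induct_disjoint)
    case (basic A)
    then show ?case
      using annihilator_integral[OF annihilator_atMost[OF 1], of _ 0] by auto
  next
    case (compl A)
    have "(LINT x|torus_measure. u x * indicator (UNIV - A) x) = (LINT x|torus_measure. u x - u x * indicator A x)"
      by (intro Bochner_Integration.integral_cong) (auto simp: indicator_def)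
    also have "\<dots> = 0"
      using compl u u0 int[OF sets[OF compl(1)]] by simp
    finally show ?case .
  next
    case (union A)
    have [measurable]: "A n \<in> sets borel" for n
      using union(2) by (intro sets) auto
    have "(\<lambda>n. LINT x|torus_measure. u x * indicator (\<Union>i<n. A i) x) \<longlonglongrightarrow>
        (LINT x|torus_measure. u x * indicator (\<Union>i. A i) x)"
    proof (rule integral_dominated_convergence[where w = "\<lambda>x. cmod (u x)"])
      show "AE x in torus_measure. (\<lambda>n. u x * indicator (\<Union>i<n. A i) x) \<longlonglongrightarrow> u x * indicator (\<Union>i. A i) x"
        by (intro always_eventually allI tendsto_intros LIMSEQ_indicator_UN)
      show "AE x in torus_measure. norm (u x * indicator (\<Union>i<n. A i) x) \<le> cmod (u x)" for n
        by (intro always_eventually) (auto simp: indicator_def)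
    qed (use u in auto)
    moreover have "(LINT x|torus_measure. u x * indicator (\<Union>i<n. A i) x) = 0" for n
    proof (induction n)
      case (Suc n)
      have "A n \<inter> A i = {}" if "i < n" for i
        using disjoint_family_onD[OF union(1), of n i] that by simp
      then have "A n \<inter> (\<Union>i<n. A i) = {}"
        by blast
      then have "indicator (\<Union>i<Suc n. A i) x = (indicator (\<Union>i<n. A i) x + indicator (A n) x :: complex)" for x
        by (auto simp: indicator_def lessThan_Suc)
      then show ?case
        using Suc union(3)[of n] int[of "A n"] int[of "\<Union>i<n. A i"] by (simp add: distrib_left)
    qed simp
    ultimately show ?case
      by (simp add: LIMSEQ_const_iff)
  qed auto
qed

end

lemma AE_zero_if_set_integrals_zero:
  fixes v :: "'a \<Rightarrow> real"
  assumes v: "integrable M v" and 0: "\<And>S. S \<in> sets M \<Longrightarrow> (LINT x|M. v x * indicator S x) = 0"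
  shows "AE x in M. v x = 0"
proof -
  have [measurable]: "v \<in> borel_measurable M"
    using v by simp
  have *: "AE x in M. w x \<le> 0" if w: "integrable M w" "\<And>S. S \<in> sets M \<Longrightarrow> (LINT x|M. w x * indicator S x) = 0"
    for w :: "'a \<Rightarrow> real"
  proof -
    have [measurable]: "w \<in> borel_measurable M"
      using w by simp
    let ?S = "{x \<in> space M. 0 < w x}"
    have S: "?S \<in> sets M"
      by measurable
    have int: "integrable M (\<lambda>x. w x * indicator ?S x)"
      using integrable_mult_indicator[OF S w(1)] by (simp add: mult.commute)
    have "AE x in M. w x * indicator ?S x = 0"
      using w(2)[OF S] integral_nonneg_eq_0_iff_AE[OF int] by (auto simp: indicator_def)
    then show ?thesis
      using AE_space by eventually_elim (auto simp: indicator_def split: if_splits)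
  qed
  have "AE x in M. v x \<le> 0"
    using v 0 by (rule *)
  moreover have "AE x in M. - v x \<le> 0"
    using v 0 by (intro *) auto
  ultimately show ?thesis
    by eventually_elim auto
qed

lemma expi_complete:
  fixes u :: "real ^ 'n \<Rightarrow> complex"
  assumes u: "integrable torus_measure u" and 0: "\<And>m. (LINT x|torus_measure. expi m x * u x) = 0"
  shows "AE x in torus_measure. u x = 0"
proof -
  have 1: "(\<lambda>_. 1) \<in> annihilator u"
    using 0 by (auto simp: annihilator_def mult.commute)
  have int: "integrable torus_measure (\<lambda>x. u x * indicator S x)" if "S \<in> sets borel" for S
    using that by (intro integrable_bounded_mult[OF u, where B = 1]) (auto simp: indicator_def)
  have Re: "(LINT x|torus_measure. Re (u x) * indicator S x) = 0" if "S \<in> sets torus_measure" for S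
  proof -
    have "(LINT x|torus_measure. Re (u x * indicator S x)) = 0"
      using integral_Re[OF int] integral_set_eq_0[OF u 1] that by simp
    moreover have "Re (u x * indicator S x) = Re (u x) * indicator S x" for x
      by (simp add: indicator_def)
    ultimately show ?thesis by simp
  qed
  have Im: "(LINT x|torus_measure. Im (u x) * indicator S x) = 0" if "S \<in> sets torus_measure" for S
  proof -
    have "(LINT x|torus_measure. Im (u x * indicator S x)) = 0"
      using integral_Im[OF int] integral_set_eq_0[OF u 1] that by simp
    moreover have "Im (u x * indicator S x) = Im (u x) * indicator S x" for x
      by (simp add: indicator_def)
    ultimately show ?thesis by simp
  qed
  have "AE x in torus_measure. Re (u x) = 0"
    by (rule AE_zero_if_set_integrals_zero[OF integrable_Re[OF u] Re])
  moreover have "AE x in torus_measure. Im (u x) = 0"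
    by (rule AE_zero_if_set_integrals_zero[OF integrable_Im[OF u] Im])
  ultimately show ?thesis
    by eventually_elim (simp add: complex_eq_iff)
qed

section \<open>The Laplacian in the basis of exponentials\<close>

definition freq :: "nat \<Rightarrow> int ^ 'n::finite" where
  "freq = from_nat_into UNIV"

lemma bij_freq: "bij (freq :: nat \<Rightarrow> int ^ 'n)"
proof -
  have "inj (axis i :: int \<Rightarrow> int ^ 'n)" for i
    by (auto simp: inj_def axis_eq_axis)
  then have "infinite (UNIV :: (int ^ 'n) set)"
    using finite_imageD[of "axis i :: int \<Rightarrow> int ^ 'n" UNIV for i] finite_subset[OF subset_UNIV] infinite_UNIV_int
    by blast
  then show ?thesis
    unfolding freq_def by (intro bij_betw_from_nat_into) auto
qed

definition expb :: "nat \<Rightarrow> 'n::finite L2_torus" where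
  "expb k = abs_L2_torus (expi (freq k))"

lemma square_integrable_expi: "square_integrable (expi m)"
  by (rule square_integrable_continuous[OF continuous_on_expi])

lemma cinner_abs_L2_torus:
  assumes "square_integrable u" "square_integrable v"
  shows "cinner (abs_L2_torus u) (abs_L2_torus v) = (LINT x|torus_measure. cnj (u x) * v x)"
  using assms by (simp add: cinner_L2_torus_def L2_cinner.abs_eq)

lemma abs_L2_torus_eqI:
  assumes "square_integrable u" "square_integrable v" "AE x in torus_measure. u x = v x"
  shows "abs_L2_torus u = abs_L2_torus v"
  using assms by (intro Quotient_rel_abs[OF Quotient_L2_torus]) simp

lemma rep_abs_L2_torus:
  assumes "square_integrable u"
  shows "AE x in torus_measure. rep_L2_torus (abs_L2_torus u) x = u x"
  using Quotient_rep_abs[OF Quotient_L2_torus, of u] assms by simp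

lemma square_integrable_integrable:
  assumes "square_integrable u"
  shows "integrable torus_measure u"
  using square_integrable_product[OF square_integrable_continuous[of "\<lambda>_. 1"] assms] by simp

interpretation torus: hilbert_basis "expb :: nat \<Rightarrow> 'n::finite L2_torus"
proof
  show "orthonormal UNIV (expb :: nat \<Rightarrow> 'n L2_torus)"
    unfolding orthonormal_def
  proof safe
    fix j k
    have "cinner (expb j) (expb k :: 'n L2_torus) = (LINT x|torus_measure. expi (freq k - freq j :: int ^ 'n) x)"
      by (simp add: expb_def cinner_abs_L2_torus square_integrable_expi cnj_expi expi_mult)
    also have "\<dots> = (if j = k then 1 else 0)"
      using bij_is_inj[OF bij_freq[where 'n = 'n]] by (auto simp: integral_expi inj_eq)
    finally show "cinner (expb j) (expb k :: 'n L2_torus) = (if j = k then 1 else 0)" .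
  qed
  fix x :: "'n L2_torus"
  assume 0: "\<And>k. cinner (expb k) x = 0"
  have "(LINT y|torus_measure. expi m y * rep_L2_torus x y) = 0" for m
  proof -
    obtain k where k: "freq k = - m"
      using bij_is_surj[OF bij_freq[where 'n = 'n]] by (metis surjD)
    have "cinner (abs_L2_torus (expi (- m))) (abs_L2_torus (rep_L2_torus x)) = 0"
      using 0[of k] by (simp add: expb_def k abs_rep_L2_torus)
    then show ?thesis
      by (simp add: cinner_abs_L2_torus square_integrable_expi square_integrable_rep cnj_expi)
  qed
  then have "AE y in torus_measure. rep_L2_torus x y = 0"
    by (intro expi_complete square_integrable_integrable square_integrable_rep)
  then have "abs_L2_torus (rep_L2_torus x) = abs_L2_torus (\<lambda>_. 0)"
    by (intro abs_L2_torus_eqI square_integrable_rep square_integrable_zero)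
  then show "x = 0"
    by (simp add: abs_rep_L2_torus zero_L2_torus_def)
qed

definition eigenvalue :: "'n::finite itself \<Rightarrow> nat \<Rightarrow> real" where
  "eigenvalue _ k = of_int (\<Sum>i\<in>UNIV. (freq k $ (i :: 'n))\<^sup>2)"

lemma Laplacian_expb: "(expb k, eigenvalue TYPE('n) k *\<^sub>R expb k) \<in> (Laplacian :: ('n::finite L2_torus \<times> _) set)"
proof -
  have "(abs_L2_torus (expi (freq k)), abs_L2_torus (hodge_laplacian (expi (freq k)))) \<in> (Laplacian :: ('n L2_torus \<times> _) set)"
    unfolding Laplacian_def using smooth_torus_expi by (intro subsetD[OF closure_subset]) blast
  moreover have "abs_L2_torus (hodge_laplacian (expi (freq k))) = eigenvalue TYPE('n) k *\<^sub>R (expb k :: 'n L2_torus)"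
    unfolding hodge_laplacian_expi expb_def scaleR_L2_torus_def eigenvalue_def
    using square_integrable_expi by (subst L2_scale.abs_eq) auto
  ultimately show ?thesis
    by (simp add: expb_def)
qed

lemma Laplacian_coeff:
  assumes "(v, w) \<in> (Laplacian :: ('n::finite L2_torus \<times> _) set)"
  shows "cinner (expb k) w = complex_of_real (eigenvalue TYPE('n) k) * cinner (expb k) v"
proof -
  let ?F = "{p :: 'n L2_torus \<times> 'n L2_torus. cinner (expb k) (snd p) = complex_of_real (eigenvalue TYPE('n) k) * cinner (expb k) (fst p)}"
  have "closed ?F"
    by (intro closed_Collect_eq continuous_intros
      bounded_linear.continuous_on[OF cinner.bounded_linear_right])
  moreover have "{(abs_L2_torus u, abs_L2_torus (hodge_laplacian u)) | u. smooth_torus u} \<subseteq> ?F"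
  proof safe
    fix u :: "real ^ 'n \<Rightarrow> complex" assume u: "smooth_torus u"
    then have "square_integrable u" "square_integrable (hodge_laplacian u)"
      by (auto intro: square_integrable_continuous smooth_torus_continuous continuous_on_hodge_laplacian)
    then show "cinner (expb k) (snd (abs_L2_torus u, abs_L2_torus (hodge_laplacian u))) =
        complex_of_real (eigenvalue TYPE('n) k) * cinner (expb k) (fst (abs_L2_torus u, abs_L2_torus (hodge_laplacian u)))"
      using integral_expi_laplacian[OF u, of "- freq k"]
      by (simp add: expb_def cinner_abs_L2_torus square_integrable_expi cnj_expi eigenvalue_def)
  qed
  ultimately have "Laplacian \<subseteq> ?F"
    unfolding Laplacian_def by (intro closure_minimal)
  then show ?thesis
    using assms by auto
qed

lemma function_of_Laplacian:
  assumes G: "bounded (range G)"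
  shows "(function_of G Laplacian :: 'n::finite L2_torus op) = real_diag_op expb (\<lambda>k. G (eigenvalue TYPE('n) k))"
    (is "?T = ?D")
proof -
  have b: "bounded (range (\<lambda>k. complex_of_real (G (eigenvalue TYPE('n) k))))"
    using G by (auto simp: bounded_iff)
  have "complex_linear ?D"
    by (rule complex_linear_diag_op[OF torus.basis_orthonormal b])
  moreover have "?D v = G s *\<^sub>R v" if v: "(v, s *\<^sub>R v) \<in> Laplacian" for v s
  proof -
    have "cinner (expb k) (?D v - G s *\<^sub>R v) = 0" for k
    proof -
      have "complex_of_real s * cinner (expb k) v = complex_of_real (eigenvalue TYPE('n) k) * cinner (expb k) v"
        using Laplacian_coeff[OF v, of k] by (simp add: cinner_scaleR_right scaleR_conv_of_real)
      then show ?thesis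
        by (auto simp: cinner.diff_right cinner_diag_op[OF torus.basis_orthonormal b] cinner_scaleR_right
          scaleR_conv_of_real)
    qed
    then have "?D v - G s *\<^sub>R v = 0"
      by (rule torus.basis_total)
    then show ?thesis by simp
  qed
  ultimately have "complex_linear ?D \<and> (\<forall>v s. (v, s *\<^sub>R v) \<in> Laplacian \<longrightarrow> ?D v = G s *\<^sub>R v)"
    by blast
  from someI[of "\<lambda>T. complex_linear T \<and> (\<forall>v s. (v, s *\<^sub>R v) \<in> Laplacian \<longrightarrow> T v = G s *\<^sub>R v)", OF this]
  have "complex_linear ?T" "\<And>v s. (v, s *\<^sub>R v) \<in> Laplacian \<Longrightarrow> ?T v = G s *\<^sub>R v"
    unfolding function_of_def by blast+
  then show ?thesis
    using Laplacian_expb[where 'n = 'n] by (intro torus.op_eq_diag_op b) (simp_all add: scaleR_scaleC)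
qed

section \<open>Weak trace estimates\<close>

lemma abs_L2_torus_sum_expi:
  assumes "finite F"
  shows "abs_L2_torus (\<lambda>x. \<Sum>k\<in>F. c k * expi (freq k) x) = (\<Sum>k\<in>F. c k *\<^sub>C (expb k :: 'n::finite L2_torus))"
    and "square_integrable (\<lambda>x :: real ^ 'n. \<Sum>k\<in>F. c k * expi (freq k) x)"
proof -
  show sq: "square_integrable (\<lambda>x :: real ^ 'n. \<Sum>k\<in>F. c k * expi (freq k) x)" for F
    by (intro square_integrable_continuous continuous_intros continuous_on_expi)
  show "abs_L2_torus (\<lambda>x. \<Sum>k\<in>F. c k * expi (freq k) x) = (\<Sum>k\<in>F. c k *\<^sub>C (expb k :: 'n L2_torus))"
    using assms
  proof (induction F rule: finite_induct)
    case empty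
    then show ?case
      by (simp add: zero_L2_torus_def)
  next
    case (insert k F)
    have "abs_L2_torus (\<lambda>x. c k * expi (freq k) x) = c k *\<^sub>C (expb k :: 'n L2_torus)"
      by (simp add: scaleC_L2_torus_def expb_def L2_scale.abs_eq square_integrable_expi)
    moreover have "abs_L2_torus (\<lambda>x :: real ^ 'n. c k * expi (freq k) x + (\<Sum>k\<in>F. c k * expi (freq k) x)) =
        abs_L2_torus (\<lambda>x. c k * expi (freq k) x) + abs_L2_torus (\<lambda>x. \<Sum>k\<in>F. c k * expi (freq k) x)"
      using sq[of F] square_integrable_mult[OF square_integrable_expi[of "freq k"], of "c k"]
      by (subst plus_L2_torus.abs_eq) simp_all
    ultimately show ?case
      using insert by simp
  qed
qed

lemma rep_L2_torus_plus:
  "AE x in torus_measure. rep_L2_torus (u + v) x = rep_L2_torus u x + rep_L2_torus v x"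
proof -
  have "u + v = abs_L2_torus (\<lambda>x. rep_L2_torus u x + rep_L2_torus v x)"
    using plus_L2_torus.abs_eq[of "rep_L2_torus u" "rep_L2_torus v"]
    by (simp add: square_integrable_rep abs_rep_L2_torus)
  then show ?thesis
    using rep_abs_L2_torus[OF square_integrable_add[OF square_integrable_rep square_integrable_rep]] by simp
qed

lemma rep_L2_torus_scale:
  "AE x in torus_measure. rep_L2_torus (c *\<^sub>C u) x = c * rep_L2_torus u x"
proof -
  have "c *\<^sub>C u = abs_L2_torus (\<lambda>x. c * rep_L2_torus u x)"
    using L2_scale.abs_eq[of "rep_L2_torus u" c]
    by (simp add: square_integrable_rep abs_rep_L2_torus scaleC_L2_torus_def)
  then show ?thesis
    using rep_abs_L2_torus[OF square_integrable_mult[OF square_integrable_rep]] by simp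
qed

lemma borel_measurable_rep [measurable]: "rep_L2_torus u \<in> borel_measurable borel"
  using conjunct1[OF square_integrable_rep[of u, unfolded square_integrable_def]] by simp

lemma nn_integral_rep: "(\<integral>\<^sup>+x. ennreal ((cmod (rep_L2_torus u x))\<^sup>2) \<partial>torus_measure) = ennreal ((norm u)\<^sup>2)"
  using square_integrable_rep[of u] norm_abs_L2_torus[OF square_integrable_rep, of u]
  by (subst nn_integral_eq_integral) (auto simp: square_integrable_def abs_rep_L2_torus)

lemma cmod_add_power2_le: "(cmod (a + b))\<^sup>2 \<le> 2 * (cmod a)\<^sup>2 + 2 * (cmod b)\<^sup>2"
proof -
  have "(cmod (a + b))\<^sup>2 \<le> (cmod a + cmod b)\<^sup>2"
    by (intro power_mono norm_triangle_ineq) auto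
  also have "\<dots> \<le> 2 * (cmod a)\<^sup>2 + 2 * (cmod b)\<^sup>2"
    using sum_squares_bound[of "cmod a" "cmod b"] by (simp add: power2_sum)
  finally show ?thesis .
qed

lemma ln_level_le:
  assumes n: "1 \<le> n"
  shows "ln (1 + real (n * (j + 1) ^ 4)) \<le> ln (1 + real n) * (1 + 8 * ln (1 + real j))"
proof -
  have one: "(1 :: real) \<le> (1 + real j) ^ 4"
    by (intro one_le_power) simp
  have "1 + real (n * (j + 1) ^ 4) \<le> (1 + real n) * (1 + real j) ^ 4"
    using one by (simp add: distrib_right add.commute)
  then have "ln (1 + real (n * (j + 1) ^ 4)) \<le> ln ((1 + real n) * (1 + real j) ^ 4)"
    by (intro ln_mono) (auto simp: add_pos_nonneg)
  also have "\<dots> = ln (1 + real n) + 4 * ln (1 + real j)"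
    by (simp add: ln_mult_pos ln_realpow)
  also have "4 * ln (1 + real j) \<le> ln (1 + real n) * (8 * ln (1 + real j))"
  proof -
    have "1/2 \<le> ln (2 :: real)"
      using ln2_ge_two_thirds by simp
    also have "ln 2 \<le> ln (1 + real n)"
      using n by (intro ln_mono) auto
    finally have "1/2 * (8 * ln (1 + real j)) \<le> ln (1 + real n) * (8 * ln (1 + real j))"
      by (intro mult_right_mono) auto
    then show ?thesis by simp
  qed
  finally show ?thesis
    by (simp add: distrib_left)
qed

lemma powr_add_le:
  fixes a b p :: real
  assumes "0 \<le> a" "0 \<le> b" "0 \<le> p"
  shows "(a + b) powr p \<le> 2 powr p * (a powr p + b powr p)"
proof -
  have "(a + b) powr p \<le> (2 * max a b) powr p"
    using assms by (intro powr_mono2) auto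
  also have "\<dots> = 2 powr p * max a b powr p"
    using assms by (simp add: powr_mult)
  also have "\<dots> \<le> 2 powr p * (a powr p + b powr p)"
    by (intro mult_left_mono) (auto simp: max_def)
  finally show ?thesis .
qed

lemma le_one_plus_powr:
  fixes m p :: real
  assumes "0 \<le> m" "1 \<le> p"
  shows "m \<le> (1 + m) powr p"
proof -
  have "(1 + m) powr 1 \<le> (1 + m) powr p"
    using assms by (intro powr_mono) auto
  then show ?thesis
    using assms by simp
qed

lemma summable_inverse_squares: "summable (\<lambda>j. 1 / (1 + real j)\<^sup>2)"
  using summable_Suc_iff[of "\<lambda>n. 1 / real n ^ 2"] inverse_power_summable[of 2, where 'a = real]
  by (simp add: inverse_eq_divide add.commute)

definition llog :: "real \<Rightarrow> real" where
  "llog h = h * (1 + 8 * ln (1 + h))"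

locale torus_operator =
  fixes A :: "'n::finite L2_torus op" and a :: "nat \<Rightarrow> real" and C :: real
  assumes A_eq: "A = real_diag_op expb a"
    and a_nonneg: "\<And>k. 0 \<le> a k" and a_bounded: "bounded (range a)"
    and A_L1: "A \<in> L1_inf" and C_nonneg: "0 \<le> C"
    and C: "\<And>n. (\<Sum>k<n. singular_value A k) \<le> C * ln (1 + real n)"
begin

lemmas on = torus.basis_orthonormal[where 'n = 'n]

lemma positive_A: "positive_op A"
  unfolding A_eq by (rule positive_diag_op[OF torus.basis_orthonormal a_bounded a_nonneg])

lemma sqrt_A: "sqrt_op A = real_diag_op expb (\<lambda>k. sqrt (a k))"
  unfolding A_eq by (rule sqrt_op_diag[OF torus.basis_orthonormal a_bounded a_nonneg])

lemma sqrt_a_bounded: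
  "bounded (range (\<lambda>k. complex_of_real (if P k then sqrt (a k) else 0)))"
proof -
  obtain B where B: "\<And>k. \<bar>a k\<bar> \<le> B"
    using a_bounded by (auto simp: bounded_iff)
  have "\<bar>sqrt (a k)\<bar> \<le> sqrt B" for k
    using B[of k] a_nonneg[of k] by simp
  moreover from this have "0 \<le> sqrt B"
    using abs_ge_zero order_trans by blast
  ultimately show ?thesis
    by (auto simp: bounded_iff intro!: exI[of _ "sqrt B"])
qed

lemma sqrt_a_bounded': "bounded (range (\<lambda>k. complex_of_real (sqrt (a k))))"
  using sqrt_a_bounded[of "\<lambda>_. True"] by simp

lemma sum_a_le:
  assumes "finite F"
  shows "(\<Sum>k\<in>F. a k) \<le> C * ln (1 + real (card F))"
proof -
  have b: "bounded (range (\<lambda>k. complex_of_real (a k)))"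
    using a_bounded by (auto simp: bounded_iff)
  have onF: "orthonormal F (expb :: nat \<Rightarrow> 'n L2_torus)"
    by (rule orthonormal_subset[OF on]) simp
  have "Re (cinner (expb k) (A (expb k))) = a k" for k
    using diag_op_eigen[OF on b, of k] orthonormalD[OF on, of k k]
    by (simp add: A_eq cinner_scaleC_right)
  then have "(\<Sum>k\<in>F. a k) = (\<Sum>k\<in>F. Re (cinner (expb k) (A (expb k))))"
    by simp
  also have "\<dots> \<le> (\<Sum>k<card F. singular_value A k)"
    by (intro torus.ky_fan torus.L1_inf_compact A_L1 positive_A assms onF)
  also have "\<dots> \<le> C * ln (1 + real (card F))"
    by (rule C)
  finally show ?thesis .
qed

lemma large_a_finite:
  assumes N: "1 \<le> N"
  defines "t \<equiv> C * ln (1 + real N) / real N"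
  shows "finite {k. t < a k}" "(\<Sum>k | t < a k. a k) \<le> C * ln (1 + real N)"
proof -
  let ?F = "{k. t < a k}"
  have no: False if V: "V \<subseteq> ?F" "finite V" "card V = N" for V
  proof -
    have "real N * t < (\<Sum>k\<in>V. a k)"
      using V N sum_strict_mono[of V "\<lambda>_. t" a] by (cases "V = {}") auto
    also have "\<dots> \<le> C * ln (1 + real N)"
      using sum_a_le[OF V(2)] V(3) by simp
    finally show False
      using N by (simp add: t_def)
  qed
  show fin: "finite ?F"
    using no infinite_arbitrarily_large[of ?F N] by blast
  have "card ?F < N"
  proof (rule ccontr)
    assume "\<not> card ?F < N"
    then obtain V where "V \<subseteq> ?F" "card V = N" "finite V"
      using obtain_subset_with_card_n[of N ?F] by auto
    then show False
      using no by blast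
  qed
  then have "C * ln (1 + real (card ?F)) \<le> C * ln (1 + real N)"
    by (intro mult_left_mono ln_mono C_nonneg) auto
  then show "(\<Sum>k\<in>?F. a k) \<le> C * ln (1 + real N)"
    using sum_a_le[OF fin] by simp
qed

text \<open>Cutting off the large eigenvalues splits \<open>\<surd>A w\<close> into a trigonometric polynomial, controlled pointwise
  by Bessel's inequality because the exponentials have modulus one, and a remainder of small norm.\<close>

lemma sqrt_A_split:
  assumes F: "finite F" and t: "\<And>k. k \<notin> F \<Longrightarrow> a k \<le> t" "0 \<le> t"
    and W: "finite W" "orthonormal W (\<lambda>x. x)"
  obtains g :: "'n L2_torus \<Rightarrow> 'n L2_torus" where
    "\<And>w. (norm (g w))\<^sup>2 \<le> t * (norm w)\<^sup>2"
    "AE x in torus_measure. (\<Sum>w\<in>W. (cmod (rep_L2_torus (sqrt_op A w) x))\<^sup>2) \<le>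
       2 * (\<Sum>k\<in>F. a k) + 2 * (\<Sum>w\<in>W. (cmod (rep_L2_torus (g w) x))\<^sup>2)"
proof
  let ?s = "\<lambda>k. complex_of_real (if k \<notin> F then sqrt (a k) else 0)"
  define g :: "'n L2_torus \<Rightarrow> 'n L2_torus" where "g = diag_op expb ?s"
  have b: "bounded (range ?s)"
    by (rule sqrt_a_bounded)
  show "(norm (g w))\<^sup>2 \<le> t * (norm w)\<^sup>2" for w
  proof -
    have "cmod (?s k) \<le> sqrt t" for k
      using t a_nonneg by simp
    then have "norm (g w) \<le> sqrt t * norm w"
      unfolding g_def by (rule norm_diag_op_le[OF on b])
    then have "(norm (g w))\<^sup>2 \<le> (sqrt t * norm w)\<^sup>2"
      by (intro power_mono) auto
    then show ?thesis
      using t(2) by (simp add: power_mult_distrib)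
  qed
  define c where "c w k = complex_of_real (sqrt (a k)) * cinner (expb k) w" for w :: "'n L2_torus" and k
  define f where "f w x = (\<Sum>k\<in>F. c w k * expi (freq k) x)" for w and x :: "real ^ 'n"
  have decomp: "sqrt_op A w = (\<Sum>k\<in>F. c w k *\<^sub>C expb k) + g w" for w
  proof -
    have "cinner (expb j) (sqrt_op A w - ((\<Sum>k\<in>F. c w k *\<^sub>C expb k) + g w)) = 0" for j
    proof -
      have "cinner (expb j) (\<Sum>k\<in>F. c w k *\<^sub>C (expb k :: 'n L2_torus)) = (\<Sum>k\<in>F. c w k * (if j = k then 1 else 0))"
        by (simp add: cinner.sum_right cinner_scaleC_right orthonormalD[OF on])
      also have "\<dots> = (if j \<in> F then c w j else 0)"
        using F by (simp add: if_distrib sum.delta' cong: if_cong)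
      finally show ?thesis
        by (simp add: cinner.diff_right cinner_add_right g_def cinner_diag_op[OF on b] sqrt_A
          cinner_diag_op[OF on sqrt_a_bounded'] c_def)
    qed
    then have "sqrt_op A w - ((\<Sum>k\<in>F. c w k *\<^sub>C expb k) + g w) = 0"
      by (rule torus.basis_total)
    then show ?thesis by simp
  qed
  have rep: "AE x in torus_measure. rep_L2_torus (sqrt_op A w) x = f w x + rep_L2_torus (g w) x" for w
    using rep_L2_torus_plus[of "\<Sum>k\<in>F. c w k *\<^sub>C expb k" "g w"]
      rep_abs_L2_torus[OF abs_L2_torus_sum_expi(2)[OF F, of "c w"]]
    unfolding decomp[symmetric] abs_L2_torus_sum_expi(1)[OF F]
    by eventually_elim (simp add: f_def)
  have f_le: "(\<Sum>w\<in>W. (cmod (f w x))\<^sup>2) \<le> (\<Sum>k\<in>F. a k)" for x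
  proof -
    define z where "z = (\<Sum>k\<in>F. (complex_of_real (sqrt (a k)) * cnj (expi (freq k) x)) *\<^sub>C (expb k :: 'n L2_torus))"
    have "f w x = cinner z w" for w
      by (simp add: f_def z_def c_def cinner.sum_left cinner_scaleC_left ac_simps)
    then have "(\<Sum>w\<in>W. (cmod (f w x))\<^sup>2) = (\<Sum>w\<in>W. (cmod (cinner w z))\<^sup>2)"
      by (simp add: cmod_cinner_commute)
    also have "\<dots> \<le> (norm z)\<^sup>2"
      by (rule bessel[OF W(2,1)])
    also have "\<dots> = (\<Sum>k\<in>F. (cmod (complex_of_real (sqrt (a k)) * cnj (expi (freq k) x)))\<^sup>2)"
      unfolding z_def by (intro norm_orthonormal_sum F orthonormal_subset[OF on]) simp
    also have "\<dots> = (\<Sum>k\<in>F. a k)"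
      using a_nonneg by (simp add: norm_mult)
    finally show ?thesis .
  qed
  have "AE x in torus_measure. \<forall>w\<in>W. rep_L2_torus (sqrt_op A w) x = f w x + rep_L2_torus (g w) x"
    using rep by (intro AE_finite_allI W(1)) blast
  then show "AE x in torus_measure. (\<Sum>w\<in>W. (cmod (rep_L2_torus (sqrt_op A w) x))\<^sup>2) \<le>
       2 * (\<Sum>k\<in>F. a k) + 2 * (\<Sum>w\<in>W. (cmod (rep_L2_torus (g w) x))\<^sup>2)"
  proof eventually_elim
    case (elim x)
    then have "(\<Sum>w\<in>W. (cmod (rep_L2_torus (sqrt_op A w) x))\<^sup>2) = (\<Sum>w\<in>W. (cmod (f w x + rep_L2_torus (g w) x))\<^sup>2)"
      by simp
    also have "\<dots> \<le> (\<Sum>w\<in>W. 2 * (cmod (f w x))\<^sup>2 + 2 * (cmod (rep_L2_torus (g w) x))\<^sup>2)"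
      by (intro sum_mono cmod_add_power2_le)
    also have "\<dots> = 2 * (\<Sum>w\<in>W. (cmod (f w x))\<^sup>2) + 2 * (\<Sum>w\<in>W. (cmod (rep_L2_torus (g w) x))\<^sup>2)"
      by (simp add: sum.distrib sum_distrib_left)
    also have "\<dots> \<le> 2 * (\<Sum>k\<in>F. a k) + 2 * (\<Sum>w\<in>W. (cmod (rep_L2_torus (g w) x))\<^sup>2)"
      using f_le[of x] by simp
    finally show ?case .
  qed
qed

text \<open>On the level set \<open>\<lfloor>h\<rfloor> = j\<close> the eigenvalues are cut off after about \<open>N (j + 1)\<^sup>4\<close> terms, so that the
  contributions of the remainders are summable over \<open>j\<close>.\<close>

lemma level_estimate:
  fixes h :: "real ^ 'n \<Rightarrow> real"
  assumes h [measurable]: "h \<in> borel_measurable borel" and h0: "\<And>x. 0 \<le> h x"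
    and W: "finite W" "orthonormal W (\<lambda>x. x)" "W \<noteq> {}"
  shows "(\<integral>\<^sup>+x. ennreal (h x * (\<Sum>w\<in>W. (cmod (rep_L2_torus (sqrt_op A w) x))\<^sup>2)) \<partial>torus_measure) \<le>
    ennreal (2 * C * ln (1 + real (card W))) * (\<integral>\<^sup>+x. ennreal (llog (h x)) \<partial>torus_measure) +
    ennreal (18 * C * ln (1 + real (card W)) * (\<Sum>j. 1 / (1 + real j)\<^sup>2))"
proof -
  define n where "n = card W"
  define D where "D = 2 * C * ln (1 + real n)"
  define S where "S x = (\<Sum>w\<in>W. (cmod (rep_L2_torus (sqrt_op A w) x))\<^sup>2)" for x
  define L where "L j = {x. nat \<lfloor>h x\<rfloor> = j}" for j
  define N where "N j = n * (j + 1) ^ 4" for j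
  define t where "t j = C * ln (1 + real (N j)) / real (N j)" for j
  have n: "1 \<le> n"
    using W by (simp add: n_def Suc_le_eq card_gt_0_iff)
  have N1: "1 \<le> N j" for j
    using n by (simp add: N_def)
  have D0: "0 \<le> D"
    using C_nonneg by (simp add: D_def)
  have t0: "0 \<le> t j" for j
    using C_nonneg by (simp add: t_def)
  have [measurable]: "S \<in> borel_measurable borel"
    unfolding S_def by measurable
  have [measurable]: "L j \<in> sets borel" for j
    unfolding L_def by measurable
  have [measurable]: "(\<lambda>x. llog (h x)) \<in> borel_measurable borel"
    unfolding llog_def by measurable
  have S0: "0 \<le> S x" for x
    by (simp add: S_def sum_nonneg)
  have disj: "disjoint_family L"
    by (auto simp: disjoint_family_on_def L_def)
  have split: "(\<Sum>j. c * indicator (L j) x) = c" for c :: ennreal and x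
    using suminf_cmult_indicator[OF disj, of x "nat \<lfloor>h x\<rfloor>" "\<lambda>_. c"] by (simp add: L_def)
  have level: "(\<integral>\<^sup>+x. ennreal (h x * S x) * indicator (L j) x \<partial>torus_measure) \<le>
      (\<integral>\<^sup>+x. ennreal (D * llog (h x)) * indicator (L j) x \<partial>torus_measure) + ennreal (9 * D * (1 / (1 + real j)\<^sup>2))" for j
  proof -
    let ?F = "{k. t j < a k}"
    have F: "finite ?F" "(\<Sum>k\<in>?F. a k) \<le> C * ln (1 + real (N j))"
      using large_a_finite[OF N1[of j]] by (simp_all add: t_def)
    obtain g where g: "\<And>w. (norm (g w))\<^sup>2 \<le> t j * (norm w)\<^sup>2"
      and AE: "AE x in torus_measure. S x \<le> 2 * (\<Sum>k\<in>?F. a k) + 2 * (\<Sum>w\<in>W. (cmod (rep_L2_torus (g w) x))\<^sup>2)"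
      using sqrt_A_split[OF F(1) _ t0 W(1,2), of j] unfolding S_def by (metis (mono_tags) mem_Collect_eq not_le)
    define T where "T x = (\<Sum>w\<in>W. (cmod (rep_L2_torus (g w) x))\<^sup>2)" for x
    have [measurable]: "T \<in> borel_measurable borel"
      unfolding T_def by measurable
    have T0: "0 \<le> T x" for x
      by (simp add: T_def sum_nonneg)
    have T: "(\<integral>\<^sup>+x. ennreal (T x) \<partial>torus_measure) \<le> ennreal (real n * t j)"
    proof -
      have "(\<integral>\<^sup>+x. ennreal (T x) \<partial>torus_measure) = (\<integral>\<^sup>+x. (\<Sum>w\<in>W. ennreal ((cmod (rep_L2_torus (g w) x))\<^sup>2)) \<partial>torus_measure)"
        by (simp add: T_def sum_ennreal)
      also have "\<dots> = (\<Sum>w\<in>W. ennreal ((norm (g w))\<^sup>2))"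
        by (subst nn_integral_sum) (auto simp: nn_integral_rep)
      also have "\<dots> \<le> (\<Sum>w\<in>W. ennreal (t j))"
        using g orthonormal_norm[OF W(2)] by (intro sum_mono ennreal_leI) (metis mult.right_neutral power_one)
      also have "\<dots> = ennreal (real n * t j)"
        using t0[of j] by (simp add: n_def ennreal_mult ennreal_of_nat_eq_real_of_nat)
      finally show ?thesis .
    qed
    have log: "ln (1 + real (N j)) \<le> ln (1 + real n) * (1 + 8 * ln (1 + real j))"
      unfolding N_def by (rule ln_level_le[OF n])
    have "AE x in torus_measure. ennreal (h x * S x) * indicator (L j) x \<le>
        ennreal (D * llog (h x)) * indicator (L j) x + ennreal (2 * (1 + real j)) * ennreal (T x)"
      using AE
    proof eventually_elim
      case (elim x)
      show ?case
      proof (cases "x \<in> L j")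
        case True
        then have j: "real j \<le> h x" "h x \<le> 1 + real j"
          using h0[of x] by (auto simp: L_def) linarith+
        have "h x * S x \<le> h x * (2 * (\<Sum>k\<in>?F. a k) + 2 * T x)"
          using elim h0 by (intro mult_left_mono) (auto simp: T_def)
        also have "\<dots> = h x * (2 * (\<Sum>k\<in>?F. a k)) + h x * (2 * T x)"
          by (rule distrib_left)
        also have "\<dots> \<le> D * llog (h x) + (2 * (1 + real j)) * T x"
        proof (rule add_mono)
          have "ln (1 + real j) \<le> ln (1 + h x)"
            using j by (intro ln_mono) auto
          then have "ln (1 + real n) * (1 + 8 * ln (1 + real j)) \<le> ln (1 + real n) * (1 + 8 * ln (1 + h x))"
            by (intro mult_left_mono) auto
          then have "C * ln (1 + real (N j)) \<le> C * (ln (1 + real n) * (1 + 8 * ln (1 + h x)))"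
            using log C_nonneg by (intro mult_left_mono) auto
          then have "h x * (2 * (\<Sum>k\<in>?F. a k)) \<le> h x * (2 * (C * (ln (1 + real n) * (1 + 8 * ln (1 + h x)))))"
            using F(2) h0[of x] by (intro mult_left_mono) auto
          then show "h x * (2 * (\<Sum>k\<in>?F. a k)) \<le> D * llog (h x)"
            by (simp add: D_def llog_def ac_simps)
          show "h x * (2 * T x) \<le> (2 * (1 + real j)) * T x"
            using mult_right_mono[OF j(2), of "2 * T x"] T0[of x] by (simp add: ac_simps)
        qed
        finally have "ennreal (h x * S x) \<le> ennreal (D * llog (h x) + (2 * (1 + real j)) * T x)"
          by (rule ennreal_leI)
        also have "\<dots> = ennreal (D * llog (h x)) + ennreal (2 * (1 + real j)) * ennreal (T x)"
          using D0 T0[of x] h0[of x] by (subst ennreal_plus) (auto simp: ennreal_mult llog_def)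
        finally show ?thesis
          using True by simp
      qed simp
    qed
    then have "(\<integral>\<^sup>+x. ennreal (h x * S x) * indicator (L j) x \<partial>torus_measure) \<le>
        (\<integral>\<^sup>+x. ennreal (D * llog (h x)) * indicator (L j) x + ennreal (2 * (1 + real j)) * ennreal (T x) \<partial>torus_measure)"
      by (rule nn_integral_mono_AE)
    also have "\<dots> = (\<integral>\<^sup>+x. ennreal (D * llog (h x)) * indicator (L j) x \<partial>torus_measure) +
        ennreal (2 * (1 + real j)) * (\<integral>\<^sup>+x. ennreal (T x) \<partial>torus_measure)"
      by (simp add: nn_integral_add nn_integral_cmult)
    also have "ennreal (2 * (1 + real j)) * (\<integral>\<^sup>+x. ennreal (T x) \<partial>torus_measure) \<le>
        ennreal (2 * (1 + real j)) * ennreal (real n * t j)"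
      by (intro mult_left_mono T) auto
    also have "\<dots> = ennreal (2 * (1 + real j) * (real n * t j))"
      using t0[of j] by (intro ennreal_mult[symmetric]) auto
    also have "\<dots> \<le> ennreal (9 * D * (1 / (1 + real j)\<^sup>2))"
    proof (rule ennreal_leI)
      let ?j = "1 + real j"
      have j: "1 \<le> ?j" by simp
      have alg: "2 * y * (m * (C * (l * (9 * y)) / (m * y ^ 4))) = 9 * (2 * C * l) * (1 / y\<^sup>2)"
        if "0 < y" "0 < m" for y m l :: real
        using that by (simp add: field_simps power2_eq_square power4_eq_xxxx)
      have "1 + 8 * ln ?j \<le> 9 * ?j"
        using ln_le_minus_one[of ?j] by simp
      then have "ln (1 + real (N j)) \<le> ln (1 + real n) * (9 * ?j)"
        using order_trans[OF log mult_left_mono[of "1 + 8 * ln ?j" "9 * ?j" "ln (1 + real n)"]] by simp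
      then have "C * ln (1 + real (N j)) \<le> C * (ln (1 + real n) * (9 * ?j))"
        using C_nonneg by (rule mult_left_mono)
      then have "t j \<le> C * (ln (1 + real n) * (9 * ?j)) / real (N j)"
        unfolding t_def using N1[of j] by (intro divide_right_mono) auto
      also have "real (N j) = real n * ?j ^ 4"
        by (simp add: N_def add.commute)
      finally have "2 * ?j * (real n * t j) \<le> 2 * ?j * (real n * (C * (ln (1 + real n) * (9 * ?j)) / (real n * ?j ^ 4)))"
        using j by (intro mult_left_mono) auto
      also have "\<dots> = 9 * D * (1 / ?j\<^sup>2)"
        unfolding D_def by (rule alg) (use n in auto)
      finally show "2 * ?j * (real n * t j) \<le> 9 * D * (1 / ?j\<^sup>2)" .
    qed
    finally show ?thesis
      by (simp add: add_mono)
  qed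
  have "(\<integral>\<^sup>+x. ennreal (h x * S x) \<partial>torus_measure) = (\<integral>\<^sup>+x. (\<Sum>j. ennreal (h x * S x) * indicator (L j) x) \<partial>torus_measure)"
    by (simp only: split)
  also have "\<dots> = (\<Sum>j. \<integral>\<^sup>+x. ennreal (h x * S x) * indicator (L j) x \<partial>torus_measure)"
    by (intro nn_integral_suminf) measurable
  also have "\<dots> \<le> (\<Sum>j. (\<integral>\<^sup>+x. ennreal (D * llog (h x)) * indicator (L j) x \<partial>torus_measure) + ennreal (9 * D * (1 / (1 + real j)\<^sup>2)))"
    by (intro suminf_le level) auto
  also have "\<dots> = (\<Sum>j. \<integral>\<^sup>+x. ennreal (D * llog (h x)) * indicator (L j) x \<partial>torus_measure) + (\<Sum>j. ennreal (9 * D * (1 / (1 + real j)\<^sup>2)))"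
    by (intro suminf_add[symmetric]) auto
  also have "(\<Sum>j. \<integral>\<^sup>+x. ennreal (D * llog (h x)) * indicator (L j) x \<partial>torus_measure) =
      (\<integral>\<^sup>+x. (\<Sum>j. ennreal (D * llog (h x)) * indicator (L j) x) \<partial>torus_measure)"
    by (intro nn_integral_suminf[symmetric]) measurable
  also have "\<dots> = (\<integral>\<^sup>+x. ennreal D * ennreal (llog (h x)) \<partial>torus_measure)"
    using D0 h0 by (simp only: split) (simp add: ennreal_mult llog_def)
  also have "\<dots> = ennreal D * (\<integral>\<^sup>+x. ennreal (llog (h x)) \<partial>torus_measure)"
    by (intro nn_integral_cmult) measurable
  also have "(\<Sum>j. ennreal (9 * D * (1 / (1 + real j)\<^sup>2))) = ennreal (\<Sum>j. 9 * D * (1 / (1 + real j)\<^sup>2))"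
    using D0 by (intro suminf_ennreal2 summable_mult summable_inverse_squares) auto
  also have "(\<Sum>j. 9 * D * (1 / (1 + real j)\<^sup>2)) = 9 * D * (\<Sum>j. 1 / (1 + real j)\<^sup>2)"
    by (rule suminf_mult[OF summable_inverse_squares])
  finally show ?thesis
    by (simp add: S_def D_def n_def mult.assoc)
qed

lemma llog_le:
  assumes p: "1 < p" and h: "0 \<le> h"
  shows "llog h \<le> (1 + 8 / (p - 1)) * 2 powr p * (1 + h powr p)"
proof -
  have "ln (1 + h) \<le> (1 + h) powr (p - 1) / (p - 1)"
    using p h by (intro ln_powr_bound) auto
  then have "1 + 8 * ln (1 + h) \<le> (1 + h) powr (p - 1) + 8 * ((1 + h) powr (p - 1) / (p - 1))"
    using p h ge_one_powr_ge_zero[of "1 + h" "p - 1"] by simp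
  also have "\<dots> = (1 + 8 / (p - 1)) * (1 + h) powr (p - 1)"
    by (simp add: distrib_right)
  finally have "llog h \<le> (1 + h) * ((1 + 8 / (p - 1)) * (1 + h) powr (p - 1))"
    unfolding llog_def using h by (intro mult_mono) auto
  also have "\<dots> = (1 + 8 / (p - 1)) * (1 + h) powr p"
  proof -
    have "(1 + h) powr p = (1 + h) powr 1 * (1 + h) powr (p - 1)"
      by (subst powr_add[symmetric]) simp
    then show ?thesis
      using h by simp
  qed
  also have "(1 + h) powr p \<le> 2 powr p * (1 + h powr p)"
    using powr_add_le[of 1 h p] p h by simp
  then have "(1 + 8 / (p - 1)) * (1 + h) powr p \<le> (1 + 8 / (p - 1)) * (2 powr p * (1 + h powr p))"
    using p by (intro mult_left_mono) auto
  finally show ?thesis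
    by (simp add: mult.assoc)
qed

lemma unit_ball_estimate:
  assumes p: "1 < p"
  obtains K where "0 \<le> K"
    "\<And>h W. h \<in> borel_measurable borel \<Longrightarrow> (\<And>x. 0 \<le> h x) \<Longrightarrow> integrable torus_measure (\<lambda>x. h x powr p) \<Longrightarrow>
      (LINT x|torus_measure. h x powr p) \<le> 1 \<Longrightarrow> finite W \<Longrightarrow> orthonormal W (\<lambda>x. x) \<Longrightarrow>
      (\<integral>\<^sup>+x. ennreal (h x * (\<Sum>w\<in>W. (cmod (rep_L2_torus (sqrt_op A w) x))\<^sup>2)) \<partial>torus_measure) \<le>
      ennreal (K * ln (1 + real (card W)))"
proof
  define c where "c = (1 + 8 / (p - 1)) * 2 powr p"
  define Z where "Z = (\<Sum>j. 1 / (1 + real j)\<^sup>2)"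
  have c: "0 \<le> c"
    using p by (simp add: c_def)
  have Z: "0 \<le> Z"
    unfolding Z_def by (intro suminf_nonneg summable_inverse_squares) simp
  define K where "K = 2 * C * (2 * c) + 18 * C * Z"
  show "0 \<le> K"
    using C_nonneg c Z by (simp add: K_def)
  fix h :: "real ^ 'n \<Rightarrow> real" and W :: "'n L2_torus set"
  assume h [measurable]: "h \<in> borel_measurable borel" and h0: "\<And>x. 0 \<le> h x"
    and int: "integrable torus_measure (\<lambda>x. h x powr p)" and le1: "(LINT x|torus_measure. h x powr p) \<le> 1"
    and W: "finite W" "orthonormal W (\<lambda>x. x)"
  show "(\<integral>\<^sup>+x. ennreal (h x * (\<Sum>w\<in>W. (cmod (rep_L2_torus (sqrt_op A w) x))\<^sup>2)) \<partial>torus_measure) \<le>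
      ennreal (K * ln (1 + real (card W)))"
  proof (cases "W = {}")
    case False
    let ?l = "ln (1 + real (card W))"
    have "(\<integral>\<^sup>+x. ennreal (llog (h x)) \<partial>torus_measure) \<le> (\<integral>\<^sup>+x. ennreal (c * (1 + h x powr p)) \<partial>torus_measure)"
      using llog_le[OF p h0] by (intro nn_integral_mono ennreal_leI) (simp add: c_def)
    also have "\<dots> = ennreal (LINT x|torus_measure. c * (1 + h x powr p))"
      using int c by (intro nn_integral_eq_integral) auto
    also have "(LINT x|torus_measure. c * (1 + h x powr p)) = c * (1 + (LINT x|torus_measure. h x powr p))"
      using int emeasure_torus_UNIV[where 'n = 'n] by (simp add: measure_def)
    also have "ennreal (c * (1 + (LINT x|torus_measure. h x powr p))) \<le> ennreal (c * 2)"
      using le1 c by (intro ennreal_leI mult_left_mono) auto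
    finally have "ennreal (2 * C * ?l) * (\<integral>\<^sup>+x. ennreal (llog (h x)) \<partial>torus_measure) \<le> ennreal (2 * C * ?l) * ennreal (c * 2)"
      by (intro mult_left_mono) auto
    then have "(\<integral>\<^sup>+x. ennreal (h x * (\<Sum>w\<in>W. (cmod (rep_L2_torus (sqrt_op A w) x))\<^sup>2)) \<partial>torus_measure) \<le>
        ennreal (2 * C * ?l) * ennreal (c * 2) + ennreal (18 * C * ?l * Z)"
      using level_estimate[OF h h0 W False] unfolding Z_def by (meson add_right_mono order_trans)
    also have "\<dots> = ennreal (2 * C * ?l * (c * 2) + 18 * C * ?l * Z)"
      using C_nonneg c Z by (simp add: ennreal_mult[symmetric] ennreal_plus[symmetric] del: ennreal_plus)
    also have "2 * C * ?l * (c * 2) + 18 * C * ?l * Z = K * ?l"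
      by (simp add: K_def algebra_simps)
    finally show ?thesis .
  qed simp
qed

end

section \<open>The symmetrised products\<close>

definition lp_nonneg :: "real \<Rightarrow> (real ^ 'n::finite \<Rightarrow> real) set" where
  "lp_nonneg p = {h \<in> borel_measurable borel. (\<forall>x. 0 \<le> h x) \<and> integrable torus_measure (\<lambda>x. h x powr p)}"

lemma lp_nonneg_measurable [measurable_dest]: "h \<in> lp_nonneg p \<Longrightarrow> h \<in> borel_measurable borel"
  and lp_nonneg_nonneg: "h \<in> lp_nonneg p \<Longrightarrow> 0 \<le> h x"
  and lp_nonneg_integrable: "h \<in> lp_nonneg p \<Longrightarrow> integrable torus_measure (\<lambda>x. h x powr p)"
  by (simp_all add: lp_nonneg_def)

lemma lp_nonneg_dominated:
  fixes g :: "real ^ 'n::finite \<Rightarrow> real"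
  assumes g [measurable]: "g \<in> borel_measurable borel" and p: "0 \<le> p" and bound: "integrable torus_measure G"
    and le: "\<And>x. 0 \<le> g x" "AE x in torus_measure. g x powr p \<le> G x"
  shows "g \<in> lp_nonneg p"
proof -
  have "integrable torus_measure (\<lambda>x. g x powr p)"
  proof (rule Bochner_Integration.integrable_bound[OF bound])
    show "AE x in torus_measure. norm (g x powr p) \<le> norm (G x)"
      using le(2) by eventually_elim (auto intro: order_trans[OF _ abs_ge_self])
  qed measurable
  then show ?thesis
    using g le(1) by (simp add: lp_nonneg_def)
qed

lemma lp_nonneg_add:
  assumes g: "g \<in> lp_nonneg p" and h: "h \<in> lp_nonneg p" and p: "0 \<le> p"
  shows "(\<lambda>x. g x + h x) \<in> lp_nonneg p"
proof (rule lp_nonneg_dominated[where G = "\<lambda>x. 2 powr p * (g x powr p + h x powr p)"])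
  show "(\<lambda>x. g x + h x) \<in> borel_measurable borel"
    using g h by measurable
  show "integrable torus_measure (\<lambda>x. 2 powr p * (g x powr p + h x powr p))"
    using g h by (simp add: lp_nonneg_integrable)
  show "AE x in torus_measure. (g x + h x) powr p \<le> 2 powr p * (g x powr p + h x powr p)"
    using lp_nonneg_nonneg[OF g] lp_nonneg_nonneg[OF h] p by (intro always_eventually allI powr_add_le)
qed (use lp_nonneg_nonneg[OF g] lp_nonneg_nonneg[OF h] p in auto)

lemma lp_nonneg_scale:
  assumes h: "h \<in> lp_nonneg p" and r: "0 \<le> r" and p: "0 \<le> p"
  shows "(\<lambda>x. r * h x) \<in> lp_nonneg p"
proof (rule lp_nonneg_dominated[where G = "\<lambda>x. r powr p * h x powr p"])
  show "(\<lambda>x. r * h x) \<in> borel_measurable borel"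
    using h by measurable
  show "integrable torus_measure (\<lambda>x. r powr p * h x powr p)"
    using h by (simp add: lp_nonneg_integrable)
  show "AE x in torus_measure. (r * h x) powr p \<le> r powr p * h x powr p"
    using lp_nonneg_nonneg[OF h] r by (intro always_eventually) (simp add: powr_mult)
qed (use lp_nonneg_nonneg[OF h] p r in auto)

lemma lp_nonneg_bounded:
  fixes h :: "real ^ 'n::finite \<Rightarrow> real"
  assumes "h \<in> borel_measurable borel" "\<And>x. 0 \<le> h x" "\<And>x. h x \<le> B" "0 \<le> p"
  shows "h \<in> lp_nonneg p"
  using assms by (intro lp_nonneg_dominated[where G = "\<lambda>_. B powr p"]) (auto intro!: always_eventually powr_mono2)

lemma sqrt_op_square:
  assumes "positive_op T" "compact_op T" "orthonormal UNIV (e :: nat \<Rightarrow> 'h::complex_hilbert)"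
  shows "sqrt_op T o\<^sub>L sqrt_op T = (T :: 'h op)"
proof -
  obtain \<phi> :: "nat \<Rightarrow> 'h" and \<mu> where \<phi>: "orthonormal UNIV \<phi>" and \<mu>: "decseq \<mu>" "\<And>k. 0 \<le> \<mu> k" "\<mu> \<longlonglongrightarrow> 0"
    and eq: "T = real_diag_op \<phi> \<mu>"
    using compact_positive_spectral[OF assms] by blast
  have s: "decseq (\<lambda>k. sqrt (\<mu> k))" "\<And>k. 0 \<le> sqrt (\<mu> k)"
    using \<mu>(2) decseqD[OF \<mu>(1)] by (auto simp: decseq_def)
  note b = decseq_bounded_real(2)[OF s]
  have "complex_of_real (sqrt (\<mu> k)) * complex_of_real (sqrt (\<mu> k)) = complex_of_real (\<mu> k)" for k
    using \<mu>(2)[of k] by (simp flip: of_real_mult)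
  then show ?thesis
    unfolding eq sqrt_op_diag[OF \<phi> decseq_bounded_real(1)[OF \<mu>(1,2)] \<mu>(2)] diag_op_compose[OF \<phi> b b] by simp
qed

lemma ln_Suc_over_n: "(\<lambda>n. ln (1 + real n) / real n) \<longlonglongrightarrow> 0"
proof (rule tendsto_sandwich[OF _ _ tendsto_const])
  show "\<forall>\<^sub>F n in sequentially. 0 \<le> ln (1 + real n) / real n"
    by simp
  show "\<forall>\<^sub>F n in sequentially. ln (1 + real n) / real n \<le> (ln (real (Suc n)) / real (Suc n)) * 2"
    using eventually_gt_at_top[of 0]
  proof eventually_elim
    case (elim n)
    have "1 / real n \<le> 2 / real (Suc n)"
      using elim by (simp add: field_simps)
    then have "ln (real (Suc n)) * (1 / real n) \<le> ln (real (Suc n)) * (2 / real (Suc n))"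
      by (intro mult_left_mono) auto
    then show ?case
      by simp
  qed
  from tendsto_mult[OF LIMSEQ_Suc[OF lim_ln_over_n] tendsto_const[of 2]]
  show "(\<lambda>n. (ln (real (Suc n)) / real (Suc n)) * 2) \<longlonglongrightarrow> 0"
    by simp
qed

context torus_operator
begin

definition form :: "(real ^ 'n \<Rightarrow> real) \<Rightarrow> 'n L2_torus \<Rightarrow> real" where
  "form h u = (LINT x|torus_measure. h x * (cmod (rep_L2_torus (sqrt_op A u) x))\<^sup>2)"

lemma complex_linear_sqrt_A: "complex_linear (sqrt_op A)"
  unfolding sqrt_A by (rule complex_linear_diag_op[OF on sqrt_a_bounded'])

lemma lp_estimate:
  assumes p: "1 < p"
  obtains K where "0 \<le> K"
    "\<And>h l W. h \<in> lp_nonneg p \<Longrightarrow> 0 < l \<Longrightarrow> (LINT x|torus_measure. h x powr p) \<le> l powr p \<Longrightarrow>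
      finite W \<Longrightarrow> orthonormal W (\<lambda>x. x) \<Longrightarrow>
      (\<integral>\<^sup>+x. ennreal (h x * (\<Sum>w\<in>W. (cmod (rep_L2_torus (sqrt_op A w) x))\<^sup>2)) \<partial>torus_measure) \<le>
      ennreal (l * K * ln (1 + real (card W)))"
proof -
  obtain K where K: "0 \<le> K"
    "\<And>h W. h \<in> borel_measurable borel \<Longrightarrow> (\<And>x. 0 \<le> h x) \<Longrightarrow> integrable torus_measure (\<lambda>x. h x powr p) \<Longrightarrow>
      (LINT x|torus_measure. h x powr p) \<le> 1 \<Longrightarrow> finite W \<Longrightarrow> orthonormal W (\<lambda>x. x) \<Longrightarrow>
      (\<integral>\<^sup>+x. ennreal (h x * (\<Sum>w\<in>W. (cmod (rep_L2_torus (sqrt_op A w) x))\<^sup>2)) \<partial>torus_measure) \<le>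
      ennreal (K * ln (1 + real (card W)))"
    using unit_ball_estimate[OF p] by blast
  show ?thesis
  proof (rule that[OF K(1)])
    fix h :: "real ^ 'n \<Rightarrow> real" and l W
    assume h: "h \<in> lp_nonneg p" and l: "0 < l" and le: "(LINT x|torus_measure. h x powr p) \<le> l powr p"
      and W: "finite W" "orthonormal W (\<lambda>x :: 'n L2_torus. x)"
    have [measurable]: "h \<in> borel_measurable borel"
      using h by measurable
    define S where "S x = (\<Sum>w\<in>W. (cmod (rep_L2_torus (sqrt_op A w) x))\<^sup>2)" for x
    have [measurable]: "S \<in> borel_measurable borel"
      unfolding S_def by measurable
    have S0: "0 \<le> S x" for x
      by (simp add: S_def sum_nonneg)
    have pw: "(h x / l) powr p = h x powr p / l powr p" for x
      using l lp_nonneg_nonneg[OF h] by (simp add: powr_divide)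
    have "(\<integral>\<^sup>+x. ennreal (h x / l * S x) \<partial>torus_measure) \<le> ennreal (K * ln (1 + real (card W)))"
      unfolding S_def using h l le W
      by (intro K(2)) (auto simp: pw lp_nonneg_nonneg lp_nonneg_integrable)
    then have "ennreal l * (\<integral>\<^sup>+x. ennreal (h x / l * S x) \<partial>torus_measure) \<le>
        ennreal l * ennreal (K * ln (1 + real (card W)))"
      by (intro mult_left_mono) auto
    also have "ennreal l * (\<integral>\<^sup>+x. ennreal (h x / l * S x) \<partial>torus_measure) =
        (\<integral>\<^sup>+x. ennreal l * ennreal (h x / l * S x) \<partial>torus_measure)"
      by (intro nn_integral_cmult[symmetric]) measurable
    also have "\<dots> = (\<integral>\<^sup>+x. ennreal (h x * S x) \<partial>torus_measure)"
      using l lp_nonneg_nonneg[OF h] S0 by (intro nn_integral_cong) (auto simp flip: ennreal_mult)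
    also have "ennreal l * ennreal (K * ln (1 + real (card W))) = ennreal (l * K * ln (1 + real (card W)))"
      using l K(1) by (simp add: ennreal_mult[symmetric] mult.assoc)
    finally show "(\<integral>\<^sup>+x. ennreal (h x * (\<Sum>w\<in>W. (cmod (rep_L2_torus (sqrt_op A w) x))\<^sup>2)) \<partial>torus_measure) \<le>
        ennreal (l * K * ln (1 + real (card W)))"
      by (simp add: S_def)
  qed
qed

lemma rep_sqrt_A_scale:
  "AE x in torus_measure. rep_L2_torus (sqrt_op A (c *\<^sub>C u)) x = c * rep_L2_torus (sqrt_op A u) x"
  using rep_L2_torus_scale[of c "sqrt_op A u"] by (simp add: complex_linearD[OF complex_linear_sqrt_A])

lemma unit_vector_decomp:
  fixes u :: "'n L2_torus"
  obtains w where "norm w = 1" "u = complex_of_real (norm u) *\<^sub>C w"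
proof (cases "u = 0")
  case True
  then show ?thesis
    using that[of "expb 0"] orthonormal_norm[OF on] by simp
next
  case False
  then show ?thesis
    using that[of "(1 / norm u) *\<^sub>R u"] by (simp flip: scaleR_scaleC)
qed

lemma form_bounded:
  assumes p: "1 < p" and h: "h \<in> lp_nonneg p"
  obtains M where "0 \<le> M" "\<And>u. integrable torus_measure (\<lambda>x. h x * (cmod (rep_L2_torus (sqrt_op A u) x))\<^sup>2)"
    "\<And>u. form h u \<le> M * (norm u)\<^sup>2"
proof -
  obtain K where K: "0 \<le> K"
    "\<And>h l W. h \<in> lp_nonneg p \<Longrightarrow> 0 < l \<Longrightarrow> (LINT x|torus_measure. h x powr p) \<le> l powr p \<Longrightarrow>
      finite W \<Longrightarrow> orthonormal W (\<lambda>x. x) \<Longrightarrow>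
      (\<integral>\<^sup>+x. ennreal (h x * (\<Sum>w\<in>W. (cmod (rep_L2_torus (sqrt_op A w) x))\<^sup>2)) \<partial>torus_measure) \<le>
      ennreal (l * K * ln (1 + real (card W)))"
    using lp_estimate[OF p] by blast
  have [measurable]: "h \<in> borel_measurable borel"
    using h by measurable
  define l where "l = 1 + (LINT x|torus_measure. h x powr p)"
  have l: "1 \<le> l"
    by (simp add: l_def)
  have le: "(LINT x|torus_measure. h x powr p) \<le> l powr p"
    unfolding l_def using p by (intro le_one_plus_powr) auto
  define M where "M = l * K * ln 2"
  have M: "0 \<le> M"
    using l K(1) by (simp add: M_def)
  have unit: "(\<integral>\<^sup>+x. ennreal (h x * (cmod (rep_L2_torus (sqrt_op A w) x))\<^sup>2) \<partial>torus_measure) \<le> ennreal M"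
    if "norm w = 1" for w
    using K(2)[OF h _ le, of "{w}"] that l by (simp add: M_def orthonormal_def cinner_self)
  have all: "(\<integral>\<^sup>+x. ennreal (h x * (cmod (rep_L2_torus (sqrt_op A u) x))\<^sup>2) \<partial>torus_measure) \<le> ennreal (M * (norm u)\<^sup>2)" for u
  proof -
    obtain w where w: "norm w = 1" "u = complex_of_real (norm u) *\<^sub>C w"
      by (rule unit_vector_decomp)
    have "AE x in torus_measure. rep_L2_torus (sqrt_op A u) x = complex_of_real (norm u) * rep_L2_torus (sqrt_op A w) x"
      using rep_sqrt_A_scale[of "complex_of_real (norm u)" w] w(2) by simp
    then have "AE x in torus_measure. ennreal (h x * (cmod (rep_L2_torus (sqrt_op A u) x))\<^sup>2) =
        ennreal ((norm u)\<^sup>2) * ennreal (h x * (cmod (rep_L2_torus (sqrt_op A w) x))\<^sup>2)"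
      by eventually_elim (use lp_nonneg_nonneg[OF h] in \<open>simp add: norm_mult power_mult_distrib ac_simps flip: ennreal_mult\<close>)
    then have "(\<integral>\<^sup>+x. ennreal (h x * (cmod (rep_L2_torus (sqrt_op A u) x))\<^sup>2) \<partial>torus_measure) =
        (\<integral>\<^sup>+x. ennreal ((norm u)\<^sup>2) * ennreal (h x * (cmod (rep_L2_torus (sqrt_op A w) x))\<^sup>2) \<partial>torus_measure)"
      by (rule nn_integral_cong_AE)
    also have "\<dots> = ennreal ((norm u)\<^sup>2) * (\<integral>\<^sup>+x. ennreal (h x * (cmod (rep_L2_torus (sqrt_op A w) x))\<^sup>2) \<partial>torus_measure)"
      by (intro nn_integral_cmult) measurable
    also have "\<dots> \<le> ennreal ((norm u)\<^sup>2) * ennreal M"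
      by (intro mult_left_mono unit w(1)) auto
    also have "\<dots> = ennreal (M * (norm u)\<^sup>2)"
      using M by (simp add: ennreal_mult[symmetric] mult.commute)
    finally show ?thesis .
  qed
  have int: "integrable torus_measure (\<lambda>x. h x * (cmod (rep_L2_torus (sqrt_op A u) x))\<^sup>2)" for u
    using lp_nonneg_nonneg[OF h] le_less_trans[OF all[of u] ennreal_less_top]
    by (intro integrableI_bounded) (auto simp: abs_mult)
  show ?thesis
  proof (rule that[OF M int])
    fix u
    have "ennreal (form h u) \<le> ennreal (M * (norm u)\<^sup>2)"
      using all[of u] nn_integral_eq_integral[OF int[of u]] lp_nonneg_nonneg[OF h] by (simp add: form_def)
    then show "form h u \<le> M * (norm u)\<^sup>2"
      using M by (simp add: ennreal_le_iff)
  qed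
qed

lemma form_integrable:
  assumes "1 < p" "h \<in> lp_nonneg p"
  shows "integrable torus_measure (\<lambda>x. h x * (cmod (rep_L2_torus (sqrt_op A u) x))\<^sup>2)"
  using form_bounded[OF assms] by metis

lemma form_sum_le:
  assumes p: "1 < p"
  obtains K where "0 \<le> K"
    "\<And>h l W. h \<in> lp_nonneg p \<Longrightarrow> 0 < l \<Longrightarrow> (LINT x|torus_measure. h x powr p) \<le> l powr p \<Longrightarrow>
      finite W \<Longrightarrow> orthonormal W (\<lambda>x. x) \<Longrightarrow> (\<Sum>w\<in>W. form h w) \<le> l * K * ln (1 + real (card W))"
proof -
  obtain K where K: "0 \<le> K"
    "\<And>h l W. h \<in> lp_nonneg p \<Longrightarrow> 0 < l \<Longrightarrow> (LINT x|torus_measure. h x powr p) \<le> l powr p \<Longrightarrow>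
      finite W \<Longrightarrow> orthonormal W (\<lambda>x. x) \<Longrightarrow>
      (\<integral>\<^sup>+x. ennreal (h x * (\<Sum>w\<in>W. (cmod (rep_L2_torus (sqrt_op A w) x))\<^sup>2)) \<partial>torus_measure) \<le>
      ennreal (l * K * ln (1 + real (card W)))"
    using lp_estimate[OF p] by blast
  show ?thesis
  proof (rule that[OF K(1)])
    fix h :: "real ^ 'n \<Rightarrow> real" and l W
    assume h: "h \<in> lp_nonneg p" and l: "0 < l" and le: "(LINT x|torus_measure. h x powr p) \<le> l powr p"
      and W: "finite W" "orthonormal W (\<lambda>x :: 'n L2_torus. x)"
    let ?f = "\<lambda>x. \<Sum>w\<in>W. h x * (cmod (rep_L2_torus (sqrt_op A w) x))\<^sup>2"
    have int: "integrable torus_measure ?f"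
      by (intro Bochner_Integration.integrable_sum form_integrable[OF p h])
    have "(\<Sum>w\<in>W. form h w) = (LINT x|torus_measure. ?f x)"
      unfolding form_def by (intro Bochner_Integration.integral_sum[symmetric] form_integrable[OF p h])
    moreover have "ennreal (LINT x|torus_measure. ?f x) \<le> ennreal (l * K * ln (1 + real (card W)))"
      using K(2)[OF h l le W] lp_nonneg_nonneg[OF h]
      by (subst nn_integral_eq_integral[OF int, symmetric]) (auto simp: sum_distrib_left sum_nonneg)
    ultimately show "(\<Sum>w\<in>W. form h w) \<le> l * K * ln (1 + real (card W))"
      using l K(1) by (simp add: ennreal_le_iff)
  qed
qed

lemma mult_sqrt_norm:
  "(cmod (complex_of_real (sqrt r) * z))\<^sup>2 = r * (cmod z)\<^sup>2" if "0 \<le> r"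
  using that by (simp add: norm_mult power_mult_distrib)

context
  fixes p :: real and h :: "real ^ 'n \<Rightarrow> real"
  assumes p: "1 < p" and h: "h \<in> lp_nonneg p"
begin

lemma h_measurable [measurable]: "h \<in> borel_measurable borel"
  using h by measurable

lemma square_integrable_sqrt_mult:
  "square_integrable (\<lambda>x. complex_of_real (sqrt (h x)) * rep_L2_torus (sqrt_op A u) x)"
  unfolding square_integrable_def
  using form_integrable[OF p h, of u] lp_nonneg_nonneg[OF h] by (simp add: mult_sqrt_norm)

lemma is_bounded_closure_exists:
  "\<exists>X. is_bounded_closure (\<lambda>x. complex_of_real (sqrt (h x))) (sqrt_op A) X"
proof -
  let ?g = "\<lambda>x. complex_of_real (sqrt (h x))"
  define Y where "Y u = mult_op ?g (sqrt_op A u)" for u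
  note sq = square_integrable_sqrt_mult
  obtain M where M: "0 \<le> M" "\<And>u. form h u \<le> M * (norm u)\<^sup>2"
    using form_bounded[OF p h] by metis
  have add: "Y (u + v) = Y u + Y v" for u v
  proof -
    have "Y u + Y v = abs_L2_torus (\<lambda>x. ?g x * rep_L2_torus (sqrt_op A u) x + ?g x * rep_L2_torus (sqrt_op A v) x)"
      unfolding Y_def mult_op_def using sq[of u] sq[of v] by (subst plus_L2_torus.abs_eq) simp_all
    also have "\<dots> = Y (u + v)"
      unfolding Y_def mult_op_def
    proof (rule abs_L2_torus_eqI)
      show "AE x in torus_measure. ?g x * rep_L2_torus (sqrt_op A u) x + ?g x * rep_L2_torus (sqrt_op A v) x =
          ?g x * rep_L2_torus (sqrt_op A (u + v)) x"
        using rep_L2_torus_plus[of "sqrt_op A u" "sqrt_op A v", folded blinfun.add_right]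
        by eventually_elim (simp add: distrib_left)
    qed (intro square_integrable_add sq)+
    finally show ?thesis ..
  qed
  have scale: "Y (c *\<^sub>C u) = c *\<^sub>C Y u" for c u
  proof -
    have "c *\<^sub>C Y u = abs_L2_torus (\<lambda>x. c * (?g x * rep_L2_torus (sqrt_op A u) x))"
      unfolding Y_def mult_op_def scaleC_L2_torus_def using sq[of u] by (subst L2_scale.abs_eq) simp_all
    also have "\<dots> = Y (c *\<^sub>C u)"
      unfolding Y_def mult_op_def
    proof (rule abs_L2_torus_eqI)
      show "AE x in torus_measure. c * (?g x * rep_L2_torus (sqrt_op A u) x) =
          ?g x * rep_L2_torus (sqrt_op A (c *\<^sub>C u)) x"
        using rep_sqrt_A_scale[of c u] by eventually_elim simp
    qed (intro square_integrable_mult sq)+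
    finally show ?thesis ..
  qed
  have norm: "(norm (Y u))\<^sup>2 = form h u" for u
    unfolding Y_def mult_op_def form_def using norm_abs_L2_torus[OF sq[of u]] lp_nonneg_nonneg[OF h]
    by (simp add: mult_sqrt_norm)
  have "bounded_linear Y"
  proof (rule bounded_linear_intro)
    show "Y (u + v) = Y u + Y v" for u v
      by (rule add)
    show "Y (r *\<^sub>R u) = r *\<^sub>R Y u" for r u
      by (simp add: scaleR_scaleC scale)
    show "norm (Y u) \<le> norm u * sqrt M" for u
    proof (rule power2_le_imp_le)
      show "(norm (Y u))\<^sup>2 \<le> (norm u * sqrt M)\<^sup>2"
        using M(2)[of u] M(1) by (simp add: norm power_mult_distrib mult.commute)
    qed (use M(1) in auto)
  qed
  then have X: "blinfun_apply (Blinfun Y) = Y"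
    by (rule bounded_linear_Blinfun_apply)
  have "is_bounded_closure ?g (sqrt_op A) (Blinfun Y)"
    unfolding is_bounded_closure_def complex_linear_def X
    by (simp add: scale mult_domain_def sq) (simp add: Y_def)
  then show ?thesis ..
qed

lemma sandwich_nonneg_defined_lp: "sandwich_nonneg_defined A h"
  unfolding sandwich_nonneg_defined_def by (rule is_bounded_closure_exists)

lemma
  shows positive_sandwich: "positive_op (sandwich_nonneg A h)"
    and sandwich_form: "cinner u (sandwich_nonneg A h u) = complex_of_real (form h u)"
    and compact_sandwich: "compact_op (sandwich_nonneg A h)"
proof -
  let ?g = "\<lambda>x. complex_of_real (sqrt (h x))"
  define X where "X = (SOME X. is_bounded_closure ?g (sqrt_op A) X)"
  have "is_bounded_closure ?g (sqrt_op A) X"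
    unfolding X_def by (rule someI_ex[OF is_bounded_closure_exists])
  then have lin: "complex_linear X" and X: "X u = mult_op ?g (sqrt_op A u)" for u
    using square_integrable_sqrt_mult by (auto simp: is_bounded_closure_def mult_domain_def)
  have norm: "(norm (X u))\<^sup>2 = form h u" for u
    unfolding X mult_op_def form_def
    using norm_abs_L2_torus[OF square_integrable_sqrt_mult[of u]] lp_nonneg_nonneg[OF h]
    by (simp add: mult_sqrt_norm)
  define Y where "Y = adjoint_op X o\<^sub>L X"
  have Y: "positive_op Y"
    unfolding Y_def by (rule torus.positive_adjoint_compose[OF lin])
  have form: "cinner u (Y u) = complex_of_real (form h u)" for u
    using torus.adjoint_compose_form[OF lin, of u u] by (simp add: Y_def cinner_self norm)
  obtain K where K: "0 \<le> K"
    "\<And>h l W. h \<in> lp_nonneg p \<Longrightarrow> 0 < l \<Longrightarrow> (LINT x|torus_measure. h x powr p) \<le> l powr p \<Longrightarrow>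
      finite W \<Longrightarrow> orthonormal W (\<lambda>x. x) \<Longrightarrow> (\<Sum>w\<in>W. form h w) \<le> l * K * ln (1 + real (card W))"
    using form_sum_le[OF p] by blast
  define l where "l = 1 + (LINT x|torus_measure. h x powr p)"
  have l: "1 \<le> l"
    by (simp add: l_def)
  have le: "(LINT x|torus_measure. h x powr p) \<le> l powr p"
    unfolding l_def using p by (intro le_one_plus_powr) auto
  have compact: "compact_op Y"
  proof (rule compact_positive_opI[OF Y])
    show "(\<lambda>n. l * K * ln (1 + real n) / real n) \<longlonglongrightarrow> 0"
      using tendsto_mult_right_zero[OF ln_Suc_over_n, of "l * K"] by simp
    show "(\<Sum>w\<in>W. Re (cinner w (Y w))) \<le> l * K * ln (1 + real (card W))"
      if "finite W" "orthonormal W (\<lambda>x. x)" for W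
      using K(2)[OF h _ le that] l by (simp add: form)
  qed
  have eq: "sandwich_nonneg A h = Y"
    using sqrt_op_square[OF Y compact on]
    by (simp add: sandwich_nonneg_def Let_def abs_op_def Y_def flip: X_def)
  show "positive_op (sandwich_nonneg A h)" "compact_op (sandwich_nonneg A h)"
    "cinner u (sandwich_nonneg A h u) = complex_of_real (form h u)"
    using Y compact form by (simp_all add: eq)
qed

lemma sandwich_sum_le:
  assumes "\<And>W. finite W \<Longrightarrow> orthonormal W (\<lambda>x. x) \<Longrightarrow> card W = n \<Longrightarrow> (\<Sum>w\<in>W. form h w) \<le> c"
  shows "(\<Sum>k<n. singular_value (sandwich_nonneg A h) k) \<le> c"
  using assms by (intro torus.singular_value_sum_leI compact_sandwich positive_sandwich) (simp add: sandwich_form)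

end

lemma sandwich_bound:
  assumes p: "1 < p"
  obtains K where "0 \<le> K"
    "\<And>h l n. h \<in> lp_nonneg p \<Longrightarrow> 0 < l \<Longrightarrow> (LINT x|torus_measure. h x powr p) \<le> l powr p \<Longrightarrow>
      (\<Sum>k<n. singular_value (sandwich_nonneg A h) k) \<le> l * K * ln (1 + real n)"
proof -
  obtain K where K: "0 \<le> K"
    "\<And>h l W. h \<in> lp_nonneg p \<Longrightarrow> 0 < l \<Longrightarrow> (LINT x|torus_measure. h x powr p) \<le> l powr p \<Longrightarrow>
      finite W \<Longrightarrow> orthonormal W (\<lambda>x. x) \<Longrightarrow> (\<Sum>w\<in>W. form h w) \<le> l * K * ln (1 + real (card W))"
    using form_sum_le[OF p] by blast
  show ?thesis
  proof (rule that[OF K(1)])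
    fix h :: "real ^ 'n \<Rightarrow> real" and l n
    assume h: "h \<in> lp_nonneg p" and l: "0 < l" and le: "(LINT x|torus_measure. h x powr p) \<le> l powr p"
    show "(\<Sum>k<n. singular_value (sandwich_nonneg A h) k) \<le> l * K * ln (1 + real n)"
      using K(2)[OF h l le] by (intro sandwich_sum_le[OF p h]) auto
  qed
qed

lemma sandwich_L1_inf:
  assumes p: "1 < p" and h: "h \<in> lp_nonneg p"
  shows "sandwich_nonneg A h \<in> L1_inf"
proof -
  obtain K where "0 \<le> K" and K: "\<And>h l n. h \<in> lp_nonneg p \<Longrightarrow> 0 < l \<Longrightarrow> (LINT x|torus_measure. h x powr p) \<le> l powr p \<Longrightarrow>
      (\<Sum>k<n. singular_value (sandwich_nonneg A h) k) \<le> l * K * ln (1 + real n)"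
    using sandwich_bound[OF p] by blast
  define l where "l = 1 + (LINT x|torus_measure. h x powr p)"
  have l: "1 \<le> l"
    by (simp add: l_def)
  have "(LINT x|torus_measure. h x powr p) \<le> l powr p"
    unfolding l_def using p by (intro le_one_plus_powr) auto
  then show ?thesis
    using K[OF h, of l] l by (intro torus.L1_infI[OF compact_sandwich[OF p h], where C = "l * K"]) auto
qed

lemma sandwich_pos_L1_inf: "1 < p \<Longrightarrow> h \<in> lp_nonneg p \<Longrightarrow> sandwich_nonneg A h \<in> torus.pos_L1_inf"
  by (simp add: torus.pos_L1_inf_def sandwich_L1_inf positive_sandwich)

lemma sandwich_eqI:
  assumes p: "1 < p" and h: "h \<in> lp_nonneg p" and T: "complex_linear T"
    and form: "\<And>u. cinner u (T u) = complex_of_real (form h u)"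
  shows "sandwich_nonneg A h = T"
  using form T positive_op_complex_linear[OF positive_sandwich[OF p h]]
  by (intro form_eq_imp_eq) (simp_all add: sandwich_form[OF p h])

lemma sandwich_cong_AE:
  assumes p: "1 < p" and h: "h \<in> lp_nonneg p" and g: "g \<in> lp_nonneg p" and AE: "AE x in torus_measure. h x = g x"
  shows "sandwich_nonneg A h = sandwich_nonneg A g"
proof (rule sandwich_eqI[OF p h positive_op_complex_linear[OF positive_sandwich[OF p g]]])
  fix u
  have [measurable]: "h \<in> borel_measurable borel" "g \<in> borel_measurable borel"
    using h g by measurable
  have "form h u = form g u"
    unfolding form_def by (intro integral_cong_AE) (use AE in \<open>auto elim!: eventually_mono\<close>)
  then show "cinner u (sandwich_nonneg A g u) = complex_of_real (form h u)"
    by (simp add: sandwich_form[OF p g])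
qed

lemma sandwich_add:
  assumes p: "1 < p" and h: "h \<in> lp_nonneg p" and g: "g \<in> lp_nonneg p"
  shows "sandwich_nonneg A (\<lambda>x. h x + g x) = sandwich_nonneg A h + sandwich_nonneg A g"
proof (rule sandwich_eqI[OF p])
  show "(\<lambda>x. h x + g x) \<in> lp_nonneg p"
    using p by (intro lp_nonneg_add h g) simp
  show "complex_linear (sandwich_nonneg A h + sandwich_nonneg A g)"
    by (intro complex_linear_add positive_op_complex_linear positive_sandwich[OF p] h g)
  show "cinner u ((sandwich_nonneg A h + sandwich_nonneg A g) u) = complex_of_real (form (\<lambda>x. h x + g x) u)" for u
    using form_integrable[OF p h, of u] form_integrable[OF p g, of u]
    by (simp add: blinfun.add_left cinner_add_right sandwich_form[OF p h] sandwich_form[OF p g] form_def distrib_right)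
qed

lemma sandwich_scale:
  assumes p: "1 < p" and h: "h \<in> lp_nonneg p" and r: "0 \<le> r"
  shows "sandwich_nonneg A (\<lambda>x. r * h x) = scale_op (complex_of_real r) (sandwich_nonneg A h)"
proof (rule sandwich_eqI[OF p])
  show "(\<lambda>x. r * h x) \<in> lp_nonneg p"
    using p by (intro lp_nonneg_scale h r) simp
  show "complex_linear (scale_op (complex_of_real r) (sandwich_nonneg A h))"
    by (intro complex_linear_scale positive_op_complex_linear positive_sandwich[OF p] h)
  show "cinner u (scale_op (complex_of_real r) (sandwich_nonneg A h) u) = complex_of_real (form (\<lambda>x. r * h x) u)" for u
    by (simp add: scale_op.rep_eq cinner_scaleC_right sandwich_form[OF p h] form_def mult.assoc)
qed

lemma sandwich_one: "sandwich_nonneg A (\<lambda>_. 1) = A"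
proof (rule sandwich_eqI[of 2])
  show "(\<lambda>_. 1) \<in> lp_nonneg 2"
    by (rule lp_nonneg_bounded[where B = 1]) auto
  show "complex_linear A"
    by (rule positive_op_complex_linear[OF positive_A])
  show "cinner u (A u) = complex_of_real (form (\<lambda>_. 1) u)" for u
  proof -
    have "positive_op (sqrt_op A)"
      unfolding sqrt_A
      using sqrt_a_bounded' a_nonneg by (intro positive_diag_op[OF on]) (auto simp: bounded_iff)
    then have "cinner (sqrt_op A u) (sqrt_op A u) = cinner u (sqrt_op A (sqrt_op A u))"
      by (rule positive_op_selfadjoint)
    moreover have "sqrt_op A o\<^sub>L sqrt_op A = A"
      by (rule sqrt_op_square[OF positive_A torus.L1_inf_compact[OF A_L1] on])
    ultimately have "cinner u (A u) = complex_of_real ((norm (sqrt_op A u))\<^sup>2)"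
      by (metis blinfun_apply_blinfun_compose cinner_self)
    moreover have "(norm (sqrt_op A u))\<^sup>2 = form (\<lambda>_. 1) u"
      using norm_abs_L2_torus[OF square_integrable_rep, of "sqrt_op A u"] by (simp add: form_def abs_rep_L2_torus)
    ultimately show ?thesis by simp
  qed
qed simp

end

section \<open>Translation invariance and the trace formula\<close>

lemma (in hilbert_basis) cinner_sums: "(\<lambda>k. cinner x (e k) * cinner (e k) y) sums cinner x y"
  using bounded_linear.sums[OF cinner.bounded_linear_right basis_expansion, of x y]
  by (simp add: cinner_scaleC_right mult.commute)

definition expi_coeff :: "int ^ 'n::finite \<Rightarrow> 'n L2_torus \<Rightarrow> complex" where
  "expi_coeff m v = (LINT x|torus_measure. expi m x * complex_of_real ((cmod (rep_L2_torus v x))\<^sup>2))"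

lemma square_integrable_expi_mult:
  assumes "square_integrable u"
  shows "square_integrable (\<lambda>x. expi m x * u x)"
  using assms unfolding square_integrable_def by (auto simp: norm_mult intro!: borel_measurable_times)

lemma expi_coeff_sums:
  fixes v :: "'n::finite L2_torus"
  assumes j: "\<And>k. freq (j k) = freq k - m"
  shows "(\<lambda>k. cinner v (expb k) * cinner (expb (j k)) v) sums expi_coeff m v"
proof -
  define w where "w = abs_L2_torus (\<lambda>x. expi m x * rep_L2_torus v x)"
  note sq = square_integrable_expi_mult[OF square_integrable_rep, of m v]
  have "cinner v w = (LINT x|torus_measure. cnj (rep_L2_torus v x) * (expi m x * rep_L2_torus v x))"
    using cinner_abs_L2_torus[OF square_integrable_rep sq, of v] by (simp add: abs_rep_L2_torus w_def)
  also have "\<dots> = expi_coeff m v"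
    unfolding expi_coeff_def complex_norm_square by (intro Bochner_Integration.integral_cong) (auto simp: ac_simps)
  finally have "cinner v w = expi_coeff m v" .
  moreover have "cinner (expb k) w = cinner (expb (j k)) v" for k
  proof -
    have "cinner (expb k) w = (LINT x|torus_measure. cnj (expi (freq k) x) * (expi m x * rep_L2_torus v x))"
      unfolding expb_def w_def by (rule cinner_abs_L2_torus[OF square_integrable_expi sq])
    also have "\<dots> = (LINT x|torus_measure. cnj (expi (freq (j k)) x) * rep_L2_torus v x)"
      by (simp add: cnj_expi mult.assoc[symmetric] expi_mult j)
    also have "\<dots> = cinner (expb (j k)) v"
      using cinner_abs_L2_torus[OF square_integrable_expi square_integrable_rep, of "freq (j k)" v]
      by (simp add: expb_def abs_rep_L2_torus)
    finally show ?thesis .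
  qed
  ultimately show ?thesis
    using torus.cinner_sums[of v w] by simp
qed

text \<open>Translation by half a period of \<open>expi m\<close>, described by its action on the exponentials.\<close>

lemma half_period_translation:
  assumes m: "m \<noteq> (0 :: int ^ 'n::finite)"
  obtains d :: "nat \<Rightarrow> complex" where "\<And>k. cmod (d k) = 1"
    "\<And>v. expi_coeff m (diag_op expb d v) = - expi_coeff m (v :: 'n L2_torus)"
proof -
  obtain i where i: "m $ i \<noteq> 0"
    using m by (auto simp: vec_eq_iff)
  define t where "t = (axis i (pi / of_int (m $ i)) :: real ^ 'n)"
  define d where "d k = expi (freq k) t" for k
  have mt: "expi (- m) t = - 1"
    using i by (simp add: expi_def t_def phase_axis cis.ctr complex_eq_iff)
  have d1: "cmod (d k) = 1" for k
    by (simp add: d_def)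
  have b: "bounded (range d)"
    using d1 by (auto simp: bounded_iff)
  note on = torus.basis_orthonormal[where 'n = 'n]
  define j where "j k = inv freq (freq k - m)" for k
  have j: "freq (j k) = freq k - m" for k
    unfolding j_def by (rule surj_f_inv_f[OF bij_is_surj[OF bij_freq]])
  have "expi_coeff m (diag_op expb d v) = - expi_coeff m v" for v :: "'n L2_torus"
  proof -
    have "cinner (diag_op expb d v) (expb k) * cinner (expb (j k)) (diag_op expb d v) =
        - (cinner v (expb k) * cinner (expb (j k)) v)" for k
    proof -
      have "cinner (diag_op expb d v) (expb k) = cnj (d k) * cinner v (expb k)"
        using cinner_diag_op[OF on b, of k v] cinner_commute[of "diag_op expb d v"] cinner_commute[of v]
        by simp
      moreover have "cnj (d k) * d (j k) = - 1"
        by (simp add: d_def cnj_expi expi_mult j mt)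
      moreover have "cnj (d k) * cinner v (expb k) * (d (j k) * cinner (expb (j k)) v) =
          (cnj (d k) * d (j k)) * (cinner v (expb k) * cinner (expb (j k)) v)"
        by (simp only: ac_simps)
      ultimately show ?thesis
        by (simp add: cinner_diag_op[OF on b])
    qed
    then have "(\<lambda>k. - (cinner v (expb k) * cinner (expb (j k)) v)) sums expi_coeff m (diag_op expb d v)"
      using expi_coeff_sums[OF j, of "diag_op expb d v"] by simp
    from sums_unique2[OF this sums_minus[OF expi_coeff_sums[OF j, of v]]] show ?thesis .
  qed
  then show ?thesis
    using that d1 by blast
qed

lemma cinner_unimodular_diag_op:
  assumes d: "\<And>k. cmod (d k) = 1"
  shows "cinner (diag_op expb d x) (diag_op expb d y) = cinner x (y :: 'n::finite L2_torus)"
proof -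
  note on = torus.basis_orthonormal[where 'n = 'n]
  have b: "bounded (range d)"
    using d by (auto simp: bounded_iff)
  have "cinner (diag_op expb d x) (expb k) * cinner (expb k) (diag_op expb d y) = cinner x (expb k) * cinner (expb k) y" for k
  proof -
    have "cinner (diag_op expb d x) (expb k) = cnj (d k) * cinner x (expb k)"
      using cinner_diag_op[OF on b, of k x] cinner_commute[of "diag_op expb d x"] cinner_commute[of x] by simp
    moreover have "cnj (d k) * d k = 1"
      using complex_norm_square[of "d k"] d[of k] by (simp add: mult.commute)
    moreover have "cnj (d k) * cinner x (expb k) * (d k * cinner (expb k) y) =
        (cnj (d k) * d k) * (cinner x (expb k) * cinner (expb k) y)"
      by (simp only: ac_simps)
    ultimately show ?thesis
      by (simp add: cinner_diag_op[OF on b])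
  qed
  then have "(\<lambda>k. cinner x (expb k) * cinner (expb k) y) sums cinner (diag_op expb d x) (diag_op expb d y)"
    using torus.cinner_sums[of "diag_op expb d x" "diag_op expb d y"] by simp
  from sums_unique2[OF this torus.cinner_sums] show ?thesis .
qed

lemma lp_nonneg_const: "0 \<le> r \<Longrightarrow> 0 \<le> p \<Longrightarrow> (\<lambda>_. r) \<in> lp_nonneg p"
  by (rule lp_nonneg_bounded[where B = r]) auto

lemma lp_nonneg_imp_integrable:
  assumes p: "1 < p" and h: "h \<in> lp_nonneg p"
  shows "integrable torus_measure (h :: real ^ 'n::finite \<Rightarrow> real)"
proof (rule Bochner_Integration.integrable_bound)
  show "integrable torus_measure (\<lambda>x. 1 + h x powr p)"
    using lp_nonneg_integrable[OF h] by simp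
  have "h x \<le> 1 + h x powr p" for x
  proof (cases "h x \<le> 1")
    case False
    then have "h x powr 1 \<le> h x powr p"
      using p by (intro powr_mono) auto
    then show ?thesis
      using False by simp
  qed (auto intro: order_trans)
  then show "AE x in torus_measure. norm (h x) \<le> norm (1 + h x powr p)"
    using lp_nonneg_nonneg[OF h] by (intro always_eventually) auto
qed (use lp_nonneg_measurable[OF h] in simp)

lemma wave_measurable [measurable]: "(\<lambda>x. cos (phase m x + \<theta>)) \<in> borel_measurable borel"
proof -
  have "cos (phase m x + \<theta>) = Re (cis \<theta> * expi m x)" for x
    by (simp add: expi_def cis_mult add.commute)
  then show ?thesis
    by simp
qed

lemma wave_lp_nonneg:
  assumes s: "\<bar>s\<bar> \<le> 1"
  shows "(\<lambda>x :: real ^ 'n::finite. 1 + s * cos (phase m x + \<theta>)) \<in> lp_nonneg 2"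
proof (rule lp_nonneg_bounded[where B = 2])
  have "\<bar>s * cos (phase m x + \<theta>)\<bar> \<le> 1" for x
    unfolding abs_mult using s abs_cos_le_one by (intro mult_le_one) auto
  then show "0 \<le> 1 + s * cos (phase m x + \<theta>)" "1 + s * cos (phase m x + \<theta>) \<le> 2" for x
    by (simp_all add: abs_le_iff) (smt (verit))+
qed auto

context torus_operator
begin

lemma form_wave:
  "form (\<lambda>x. 1 + s * cos (phase m x + \<theta>)) u =
    (norm (sqrt_op A u))\<^sup>2 + s * Re (cis \<theta> * expi_coeff m (sqrt_op A u))"
proof -
  define v where "v = sqrt_op A u"
  have int: "integrable torus_measure (\<lambda>x. (cmod (rep_L2_torus v x))\<^sup>2)"
    using square_integrable_rep[of v] by (simp add: square_integrable_def)
  have int': "integrable torus_measure (\<lambda>x. cis \<theta> * (expi m x * complex_of_real ((cmod (rep_L2_torus v x))\<^sup>2)))"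
    using int by (intro integrable_mult_right Bochner_Integration.integrable_bound[OF int]) (auto simp: norm_mult norm_power)
  have "(1 + s * cos (phase m x + \<theta>)) * (cmod (rep_L2_torus v x))\<^sup>2 = (cmod (rep_L2_torus v x))\<^sup>2 +
      s * Re (cis \<theta> * (expi m x * complex_of_real ((cmod (rep_L2_torus v x))\<^sup>2)))" for x
  proof -
    have eq: "cis \<theta> * (expi m x * complex_of_real ((cmod (rep_L2_torus v x))\<^sup>2)) =
        complex_of_real ((cmod (rep_L2_torus v x))\<^sup>2) * cis (phase m x + \<theta>)"
      by (simp add: expi_def cis_mult[symmetric] ac_simps)
    show ?thesis
      unfolding eq by (simp add: algebra_simps)
  qed
  then have "form (\<lambda>x. 1 + s * cos (phase m x + \<theta>)) u = (LINT x|torus_measure. (cmod (rep_L2_torus v x))\<^sup>2) +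
      s * (LINT x|torus_measure. Re (cis \<theta> * (expi m x * complex_of_real ((cmod (rep_L2_torus v x))\<^sup>2))))"
    unfolding form_def v_def[symmetric] using int integrable_Re[OF int'] by simp
  also have "(LINT x|torus_measure. Re (cis \<theta> * (expi m x * complex_of_real ((cmod (rep_L2_torus v x))\<^sup>2)))) =
      Re (cis \<theta> * expi_coeff m v)"
    unfolding expi_coeff_def integral_Re[OF int'] by simp
  also have "(LINT x|torus_measure. (cmod (rep_L2_torus v x))\<^sup>2) = (norm v)\<^sup>2"
    using norm_abs_L2_torus[OF square_integrable_rep, of v] by (simp add: abs_rep_L2_torus)
  finally show ?thesis
    by (simp add: v_def)
qed

lemma form_wave_translate:
  assumes d: "\<And>k. cmod (d k) = 1" "\<And>v. expi_coeff m (diag_op expb d v) = - expi_coeff m (v :: 'n L2_torus)"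
  shows "form (\<lambda>x. 1 + s * cos (phase m x + \<theta>)) (diag_op expb d u) = form (\<lambda>x. 1 + (- s) * cos (phase m x + \<theta>)) u"
proof -
  have b: "bounded (range d)"
    using d by (auto simp: bounded_iff)
  have "sqrt_op A o\<^sub>L diag_op expb d = diag_op expb d o\<^sub>L sqrt_op A"
    unfolding sqrt_A diag_op_compose[OF on sqrt_a_bounded' b] diag_op_compose[OF on b sqrt_a_bounded']
    by (simp add: mult.commute)
  then have comm: "sqrt_op A (diag_op expb d u) = diag_op expb d (sqrt_op A u)"
    by (metis blinfun_apply_blinfun_compose)
  have "complex_of_real ((norm (diag_op expb d (sqrt_op A u)))\<^sup>2) = complex_of_real ((norm (sqrt_op A u))\<^sup>2)"
    using cinner_unimodular_diag_op[OF d(1), where x = "sqrt_op A u" and y = "sqrt_op A u"] by (simp only: cinner_self)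
  then have "(norm (diag_op expb d (sqrt_op A u)))\<^sup>2 = (norm (sqrt_op A u))\<^sup>2"
    by (simp only: of_real_eq_iff)
  then show ?thesis
    unfolding form_wave comm d(2) by (simp add: algebra_simps)
qed

definition sandwich_trace :: "((nat \<Rightarrow>\<^sub>C real) \<Rightarrow>\<^sub>L real) \<Rightarrow> (real ^ 'n \<Rightarrow> real) \<Rightarrow> real" where
  "sandwich_trace \<omega> h = torus.omega_gamma \<omega> (sandwich_nonneg A h)"

definition signed_sandwich_trace :: "((nat \<Rightarrow>\<^sub>C real) \<Rightarrow>\<^sub>L real) \<Rightarrow> (real ^ 'n \<Rightarrow> real) \<Rightarrow> real" where
  "signed_sandwich_trace \<omega> f = sandwich_trace \<omega> (\<lambda>x. max 0 (f x)) - sandwich_trace \<omega> (\<lambda>x. max 0 (- f x))"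

context
  fixes \<omega> :: "(nat \<Rightarrow>\<^sub>C real) \<Rightarrow>\<^sub>L real"
  assumes \<omega>: "\<omega> \<in> DL2 TYPE('n L2_torus)"
begin

lemma sandwich_trace_add:
  assumes "1 < p" "h \<in> lp_nonneg p" "g \<in> lp_nonneg p"
  shows "sandwich_trace \<omega> (\<lambda>x. h x + g x) = sandwich_trace \<omega> h + sandwich_trace \<omega> g"
  unfolding sandwich_trace_def sandwich_add[OF assms]
  by (intro torus.omega_gamma_add \<omega> sandwich_L1_inf[OF assms(1)] positive_sandwich[OF assms(1)] assms(2,3))

lemma sandwich_trace_scale:
  assumes "1 < p" "h \<in> lp_nonneg p" "0 \<le> r"
  shows "sandwich_trace \<omega> (\<lambda>x. r * h x) = r * sandwich_trace \<omega> h"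
  unfolding sandwich_trace_def sandwich_scale[OF assms]
  by (intro torus.omega_gamma_scale sandwich_L1_inf[OF assms(1)] positive_sandwich[OF assms(1)] assms(2,3))

lemma sandwich_trace_nonneg: "1 < p \<Longrightarrow> h \<in> lp_nonneg p \<Longrightarrow> 0 \<le> sandwich_trace \<omega> h"
  unfolding sandwich_trace_def by (intro torus.omega_gamma_nonneg \<omega> sandwich_L1_inf)

lemma sandwich_trace_cong_AE:
  assumes "1 < p" "h \<in> lp_nonneg p" "g \<in> lp_nonneg p" "AE x in torus_measure. h x = g x"
  shows "sandwich_trace \<omega> h = sandwich_trace \<omega> g"
  unfolding sandwich_trace_def sandwich_cong_AE[OF assms] ..

lemma sandwich_trace_const:
  assumes "0 \<le> r"
  shows "sandwich_trace \<omega> (\<lambda>_. r) = r * torus.omega_gamma \<omega> A"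
proof -
  have "(\<lambda>_. 1) \<in> (lp_nonneg 2 :: (real ^ 'n \<Rightarrow> real) set)"
    by (intro lp_nonneg_const) simp_all
  from sandwich_trace_scale[OF _ this assms] show ?thesis
    by (simp add: sandwich_trace_def sandwich_one)
qed

lemma sandwich_trace_bound:
  assumes p: "1 < p"
  obtains K where "0 \<le> K"
    "\<And>h l. h \<in> lp_nonneg p \<Longrightarrow> 0 \<le> l \<Longrightarrow> (LINT x|torus_measure. h x powr p) \<le> l powr p \<Longrightarrow> sandwich_trace \<omega> h \<le> l * K"
proof -
  obtain K where K: "0 \<le> K"
    "\<And>h l n. h \<in> lp_nonneg p \<Longrightarrow> 0 < l \<Longrightarrow> (LINT x|torus_measure. h x powr p) \<le> l powr p \<Longrightarrow>
      (\<Sum>k<n. singular_value (sandwich_nonneg A h) k) \<le> l * K * ln (1 + real n)"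
    using sandwich_bound[OF p] by blast
  show ?thesis
  proof (rule that[OF K(1)])
    fix h :: "real ^ 'n \<Rightarrow> real" and l
    assume h: "h \<in> lp_nonneg p" and l: "0 \<le> l" and le: "(LINT x|torus_measure. h x powr p) \<le> l powr p"
    have 1: "sandwich_trace \<omega> h \<le> r * K" if r: "l < r" for r
    proof -
      have "l powr p \<le> r powr p"
        using l r p by (intro powr_mono2) auto
      then show ?thesis
        unfolding sandwich_trace_def using K(2)[OF h, of r] l r le
        by (intro torus.omega_gamma_le[OF \<omega> sandwich_L1_inf[OF p h]]) auto
    qed
    show "sandwich_trace \<omega> h \<le> l * K"
    proof (rule field_le_epsilon)
      fix e :: real assume e: "0 < e"
      have "sandwich_trace \<omega> h \<le> (l + e / (K + 1)) * K"
        using e K(1) by (intro 1) (simp add: add_nonneg_pos)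
      also have "\<dots> = l * K + e * (K / (K + 1))"
        by (simp add: distrib_right)
      also have "\<dots> \<le> l * K + e * 1"
        using e K(1) by (intro add_left_mono mult_left_mono) auto
      finally show "sandwich_trace \<omega> h \<le> l * K + e" by simp
    qed
  qed
qed

lemma signed_sandwich_trace_eqI:
  assumes p: "1 < p" and h: "h \<in> lp_nonneg p" "g \<in> lp_nonneg p" and f [measurable]: "f \<in> borel_measurable borel"
    and AE: "AE x in torus_measure. f x = h x - g x"
  shows "signed_sandwich_trace \<omega> f = sandwich_trace \<omega> h - sandwich_trace \<omega> g"
proof -
  have p0: "0 \<le> p" using p by simp
  have pos: "(\<lambda>x. max 0 (f x)) \<in> lp_nonneg p"
  proof (rule lp_nonneg_dominated[OF _ p0 lp_nonneg_integrable[OF h(1)]])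
    show "AE x in torus_measure. max 0 (f x) powr p \<le> h x powr p"
      using AE by eventually_elim (use lp_nonneg_nonneg[OF h(1)] lp_nonneg_nonneg[OF h(2)] p0 in \<open>auto intro!: powr_mono2\<close>)
  qed auto
  have neg: "(\<lambda>x. max 0 (- f x)) \<in> lp_nonneg p"
  proof (rule lp_nonneg_dominated[OF _ p0 lp_nonneg_integrable[OF h(2)]])
    show "AE x in torus_measure. max 0 (- f x) powr p \<le> g x powr p"
      using AE by eventually_elim (use lp_nonneg_nonneg[OF h(1)] lp_nonneg_nonneg[OF h(2)] p0 in \<open>auto intro!: powr_mono2\<close>)
  qed auto
  have "sandwich_trace \<omega> (\<lambda>x. max 0 (f x) + g x) = sandwich_trace \<omega> (\<lambda>x. max 0 (- f x) + h x)"
    using AE by (intro sandwich_trace_cong_AE[OF p] lp_nonneg_add pos neg h p0) (auto elim!: eventually_mono)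
  then show ?thesis
    unfolding sandwich_trace_add[OF p pos h(2)] sandwich_trace_add[OF p neg h(1)] by (simp add: signed_sandwich_trace_def)
qed

text \<open>The waves \<open>1 + cos\<close> and \<open>1 - cos\<close> are translates of each other and add up to 2.\<close>

lemma sandwich_trace_wave:
  assumes m: "m \<noteq> 0"
  shows "sandwich_trace \<omega> (\<lambda>x. 1 + cos (phase m x + \<theta>)) = torus.omega_gamma \<omega> A"
proof -
  obtain d where d: "\<And>k. cmod (d k) = 1"
    "\<And>v. expi_coeff m (diag_op expb d v) = - expi_coeff m (v :: 'n L2_torus)"
    using half_period_translation[OF m] by blast
  define h where "h s x = 1 + s * cos (phase m x + \<theta>)" for s and x :: "real ^ 'n"
  have h: "h 1 \<in> lp_nonneg 2" "h (- 1) \<in> lp_nonneg 2"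
    using wave_lp_nonneg[of 1 m \<theta>] wave_lp_nonneg[of "- 1" m \<theta>] by (simp_all add: h_def[abs_def])
  have U: "orthonormal W (diag_op expb d)" if "orthonormal W (\<lambda>x :: 'n L2_torus. x)" for W
    using that by (simp add: orthonormal_def cinner_unimodular_diag_op[OF d(1)])
  have le: "sandwich_trace \<omega> (h (- s)) \<le> sandwich_trace \<omega> (h s)" if hs: "h s \<in> lp_nonneg 2" "h (- s) \<in> lp_nonneg 2" for s
    unfolding sandwich_trace_def
  proof (rule torus.omega_gamma_mono[OF \<omega> sandwich_L1_inf sandwich_L1_inf])
    show "(\<Sum>k<n. singular_value (sandwich_nonneg A (h (- s))) k) \<le> (\<Sum>k<n. singular_value (sandwich_nonneg A (h s)) k)" for n
    proof (rule sandwich_sum_le[OF _ hs(2)])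
      fix W :: "'n L2_torus set" assume W: "finite W" "orthonormal W (\<lambda>x. x)" "card W = n"
      have "form (h (- s)) w = Re (cinner (diag_op expb d w) (sandwich_nonneg A (h s) (diag_op expb d w)))" for w
        using form_wave_translate[OF d, of s \<theta> w] sandwich_form[OF _ hs(1)] by (simp add: h_def[abs_def])
      then have "(\<Sum>w\<in>W. form (h (- s)) w) =
          (\<Sum>w\<in>W. Re (cinner (diag_op expb d w) (sandwich_nonneg A (h s) (diag_op expb d w))))"
        by simp
      also have "\<dots> \<le> (\<Sum>k<card W. singular_value (sandwich_nonneg A (h s)) k)"
        using hs(1) by (intro torus.ky_fan compact_sandwich[of 2] positive_sandwich[of 2] W(1) U W(2)) auto
      finally show "(\<Sum>w\<in>W. form (h (- s)) w) \<le> (\<Sum>k<n. singular_value (sandwich_nonneg A (h s)) k)"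
        by (simp add: W(3))
    qed simp
  qed (use hs in auto)
  have "sandwich_trace \<omega> (h 1) = sandwich_trace \<omega> (h (- 1))"
    using le[of 1] le[of "- 1"] h by simp
  moreover have "sandwich_trace \<omega> (h 1) + sandwich_trace \<omega> (h (- 1)) = sandwich_trace \<omega> (\<lambda>x. h 1 x + h (- 1) x)"
    using h by (intro sandwich_trace_add[symmetric, of 2]) auto
  moreover have "\<dots> = 2 * torus.omega_gamma \<omega> A"
    using sandwich_trace_const[of 2] by (simp add: h_def)
  ultimately have "sandwich_trace \<omega> (h 1) = torus.omega_gamma \<omega> A"
    by simp
  then show ?thesis
    by (simp add: h_def[abs_def])
qed

definition L2_trace :: "'n L2_torus \<Rightarrow> real" where
  "L2_trace u = signed_sandwich_trace \<omega> (\<lambda>x. Re (rep_L2_torus u x))"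

lemma Re_parts_lp_nonneg:
  "(\<lambda>x. max 0 (Re (rep_L2_torus u x))) \<in> lp_nonneg 2" "(\<lambda>x. max 0 (- Re (rep_L2_torus u x))) \<in> lp_nonneg 2"
proof -
  have int: "integrable torus_measure (\<lambda>x. (cmod (rep_L2_torus u x))\<^sup>2)"
    using square_integrable_rep[of u] by (simp add: square_integrable_def)
  have le: "max 0 r powr 2 \<le> (cmod z)\<^sup>2" if "\<bar>r\<bar> \<le> cmod z" for r z
    using that by (auto simp: max_def intro!: power_mono)
  show "(\<lambda>x. max 0 (Re (rep_L2_torus u x))) \<in> lp_nonneg 2" "(\<lambda>x. max 0 (- Re (rep_L2_torus u x))) \<in> lp_nonneg 2"
    by (rule lp_nonneg_dominated[OF _ _ int]; use le abs_Re_le_cmod in \<open>auto intro!: always_eventually\<close>)+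
qed

lemma L2_trace_eqI:
  assumes "h \<in> lp_nonneg 2" "g \<in> lp_nonneg 2" "AE x in torus_measure. Re (rep_L2_torus u x) = h x - g x"
  shows "L2_trace u = sandwich_trace \<omega> h - sandwich_trace \<omega> g"
  unfolding L2_trace_def using assms by (intro signed_sandwich_trace_eqI[of 2]) auto

lemma L2_trace_add: "L2_trace (u + v) = L2_trace u + L2_trace v"
proof -
  let ?p = "\<lambda>u x. max 0 (Re (rep_L2_torus u x))" and ?n = "\<lambda>u x. max 0 (- Re (rep_L2_torus u x))"
  have "L2_trace (u + v) = sandwich_trace \<omega> (\<lambda>x. ?p u x + ?p v x) - sandwich_trace \<omega> (\<lambda>x. ?n u x + ?n v x)"
  proof (rule L2_trace_eqI)
    show "AE x in torus_measure. Re (rep_L2_torus (u + v) x) = ?p u x + ?p v x - (?n u x + ?n v x)"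
      using rep_L2_torus_plus[of u v] by eventually_elim (auto simp: max_def)
  qed (intro lp_nonneg_add Re_parts_lp_nonneg; simp)+
  then show ?thesis
    using sandwich_trace_add[OF _ Re_parts_lp_nonneg(1)[of u] Re_parts_lp_nonneg(1)[of v]]
      sandwich_trace_add[OF _ Re_parts_lp_nonneg(2)[of u] Re_parts_lp_nonneg(2)[of v]]
    by (simp add: L2_trace_def signed_sandwich_trace_def)
qed

lemma L2_trace_scaleR: "L2_trace (r *\<^sub>R u) = r * L2_trace u"
proof -
  let ?p = "\<lambda>x. max 0 (Re (rep_L2_torus u x))" and ?n = "\<lambda>x. max 0 (- Re (rep_L2_torus u x))"
  have rep: "AE x in torus_measure. Re (rep_L2_torus (r *\<^sub>R u) x) = r * Re (rep_L2_torus u x)"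
    using rep_L2_torus_scale[of "complex_of_real r" u] unfolding scaleR_scaleC by eventually_elim simp
  show ?thesis
  proof (cases "0 \<le> r")
    case True
    have "L2_trace (r *\<^sub>R u) = sandwich_trace \<omega> (\<lambda>x. r * ?p x) - sandwich_trace \<omega> (\<lambda>x. r * ?n x)"
    proof (rule L2_trace_eqI)
      show "AE x in torus_measure. Re (rep_L2_torus (r *\<^sub>R u) x) = r * ?p x - r * ?n x"
        using rep by eventually_elim (auto simp: max_def)
    qed (intro lp_nonneg_scale Re_parts_lp_nonneg True; simp)+
    then show ?thesis
      using sandwich_trace_scale[OF _ Re_parts_lp_nonneg(1) True] sandwich_trace_scale[OF _ Re_parts_lp_nonneg(2) True]
      by (simp add: L2_trace_def signed_sandwich_trace_def right_diff_distrib)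
  next
    case False
    then have r: "0 \<le> - r" by simp
    have "L2_trace (r *\<^sub>R u) = sandwich_trace \<omega> (\<lambda>x. - r * ?n x) - sandwich_trace \<omega> (\<lambda>x. - r * ?p x)"
    proof (rule L2_trace_eqI)
      show "AE x in torus_measure. Re (rep_L2_torus (r *\<^sub>R u) x) = - r * ?n x - - r * ?p x"
        using rep by eventually_elim (auto simp: max_def)
    qed (intro lp_nonneg_scale Re_parts_lp_nonneg r; simp)+
    then show ?thesis
      using sandwich_trace_scale[OF _ Re_parts_lp_nonneg(1) r] sandwich_trace_scale[OF _ Re_parts_lp_nonneg(2) r]
      by (simp add: L2_trace_def signed_sandwich_trace_def right_diff_distrib)
  qed
qed

lemma bounded_linear_L2_trace: "bounded_linear L2_trace"
proof -
  obtain K where K: "0 \<le> K"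
    "\<And>h l. h \<in> lp_nonneg 2 \<Longrightarrow> 0 \<le> l \<Longrightarrow> (LINT x|torus_measure. h x powr 2) \<le> l powr 2 \<Longrightarrow> sandwich_trace \<omega> h \<le> l * K"
    by (rule sandwich_trace_bound[of 2]) auto
  have bound: "sandwich_trace \<omega> h \<le> norm u * K"
    if h: "h \<in> lp_nonneg 2" and le: "\<And>x. h x \<le> cmod (rep_L2_torus u x)" for h and u :: "'n L2_torus"
  proof (rule K(2)[OF h])
    have "(LINT x|torus_measure. h x powr 2) \<le> (LINT x|torus_measure. (cmod (rep_L2_torus u x))\<^sup>2)"
      using square_integrable_rep[of u] le lp_nonneg_nonneg[OF h]
      by (intro integral_mono lp_nonneg_integrable[OF h]) (auto simp: square_integrable_def intro!: power_mono)
    also have "\<dots> = norm u powr 2"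
      using norm_abs_L2_torus[OF square_integrable_rep, of u] by (simp add: abs_rep_L2_torus)
    finally show "(LINT x|torus_measure. h x powr 2) \<le> norm u powr 2" .
  qed simp
  show ?thesis
  proof (rule bounded_linear_intro)
    show "L2_trace (u + v) = L2_trace u + L2_trace v" for u v
      by (rule L2_trace_add)
    show "L2_trace (r *\<^sub>R u) = r *\<^sub>R L2_trace u" for r u
      by (simp add: L2_trace_scaleR)
    show "norm (L2_trace u) \<le> norm u * K" for u
    proof -
      have le: "max 0 (Re z) \<le> cmod z" "max 0 (- Re z) \<le> cmod z" for z
        using abs_Re_le_cmod[of z] by auto
      have "0 \<le> sandwich_trace \<omega> (\<lambda>x. max 0 (Re (rep_L2_torus u x)))" "0 \<le> sandwich_trace \<omega> (\<lambda>x. max 0 (- Re (rep_L2_torus u x)))"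
        by (intro sandwich_trace_nonneg[of 2] Re_parts_lp_nonneg; simp)+
      moreover have "sandwich_trace \<omega> (\<lambda>x. max 0 (Re (rep_L2_torus u x))) \<le> norm u * K"
        "sandwich_trace \<omega> (\<lambda>x. max 0 (- Re (rep_L2_torus u x))) \<le> norm u * K"
        by (intro bound Re_parts_lp_nonneg le)+
      ultimately show ?thesis
        by (simp add: L2_trace_def signed_sandwich_trace_def)
    qed
  qed
qed

lemma L2_trace_expb:
  "L2_trace (z *\<^sub>C expb k) = torus.omega_gamma \<omega> A * Re (cinner (abs_L2_torus (\<lambda>_. 1)) (z *\<^sub>C (expb k :: 'n L2_torus)))"
proof -
  have rep: "AE x in torus_measure. rep_L2_torus (z *\<^sub>C (expb k :: 'n L2_torus)) x = z * expi (freq k) x"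
    using rep_L2_torus_scale[of z "expb k"] rep_abs_L2_torus[OF square_integrable_expi, of "freq k"]
    unfolding expb_def by eventually_elim simp
  have inner: "cinner (abs_L2_torus (\<lambda>_. 1)) (z *\<^sub>C (expb k :: 'n L2_torus)) = z * (if freq k = (0 :: int ^ 'n) then 1 else 0)"
  proof -
    have "(\<lambda>_ :: real ^ 'n. 1) = expi 0"
      by (simp add: fun_eq_iff)
    then show ?thesis
      by (simp only: cinner_scaleC_right expb_def cinner_abs_L2_torus[OF square_integrable_expi square_integrable_expi]
        cnj_expi expi_mult integral_expi) simp
  qed
  show ?thesis
  proof (cases "freq k = (0 :: int ^ 'n)")
    case True
    have "L2_trace (z *\<^sub>C expb k) = sandwich_trace \<omega> (\<lambda>_. max 0 (Re z)) - sandwich_trace \<omega> (\<lambda>_. max 0 (- Re z))"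
    proof (rule L2_trace_eqI)
      show "AE x in torus_measure. Re (rep_L2_torus (z *\<^sub>C (expb k :: 'n L2_torus)) x) = max 0 (Re z) - max 0 (- Re z)"
        using rep by eventually_elim (auto simp: True max_def)
    qed (intro lp_nonneg_const; simp)+
    also have "\<dots> = torus.omega_gamma \<omega> A * Re z"
      by (simp add: sandwich_trace_const max_def)
    finally show ?thesis
      by (simp add: inner True)
  next
    case False
    define r where "r = cmod z"
    define \<theta> where "\<theta> = Arg z"
    have r: "0 \<le> r"
      by (simp add: r_def)
    have z: "z = complex_of_real r * cis \<theta>"
      using rcis_cmod_Arg[of z] by (simp add: rcis_def r_def \<theta>_def)
    have wave: "(\<lambda>x :: real ^ 'n. 1 + cos (phase (freq k) x + \<theta>)) \<in> lp_nonneg 2"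
      using wave_lp_nonneg[of 1 "freq k" \<theta>] by simp
    have "L2_trace (z *\<^sub>C expb k) = sandwich_trace \<omega> (\<lambda>x. r * (1 + cos (phase (freq k) x + \<theta>))) - sandwich_trace \<omega> (\<lambda>_. r)"
    proof (rule L2_trace_eqI)
      show "(\<lambda>x :: real ^ 'n. r * (1 + cos (phase (freq k) x + \<theta>))) \<in> lp_nonneg 2"
        by (intro lp_nonneg_scale wave r) simp
      show "(\<lambda>_ :: real ^ 'n. r) \<in> lp_nonneg 2"
        by (intro lp_nonneg_const r) simp
      show "AE x in torus_measure. Re (rep_L2_torus (z *\<^sub>C (expb k :: 'n L2_torus)) x) =
          r * (1 + cos (phase (freq k) x + \<theta>)) - r"
        using rep
      proof eventually_elim
        case (elim x)
        have "z * expi (freq k) x = complex_of_real r * cis (phase (freq k) x + \<theta>)"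
          by (simp add: z expi_def cis_mult[symmetric] mult.commute mult.left_commute)
        then show ?case
          by (simp add: elim algebra_simps)
      qed
    qed
    also have "\<dots> = 0"
      using sandwich_trace_scale[OF _ wave r] sandwich_trace_wave[OF False, of \<theta>] sandwich_trace_const[OF r] by simp
    finally show ?thesis
      by (simp add: inner False)
  qed
qed

lemma L2_trace_eq: "L2_trace u = torus.omega_gamma \<omega> A * Re (cinner (abs_L2_torus (\<lambda>_. 1)) u)"
proof -
  have "bounded_linear (\<lambda>u :: 'n L2_torus. torus.omega_gamma \<omega> A * Re (cinner (abs_L2_torus (\<lambda>_. 1)) u))"
    by (intro bounded_linear_const_mult bounded_linear_compose[OF bounded_linear_Re] cinner.bounded_linear_right)
  from bounded_linear.sums[OF this torus.basis_expansion[of u]] bounded_linear.sums[OF bounded_linear_L2_trace torus.basis_expansion[of u]]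
  show ?thesis
    unfolding L2_trace_expb by (rule sums_unique2[rotated])
qed

lemma sandwich_trace_bounded_integral:
  assumes h [measurable]: "h \<in> borel_measurable borel" and h0: "\<And>x. 0 \<le> h x" and B: "\<And>x. h x \<le> B"
  shows "sandwich_trace \<omega> h = torus.omega_gamma \<omega> A * (LINT x|torus_measure. h x)"
proof -
  have lp: "h \<in> lp_nonneg 2"
    using B h0 by (intro lp_nonneg_bounded) auto
  have sq: "square_integrable (\<lambda>x. complex_of_real (h x))"
    unfolding square_integrable_def
    using lp_nonneg_integrable[OF lp] h0 by (simp add: powr_numeral)
  define u where "u = abs_L2_torus (\<lambda>x. complex_of_real (h x))"
  have "L2_trace u = sandwich_trace \<omega> h - sandwich_trace \<omega> (\<lambda>_. 0)"
  proof (rule L2_trace_eqI[OF lp])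
    show "(\<lambda>_ :: real ^ 'n. 0) \<in> lp_nonneg 2"
      by (intro lp_nonneg_const) simp_all
    show "AE x in torus_measure. Re (rep_L2_torus u x) = h x - 0"
      using rep_abs_L2_torus[OF sq] unfolding u_def by eventually_elim simp
  qed
  then have "sandwich_trace \<omega> h = L2_trace u"
    using sandwich_trace_const[of 0] by simp
  also have "\<dots> = torus.omega_gamma \<omega> A * Re (cinner (abs_L2_torus (\<lambda>_. 1)) u)"
    by (rule L2_trace_eq)
  also have "cinner (abs_L2_torus (\<lambda>_. 1)) u = complex_of_real (LINT x|torus_measure. h x)"
    using cinner_abs_L2_torus[OF square_integrable_continuous[of "\<lambda>_. 1"] sq] by (simp add: u_def)
  finally show ?thesis
    by simp
qed

lemma sandwich_trace_integral:
  assumes p: "1 < p" and h: "h \<in> lp_nonneg p"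
  shows "sandwich_trace \<omega> h = torus.omega_gamma \<omega> A * (LINT x|torus_measure. h x)"
proof -
  have [measurable]: "h \<in> borel_measurable borel"
    using h by measurable
  note h0 = lp_nonneg_nonneg[OF h]
  obtain K where K: "0 \<le> K"
    "\<And>h l. h \<in> lp_nonneg p \<Longrightarrow> 0 \<le> l \<Longrightarrow> (LINT x|torus_measure. h x powr p) \<le> l powr p \<Longrightarrow> sandwich_trace \<omega> h \<le> l * K"
    using sandwich_trace_bound[OF p] by blast
  define g where "g n x = min (h x) (real n)" for n x
  define r where "r n x = h x - g n x" for n x
  have [measurable]: "g n \<in> borel_measurable borel" "r n \<in> borel_measurable borel" for n
    unfolding g_def r_def by measurable
  have g0: "0 \<le> g n x" "g n x \<le> real n" "g n x \<le> h x" and r0: "0 \<le> r n x" "r n x \<le> h x" for n x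
    using h0[of x] by (auto simp: g_def r_def)
  have g: "g n \<in> lp_nonneg p" for n
    using g0 p by (intro lp_nonneg_bounded) auto
  have r: "r n \<in> lp_nonneg p" for n
    using r0 p by (intro lp_nonneg_dominated[OF _ _ lp_nonneg_integrable[OF h]]) (auto intro!: always_eventually powr_mono2)
  have eq: "sandwich_trace \<omega> h = torus.omega_gamma \<omega> A * (LINT x|torus_measure. g n x) + sandwich_trace \<omega> (r n)" for n
    using sandwich_trace_add[OF p g r, of n n] sandwich_trace_bounded_integral[of "g n" "real n"] g0 by (simp add: r_def)
  have lim_pt: "(\<lambda>n. g n x) \<longlonglongrightarrow> h x" for x
  proof (rule tendsto_eventually)
    obtain N where "h x \<le> real N"
      using real_arch_simple by blast
    then show "\<forall>\<^sub>F n in sequentially. g n x = h x"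
      unfolding g_def by (intro eventually_sequentiallyI[of N]) auto
  qed
  have lim_r: "(\<lambda>n. r n x) \<longlonglongrightarrow> 0" for x
    using tendsto_diff[OF tendsto_const[of "h x"] lim_pt[of x]] by (simp add: r_def)
  have "(\<lambda>n. LINT x|torus_measure. g n x) \<longlonglongrightarrow> (LINT x|torus_measure. h x)"
    using g0 by (intro integral_dominated_convergence[where w = h] lp_nonneg_imp_integrable[OF p h])
      (auto intro!: always_eventually lim_pt)
  then have lim_g: "(\<lambda>n. torus.omega_gamma \<omega> A * (LINT x|torus_measure. g n x)) \<longlonglongrightarrow> torus.omega_gamma \<omega> A * (LINT x|torus_measure. h x)"
    by (rule tendsto_mult_left)
  define l where "l n = (LINT x|torus_measure. r n x powr p) powr (1 / p)" for n
  have int_r0: "0 \<le> (LINT x|torus_measure. r n x powr p)" for n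
    by (intro Bochner_Integration.integral_nonneg) simp
  have "(\<lambda>n. LINT x|torus_measure. r n x powr p) \<longlonglongrightarrow> (LINT x|(torus_measure :: (real ^ 'n) measure). 0)"
  proof (rule integral_dominated_convergence[where w = "\<lambda>x. h x powr p"])
    show "integrable torus_measure (\<lambda>x. h x powr p)"
      by (rule lp_nonneg_integrable[OF h])
    show "AE x in torus_measure. (\<lambda>n. r n x powr p) \<longlonglongrightarrow> 0"
      using p r0 by (intro always_eventually allI tendsto_zero_powrI[OF lim_r tendsto_const]) auto
    show "AE x in torus_measure. norm (r n x powr p) \<le> h x powr p" for n
      using r0 p by (intro always_eventually) (auto intro!: powr_mono2)
  qed measurable
  then have "(\<lambda>n. LINT x|torus_measure. r n x powr p) \<longlonglongrightarrow> 0"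
    by simp
  then have "l \<longlonglongrightarrow> 0"
    unfolding l_def[abs_def] using p int_r0 by (intro tendsto_zero_powrI[OF _ tendsto_const]) auto
  then have lK: "(\<lambda>n. l n * K) \<longlonglongrightarrow> 0"
    by (rule tendsto_mult_left_zero)
  have upper: "sandwich_trace \<omega> (r n) \<le> l n * K" for n
    using int_r0 p by (intro K(2)[OF r]) (auto simp: l_def powr_powr)
  have lower: "0 \<le> sandwich_trace \<omega> (r n)" for n
    by (rule sandwich_trace_nonneg[OF p r])
  have "(\<lambda>n. sandwich_trace \<omega> (r n)) \<longlonglongrightarrow> 0"
    by (rule tendsto_sandwich[OF always_eventually[OF allI[OF lower]] always_eventually[OF allI[OF upper]] tendsto_const lK])
  from tendsto_add[OF lim_g this] have "(\<lambda>n. sandwich_trace \<omega> h) \<longlonglongrightarrow> torus.omega_gamma \<omega> A * (LINT x|torus_measure. h x)"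
    by (simp flip: eq)
  then show ?thesis
    by (simp add: LIMSEQ_const_iff)
qed

end

end

theorem theorem5p9:
  fixes G :: "real \<Rightarrow> real" and \<epsilon> :: real and A :: "'n::finite L2_torus op"
  assumes "G \<in> borel_measurable borel" and "\<And>s. 0 \<le> G s" and "bounded (range G)"
    and A: "A = function_of G Laplacian"
    and "positive_op A" and "A \<in> L1_inf" and "dixmier_measurable A"
    and "0 < \<epsilon>"
  shows "\<exists>c\<ge>0.
    (\<forall>\<omega>\<in>DL2 TYPE('n L2_torus). dixmier_trace \<omega> A = complex_of_real c) \<and>
    (\<forall>f\<in>Lp_torus (1 + \<epsilon>).
       sandwich_defined A f \<and> sandwich A f \<in> L1_inf \<and>
       (\<forall>\<omega>\<in>DL2 TYPE('n L2_torus).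
          dixmier_trace \<omega> (sandwich A f) = complex_of_real c * (LINT x|torus_measure. f x)))"
proof -
  define p where "p = 1 + \<epsilon>"
  have p: "1 < p"
    using assms(8) by (simp add: p_def)
  obtain C where C: "0 \<le> C" "\<And>n. (\<Sum>k<n. singular_value A k) \<le> C * ln (1 + real n)"
    using torus.L1_infE[OF assms(6)] by blast
  interpret torus_operator A "\<lambda>k. G (eigenvalue TYPE('n) k)" C
  proof
    show "A = real_diag_op expb (\<lambda>k. G (eigenvalue TYPE('n) k))"
      unfolding A by (rule function_of_Laplacian[OF assms(3)])
    show "bounded (range (\<lambda>k. G (eigenvalue TYPE('n) k)))"
      using assms(3) by (rule bounded_subset) auto
  qed (use assms C in auto)
  have tr: "dixmier_trace \<omega> A = complex_of_real (torus.omega_gamma \<omega> A)" if "\<omega> \<in> DL2 TYPE('n L2_torus)" for \<omega>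
    by (rule torus.dixmier_trace_positive[OF that assms(6,5)])
  have "\<exists>c\<ge>0. \<forall>\<omega>\<in>DL2 TYPE('n L2_torus). torus.omega_gamma \<omega> A = c"
  proof (cases "DL2 TYPE('n L2_torus) = {}")
    case False
    then obtain \<omega>0 where \<omega>0: "\<omega>0 \<in> DL2 TYPE('n L2_torus)"
      by blast
    have "torus.omega_gamma \<omega> A = torus.omega_gamma \<omega>0 A" if "\<omega> \<in> DL2 TYPE('n L2_torus)" for \<omega>
    proof -
      have "dixmier_trace \<omega> A = dixmier_trace \<omega>0 A"
        using assms(7) that \<omega>0 unfolding dixmier_measurable_def by blast
      then show ?thesis
        unfolding tr[OF that] tr[OF \<omega>0] of_real_eq_iff .
    qed
    then show ?thesis
      using torus.omega_gamma_nonneg[OF \<omega>0 assms(6)] by (intro exI[of _ "torus.omega_gamma \<omega>0 A"]) auto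
  qed auto
  then obtain c where c: "0 \<le> c" "\<And>\<omega>. \<omega> \<in> DL2 TYPE('n L2_torus) \<Longrightarrow> torus.omega_gamma \<omega> A = c"
    by blast
  have f: "sandwich_defined A f \<and> sandwich A f \<in> L1_inf \<and>
       (\<forall>\<omega>\<in>DL2 TYPE('n L2_torus). dixmier_trace \<omega> (sandwich A f) = complex_of_real c * (LINT x|torus_measure. f x))"
    if f: "f \<in> Lp_torus (1 + \<epsilon>)" for f
  proof -
    have fm [measurable]: "f \<in> borel_measurable borel" and int: "integrable torus_measure (\<lambda>x. cmod (f x) powr p)"
      using f by (auto simp: Lp_torus_def p_def)
    have part: "(\<lambda>x. max 0 (r x)) \<in> lp_nonneg p"
      if [measurable]: "r \<in> borel_measurable borel" and "\<And>x. \<bar>r x\<bar> \<le> cmod (f x)" for r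
    proof (rule lp_nonneg_dominated[OF _ _ int])
      have "max 0 (r x) \<le> cmod (f x)" for x
        using that(2)[of x] by auto
      then show "AE x in torus_measure. max 0 (r x) powr p \<le> cmod (f x) powr p"
        using p by (intro always_eventually allI powr_mono2) auto
    qed (use p in auto)
    have parts: "(\<lambda>x. max 0 (Re (f x))) \<in> lp_nonneg p" "(\<lambda>x. max 0 (- Re (f x))) \<in> lp_nonneg p"
      "(\<lambda>x. max 0 (Im (f x))) \<in> lp_nonneg p" "(\<lambda>x. max 0 (- Im (f x))) \<in> lp_nonneg p"
      by (intro part; simp add: abs_Re_le_cmod abs_Im_le_cmod)+
    note pos = sandwich_pos_L1_inf[OF p parts(1)] sandwich_pos_L1_inf[OF p parts(2)]
      sandwich_pos_L1_inf[OF p parts(3)] sandwich_pos_L1_inf[OF p parts(4)]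
    have eq: "sandwich A f = torus.combination
        (sandwich_nonneg A (\<lambda>x. max 0 (Re (f x)))) (sandwich_nonneg A (\<lambda>x. max 0 (- Re (f x))))
        (sandwich_nonneg A (\<lambda>x. max 0 (Im (f x)))) (sandwich_nonneg A (\<lambda>x. max 0 (- Im (f x))))"
      by (simp add: sandwich_def torus.combination_def)
    have "dixmier_trace \<omega> (sandwich A f) = complex_of_real c * (LINT x|torus_measure. f x)"
      if \<omega>: "\<omega> \<in> DL2 TYPE('n L2_torus)" for \<omega>
    proof -
      have diff: "torus.omega_gamma \<omega> (sandwich_nonneg A (\<lambda>x. max 0 (r x))) - torus.omega_gamma \<omega> (sandwich_nonneg A (\<lambda>x. max 0 (- r x))) =
          c * (LINT x|torus_measure. r x)"
        if r: "(\<lambda>x. max 0 (r x)) \<in> lp_nonneg p" "(\<lambda>x. max 0 (- r x)) \<in> lp_nonneg p" for r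
      proof -
        have "(LINT x|torus_measure. max 0 (r x)) - (LINT x|torus_measure. max 0 (- r x)) =
            (LINT x|torus_measure. max 0 (r x) - max 0 (- r x))"
          by (intro Bochner_Integration.integral_diff[symmetric] lp_nonneg_imp_integrable[OF p] r)
        also have "\<dots> = (LINT x|torus_measure. r x)"
          by (intro Bochner_Integration.integral_cong) (auto simp: max_def)
        finally show ?thesis
          using sandwich_trace_integral[OF \<omega> p r(1)] sandwich_trace_integral[OF \<omega> p r(2)]
          by (simp add: sandwich_trace_def c(2)[OF \<omega>] flip: right_diff_distrib)
      qed
      have fi: "integrable torus_measure f"
      proof (rule Bochner_Integration.integrable_bound)
        have "(\<lambda>x. cmod (f x)) \<in> lp_nonneg p"
          using int by (simp add: lp_nonneg_def)
        then show "integrable torus_measure (\<lambda>x. cmod (f x))"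
          by (rule lp_nonneg_imp_integrable[OF p])
      qed auto
      have "(LINT x|torus_measure. f x) = complex_of_real (LINT x|torus_measure. Re (f x)) +
          \<i> * complex_of_real (LINT x|torus_measure. Im (f x))"
        using integral_Re[OF fi] integral_Im[OF fi] by (simp add: complex_eq_iff)
      then show ?thesis
        unfolding eq torus.dixmier_trace_combination[OF \<omega> pos] diff[OF parts(1,2)] diff[OF parts(3,4)]
        by (simp add: distrib_left mult.left_commute)
    qed
    moreover have "sandwich A f \<in> L1_inf"
      unfolding eq by (rule torus.combination_L1_inf[OF pos])
    moreover have "sandwich_defined A f"
      unfolding sandwich_defined_def by (intro conjI sandwich_nonneg_defined_lp[OF p] parts)
    ultimately show ?thesis
      by blast
  qed
  show ?thesis
    using c f tr by (intro exI[of _ c]) auto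
qed

end
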